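(* Let $D$ be a random variable supported on the nonnegative integers with $0<E[D(D-2)]<\infty$, and let $\mathcal G=(G_n)_{n\ge 1}$ be sampled from the configuration model with independent $D$-distributed degrees (with an extra vertex $\mathfrak b$ attached to vertex $1$). Let $a=\frac{E[D^2]}{E[D]}-1$ and $\Lambda=2a-1-2\sqrt{a^2-a}$. Then the critical rate $\lambda_c(\mathcal G)$ for chase-escape on $\mathcal G$ satisfies $$\Lambda\le\lambda_c(\mathcal G)<\infty .$$
   Context: Graphs. Let $D_1,D_2,\dots$ be independent copies of $D$. The random multigraph $G_n$ has vertex set $\{\mathfrak b,1,\dots,n\}$ and is built as follows: vertex $i\in\{1,\dots,n\}$ receives $D_i$ half-edges ($\mathfrak b$ receives none); if $\sum_{i=1}^n D_i$ is odd, one extra half-edge is added to vertex $n$; a perfect matching of all half-edges is chosen uniformly at random, and each matched pair becomes an edge (self-loops and multiple edges are allowed). In addition a single edge is placed between $\mathfrak b$ and $1$. Chase-escape with rate $\lambda>0$ on $G_n$. Each vertex is in one of the states $r$ (red), $b$ (blue), $w$ (white). Initially vertex $1$ is red, $\mathfrak b$ is blue, and all other vertices are white. Along each edge, a pair of adjacent vertices in states $(r,w)$ becomes $(r,r)$ according to a rate-$\lambda$ Poisson process, and a pair of adjacent vertices in states $(b,r)$ becomes $(b,b)$ according to a rate-$1$ Poisson process, all Poisson processes being independent. Let $\mathcal R_n$ be the set of vertices of $G_n$ that are red at some time. $\mathbf P_\lambda$ denotes the joint probability measure of the degrees, the matching and the chase-escape dynamics. Critical rate: $$\lambda_c(\mathcal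 G)=\sup\Big\{\lambda>0:\ \sup_{\delta>0}\limsup_{n\to\infty}\mathbf P_\lambda(|\mathcal R_n|>\delta n)=0\Big\}.$$ *)

theory Defs
  imports "HOL-Probability.Probability"
begin

text \<open>The vertex \<open>\<bb>\<close> is encoded as \<open>0\<close>, so the vertex set of \<open>G\<^sub>n\<close> is \<open>{0..n}\<close>.\<close>

type_synonym vertex = nat

text \<open>The half-edge \<open>(i, k)\<close> is the \<open>k\<close>-th half-edge of vertex \<open>i\<close>, counting from \<open>0\<close>.\<close>

type_synonym half_edge = "vertex \<times> nat"

definition vertex_degree :: "nat \<Rightarrow> (vertex \<Rightarrow> nat) \<Rightarrow> vertex \<Rightarrow> nat" where
  "vertex_degree n d i = d i + (if i = n \<and> odd (\<Sum>j=1..n. d j) then 1 else 0)"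

definition half_edges :: "nat \<Rightarrow> (vertex \<Rightarrow> nat) \<Rightarrow> half_edge set" where
  "half_edges n d = (SIGMA i:{1..n}. {..<vertex_degree n d i})"

definition perfect_matchings :: "'a set \<Rightarrow> 'a set set set" where
  "perfect_matchings H = {M. partition_on H M \<and> (\<forall>p\<in>M. card p = 2)}"

definition config_model :: "nat pmf \<Rightarrow> nat \<Rightarrow> ((vertex \<Rightarrow> nat) \<times> half_edge set set) pmf" where
  "config_model D n =
     bind_pmf (Pi_pmf {1..n} 0 (\<lambda>_. D))
       (\<lambda>d. map_pmf (Pair d) (pmf_of_set (perfect_matchings (half_edges n d))))"

text \<open>\<open>Root\<close> is the edge between \<open>\<bb>\<close> and \<open>1\<close>.  Parallel edges are distinguished by
  their half-edges, and a self-loop has a singleton set of end vertices.\<close>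

datatype edge = Root | Matched "half_edge set"

fun ends :: "edge \<Rightarrow> vertex set" where
  "ends Root = {0, 1}"
| "ends (Matched p) = fst ` p"

definition graph_edges :: "half_edge set set \<Rightarrow> edge set" where
  "graph_edges M = insert Root (Matched ` M)"

datatype state = Red | Blue | White

text \<open>Every edge carries two Poisson processes: the rings of \<open>Spread\<close> (rate \<open>\<lambda>\<close>) turn
  \<open>(r,w)\<close> into \<open>(r,r)\<close>, those of \<open>Chase\<close> (rate \<open>1\<close>) turn \<open>(b,r)\<close> into \<open>(b,b)\<close>.\<close>

datatype kind = Spread | Chase

fun rate :: "real \<Rightarrow> kind \<Rightarrow> real" where
  "rate l Spread = l"
| "rate l Chase = 1"

text \<open>A Poisson process is given by its independent exponential interarrival times;
  \<open>X (e, c, k)\<close> is the \<open>k\<close>-th interarrival time (from \<open>k = 0\<close>) of the process of kind \<open>c\<close> on edge \<open>e\<close>.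
  There are processes for all potential edges, but only those of actual edges are used.\<close>

type_synonym clocks = "edge \<times> kind \<times> nat \<Rightarrow> real"

definition clock_measure :: "real \<Rightarrow> clocks measure" where
  "clock_measure l =
     PiM UNIV (\<lambda>(e, c, k). density lborel (exponential_density (rate l c)))"

definition arrivals :: "clocks \<Rightarrow> edge \<Rightarrow> kind \<Rightarrow> real set" where
  "arrivals X e c = range (\<lambda>k. \<Sum>j\<le>k. X (e, c, j))"

definition ring_times :: "edge set \<Rightarrow> clocks \<Rightarrow> real set" where
  "ring_times E X = (\<Union>e\<in>E. \<Union>c. arrivals X e c)"

text \<open>The effect of all rings at time \<open>s\<close> on a configuration \<open>\<xi>\<close>.  Almost surely at most
  one process rings at any given time.\<close>

definition update :: "edge set \<Rightarrow> clocks \<Rightarrow> real \<Rightarrow> (vertex \<Rightarrow> state) \<Rightarrow> vertex \<Rightarrow> state" where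
  "update E X s \<xi> v =
     (if \<xi> v = White \<and> (\<exists>e\<in>E. \<exists>u. ends e = {u, v} \<and> \<xi> u = Red \<and> s \<in> arrivals X e Spread)
      then Red
      else if \<xi> v = Red \<and> (\<exists>e\<in>E. \<exists>u. ends e = {u, v} \<and> \<xi> u = Blue \<and> s \<in> arrivals X e Chase)
      then Blue
      else \<xi> v)"

definition initial :: "vertex \<Rightarrow> state" where
  "initial v = (if v = 0 then Blue else if v = 1 then Red else White)"

text \<open>The configuration at time \<open>t\<close>: the rings up to time \<open>t\<close> are applied in chronological
  order.  For a finite edge set, there are almost surely only finitely many of them.\<close>

definition chase_escape :: "edge set \<Rightarrow> clocks \<Rightarrow> real \<Rightarrow> vertex \<Rightarrow> state" where
  "chase_escape E X t =
     fold (update E X) (sorted_list_of_set {s \<in> ring_times E X. s \<le> t}) initial"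

definition ever_red :: "nat \<Rightarrow> edge set \<Rightarrow> clocks \<Rightarrow> vertex set" where
  "ever_red n E X = {v \<in> {0..n}. \<exists>t\<ge>0. chase_escape E X t v = Red}"

text \<open>The joint law of degrees, matching and clocks.  Restricting the discrete component to
  its countable support does not change the law, but it makes the events of interest
  measurable in the product space.\<close>

definition chase_escape_measure ::
    "nat pmf \<Rightarrow> real \<Rightarrow> nat \<Rightarrow> (((vertex \<Rightarrow> nat) \<times> half_edge set set) \<times> clocks) measure" where
  "chase_escape_measure D l n =
     restrict_space (measure_pmf (config_model D n)) (set_pmf (config_model D n))
       \<Otimes>\<^sub>M clock_measure l"

definition prob_many_red :: "nat pmf \<Rightarrow> real \<Rightarrow> nat \<Rightarrow> real \<Rightarrow> real" where
  "prob_many_red D l n \<delta> =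
     \<P>(((d, M), X) in chase_escape_measure D l n.
        real (card (ever_red n (graph_edges M) X)) > \<delta> * real n)"

text \<open>The supremum is taken in the extended reals, so that its finiteness is a genuine claim.\<close>

definition critical_rate :: "nat pmf \<Rightarrow> ereal" where
  "critical_rate D =
     Sup (ereal ` {l. 0 < l \<and>
       (SUP \<delta>\<in>{0<..}. limsup (\<lambda>n. ereal (prob_many_red D l n \<delta>))) = 0})"

end

theory Submission
  imports Defs
begin

text \<open>\<^bold>\<open>Lower bound.\<close> An infected vertex is the end of a path from \<open>1\<close> along which the infection travelled.
  Blue follows along the same path, so the chain of \<open>Spread\<close> rings along a path with \<open>k\<close> edges must be
  faster than the chain of \<open>Chase\<close> rings that ends one edge earlier; by an exponential moment bound this
  has probability of order \<open>q\<^sup>k\<close> with \<open>q = 4 \<lambda> / (1 + \<lambda>)\<^sup>2\<close>.  The expected number of such paths is of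
  order \<open>a\<^sup>k\<close>, and \<open>\<Lambda>\<close> is the smaller root of \<open>4 a \<lambda> = (1 + \<lambda>)\<^sup>2\<close>.

  \<^bold>\<open>Finiteness.\<close> Vertices of degree above a large constant are given up.  The others are explored in the order
  of their infection, and the matching is revealed along the way.  A vertex is bad if blue catches it
  or it fails to infect its neighbours within a short time \<open>\<epsilon>\<close>; for large \<open>\<lambda>\<close> bad vertices are rare.
  The number of unrevealed half-edges at discovered vertices, corrected by small terms for the
  discovered vertices and the bad ones, has positive drift as long as few vertices have been explored,
  because \<open>E[D(D - 2)] > 0\<close>.  So its negative exponential is a supermartingale, which is at least \<open>1\<close>
  when the exploration gets stuck and less than \<open>1\<close> in the mean at the start.  Hence the exploration reaches linear size
  with a probability that is bounded away from \<open>0\<close>.\<close>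

section \<open>Exponential clocks\<close>

text \<open>The lower bound is a first-moment argument with a cut-off \<open>K\<close>. Vertices
  reached by paths shorter than \<open>K\<close> are boundedly many in expectation, so they cannot
  make up \<open>\<delta> * n\<close> red vertices; slow paths of length exactly \<open>K\<close>
  have an expectation that is geometric in \<open>K\<close>, uniformly in large \<open>n\<close>.
  Hence \<open>n\<close> tends to infinity before \<open>K\<close> does. The obstacle in the
  finiteness proof is that the order of exploration depends on the matching and on the clocks
  jointly. Each step is therefore split at an intermediate quantity \<open>half_step\<close>. With
  the clocks fixed, matchings are averaged over classes with the same revealed pairs; with the
  matching fixed, a single fresh clock is integrated out. Conditional expectations thus become
  finite averages and iterated integrals. The constant \<open>\<zeta>\<close> is charged when a
  vertex is discovered and refunded when it is explored; the refund finances the risk that the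
  vertex is bad. Pairs at vertices of degree above \<open>K\<close> are revealed in advance, so
  every increment is at most \<open>K + 3\<close> in absolute value. The constants are chosen in the
  order \<open>\<zeta>\<close>, \<open>K\<close>, \<open>\<theta>\<close>,
  \<open>\<epsilon>\<close>, and the rate last.\<close>

lemma UNIV_kind: "(UNIV :: kind set) = {Spread, Chase}"
  using kind.exhaust by auto

lemma rate_pos: "0 < l \<Longrightarrow> 0 < rate l c"
  by (cases c) auto

abbreviation exponential :: "real \<Rightarrow> real measure" where
  "exponential r \<equiv> density lborel (exponential_density r)"

lemma nn_integral_exponential:
  assumes "g \<in> borel_measurable borel"
  shows "(\<integral>\<^sup>+y. g y \<partial>exponential r) = (\<integral>\<^sup>+y. ennreal (exponential_density r y) * g y \<partial>lborel)"
  using assms by (subst nn_integral_density) auto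

lemma exponential_density_mult_exp:
  fixes r s y :: real
  assumes "0 < r" "0 < r + s"
  shows "exponential_density r y * exp (- s * y) = r / (r + s) * exponential_density (r + s) y"
  using assms by (simp add: exponential_density_def flip: exp_add) (simp add: algebra_simps)

lemma nn_integral_exp_exponential:
  fixes r s :: real
  assumes "0 < r" "0 < r + s"
  shows "(\<integral>\<^sup>+y. ennreal (exp (- s * y)) \<partial>exponential r) = ennreal (r / (r + s))"
proof -
  have "(\<integral>\<^sup>+y. ennreal (exp (- s * y)) \<partial>exponential r)
      = (\<integral>\<^sup>+y. ennreal (exponential_density r y) * ennreal (exp (- s * y)) \<partial>lborel)"
    by (rule nn_integral_exponential) measurable
  also have "\<dots> = (\<integral>\<^sup>+y. ennreal (r / (r + s)) * ennreal (exponential_density (r + s) y) \<partial>lborel)"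
    using assms exponential_density_mult_exp[OF assms] exponential_density_nonneg
    by (intro nn_integral_cong) (simp flip: ennreal_mult)
  also have "\<dots> = ennreal (r / (r + s)) * (\<integral>\<^sup>+y. ennreal (exponential_density (r + s) y) \<partial>lborel)"
    by (rule nn_integral_cmult) measurable
  also have "(\<integral>\<^sup>+y. ennreal (exponential_density (r + s) y) \<partial>lborel) = 1"
    using prob_space.emeasure_space_1[OF prob_space_exponential_density[OF assms(2)]]
    by (simp add: emeasure_density)
  finally show ?thesis by simp
qed

text \<open>The substitution of \<open>u + y\<close> for \<open>y\<close> multiplies the density by
  \<open>exp (- r * u)\<close>. This is the source of the Poisson property in
  \<open>nn_integral_next_ring\<close>.\<close>

lemma exponential_memoryless:
  fixes r u :: real
  assumes [measurable]: "g \<in> borel_measurable borel" and "0 < r" "0 \<le> u"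
  shows "(\<integral>\<^sup>+y. indicator {u<..} y * g (y - u) \<partial>exponential r)
    = ennreal (exp (- r * u)) * (\<integral>\<^sup>+y. g y \<partial>exponential r)"
proof -
  have "(\<integral>\<^sup>+y. indicator {u<..} y * g (y - u) \<partial>exponential r)
      = (\<integral>\<^sup>+y. ennreal (exponential_density r y) * (indicator {u<..} y * g (y - u)) \<partial>lborel)"
    by (rule nn_integral_exponential) measurable
  also have "\<dots> = (\<integral>\<^sup>+y. ennreal (exponential_density r (u + 1 * y))
      * (indicator {u<..} (u + 1 * y) * g ((u + 1 * y) - u)) \<partial>lborel)"
    by (subst nn_integral_real_affine[where c = 1 and t = u]) auto
  also have "\<dots> = (\<integral>\<^sup>+y. ennreal (exp (- r * u)) * (ennreal (exponential_density r y) * g y) \<partial>lborel)"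
  proof (rule nn_integral_cong_AE)
    \<comment> \<open>At \<open>y = 0\<close> the strict indicator makes the left side vanish while
      the density on the right is positive, so this point has to be discarded.\<close>
    have "AE y in lborel. y \<noteq> (0::real)" by (rule AE_lborel_singleton)
    then show "AE y in lborel. ennreal (exponential_density r (u + 1 * y))
      * (indicator {u<..} (u + 1 * y) * g ((u + 1 * y) - u))
      = ennreal (exp (- r * u)) * (ennreal (exponential_density r y) * g y)"
    proof eventually_elim
      case (elim y)
      show ?case
      proof (cases "y < 0")
        case True
        then show ?thesis by (simp add: exponential_density_def)
      next
        case False
        with elim have y: "0 < y" by simp
        have e: "exponential_density r (u + y) = exp (- r * u) * exponential_density r y"
          using y \<open>0 \<le> u\<close> by (simp add: exponential_density_def algebra_simps flip: exp_add)
        show ?thesis using y \<open>0 < r\<close>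
          by (simp add: e ennreal_mult exponential_density_nonneg mult.assoc)
      qed
    qed
  qed
  also have "\<dots> = ennreal (exp (- r * u)) * (\<integral>\<^sup>+y. ennreal (exponential_density r y) * g y \<partial>lborel)"
    by (rule nn_integral_cmult) measurable
  also have "\<dots> = ennreal (exp (- r * u)) * (\<integral>\<^sup>+y. g y \<partial>exponential r)"
    by (subst nn_integral_exponential) auto
  finally show ?thesis .
qed

abbreviation clock_space :: "clocks measure" where
  "clock_space \<equiv> PiM UNIV (\<lambda>_. borel)"

lemma sets_clock_measure [simp, measurable_cong]: "sets (clock_measure l) = sets clock_space"
  unfolding clock_measure_def by (rule sets_PiM_cong) (auto split: prod.split)

lemma clock_sets_Collect: "Measurable.pred clock_space P \<Longrightarrow> {X. P X} \<in> sets clock_space"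
  unfolding pred_def by (simp add: space_PiM)

lemma space_clock_measure [simp]: "space (clock_measure l) = UNIV"
  using sets_eq_imp_space_eq[OF sets_clock_measure] by (simp add: space_PiM)

lemma clock_component_measurable [measurable]: "(\<lambda>X. X i) \<in> borel_measurable clock_space"
  by (rule measurable_component_singleton) simp

abbreviation clock_law :: "real \<Rightarrow> edge \<times> kind \<times> nat \<Rightarrow> real measure" where
  "clock_law l \<equiv> \<lambda>(e, c, k). exponential (rate l c)"

lemma product_prob_space_clock_law: "0 < l \<Longrightarrow> product_prob_space (clock_law l)"
  by (intro product_prob_spaceI) (auto intro!: prob_space_exponential_density rate_pos)

lemma prob_space_clock_measure: "0 < l \<Longrightarrow> prob_space (clock_measure l)"
  unfolding clock_measure_def
  by (intro prob_space_PiM) (auto intro!: prob_space_exponential_density rate_pos)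

lemma distr_clock_component:
  assumes "0 < l"
  shows "distr (clock_measure l) borel (\<lambda>X. X (e, c, k)) = exponential (rate l c)"
proof -
  interpret product_prob_space "clock_law l" UNIV
    using assms by (rule product_prob_space_clock_law)
  have "distr (clock_measure l) (exponential (rate l c)) (\<lambda>X. X (e, c, k)) = exponential (rate l c)"
    using PiM_component[of "(e, c, k)"] by (simp add: clock_measure_def)
  moreover have "distr (clock_measure l) (exponential (rate l c)) (\<lambda>X. X (e, c, k))
      = distr (clock_measure l) borel (\<lambda>X. X (e, c, k))"
    by (rule distr_cong) auto
  ultimately show ?thesis by simp
qed

lemma nn_integral_clock_component:
  assumes "0 < l" and [measurable]: "g \<in> borel_measurable borel"
  shows "(\<integral>\<^sup>+X. g (X (e, c, k)) \<partial>clock_measure l) = (\<integral>\<^sup>+y. g y \<partial>exponential (rate l c))"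
  by (subst distr_clock_component[OF assms(1), of e c k, symmetric]) (simp add: nn_integral_distr)

section \<open>Resampling a set of coordinates of a product measure\<close>

definition resample :: "'i set \<Rightarrow> ('i \<Rightarrow> 'a) \<Rightarrow> ('i \<Rightarrow> 'a) \<Rightarrow> 'i \<Rightarrow> 'a" where
  "resample J X Y = (\<lambda>j. if j \<in> J then Y j else X j)"

lemma resample_measurable [measurable]:
  assumes "f \<in> N \<rightarrow>\<^sub>M PiM UNIV (\<lambda>_. borel)" "g \<in> N \<rightarrow>\<^sub>M PiM UNIV (\<lambda>_. borel)"
  shows "(\<lambda>x. resample J (f x) (g x)) \<in> N \<rightarrow>\<^sub>M PiM UNIV (\<lambda>_. borel)"
proof (rule measurable_PiM_single')
  fix i
  have *: "(\<lambda>x. f x i) \<in> N \<rightarrow>\<^sub>M borel" "(\<lambda>x. g x i) \<in> N \<rightarrow>\<^sub>M borel"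
    using measurable_compose[OF assms(1) measurable_component_singleton[of i]]
      measurable_compose[OF assms(2) measurable_component_singleton[of i]] by auto
  show "(\<lambda>x. resample J (f x) (g x) i) \<in> N \<rightarrow>\<^sub>M borel"
    using * by (cases "i \<in> J") (auto simp: resample_def)
qed (auto simp: space_PiM)

text \<open>The preimage of a cylinder over \<open>K\<close> is a rectangle: the coordinates in
  \<open>K - J\<close> constrain the old family, those in \<open>K \<inter> J\<close> the new one,
  and the two products recombine.\<close>

lemma distr_resample_PiM:
  fixes M :: "'i \<Rightarrow> 'a measure"
  assumes "\<And>i. prob_space (M i)"
    and meas: "(\<lambda>(X, Y). resample J X Y) \<in> PiM UNIV M \<Otimes>\<^sub>M PiM UNIV M \<rightarrow>\<^sub>M PiM UNIV M"
  shows "distr (PiM UNIV M \<Otimes>\<^sub>M PiM UNIV M) (PiM UNIV M) (\<lambda>(X, Y). resample J X Y) = PiM UNIV M"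
    (is "distr ?PP ?P ?f = ?P")
proof -
  interpret product_prob_space M UNIV by (intro product_prob_spaceI assms)
  interpret P: prob_space ?P by (rule prob_space_PiM) (rule assms)
  interpret PP: pair_prob_space ?P ?P ..
  show ?thesis
  proof (rule PiM_eq)
    fix K F assume K: "finite K" "K \<subseteq> (UNIV::'i set)" "\<And>j. j \<in> K \<Longrightarrow> F j \<in> sets (M j)"
    let ?A = "\<lambda>K. {X \<in> space ?P. \<forall>i\<in>K. X i \<in> F i}"
    have A: "?A K' \<in> sets ?P" if "K' \<subseteq> K" for K'
    proof (rule sets.sets_Collect_finite_All)
      show "finite K'" using that K(1) by (rule finite_subset)
      fix i assume "i \<in> K'"
      then have "F i \<in> sets (M i)" using that K by auto
      then have "(\<lambda>X. X i) -` F i \<inter> space ?P \<in> sets ?P"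
        by (intro measurable_sets[OF measurable_component_singleton]) auto
      also have "(\<lambda>X. X i) -` F i \<inter> space ?P = {X \<in> space ?P. X i \<in> F i}" by auto
      finally show "{X \<in> space ?P. X i \<in> F i} \<in> sets ?P" .
    qed
    have emb: "prod_emb UNIV M K (\<Pi>\<^sub>E j\<in>K. F j) = ?A K"
      by (auto simp: prod_emb_def space_PiM PiE_def Pi_def restrict_def extensional_def)
    have "emeasure (distr ?PP ?P ?f) (?A K) = emeasure ?PP (?f -` ?A K \<inter> space ?PP)"
      using A by (intro emeasure_distr meas) auto
    also have "?f -` ?A K \<inter> space ?PP = ?A (K - J) \<times> ?A (K \<inter> J)"
      by (auto simp: resample_def space_pair_measure space_PiM PiE_def Pi_def split: if_splits)
    also have "emeasure ?PP \<dots> = emeasure ?P (?A (K - J)) * emeasure ?P (?A (K \<inter> J))"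
      using A by (intro P.emeasure_pair_measure_Times) auto
    also have "\<dots> = (\<Prod>j\<in>K-J. emeasure (M j) (F j)) * (\<Prod>j\<in>K\<inter>J. emeasure (M j) (F j))"
      using K by (intro arg_cong2[where f = "(*)"] emeasure_PiM_Collect) auto
    also have "\<dots> = (\<Prod>j\<in>K. emeasure (M j) (F j))"
      using K(1) by (subst mult.commute) (simp flip: prod.Int_Diff)
    finally show "emeasure (distr ?PP ?P ?f) (prod_emb UNIV M K (\<Pi>\<^sub>E j\<in>K. F j)) = (\<Prod>j\<in>K. emeasure (M j) (F j))"
      by (simp add: emb)
  qed simp
qed

text \<open>This takes the place of conditioning on the coordinates outside \<open>J\<close>: the
  inner integral runs over fresh values of the coordinates in \<open>J\<close> with all others
  frozen.\<close>

lemma nn_integral_resample: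
  assumes l: "0 < l" and [measurable]: "h \<in> borel_measurable clock_space"
  shows "(\<integral>\<^sup>+X. h X \<partial>clock_measure l)
    = (\<integral>\<^sup>+X. (\<integral>\<^sup>+Y. h (resample J X Y) \<partial>clock_measure l) \<partial>clock_measure l)"
proof -
  let ?P = "clock_measure l"
  interpret P: prob_space ?P using l by (rule prob_space_clock_measure)
  interpret PP: pair_prob_space ?P ?P ..
  have [measurable]: "(\<lambda>(X, Y). resample J X Y) \<in> ?P \<Otimes>\<^sub>M ?P \<rightarrow>\<^sub>M ?P"
    by (simp add: split_beta')
  have "distr (?P \<Otimes>\<^sub>M ?P) ?P (\<lambda>(X, Y). resample J X Y) = ?P"
    unfolding clock_measure_def
  proof (rule distr_resample_PiM)
    show "prob_space (clock_law l i)" for i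
      using l by (cases i) (auto intro!: prob_space_exponential_density rate_pos)
    show "(\<lambda>(X, Y). resample J X Y) \<in> Pi\<^sub>M UNIV (clock_law l) \<Otimes>\<^sub>M Pi\<^sub>M UNIV (clock_law l)
      \<rightarrow>\<^sub>M Pi\<^sub>M UNIV (clock_law l)"
      using \<open>(\<lambda>(X, Y). resample J X Y) \<in> ?P \<Otimes>\<^sub>M ?P \<rightarrow>\<^sub>M ?P\<close> by (simp add: clock_measure_def)
  qed
  then have "(\<integral>\<^sup>+X. h X \<partial>?P) = (\<integral>\<^sup>+X. h X \<partial>distr (?P \<Otimes>\<^sub>M ?P) ?P (\<lambda>(X, Y). resample J X Y))"
    by simp
  also have "\<dots> = (\<integral>\<^sup>+Z. h (resample J (fst Z) (snd Z)) \<partial>(?P \<Otimes>\<^sub>M ?P))"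
    by (subst nn_integral_distr) (auto simp: split_beta')
  also have "\<dots> = (\<integral>\<^sup>+X. (\<integral>\<^sup>+Y. h (resample J X Y) \<partial>?P) \<partial>?P)"
    by (subst P.nn_integral_fst[symmetric]) auto
  finally show ?thesis .
qed

subsection \<open>Regular clocks\<close>

definition clock_sum :: "clocks \<Rightarrow> edge \<Rightarrow> kind \<Rightarrow> nat \<Rightarrow> real" where
  "clock_sum X e c k = (\<Sum>j<k. X (e, c, j))"

lemma clock_sum_0 [simp]: "clock_sum X e c 0 = 0"
  and clock_sum_Suc: "clock_sum X e c (Suc k) = clock_sum X e c k + X (e, c, k)"
  by (simp_all add: clock_sum_def)

lemma arrivals_eq: "arrivals X e c = range (\<lambda>k. clock_sum X e c (Suc k))"
  by (simp add: arrivals_def clock_sum_def lessThan_Suc_atMost)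

lemma clock_sum_measurable [measurable]: "(\<lambda>X. clock_sum X e c k) \<in> borel_measurable clock_space"
  unfolding clock_sum_def by measurable

definition regular_clock :: "clocks \<Rightarrow> edge \<Rightarrow> kind \<Rightarrow> bool" where
  "regular_clock X e c \<longleftrightarrow> (\<forall>k. 0 < X (e, c, k)) \<and> (\<forall>N::nat. \<exists>k. real N < clock_sum X e c k)"

definition regular :: "clocks \<Rightarrow> bool" where
  "regular X \<longleftrightarrow> (\<forall>e c. regular_clock X e c)"

text \<open>The type of edges is uncountable, so almost sure regularity of each clock does not yield
  regularity of all clocks at once. Replacing irregular clocks by rings at 1, 2, 3, ... makes
  regularity hold everywhere, and on a finite edge set nothing changes almost surely. Each clock is
  repaired from its own values only, so statements such as \<open>clock_free\<close>
  survive.\<close>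

definition regularize :: "clocks \<Rightarrow> clocks" where
  "regularize X = (\<lambda>(e, c, k). if regular_clock X e c then X (e, c, k) else 1)"

lemma regular_regularize: "regular (regularize X)"
  unfolding regular_def
proof safe
  fix e c
  show "regular_clock (regularize X) e c"
  proof (cases "regular_clock X e c")
    case True
    then have "clock_sum (regularize X) e c k = clock_sum X e c k" for k
      by (simp add: clock_sum_def regularize_def)
    with True show ?thesis by (simp add: regular_clock_def regularize_def)
  next
    case False
    then have "clock_sum (regularize X) e c k = real k" for k
      by (simp add: clock_sum_def regularize_def)
    moreover have "\<exists>k. real N < real k" for N by (rule exI[of _ "Suc N"]) simp
    ultimately show ?thesis using False by (auto simp: regular_clock_def regularize_def)
  qed
qed

lemma regular_clock_measurable [measurable]: "Measurable.pred clock_space (\<lambda>X. regular_clock X e c)"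
  unfolding regular_clock_def by measurable

lemma regularize_measurable [measurable]: "regularize \<in> clock_space \<rightarrow>\<^sub>M clock_space"
proof (rule measurable_PiM_single')
  fix i :: "edge \<times> kind \<times> nat"
  obtain e c k where i: "i = (e, c, k)" by (cases i)
  show "(\<lambda>X. regularize X i) \<in> borel_measurable clock_space"
    unfolding i regularize_def by (simp, measurable)
qed (auto simp: space_PiM)

lemma regular_clock_cong:
  assumes "\<And>k. X (e, c, k) = X' (e, c, k)"
  shows "regular_clock X e c = regular_clock X' e c"
  using assms by (simp add: regular_clock_def clock_sum_def)

lemma regularize_cong:
  assumes "\<And>k. X (e, c, k) = X' (e, c, k)"
  shows "regularize X (e, c, k) = regularize X' (e, c, k)"
  using assms regular_clock_cong[of X e c X'] by (simp add: regularize_def)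

lemma nn_integral_exp_clock_sum:
  assumes l: "0 < l"
  shows "(\<integral>\<^sup>+X. ennreal (exp (- clock_sum X e c k)) \<partial>clock_measure l)
    = ennreal ((rate l c / (rate l c + 1)) ^ k)"
proof (induction k)
  case 0
  then show ?case using prob_space.emeasure_space_1[OF prob_space_clock_measure[OF l]] by simp
next
  case (Suc k)
  interpret P: prob_space "clock_measure l" using l by (rule prob_space_clock_measure)
  let ?J = "{(e, c, k)}"
  have r: "0 < rate l c" using l by (rule rate_pos)
  have s: "clock_sum (resample ?J X Y) e c k = clock_sum X e c k" for X Y
    by (simp add: clock_sum_def resample_def)
  have "(\<integral>\<^sup>+X. ennreal (exp (- clock_sum X e c (Suc k))) \<partial>clock_measure l)
      = (\<integral>\<^sup>+X. (\<integral>\<^sup>+Y. ennreal (exp (- clock_sum (resample ?J X Y) e c (Suc k))) \<partial>clock_measure l) \<partial>clock_measure l)"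
    by (rule nn_integral_resample[OF l]) measurable
  also have "\<dots> = (\<integral>\<^sup>+X. (\<integral>\<^sup>+Y. ennreal (exp (- clock_sum X e c k)) * ennreal (exp (- 1 * Y (e, c, k))) \<partial>clock_measure l) \<partial>clock_measure l)"
    unfolding clock_sum_Suc s by (simp add: resample_def flip: ennreal_mult exp_add)
  also have "\<dots> = (\<integral>\<^sup>+X. ennreal (exp (- clock_sum X e c k)) * (\<integral>\<^sup>+Y. ennreal (exp (- 1 * Y (e, c, k))) \<partial>clock_measure l) \<partial>clock_measure l)"
    by (intro nn_integral_cong nn_integral_cmult) measurable
  also have "(\<integral>\<^sup>+Y. ennreal (exp (- 1 * Y (e, c, k))) \<partial>clock_measure l) = ennreal (rate l c / (rate l c + 1))"
    using nn_integral_clock_component[OF l, of "\<lambda>y. ennreal (exp (- 1 * y))" e c k]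
      nn_integral_exp_exponential[of "rate l c" 1] r by simp
  also have "(\<integral>\<^sup>+X. ennreal (exp (- clock_sum X e c k)) * ennreal (rate l c / (rate l c + 1)) \<partial>clock_measure l)
     = (\<integral>\<^sup>+X. ennreal (exp (- clock_sum X e c k)) \<partial>clock_measure l) * ennreal (rate l c / (rate l c + 1))"
    by (rule nn_integral_multc) measurable
  finally show ?case using r unfolding Suc.IH by (simp add: mult.commute flip: ennreal_mult)
qed

lemma AE_clock_pos:
  assumes l: "0 < l"
  shows "AE X in clock_measure l. 0 < X (e, c, k)"
proof -
  have "AE y in exponential (rate l c). 0 < y"
  proof (subst AE_density)
    have "AE y in lborel. y \<noteq> (0::real)" by (rule AE_lborel_singleton)
    then show "AE y in lborel. 0 < ennreal (exponential_density (rate l c) y) \<longrightarrow> 0 < y"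
      by eventually_elim (auto simp: exponential_density_def)
  qed simp
  then have "AE y in distr (clock_measure l) borel (\<lambda>X. X (e, c, k)). 0 < y"
    unfolding distr_clock_component[OF l] .
  then show ?thesis by (subst (asm) AE_distr_iff) auto
qed

text \<open>Exponential Markov inequality: staying below \<open>a\<close> up to index
  \<open>k\<close> has probability at most \<open>exp a * q ^ k\<close>, where \<open>q < 1\<close>
  is the Laplace transform of one interarrival time at 1.\<close>

lemma AE_clock_sum_unbounded:
  assumes l: "0 < l"
  shows "AE X in clock_measure l. \<exists>k. a < clock_sum X e c k"
proof -
  let ?P = "clock_measure l"
  interpret P: prob_space ?P using l by (rule prob_space_clock_measure)
  define q where "q = rate l c / (rate l c + 1)"
  have q: "0 \<le> q" "q < 1" using rate_pos[OF l, of c] by (auto simp: q_def field_simps)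
  let ?B = "{X. \<forall>k. clock_sum X e c k \<le> a}"
  have B [measurable]: "?B \<in> sets ?P" unfolding sets_clock_measure by (rule clock_sets_Collect) measurable
  have le: "emeasure ?P ?B \<le> ennreal (exp a * q ^ k)" for k
  proof -
    have "emeasure ?P ?B = (\<integral>\<^sup>+X. indicator ?B X \<partial>?P)" by (rule nn_integral_indicator[symmetric]) (rule B)
    also have "\<dots> \<le> (\<integral>\<^sup>+X. ennreal (exp a) * ennreal (exp (- clock_sum X e c k)) \<partial>?P)"
    proof (rule nn_integral_mono)
      fix X
      show "indicator ?B X \<le> ennreal (exp a) * ennreal (exp (- clock_sum X e c k))"
      proof (cases "X \<in> ?B")
        case True
        then have "clock_sum X e c k \<le> a" by auto
        then have "1 \<le> exp a * exp (- clock_sum X e c k)"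
          by (simp flip: exp_add)
        with True show ?thesis by (simp add: ennreal_1[symmetric] flip: ennreal_mult del: ennreal_1)
      qed simp
    qed
    also have "\<dots> = ennreal (exp a) * (\<integral>\<^sup>+X. ennreal (exp (- clock_sum X e c k)) \<partial>?P)"
      by (rule nn_integral_cmult) measurable
    also have "\<dots> = ennreal (exp a * q ^ k)"
      using q by (simp add: nn_integral_exp_clock_sum[OF l] q_def ennreal_mult)
    finally show ?thesis .
  qed
  have "(\<lambda>k. ennreal (exp a * q ^ k)) \<longlonglongrightarrow> ennreal (exp a * 0)"
    using q by (intro tendsto_ennrealI tendsto_mult tendsto_const LIMSEQ_realpow_zero)
  then have "emeasure ?P ?B \<le> ennreal (exp a * 0)"
    by (rule LIMSEQ_le_const) (use le in auto)
  then have "emeasure ?P ?B = 0" by simp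
  then have "AE X in ?P. X \<notin> ?B" using AE_not_in[OF null_setsI[OF _ B]] by simp
  then show ?thesis by eventually_elim (auto simp: not_le)
qed

lemma AE_regular_clock: "0 < l \<Longrightarrow> AE X in clock_measure l. regular_clock X e c"
  unfolding regular_clock_def
  by (intro AE_conjI AE_all_countable[THEN iffD2] allI AE_clock_pos AE_clock_sum_unbounded)

lemma AE_regularize_eq:
  assumes "0 < l" "finite E"
  shows "AE X in clock_measure l. \<forall>e\<in>E. \<forall>c k. regularize X (e, c, k) = X (e, c, k)"
proof -
  have "AE X in clock_measure l. \<forall>e\<in>E. \<forall>c\<in>{Spread, Chase}. regular_clock X e c"
    using assms by (intro AE_finite_allI AE_regular_clock) auto
  then show ?thesis
  proof eventually_elim
    case (elim X)
    have "c \<in> {Spread, Chase}" for c by (cases c) auto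
    with elim have "regular_clock X e c" if "e \<in> E" for e c using that by blast
    then show ?case by (simp add: regularize_def)
  qed
qed

subsection \<open>The next ring of a clock\<close>

text \<open>The junk value \<open>0\<close> (for an irregular clock) is irrelevant; the series makes measurability immediate.\<close>

definition next_ring :: "clocks \<Rightarrow> edge \<Rightarrow> kind \<Rightarrow> real \<Rightarrow> real" where
  "next_ring X e c t =
     (\<Sum>k. if clock_sum X e c k \<le> t \<and> t < clock_sum X e c (Suc k) then clock_sum X e c (Suc k) else 0)"

lemma next_ring_cong:
  assumes "\<And>k. X (e, c, k) = X' (e, c, k)"
  shows "next_ring X e c = next_ring X' e c"
proof -
  have *: "clock_sum X e c = clock_sum X' e c" using assms by (simp add: clock_sum_def fun_eq_iff)
  show ?thesis by (rule ext) (unfold next_ring_def *, rule refl)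
qed

lemma arrivals_cong:
  assumes "\<And>k. X (e, c, k) = X' (e, c, k)"
  shows "arrivals X e c = arrivals X' e c"
  using assms by (simp add: arrivals_def)

lemma next_ring_measurable [measurable]:
  assumes [measurable]: "f \<in> N \<rightarrow>\<^sub>M clock_space" "g \<in> borel_measurable N"
  shows "(\<lambda>x. next_ring (f x) e c (g x)) \<in> borel_measurable N"
proof -
  have [measurable]: "(\<lambda>x. clock_sum (f x) e c k) \<in> borel_measurable N" for k
    using measurable_compose[OF assms(1) clock_sum_measurable] .
  show ?thesis unfolding next_ring_def by measurable
qed

context
  fixes X :: clocks and e c
  assumes reg: "regular_clock X e c"
begin

lemma clock_sum_strict_mono: "strict_mono (clock_sum X e c)"
  using reg by (auto simp: strict_mono_Suc_iff clock_sum_Suc regular_clock_def)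

lemma clock_sum_gt: "\<exists>k. t < clock_sum X e c k"
proof -
  obtain N :: nat where "t < real N" using reals_Archimedean2 by blast
  moreover obtain k where "real N < clock_sum X e c k" using reg by (auto simp: regular_clock_def)
  ultimately show ?thesis by (intro exI[of _ k]) simp
qed

lemma clock_index:
  assumes "0 \<le> t"
  obtains k where "clock_sum X e c k \<le> t" "t < clock_sum X e c (Suc k)"
proof -
  define m where "m = (LEAST k. t < clock_sum X e c k)"
  have m: "t < clock_sum X e c m" unfolding m_def using clock_sum_gt by (rule LeastI_ex)
  moreover from this assms have "m \<noteq> 0" by (cases m) auto
  moreover have "\<not> t < clock_sum X e c (m - 1)"
    using \<open>m \<noteq> 0\<close> unfolding m_def by (intro not_less_Least) simp
  ultimately show ?thesis by (intro that[of "m - 1"]) auto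
qed

lemma clock_index_unique:
  assumes "clock_sum X e c k \<le> t" "t < clock_sum X e c (Suc k)"
    and "clock_sum X e c k' \<le> t" "t < clock_sum X e c (Suc k')"
  shows "k = k'"
proof -
  have "k < Suc k'" "k' < Suc k"
    using assms by (auto intro: le_less_trans simp flip: strict_mono_less[OF clock_sum_strict_mono])
  then show ?thesis by simp
qed

text \<open>The intervals between consecutive rings are disjoint, so exactly one summand survives.
  The general codomain serves both the real series in \<open>next_ring\<close> and the
  \<open>ennreal\<close> series in \<open>nn_integral_next_ring\<close>.\<close>

lemma next_ring_suminf:
  fixes g :: "real \<Rightarrow> 'b::{t2_space, comm_monoid_add, topological_comm_monoid_add}"
  assumes "clock_sum X e c k \<le> t" "t < clock_sum X e c (Suc k)"
  shows "(\<Sum>k. if clock_sum X e c k \<le> t \<and> t < clock_sum X e c (Suc k) then g (clock_sum X e c (Suc k)) else 0)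
    = g (clock_sum X e c (Suc k))"
proof -
  have "(\<Sum>i. if clock_sum X e c i \<le> t \<and> t < clock_sum X e c (Suc i) then g (clock_sum X e c (Suc i)) else 0)
    = (\<Sum>i\<in>{k}. if clock_sum X e c i \<le> t \<and> t < clock_sum X e c (Suc i) then g (clock_sum X e c (Suc i)) else 0)"
    using assms clock_index_unique by (intro suminf_finite) auto
  also have "\<dots> = g (clock_sum X e c (Suc k))" using assms by simp
  finally show ?thesis .
qed

lemma next_ring_eq:
  assumes "clock_sum X e c k \<le> t" "t < clock_sum X e c (Suc k)"
  shows "next_ring X e c t = clock_sum X e c (Suc k)"
  unfolding next_ring_def using next_ring_suminf[OF assms, of "\<lambda>x. x"] .

lemma next_ring_gt: "0 \<le> t \<Longrightarrow> t < next_ring X e c t"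
  by (erule clock_index) (simp add: next_ring_eq)

lemma next_ring_arrival: "0 \<le> t \<Longrightarrow> next_ring X e c t \<in> arrivals X e c"
  by (erule clock_index) (auto simp: next_ring_eq arrivals_eq)

lemma next_ring_le:
  assumes "0 \<le> t" "s \<in> arrivals X e c" "t < s"
  shows "next_ring X e c t \<le> s"
proof -
  obtain k where k: "clock_sum X e c k \<le> t" "t < clock_sum X e c (Suc k)"
    using assms(1) by (rule clock_index)
  obtain m where m: "s = clock_sum X e c (Suc m)" using assms by (auto simp: arrivals_eq)
  have "k < Suc m"
    using k m assms by (auto intro: le_less_trans simp flip: strict_mono_less[OF clock_sum_strict_mono])
  then have "Suc k \<le> Suc m" by simp
  then have "clock_sum X e c (Suc k) \<le> s"
    using m strict_mono_mono[OF clock_sum_strict_mono] by (auto dest: monoD)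
  then show ?thesis using next_ring_eq[OF k] by simp
qed

lemma no_arrival_iff:
  assumes "0 \<le> t"
  shows "arrivals X e c \<inter> {t<..t + d} = {} \<longleftrightarrow> t + d < next_ring X e c t"
  using next_ring_le[OF assms] next_ring_gt[OF assms] next_ring_arrival[OF assms]
  by (force simp: not_le)

lemma arrivals_pos: "s \<in> arrivals X e c \<Longrightarrow> 0 < s"
  using strict_mono_less[OF clock_sum_strict_mono, of 0] by (auto simp: arrivals_eq)

lemma finite_arrivals_le: "finite {s \<in> arrivals X e c. s \<le> t}"
proof -
  obtain m where m: "t < clock_sum X e c m" using clock_sum_gt by blast
  have "{s \<in> arrivals X e c. s \<le> t} \<subseteq> clock_sum X e c ` {..m}"
  proof
    fix s assume "s \<in> {s \<in> arrivals X e c. s \<le> t}"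
    then obtain k where k: "s = clock_sum X e c (Suc k)" "s \<le> t" by (auto simp: arrivals_eq)
    then have "Suc k < m" using m by (simp flip: strict_mono_less[OF clock_sum_strict_mono])
    then show "s \<in> clock_sum X e c ` {..m}" using k by auto
  qed
  then show ?thesis by (rule finite_subset) auto
qed

end

text \<open>Split by the number \<open>k\<close> of rings up to time \<open>t\<close>. Resampling
  the interarrival time that covers \<open>t\<close>, together with memorylessness, produces the
  same exponential integral for every \<open>k\<close>, with weight \<open>w k\<close>.\<close>

lemma nn_integral_next_ring:
  assumes l: "0 < l" and t: "0 \<le> t" and [measurable]: "g \<in> borel_measurable borel"
  shows "(\<integral>\<^sup>+X. g (next_ring X e c t - t) \<partial>clock_measure l) = (\<integral>\<^sup>+y. g y \<partial>exponential (rate l c))"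
proof -
  let ?P = "clock_measure l" and ?r = "rate l c"
  interpret P: prob_space ?P using l by (rule prob_space_clock_measure)
  have r: "0 < ?r" using l by (rule rate_pos)
  \<comment> \<open>\<open>w k\<close> is the probability that exactly \<open>k\<close> rings occur
    up to time \<open>t\<close>.\<close>
  define w where "w k = (\<integral>\<^sup>+X. indicator {X. clock_sum X e c k \<le> t} X
     * ennreal (exp (- ?r * (t - clock_sum X e c k))) \<partial>?P)" for k
  define h where "h g k X = (if clock_sum X e c k \<le> t \<and> t < clock_sum X e c (Suc k)
     then g (clock_sum X e c (Suc k) - t) else 0)" for g :: "real \<Rightarrow> ennreal" and k X
  have hm [measurable]: "h g k \<in> borel_measurable clock_space" if [measurable]: "g \<in> borel_measurable borel" for g k
    unfolding h_def by measurable
  have summand: "(\<integral>\<^sup>+X. h g k X \<partial>?P) = w k * (\<integral>\<^sup>+y. g y \<partial>exponential ?r)"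
    if g[measurable]: "g \<in> borel_measurable borel" for g k
  proof -
    let ?J = "{(e, c, k)}"
    have s: "clock_sum (resample ?J X Y) e c k = clock_sum X e c k" for X Y
      by (simp add: clock_sum_def resample_def)
    have "(\<integral>\<^sup>+X. h g k X \<partial>?P) = (\<integral>\<^sup>+X. (\<integral>\<^sup>+Y. h g k (resample ?J X Y) \<partial>?P) \<partial>?P)"
      by (rule nn_integral_resample[OF l]) measurable
    also have "\<dots> = (\<integral>\<^sup>+X. indicator {X. clock_sum X e c k \<le> t} X
     * ennreal (exp (- ?r * (t - clock_sum X e c k))) * (\<integral>\<^sup>+y. g y \<partial>exponential ?r) \<partial>?P)"
    proof (rule nn_integral_cong)
      fix X
      let ?u = "t - clock_sum X e c k"
      show "(\<integral>\<^sup>+Y. h g k (resample ?J X Y) \<partial>?P) = indicator {X. clock_sum X e c k \<le> t} X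
     * ennreal (exp (- ?r * ?u)) * (\<integral>\<^sup>+y. g y \<partial>exponential ?r)"
      proof (cases "clock_sum X e c k \<le> t")
        case True
        have "(\<integral>\<^sup>+Y. h g k (resample ?J X Y) \<partial>?P)
            = (\<integral>\<^sup>+Y. indicator {?u<..} (Y (e, c, k)) * g (Y (e, c, k) - ?u) \<partial>?P)"
          unfolding h_def clock_sum_Suc s using True
          by (intro nn_integral_cong) (auto simp: resample_def indicator_def algebra_simps)
        also have "\<dots> = (\<integral>\<^sup>+y. indicator {?u<..} y * g (y - ?u) \<partial>exponential ?r)"
          by (rule nn_integral_clock_component[OF l]) measurable
        also have "\<dots> = ennreal (exp (- ?r * ?u)) * (\<integral>\<^sup>+y. g y \<partial>exponential ?r)"
          using True r by (intro exponential_memoryless) auto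
        finally show ?thesis using True by simp
      next
        case False
        then show ?thesis by (simp add: h_def s)
      qed
    qed
    also have "\<dots> = w k * (\<integral>\<^sup>+y. g y \<partial>exponential ?r)"
      unfolding w_def by (rule nn_integral_multc) measurable
    finally show ?thesis .
  qed
  have main: "(\<integral>\<^sup>+X. g (next_ring X e c t - t) \<partial>?P) = (\<Sum>k. w k) * (\<integral>\<^sup>+y. g y \<partial>exponential ?r)"
    if g[measurable]: "g \<in> borel_measurable borel" for g
  proof -
    have "(\<integral>\<^sup>+X. g (next_ring X e c t - t) \<partial>?P) = (\<integral>\<^sup>+X. (\<Sum>k. h g k X) \<partial>?P)"
    proof (rule nn_integral_cong_AE)
      have "AE X in ?P. regular_clock X e c" using l by (rule AE_regular_clock)
      then show "AE X in ?P. g (next_ring X e c t - t) = (\<Sum>k. h g k X)"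
      proof eventually_elim
        case (elim X)
        obtain k where k: "clock_sum X e c k \<le> t" "t < clock_sum X e c (Suc k)"
          using elim t by (rule clock_index)
        show ?case unfolding h_def
          using next_ring_suminf[OF elim k, of "\<lambda>x. g (x - t)"] next_ring_eq[OF elim k] by simp
      qed
    qed
    also have "\<dots> = (\<Sum>k. (\<integral>\<^sup>+X. h g k X \<partial>?P))"
      by (rule nn_integral_suminf) measurable
    also have "\<dots> = (\<Sum>k. w k) * (\<integral>\<^sup>+y. g y \<partial>exponential ?r)"
      by (simp add: summand ennreal_suminf_multc)
    finally show ?thesis .
  qed
  have "(\<integral>\<^sup>+y. 1 \<partial>exponential ?r) = 1"
    using prob_space.emeasure_space_1[OF prob_space_exponential_density[OF r]] by simp
  \<comment> \<open>Instead of evaluating the weights, \<open>main\<close> is applied to the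
    constant function 1, which forces them to add up to 1.\<close>
  then have "(\<Sum>k. w k) = 1" using main[of "\<lambda>_. 1"] P.emeasure_space_1 by simp
  then show ?thesis using main[of g] by simp
qed

text \<open>Dependence on all clocks but one is expressed as invariance under changing that clock;
  this can be verified by comparing two runs of the dynamics.\<close>

definition clock_free :: "edge \<Rightarrow> kind \<Rightarrow> (clocks \<Rightarrow> 'a) \<Rightarrow> bool" where
  "clock_free e c f \<longleftrightarrow>
     (\<forall>X X'. (\<forall>e' c' k. (e', c') \<noteq> (e, c) \<longrightarrow> X (e', c', k) = X' (e', c', k)) \<longrightarrow> f X = f X')"

lemma clock_free_resample:
  "clock_free e c f \<Longrightarrow> f (resample {i. fst i = e \<and> fst (snd i) = c} X Y) = f X"
  by (auto simp: clock_free_def resample_def elim!: allE[of _ "resample {i. fst i = e \<and> fst (snd i) = c} X Y"])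

text \<open>A clock that has not been used to determine the time \<open>\<tau>\<close> rings after \<open>\<tau>\<close> like a new one.\<close>

lemma fresh_clock:
  assumes l: "0 < l"
    and [measurable]: "f \<in> borel_measurable clock_space" "\<tau> \<in> borel_measurable clock_space"
      "g \<in> borel_measurable borel"
    and free: "clock_free e c f" "clock_free e c \<tau>" and nonneg: "\<And>X. 0 \<le> \<tau> X"
  shows "(\<integral>\<^sup>+X. f X * g (next_ring X e c (\<tau> X) - \<tau> X) \<partial>clock_measure l)
    = (\<integral>\<^sup>+X. f X \<partial>clock_measure l) * (\<integral>\<^sup>+y. g y \<partial>exponential (rate l c))"
proof -
  let ?P = "clock_measure l" and ?J = "{i. fst i = e \<and> fst (snd i) = c}"
  interpret P: prob_space ?P using l by (rule prob_space_clock_measure)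
  have nr: "next_ring (resample ?J X Y) e c = next_ring Y e c" for X Y
    by (rule next_ring_cong) (simp add: resample_def)
  have "(\<integral>\<^sup>+X. f X * g (next_ring X e c (\<tau> X) - \<tau> X) \<partial>?P)
     = (\<integral>\<^sup>+X. (\<integral>\<^sup>+Y. f X * g (next_ring Y e c (\<tau> X) - \<tau> X) \<partial>?P) \<partial>?P)"
    by (subst nn_integral_resample[OF l, where J = ?J])
      (simp_all add: clock_free_resample[OF free(1)] clock_free_resample[OF free(2)] nr)
  also have "\<dots> = (\<integral>\<^sup>+X. f X * (\<integral>\<^sup>+Y. g (next_ring Y e c (\<tau> X) - \<tau> X) \<partial>?P) \<partial>?P)"
    by (intro nn_integral_cong nn_integral_cmult) measurable
  also have "\<dots> = (\<integral>\<^sup>+X. f X * (\<integral>\<^sup>+y. g y \<partial>exponential (rate l c)) \<partial>?P)"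
    using nonneg by (simp add: nn_integral_next_ring[OF l])
  also have "\<dots> = (\<integral>\<^sup>+X. f X \<partial>?P) * (\<integral>\<^sup>+y. g y \<partial>exponential (rate l c))"
    by (rule nn_integral_multc) measurable
  finally show ?thesis .
qed

section \<open>The dynamics on a finite graph\<close>

text \<open>Local finiteness provides a last ring before \<open>t\<close>, with \<open>a\<close> as
  fallback. The configuration at \<open>t\<close> is then a single \<open>update\<close> of the
  configuration at \<open>p\<close>.\<close>

lemma ex_predecessor:
  fixes R :: "real set"
  assumes "\<And>t. finite {s \<in> R. s \<le> t}" "0 \<le> a" "a < t"
  shows "\<exists>p. a \<le> p \<and> p < t \<and> R \<inter> {p<..<t} = {} \<and> p \<in> insert a R"
proof -
  let ?S = "insert a {s \<in> R. a \<le> s \<and> s < t}"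
  have fin: "finite ?S" by (intro finite.insertI finite_subset[OF _ assms(1)[of t]]) auto
  define p where "p = Max ?S"
  have p: "p \<in> ?S" unfolding p_def using fin by (intro Max_in) auto
  moreover have "s \<le> p" if "s \<in> ?S" for s unfolding p_def using fin that by (rule Max_ge)
  ultimately have "R \<inter> {p<..<t} = {}" using assms(2,3) by (fastforce simp: not_less)
  with p assms show ?thesis by auto
qed

text \<open>Induction on the number of ring times before \<open>t\<close>. It makes continuous time
  well-founded: a claim at \<open>t\<close> may use the claim at the last ring before
  \<open>t\<close>, or at 0.\<close>

lemma time_induct:
  fixes R :: "real set"
  assumes fin: "\<And>t. finite {s \<in> R. s \<le> t}" and pos: "\<And>s. s \<in> R \<Longrightarrow> 0 < s"
    and step: "\<And>t. 0 \<le> t \<Longrightarrow>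
      (\<And>p. 0 \<le> p \<Longrightarrow> p < t \<Longrightarrow> R \<inter> {p<..<t} = {} \<Longrightarrow> p \<in> insert 0 R \<Longrightarrow> P p) \<Longrightarrow> P t"
    and t: "0 \<le> t"
  shows "P t"
  using t
proof (induction "card {s \<in> R. s < t}" arbitrary: t rule: less_induct)
  case less
  have P0: "P 0" by (rule step) auto
  show ?case
  proof (rule step[OF less.prems])
    fix p assume p: "0 \<le> p" "p < t" "p \<in> insert 0 R"
    show "P p"
    proof (cases "p = 0")
      case False
      have "finite {s \<in> R. s < t}" by (rule finite_subset[OF _ fin[of t]]) auto
      moreover have "{s \<in> R. s < p} \<subset> {s \<in> R. s < t}" using p False by force
      ultimately have "card {s \<in> R. s < p} < card {s \<in> R. s < t}" by (rule psubset_card_mono)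
      then show ?thesis by (rule less.hyps) (rule p)
    qed (simp add: P0)
  qed
qed

lemma sorted_list_of_set_insert_greatest:
  fixes A :: "'a::linorder set"
  assumes "finite A" "\<And>s. s \<in> A \<Longrightarrow> s < t"
  shows "sorted_list_of_set (insert t A) = sorted_list_of_set A @ [t]"
proof -
  have "sorted_list_of_set (set (sorted_list_of_set A @ [t])) = sorted_list_of_set A @ [t]"
    using assms by (intro sorted_list_of_set.idem_if_sorted_distinct)
      (auto simp: sorted_append intro: less_imp_le)
  then show ?thesis using assms by simp
qed

definition infected :: "edge set \<Rightarrow> clocks \<Rightarrow> vertex \<Rightarrow> bool" where
  "infected E X v \<longleftrightarrow> (\<exists>t\<ge>0. chase_escape E X t v \<noteq> White)"

definition inf_time :: "edge set \<Rightarrow> clocks \<Rightarrow> vertex \<Rightarrow> real" where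
  "inf_time E X v = Inf {t. 0 \<le> t \<and> chase_escape E X t v \<noteq> White}"

lemma update_nonwhite: "\<sigma> v \<noteq> White \<Longrightarrow> update E X t \<sigma> v \<noteq> White"
  and update_Blue: "\<sigma> v = Blue \<Longrightarrow> update E X t \<sigma> v = Blue"
  and update_not_red: "\<sigma> v = White \<Longrightarrow> update E X t \<sigma> v \<noteq> Blue"
  by (auto simp: update_def)

locale chase_dynamics =
  fixes E :: "edge set" and X :: clocks
  assumes finite_E: "finite E" and regular_X: "regular X"
begin

abbreviation "rings \<equiv> ring_times E X"
abbreviation "config \<equiv> chase_escape E X"
abbreviation "T \<equiv> inf_time E X"

lemma regular_clock: "regular_clock X e c"
  using regular_X by (simp add: regular_def)

lemma rings_pos: "s \<in> rings \<Longrightarrow> 0 < s"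
  using arrivals_pos[OF regular_clock] by (auto simp: ring_times_def)

lemma finite_rings: "finite {s \<in> rings. s \<le> t}"
proof -
  have "{s \<in> rings. s \<le> t} = (\<Union>e\<in>E. \<Union>c\<in>{Spread, Chase}. {s \<in> arrivals X e c. s \<le> t})"
    unfolding ring_times_def UNIV_kind by auto
  then show ?thesis using finite_E finite_arrivals_le[OF regular_clock] by auto
qed

lemma update_no_ring: "t \<notin> rings \<Longrightarrow> update E X t \<sigma> = \<sigma>"
  by (auto simp: update_def ring_times_def fun_eq_iff)

lemma config_initial: "t \<le> 0 \<Longrightarrow> config t = initial"
proof -
  assume "t \<le> 0"
  then have "{s \<in> rings. s \<le> t} = {}" using rings_pos by force
  then show ?thesis by (simp only: chase_escape_def) simp
qed

lemma config_step:
  assumes "p < t" "rings \<inter> {p<..<t} = {}"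
  shows "config t = update E X t (config p)"
proof (cases "t \<in> rings")
  case True
  then have "{s \<in> rings. s \<le> t} = insert t {s \<in> rings. s \<le> p}"
    using assms by fastforce
  moreover have "sorted_list_of_set (insert t {s \<in> rings. s \<le> p})
      = sorted_list_of_set {s \<in> rings. s \<le> p} @ [t]"
    using assms by (intro sorted_list_of_set_insert_greatest finite_rings) auto
  ultimately have "sorted_list_of_set {s \<in> rings. s \<le> t} = sorted_list_of_set {s \<in> rings. s \<le> p} @ [t]"
    by (rule trans[OF arg_cong[where f = sorted_list_of_set]])
  then show ?thesis by (simp only: chase_escape_def fold_append o_apply fold.simps id_apply)
next
  case False
  have "s \<le> t \<longleftrightarrow> s \<le> p" if "s \<in> rings" for s
  proof -
    have "s \<noteq> t" "\<not> (p < s \<and> s < t)" using that False assms(2) by auto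
    then show ?thesis using assms(1) by linarith
  qed
  then have "{s \<in> rings. s \<le> t} = {s \<in> rings. s \<le> p}" by auto
  then show ?thesis by (simp only: chase_escape_def update_no_ring[OF False])
qed

lemma config_const:
  assumes "p \<le> t" "rings \<inter> {p<..t} = {}"
  shows "config t = config p"
proof (cases "p = t")
  case False
  with assms have "p < t" "rings \<inter> {p<..<t} = {}" "t \<notin> rings" by auto
  then show ?thesis using config_step update_no_ring by simp
qed simp

lemma config_preserved:
  assumes Q: "\<And>\<sigma> r. Q (\<sigma> v) \<Longrightarrow> Q (update E X r \<sigma> v)"
    and s: "0 \<le> s" "s \<le> t" "Q (config s v)"
  shows "Q (config t v)"
proof -
  have "0 \<le> t" using s by simp
  have "s \<le> t \<longrightarrow> Q (config t v)"
  proof (rule time_induct[where R = rings and t = t and P = "\<lambda>t. s \<le> t \<longrightarrow> Q (config t v)"])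
    fix t assume IH: "\<And>p. 0 \<le> p \<Longrightarrow> p < t \<Longrightarrow> rings \<inter> {p<..<t} = {} \<Longrightarrow> p \<in> insert 0 rings
      \<Longrightarrow> s \<le> p \<longrightarrow> Q (config p v)"
    show "s \<le> t \<longrightarrow> Q (config t v)"
    proof
      assume "s \<le> t"
      show "Q (config t v)"
      proof (cases "s = t")
        case False
        with \<open>s \<le> t\<close> s(1) obtain p where p: "s \<le> p" "p < t" "rings \<inter> {p<..<t} = {}" "p \<in> insert s rings"
          using ex_predecessor[of rings s t] finite_rings by force
        have "Q (config p v)"
        proof (cases "p = s")
          case False
          with p IH[of p] s show ?thesis by auto
        qed (simp add: s)
        then show ?thesis using config_step[OF p(2,3)] Q by simp
      qed (use s in simp)
    qed
  qed (use finite_rings rings_pos \<open>0 \<le> t\<close> in auto)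
  then show ?thesis using s by simp
qed

lemma config_nonwhite_mono: "0 \<le> s \<Longrightarrow> s \<le> t \<Longrightarrow> config s v \<noteq> White \<Longrightarrow> config t v \<noteq> White"
  using config_preserved[where Q = "\<lambda>x. x \<noteq> White" and s = s] update_nonwhite by blast

lemma config_Blue_mono: "0 \<le> s \<Longrightarrow> s \<le> t \<Longrightarrow> config s v = Blue \<Longrightarrow> config t v = Blue"
  using config_preserved[where Q = "\<lambda>x. x = Blue" and s = s] update_Blue by blast

lemma config_last_ring:
  assumes "0 \<le> t"
  shows "\<exists>p. 0 \<le> p \<and> p \<le> t \<and> config p = config t \<and> p \<in> insert 0 rings"
proof (cases "t \<in> insert 0 rings")
  case False
  with assms have "0 < t" by auto
  then obtain p where p: "0 \<le> p" "p < t" "rings \<inter> {p<..<t} = {}" "p \<in> insert 0 rings"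
    using ex_predecessor[of rings 0 t] finite_rings by auto
  moreover from this False have "rings \<inter> {p<..t} = {}" by (auto simp: less_le)
  ultimately show ?thesis using config_const[of p t] by auto
qed (use assms in auto)

text \<open>The configuration is constant between rings, so the infimum is attained: it suffices to
  compare 0 and the finitely many rings up to some time at which \<open>v\<close> is seen
  infected.\<close>

lemma inf_time:
  assumes "infected E X v"
  shows inf_time_nonneg: "0 \<le> T v" and inf_time_nonwhite: "config (T v) v \<noteq> White"
    and inf_time_ring: "T v \<in> insert 0 rings"
    and inf_time_least: "\<And>s. 0 \<le> s \<Longrightarrow> config s v \<noteq> White \<Longrightarrow> T v \<le> s"
proof -
  obtain t where t: "0 \<le> t" "config t v \<noteq> White" using assms by (auto simp: infected_def)
  let ?S = "{r \<in> insert 0 {s \<in> rings. s \<le> t}. config r v \<noteq> White}"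
  have fin: "finite ?S" using finite_rings[of t] by auto
  have "?S \<noteq> {}" using config_last_ring[OF t(1)] t(2) by fastforce
  define m where "m = Min ?S"
  have m: "m \<in> ?S" unfolding m_def using fin \<open>?S \<noteq> {}\<close> by (rule Min_in)
  have "m \<le> t" using m t by auto
  have least: "m \<le> s" if s: "0 \<le> s" "config s v \<noteq> White" for s
  proof (cases "s \<le> t")
    case True
    obtain p where "0 \<le> p" "p \<le> s" "config p = config s" "p \<in> insert 0 rings"
      using config_last_ring[OF s(1)] by auto
    with s True have "p \<in> ?S" by auto
    then have "m \<le> p" unfolding m_def using fin by (intro Min_le)
    with \<open>p \<le> s\<close> show ?thesis by simp
  qed (use \<open>m \<le> t\<close> in simp)
  have m0: "0 \<le> m" using m rings_pos by (auto intro: less_imp_le)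
  have "T v = m" unfolding inf_time_def
    using m m0 least by (intro cInf_eq_minimum) auto
  with m m0 least show "0 \<le> T v" "config (T v) v \<noteq> White" "T v \<in> insert 0 rings"
    "\<And>s. 0 \<le> s \<Longrightarrow> config s v \<noteq> White \<Longrightarrow> T v \<le> s" by auto
qed

lemma nonwhite_iff:
  assumes "0 \<le> t"
  shows "config t v \<noteq> White \<longleftrightarrow> infected E X v \<and> T v \<le> t"
proof
  assume "config t v \<noteq> White"
  with assms show "infected E X v \<and> T v \<le> t"
    using inf_time_least[of v t] by (auto simp: infected_def)
next
  assume "infected E X v \<and> T v \<le> t"
  then show "config t v \<noteq> White"
    using config_nonwhite_mono[of "T v" t v] inf_time_nonneg[of v] inf_time_nonwhite[of v] by auto
qed

lemma infected_root: "infected E X 0" "T 0 = 0"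
  and infected_1: "infected E X 1" "T 1 = 0"
proof -
  have "config 0 0 \<noteq> White" "config 0 1 \<noteq> White" by (simp_all add: config_initial initial_def)
  then show "infected E X 0" "T 0 = 0" "infected E X 1" "T 1 = 0"
    using nonwhite_iff[of 0 0] nonwhite_iff[of 0 1] inf_time_nonneg[of 0] inf_time_nonneg[of 1]
    by (auto intro: antisym)
qed

lemma root_Blue: "0 \<le> t \<Longrightarrow> config t 0 = Blue"
  by (rule config_Blue_mono[of 0]) (simp_all add: config_initial initial_def)

lemma inf_time_pos:
  assumes "infected E X v" "v \<noteq> 0" "v \<noteq> 1"
  shows "0 < T v"
proof -
  have "config 0 v = White" using assms by (simp add: config_initial initial_def)
  then show ?thesis using inf_time_nonwhite[OF assms(1)] inf_time_nonneg[OF assms(1)]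
    by (cases "T v = 0") auto
qed

lemma infection_source:
  assumes v: "infected E X v" "v \<noteq> 0" "v \<noteq> 1"
  obtains e u p where "e \<in> E" "ends e = {u, v}" "T v \<in> arrivals X e Spread" "0 \<le> p" "p < T v"
    "rings \<inter> {p<..<T v} = {}" "config p u = Red" "u \<noteq> v" "config (T v) v = Red"
proof -
  obtain p where p: "0 \<le> p" "p < T v" "rings \<inter> {p<..<T v} = {}"
    using ex_predecessor[of rings 0 "T v"] finite_rings inf_time_pos[OF v] by auto
  have w: "config p v = White" using nonwhite_iff[of p v] p by auto
  have "config (T v) v = update E X (T v) (config p) v" using config_step[OF p(2,3)] by simp
  moreover have "config (T v) v \<noteq> White" by (rule inf_time_nonwhite[OF v(1)])
  ultimately obtain e u where e: "e \<in> E" "ends e = {u, v}" "config p u = Red" "T v \<in> arrivals X e Spread"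
    and red: "config (T v) v = Red"
    using w by (auto simp: update_def split: if_splits)
  moreover from e w have "u \<noteq> v" by auto
  ultimately show ?thesis using that p by blast
qed

lemma inf_time_Red:
  assumes "infected E X v" "v \<noteq> 0"
  shows "config (T v) v = Red"
proof (cases "v = 1")
  case True
  then show ?thesis using infected_1 by (simp add: config_initial initial_def)
qed (use infection_source assms in metis)

text \<open>Going back ring by ring from \<open>t\<close>, there is a last moment \<open>p\<close>
  at which \<open>v\<close> is still red, since it cannot be white after \<open>s\<close>. The next
  ring \<open>r\<close> is the one by which blue arrives.\<close>

lemma blue_source:
  assumes "0 \<le> s" "s \<le> t" "config s v = Red" "config t v = Blue"
  shows "\<exists>r e u p. s < r \<and> r \<le> t \<and> e \<in> E \<and> ends e = {u, v} \<and> r \<in> arrivals X e Chase \<and>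
    s \<le> p \<and> p < r \<and> rings \<inter> {p<..<r} = {} \<and> config p u = Blue \<and> config p v = Red"
proof -
  have "0 \<le> t" using assms by simp
  let ?G = "\<lambda>t. \<exists>r e u p. s < r \<and> r \<le> t \<and> e \<in> E \<and> ends e = {u, v} \<and> r \<in> arrivals X e Chase \<and>
    s \<le> p \<and> p < r \<and> rings \<inter> {p<..<r} = {} \<and> config p u = Blue \<and> config p v = Red"
  have "s \<le> t \<longrightarrow> config t v = Blue \<longrightarrow> ?G t"
  proof (rule time_induct[where R = rings and t = t and P = "\<lambda>t. s \<le> t \<longrightarrow> config t v = Blue \<longrightarrow> ?G t"])
    fix t assume IH: "\<And>p. 0 \<le> p \<Longrightarrow> p < t \<Longrightarrow> rings \<inter> {p<..<t} = {} \<Longrightarrow> p \<in> insert 0 rings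
      \<Longrightarrow> s \<le> p \<longrightarrow> config p v = Blue \<longrightarrow> ?G p"
    show "s \<le> t \<longrightarrow> config t v = Blue \<longrightarrow> ?G t"
    proof (intro impI)
      assume t: "s \<le> t" and tB: "config t v = Blue"
      note t = t tB
      with assms have "s < t" by (cases "s = t") auto
      with assms(1) obtain p where p: "s \<le> p" "p < t" "rings \<inter> {p<..<t} = {}" "p \<in> insert s rings"
        using ex_predecessor[of rings s t] finite_rings by force
      have step: "config t v = update E X t (config p) v" using config_step[OF p(2,3)] by simp
      show "?G t"
      proof (cases "config p v = Red")
        case True
        with step t(2) obtain e u where "e \<in> E" "ends e = {u, v}" "config p u = Blue" "t \<in> arrivals X e Chase"
          by (auto simp: update_def split: if_splits)
        with True p \<open>s < t\<close> show ?thesis by blast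
      next
        case False
        moreover have "config p v \<noteq> White"
          using config_nonwhite_mono[OF assms(1) p(1)] assms(3) by simp
        ultimately have "config p v = Blue" by (cases "config p v") auto
        moreover from this assms have "p \<noteq> s" by auto
        ultimately obtain r e u q where "s < r" "r \<le> p" "e \<in> E" "ends e = {u, v}" "r \<in> arrivals X e Chase"
          "s \<le> q" "q < r" "rings \<inter> {q<..<r} = {}" "config q u = Blue" "config q v = Red"
          using IH[of p] p assms(1) by auto
        then show ?thesis using p(2) by (intro exI[of _ r] exI[of _ e] exI[of _ u] exI[of _ q]) auto
      qed
    qed
  qed (use finite_rings rings_pos \<open>0 \<le> t\<close> in auto)
  then show ?thesis using assms by simp
qed

lemma spread_step:
  assumes "0 \<le> p" "p < t" "rings \<inter> {p<..<t} = {}" "config p u = Red"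
    and "e \<in> E" "ends e = {u, v}" "t \<in> arrivals X e Spread"
  shows "config t v \<noteq> White"
  using config_step[OF assms(2,3)] assms by (cases "config p v") (auto simp: update_def)

lemma chase_step:
  assumes "0 \<le> p" "p < t" "rings \<inter> {p<..<t} = {}" "config p u = Blue" "config p v \<noteq> White"
    and "e \<in> E" "ends e = {u, v}" "t \<in> arrivals X e Chase"
  shows "config t v = Blue"
  using config_step[OF assms(2,3)] assms by (cases "config p v") (auto simp: update_def)

end

text \<open>As long as all infected vertices belong to \<open>V\<close>, the dynamics uses only the edges touching \<open>V\<close>,
  their \<open>Spread\<close> clocks, and the \<open>Chase\<close> clocks of the edges within \<open>V\<close>.\<close>

lemma chase_escape_agree:
  assumes "chase_dynamics E X" "chase_dynamics E' X'"
    and edges: "\<And>e. ends e \<inter> V \<noteq> {} \<Longrightarrow> e \<in> E \<longleftrightarrow> e \<in> E'"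
    and spread: "\<And>e. e \<in> E \<Longrightarrow> ends e \<inter> V \<noteq> {} \<Longrightarrow> arrivals X e Spread = arrivals X' e Spread"
    and chase: "\<And>e. e \<in> E \<Longrightarrow> ends e \<subseteq> V \<Longrightarrow> arrivals X e Chase = arrivals X' e Chase"
    and inside: "\<And>r v. 0 \<le> r \<Longrightarrow> r < \<tau> \<Longrightarrow> chase_escape E X r v \<noteq> White \<Longrightarrow> v \<in> V"
    and t: "0 \<le> t" "t \<le> \<tau>"
  shows "chase_escape E X t = chase_escape E' X' t"
proof -
  interpret A: chase_dynamics E X by fact
  interpret B: chase_dynamics E' X' by fact
  let ?R = "A.rings \<union> B.rings"
  have upd: "update E X t \<sigma> = update E' X' t \<sigma>" if \<sigma>: "\<And>v. \<sigma> v \<noteq> White \<Longrightarrow> v \<in> V" for t \<sigma>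
  proof
    fix v
    have S: "(\<exists>e\<in>E. \<exists>u. ends e = {u, v} \<and> \<sigma> u = Red \<and> t \<in> arrivals X e Spread)
      \<longleftrightarrow> (\<exists>e\<in>E'. \<exists>u. ends e = {u, v} \<and> \<sigma> u = Red \<and> t \<in> arrivals X' e Spread)"
      (is "(\<exists>e\<in>E. \<exists>u. ?P X e u) = (\<exists>e\<in>E'. \<exists>u. ?P X' e u)")
    proof -
      have "e \<in> E \<and> ?P X e u \<longleftrightarrow> e \<in> E' \<and> ?P X' e u" for e u
        using edges[of e] spread[of e] \<sigma>[of u] by auto
      then show ?thesis by blast
    qed
    have C: "(\<exists>e\<in>E. \<exists>u. ends e = {u, v} \<and> \<sigma> u = Blue \<and> t \<in> arrivals X e Chase)
      \<longleftrightarrow> (\<exists>e\<in>E'. \<exists>u. ends e = {u, v} \<and> \<sigma> u = Blue \<and> t \<in> arrivals X' e Chase)"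
      (is "(\<exists>e\<in>E. \<exists>u. ?P X e u) = (\<exists>e\<in>E'. \<exists>u. ?P X' e u)") if "\<sigma> v = Red"
    proof -
      have "e \<in> E \<and> ?P X e u \<longleftrightarrow> e \<in> E' \<and> ?P X' e u" for e u
        using edges[of e] chase[of e] \<sigma>[of u] \<sigma>[of v] that by auto
      then show ?thesis by blast
    qed
    show "update E X t \<sigma> v = update E' X' t \<sigma> v"
    proof (cases "\<sigma> v = Red")
      case True
      then show ?thesis by (simp only: update_def S C)
    next
      case False
      then show ?thesis by (simp only: update_def S simp_thms if_False)
    qed
  qed
  have fin: "finite {s \<in> ?R. s \<le> t}" for t
  proof -
    have "{s \<in> ?R. s \<le> t} = {s \<in> A.rings. s \<le> t} \<union> {s \<in> B.rings. s \<le> t}" by auto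
    then show ?thesis using A.finite_rings B.finite_rings by simp
  qed
  have "t \<le> \<tau> \<longrightarrow> A.config t = B.config t"
  proof (rule time_induct[where R = ?R and t = t and P = "\<lambda>t. t \<le> \<tau> \<longrightarrow> A.config t = B.config t"])
    fix t :: real assume t0: "0 \<le> t" and IH: "\<And>p. 0 \<le> p \<Longrightarrow> p < t \<Longrightarrow> ?R \<inter> {p<..<t} = {} \<Longrightarrow> p \<in> insert 0 ?R
      \<Longrightarrow> p \<le> \<tau> \<longrightarrow> A.config p = B.config p"
    show "t \<le> \<tau> \<longrightarrow> A.config t = B.config t"
    proof
      assume "t \<le> \<tau>"
      show "A.config t = B.config t"
      proof (cases "t = 0")
        case False
        with t0 obtain p where p: "0 \<le> p" "p < t" "?R \<inter> {p<..<t} = {}" "p \<in> insert 0 ?R"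
          using ex_predecessor[of ?R 0 t] fin by auto
        have AB: "A.config p = B.config p" using IH[OF p] p \<open>t \<le> \<tau>\<close> by simp
        \<comment> \<open>Only the configuration at \<open>p < t\<close> enters this update. Hence
          \<open>inside\<close> is required strictly before \<open>\<tau>\<close>, and a vertex
          infected at \<open>\<tau>\<close> itself may lie outside \<open>V\<close>; this happens
          when \<open>\<tau>\<close> is the next infection time.\<close>
        have "A.config t = update E X t (A.config p)" using p by (intro A.config_step) auto
        also have "\<dots> = update E' X' t (A.config p)"
          using inside[of p] p \<open>t \<le> \<tau>\<close> by (intro upd) auto
        also have "\<dots> = B.config t" unfolding AB using p by (intro B.config_step[symmetric]) auto
        finally show ?thesis .
      qed (simp add: A.config_initial B.config_initial)
    qed
  qed (use fin A.rings_pos B.rings_pos t(1) in auto)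
  then show ?thesis using t by simp
qed

section \<open>Perfect matchings\<close>

lemma finite_perfect_matchings: "finite H \<Longrightarrow> finite (perfect_matchings H)"
  by (rule finite_subset[of _ "Pow (Pow H)"]) (auto simp: perfect_matchings_def partition_on_def)

lemma perfect_matchings_empty [simp]: "perfect_matchings {} = {{}}"
  by (auto simp: perfect_matchings_def partition_on_def)

lemma perfect_matchings_Union: "M \<in> perfect_matchings H \<Longrightarrow> \<Union>M = H"
  by (simp add: perfect_matchings_def partition_on_def)

lemma perfect_matchings_card: "M \<in> perfect_matchings H \<Longrightarrow> p \<in> M \<Longrightarrow> card p = 2"
  by (simp add: perfect_matchings_def)

lemma perfect_matchings_disjoint:
  "M \<in> perfect_matchings H \<Longrightarrow> p \<in> M \<Longrightarrow> q \<in> M \<Longrightarrow> x \<in> p \<Longrightarrow> x \<in> q \<Longrightarrow> p = q"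
  by (auto simp: perfect_matchings_def partition_on_def disjoint_def)

lemma perfect_matchings_Un:
  assumes "A \<in> perfect_matchings S" "B \<in> perfect_matchings S'" "S \<inter> S' = {}"
  shows "A \<union> B \<in> perfect_matchings (S \<union> S')"
proof -
  have "\<Union>A = S" "\<Union>B = S'" using assms by (auto dest: perfect_matchings_Union)
  then show ?thesis
    using assms unfolding perfect_matchings_def partition_on_def
    by (auto intro!: disjoint_union)
qed

lemma perfect_matchings_Diff:
  assumes "M \<in> perfect_matchings H" "A \<subseteq> M"
  shows "M - A \<in> perfect_matchings (H - \<Union>A)"
proof -
  have "\<Union>(M - A) = H - \<Union>A"
    using perfect_matchings_Union[OF assms(1)] perfect_matchings_disjoint[OF assms(1)] assms(2) by blast
  then show ?thesis
    using assms(1) by (auto simp: perfect_matchings_def partition_on_def disjoint_def)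
qed

lemma perfect_matchings_subset:
  assumes "M \<in> perfect_matchings H" "A \<subseteq> M"
  shows "A \<in> perfect_matchings (\<Union>A)"
  using assms by (auto simp: perfect_matchings_def partition_on_def disjoint_def)

text \<open>Removing \<open>A\<close> is a bijection from the matchings that contain
  \<open>A\<close> onto the matchings of the remaining points. In other words, a uniform matching
  that is known to contain \<open>A\<close> is uniform on the rest; revealing pairs always takes
  this form.\<close>

lemma perfect_matchings_extend:
  assumes "A \<in> perfect_matchings S" "S \<subseteq> H"
  shows "{M \<in> perfect_matchings H. A \<subseteq> M} = (\<union>) A ` perfect_matchings (H - S)"
    and "inj_on ((\<union>) A) (perfect_matchings (H - S))"
proof -
  have S: "\<Union>A = S" using assms(1) by (rule perfect_matchings_Union)
  show "{M \<in> perfect_matchings H. A \<subseteq> M} = (\<union>) A ` perfect_matchings (H - S)"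
  proof safe
    fix M assume M: "M \<in> perfect_matchings H" "A \<subseteq> M"
    then have "M - A \<in> perfect_matchings (H - S)" using perfect_matchings_Diff S by metis
    moreover have "M = A \<union> (M - A)" using M by auto
    ultimately show "M \<in> (\<union>) A ` perfect_matchings (H - S)" by blast
  next
    fix B assume "B \<in> perfect_matchings (H - S)"
    then have "A \<union> B \<in> perfect_matchings (S \<union> (H - S))" by (intro perfect_matchings_Un assms) auto
    then show "A \<union> B \<in> perfect_matchings H" using assms(2) by (simp add: Un_absorb1)
  qed
  have "A \<inter> B = {}" if "B \<in> perfect_matchings (H - S)" for B
  proof -
    have "p = {}" if "p \<in> A" "p \<in> B" for p
      using that perfect_matchings_Union[OF \<open>B \<in> _\<close>] S by blast
    then show ?thesis using perfect_matchings_card[OF assms(1)] by fastforce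
  qed
  then show "inj_on ((\<union>) A) (perfect_matchings (H - S))"
    unfolding inj_on_def by blast
qed

text \<open>The matchings are classified by the partner \<open>h'\<close> of a fixed point
  \<open>h\<close>; the classes are disjoint because the pairs of one matching are.\<close>

lemma perfect_matchings_step:
  assumes "finite H" "h \<in> H"
  shows "perfect_matchings H = (\<Union>h'\<in>H - {h}. insert {h, h'} ` perfect_matchings (H - {h, h'}))" (is "_ = ?R")
    and "(\<Sum>M\<in>perfect_matchings H. g M)
      = (\<Sum>h'\<in>H - {h}. \<Sum>M\<in>perfect_matchings (H - {h, h'}). g (insert {h, h'} M) :: 'b::comm_monoid_add)"
proof -
  have pair: "{{h, h'}} \<in> perfect_matchings {h, h'}" if "h' \<noteq> h" for h'
    using that by (auto simp: perfect_matchings_def partition_on_def)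
  have ext: "{M \<in> perfect_matchings H. {h, h'} \<in> M} = insert {h, h'} ` perfect_matchings (H - {h, h'})"
    and inj: "inj_on (insert {h, h'}) (perfect_matchings (H - {h, h'}))" if "h' \<in> H - {h}" for h'
  proof -
    have [simp]: "(\<union>) {{h, h'}} = insert {h, h'}" by auto
    show "{M \<in> perfect_matchings H. {h, h'} \<in> M} = insert {h, h'} ` perfect_matchings (H - {h, h'})"
      "inj_on (insert {h, h'}) (perfect_matchings (H - {h, h'}))"
      using perfect_matchings_extend[OF pair, of h' H] that assms(2) by auto
  qed
  show eq: "perfect_matchings H = ?R"
  proof (rule set_eqI)
    fix M
    have "\<exists>h'\<in>H - {h}. {h, h'} \<in> M" if M: "M \<in> perfect_matchings H"
    proof -
      obtain p where p: "p \<in> M" "h \<in> p" using perfect_matchings_Union[OF M] assms(2) by blast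
      then obtain h' where "p = {h, h'}" "h' \<noteq> h"
        using perfect_matchings_card[OF M p(1)] by (auto simp: card_2_iff)
      then show ?thesis using p perfect_matchings_Union[OF M] by auto
    qed
    then have "M \<in> perfect_matchings H \<longleftrightarrow> (\<exists>h'\<in>H - {h}. M \<in> {M \<in> perfect_matchings H. {h, h'} \<in> M})"
      by blast
    also have "\<dots> \<longleftrightarrow> (\<exists>h'\<in>H - {h}. M \<in> insert {h, h'} ` perfect_matchings (H - {h, h'}))"
      by (rule bex_cong[OF refl]) (subst ext, assumption, rule refl)
    finally show "M \<in> perfect_matchings H \<longleftrightarrow> M \<in> ?R" by simp
  qed
  have disj: "(insert {h, a} ` perfect_matchings (H - {h, a})) \<inter> (insert {h, b} ` perfect_matchings (H - {h, b})) = {}"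
    if "a \<in> H - {h}" "b \<in> H - {h}" "a \<noteq> b" for a b
  proof -
    have "False" if M: "M \<in> {M \<in> perfect_matchings H. {h, a} \<in> M}" "M \<in> {M \<in> perfect_matchings H. {h, b} \<in> M}" for M
    proof -
      have "{h, a} = {h, b}"
        using M by (intro perfect_matchings_disjoint[of M H "{h, a}" "{h, b}" h]) auto
      then show False using \<open>a \<noteq> b\<close> by (auto simp: doubleton_eq_iff)
    qed
    then show ?thesis unfolding ext[OF that(1), symmetric] ext[OF that(2), symmetric] by blast
  qed
  have "(\<Sum>M\<in>perfect_matchings H. g M)
      = (\<Sum>h'\<in>H - {h}. \<Sum>M\<in>insert {h, h'} ` perfect_matchings (H - {h, h'}). g M)"
    unfolding eq using assms disj
    by (intro sum.UNION_disjoint) (auto intro!: finite_perfect_matchings)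
  also have "\<dots> = (\<Sum>h'\<in>H - {h}. \<Sum>M\<in>perfect_matchings (H - {h, h'}). g (insert {h, h'} M))"
    by (rule sum.cong[OF refl]) (subst sum.reindex[OF inj], simp_all)
  finally show "(\<Sum>M\<in>perfect_matchings H. g M)
    = (\<Sum>h'\<in>H - {h}. \<Sum>M\<in>perfect_matchings (H - {h, h'}). g (insert {h, h'} M))" .
qed

text \<open>The double factorial of \<open>n - 1\<close> for even \<open>n\<close>, and 0 for odd
  \<open>n\<close>.\<close>

fun num_matchings :: "nat \<Rightarrow> nat" where
  "num_matchings 0 = 1"
| "num_matchings (Suc 0) = 0"
| "num_matchings (Suc (Suc n)) = Suc n * num_matchings n"

lemma num_matchings_pos: "even n \<Longrightarrow> 0 < num_matchings n"
  by (induction n rule: num_matchings.induct) auto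

lemma card_perfect_matchings: "finite H \<Longrightarrow> card (perfect_matchings H) = num_matchings (card H)"
proof (induction "card H" arbitrary: H rule: num_matchings.induct)
  case 2
  then obtain h where "H = {h}" by (metis One_nat_def card_1_singletonE)
  then have "perfect_matchings H = {}"
    using perfect_matchings_step(1)[of H h] by simp
  then show ?case using 2 by (metis card.empty num_matchings.simps(2))
next
  case (3 n)
  then have "H \<noteq> {}" by auto
  then obtain h where h: "h \<in> H" by auto
  have c: "card (H - {h, h'}) = n" if "h' \<in> H - {h}" for h'
    using that h 3 by (auto simp: card_Diff_subset card_insert_if)
  have "card (perfect_matchings H) = (\<Sum>M\<in>perfect_matchings H. 1)" by simp
  also have "\<dots> = (\<Sum>h'\<in>H - {h}. card (perfect_matchings (H - {h, h'})))"
    by (subst perfect_matchings_step(2)[OF 3(3) h]) simp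
  also have "\<dots> = (\<Sum>h'\<in>H - {h}. num_matchings n)"
    using 3 by (intro sum.cong refl) (metis c finite_Diff)
  also have "\<dots> = Suc n * num_matchings n" using 3 h by (metis card_Diff_singleton diff_Suc_1 sum_constant of_nat_id)
  finally show ?case using 3 by (metis num_matchings.simps(3))
qed auto

lemma card_perfect_matchings_extend:
  assumes "finite H" "A \<in> perfect_matchings S" "S \<subseteq> H"
  shows "card {M \<in> perfect_matchings H. A \<subseteq> M} = num_matchings (card H - card S)"
  using assms perfect_matchings_extend[OF assms(2,3)]
  by (simp add: card_image card_perfect_matchings card_Diff_subset finite_subset)

text \<open>Each of the \<open>k\<close> factors between \<open>n\<close> and
  \<open>n + 2 * k\<close> is at least \<open>n\<close>. Read as a quotient: among \<open>m\<close>
  half-edges, \<open>k\<close> prescribed disjoint pairs all occur with probability at most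
  \<open>1 / (m - 2 * k) ^ k\<close>.\<close>

lemma num_matchings_ge: "num_matchings n * n ^ k \<le> num_matchings (n + 2 * k)"
proof (induction k)
  case (Suc k)
  have "num_matchings n * n ^ Suc k \<le> (n + 2 * k + 1) * (num_matchings n * n ^ k)"
    by (simp add: algebra_simps)
  also have "\<dots> \<le> (n + 2 * k + 1) * num_matchings (n + 2 * k)"
    by (intro mult_le_mono2 Suc)
  finally show ?case by simp
qed simp

lemma perfect_matchings_of_list:
  assumes "distinct (concat (map (\<lambda>(x, y). [x, y]) ps))"
  shows "(\<lambda>(x, y). {x, y}) ` set ps \<in> perfect_matchings (set (concat (map (\<lambda>(x, y). [x, y]) ps)))"
    and "card (set (concat (map (\<lambda>(x, y). [x, y]) ps))) = 2 * length ps"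
proof -
  show "(\<lambda>(x, y). {x, y}) ` set ps \<in> perfect_matchings (set (concat (map (\<lambda>(x, y). [x, y]) ps)))"
    using assms
  proof (induction ps)
    case (Cons p ps)
    obtain x y where p: "p = (x, y)" by (cases p)
    have "{{x, y}} \<in> perfect_matchings {x, y}"
      using Cons.prems by (auto simp: p perfect_matchings_def partition_on_def)
    then have "{{x, y}} \<union> (\<lambda>(x, y). {x, y}) ` set ps
      \<in> perfect_matchings ({x, y} \<union> set (concat (map (\<lambda>(x, y). [x, y]) ps)))"
      using Cons by (intro perfect_matchings_Un) (auto simp: p)
    then show ?case by (simp add: p insert_is_Un[symmetric])
  qed simp
  have "length (concat (map (\<lambda>(x, y). [x, y]) ps)) = 2 * length ps"
    by (induction ps) auto
  then show "card (set (concat (map (\<lambda>(x, y). [x, y]) ps))) = 2 * length ps"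
    using distinct_card[OF assms] by simp
qed

lemma finite_half_edges [simp]: "finite (half_edges n d)"
  by (simp add: half_edges_def)

lemma card_half_edges: "card (half_edges n d) = (\<Sum>i=1..n. vertex_degree n d i)"
  by (simp add: half_edges_def)

lemma even_card_half_edges: "even (card (half_edges n d))"
proof (cases "n = 0")
  case False
  then have "{1..n} = insert n {1..<n}" by auto
  then have "card (half_edges n d) = (\<Sum>i=1..n. d i) + (if odd (\<Sum>j=1..n. d j) then 1 else 0)"
    unfolding card_half_edges by (simp add: vertex_degree_def)
  then show ?thesis by simp
qed (simp add: card_half_edges)

lemma perfect_matchings_half_edges:
  "finite (perfect_matchings (half_edges n d))" "perfect_matchings (half_edges n d) \<noteq> {}"
  using num_matchings_pos[OF even_card_half_edges, of n d] card_perfect_matchings[of "half_edges n d"]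
  by (auto intro!: finite_perfect_matchings)

lemma fst_half_edges: "h \<in> half_edges n d \<Longrightarrow> fst h \<in> {1..n}"
  by (auto simp: half_edges_def)

lemma matching_finite: "M \<in> perfect_matchings (half_edges n d) \<Longrightarrow> finite M"
  by (rule finite_UnionD) (simp add: perfect_matchings_Union)

lemma finite_graph_edges: "M \<in> perfect_matchings (half_edges n d) \<Longrightarrow> finite (graph_edges M)"
  by (simp add: graph_edges_def matching_finite)

lemma set_config_model:
  "set_pmf (config_model D n) \<subseteq> {(d, M). M \<in> perfect_matchings (half_edges n d)}"
  using perfect_matchings_half_edges by (auto simp: config_model_def)

section \<open>Measurability\<close>

lemma pred_eq_real [measurable (raw)]:
  fixes f g :: "'a \<Rightarrow> real"
  assumes "f \<in> borel_measurable M" "g \<in> borel_measurable M"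
  shows "Measurable.pred M (\<lambda>x. f x = g x)"
  using borel_measurable_eq[OF assms] by (simp add: pred_def)

lemma pred_le_real [measurable (raw)]:
  fixes f g :: "'a \<Rightarrow> real"
  assumes "f \<in> borel_measurable M" "g \<in> borel_measurable M"
  shows "Measurable.pred M (\<lambda>x. f x \<le> g x)"
  using borel_measurable_le[OF assms] by (simp add: pred_def)

lemma pred_Bex_countable:
  assumes "countable I" "\<And>i. i \<in> I \<Longrightarrow> Measurable.pred M (P i)"
  shows "Measurable.pred M (\<lambda>x. \<exists>i\<in>I. P i x)"
proof -
  have "{x \<in> space M. \<exists>i\<in>I. P i x} = (\<Union>i\<in>I. {x \<in> space M. P i x})" by auto
  also have "\<dots> \<in> sets M" using assms by (intro sets.countable_UN') (auto simp: pred_def)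
  finally show ?thesis by (simp add: pred_def)
qed

lemma pred_Ball_countable:
  assumes "countable I" "\<And>i. i \<in> I \<Longrightarrow> Measurable.pred M (P i)"
  shows "Measurable.pred M (\<lambda>x. \<forall>i\<in>I. P i x)"
  using pred_intros_logic(2)[OF pred_Bex_countable[OF assms(1) pred_intros_logic(2)[OF assms(2)]]] by simp

definition ring_time :: "clocks \<Rightarrow> edge \<times> kind \<times> nat \<Rightarrow> real" where
  "ring_time X = (\<lambda>(e, c, k). clock_sum X e c (Suc k))"

lemma ring_time_measurable [measurable]: "(\<lambda>X. ring_time X i) \<in> borel_measurable clock_space"
  by (cases i) (simp add: ring_time_def)

lemma ring_times_eq: "ring_times E X = ring_time X ` (E \<times> UNIV)"
proof -
  have "x \<in> ring_times E X \<longleftrightarrow> (\<exists>e\<in>E. \<exists>c k. x = ring_time X (e, c, k))" for x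
    by (auto simp: ring_times_def arrivals_eq ring_time_def)
  then show ?thesis by (auto simp: image_iff)
qed

lemma mem_arrivals_measurable [measurable]:
  assumes [measurable]: "\<tau> \<in> borel_measurable clock_space"
  shows "Measurable.pred clock_space (\<lambda>X. \<tau> X \<in> arrivals X e c)"
proof -
  have "(\<tau> X \<in> arrivals X e c) \<longleftrightarrow> (\<exists>k. \<tau> X = clock_sum X e c (Suc k))" for X
    by (auto simp: arrivals_eq)
  then show ?thesis by simp
qed

lemma update_measurable:
  assumes E: "finite E" and [measurable]: "\<tau> \<in> borel_measurable clock_space"
    and \<sigma> [measurable]: "\<And>v c. Measurable.pred clock_space (\<lambda>X. \<sigma> X v = c)"
  shows "Measurable.pred clock_space (\<lambda>X. update E X (\<tau> X) (\<sigma> X) v = c)"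
proof -
  have nb [measurable]: "Measurable.pred clock_space
      (\<lambda>X. \<exists>e\<in>E. \<exists>u. ends e = {u, v} \<and> \<sigma> X u = s \<and> \<tau> X \<in> arrivals X e k)" for s k
    using E by (intro pred_intros_finite) measurable
  have "(update E X (\<tau> X) (\<sigma> X) v = c) \<longleftrightarrow>
     (\<sigma> X v = White \<and> (if \<exists>e\<in>E. \<exists>u. ends e = {u, v} \<and> \<sigma> X u = Red \<and> \<tau> X \<in> arrivals X e Spread
        then c = Red else c = White)) \<or>
     (\<sigma> X v = Red \<and> (if \<exists>e\<in>E. \<exists>u. ends e = {u, v} \<and> \<sigma> X u = Blue \<and> \<tau> X \<in> arrivals X e Chase
        then c = Blue else c = Red)) \<or>
     (\<sigma> X v = Blue \<and> c = Blue)" for X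
    unfolding update_def by (cases "\<sigma> X v") auto
  then show ?thesis by simp
qed

lemma fold_update_measurable:
  assumes E: "finite E"
  shows "Measurable.pred clock_space (\<lambda>X. fold (update E X) (map (ring_time X) L) initial v = c)"
proof (induction L arbitrary: v c rule: rev_induct)
  case (snoc i L)
  show ?case
    using update_measurable[OF E ring_time_measurable[of i] snoc.IH] by simp
qed simp

text \<open>There are only countably many lists \<open>L\<close> of clock indices. On the event
  \<open>ev L\<close> the relevant rings are listed by \<open>L\<close> in increasing order, and the
  configuration is a fixed composition of updates along \<open>L\<close>.\<close>

lemma chase_escape_measurable:
  assumes E: "finite E" and [measurable]: "\<tau> \<in> borel_measurable clock_space"
  shows "Measurable.pred clock_space (\<lambda>X. chase_escape E X (\<tau> X) v = c)"
proof -
  let ?I = "E \<times> (UNIV :: (kind \<times> nat) set)"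
  let ?A = "\<lambda>X. {s \<in> ring_times E X. s \<le> \<tau> X}"
  have UK: "countable (UNIV :: kind set)" by (simp add: UNIV_kind)
  have "countable (UNIV :: (kind \<times> nat) set)"
    using countable_SIGMA[OF UK, of "\<lambda>_. UNIV :: nat set"] by (simp add: UNIV_Times_UNIV)
  then have I: "countable ?I" using E by (intro countable_SIGMA) (auto intro: countable_finite)
  then have LI: "countable (lists ?I)" by (rule countable_lists)
  \<comment> \<open>For simultaneous rings \<open>L\<close> names one clock per ring time; therefore
    the last clause compares times and not indices.\<close>
  define ev where "ev L X \<longleftrightarrow> sorted_wrt (<) (map (ring_time X) L) \<and> (\<forall>i\<in>set L. ring_time X i \<le> \<tau> X)
    \<and> (\<forall>i\<in>?I. ring_time X i \<le> \<tau> X \<longrightarrow> (\<exists>j\<in>set L. ring_time X j = ring_time X i))" for L X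
  have [measurable]: "Measurable.pred clock_space (ev L)" for L
  proof -
    have [measurable]: "Measurable.pred clock_space (\<lambda>X. sorted_wrt (<) (map (ring_time X) L))"
      by (induction L) (simp_all, measurable)
    have [measurable]: "Measurable.pred clock_space
        (\<lambda>X. \<forall>i\<in>?I. ring_time X i \<le> \<tau> X \<longrightarrow> (\<exists>j\<in>set L. ring_time X j = ring_time X i))"
      by (intro pred_Ball_countable[OF I] pred_intros_logic pred_intros_finite finite_set
        pred_le_real pred_eq_real ring_time_measurable assms(2))
    show ?thesis unfolding ev_def[abs_def] by measurable
  qed
  have set_eq: "ev L X \<Longrightarrow> L \<in> lists ?I \<Longrightarrow> set (map (ring_time X) L) = ?A X" for L X
    unfolding ev_def ring_times_eq by (auto simp: in_lists_conv_set) (metis imageI)+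
  have ev_list: "sorted_list_of_set (?A X) = map (ring_time X) L" if "ev L X" "L \<in> lists ?I" for L X
  proof -
    have "sorted_list_of_set (set (map (ring_time X) L)) = map (ring_time X) L"
      using that(1) by (intro sorted_list_of_set.idem_if_sorted_distinct)
        (auto simp: ev_def strict_sorted_iff)
    then show ?thesis by (simp only: set_eq[OF that])
  qed
  have ev_ex: "\<exists>L\<in>lists ?I. ev L X" if fin: "finite (?A X)" for X
  proof -
    have sub: "?A X \<subseteq> ring_time X ` ?I" by (auto simp: ring_times_eq)
    define f where "f s = (SOME i. i \<in> ?I \<and> ring_time X i = s)" for s
    have f: "f s \<in> ?I \<and> ring_time X (f s) = s" if "s \<in> ?A X" for s
    proof -
      have "\<exists>i. i \<in> ?I \<and> ring_time X i = s" using sub that by blast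
      then show ?thesis unfolding f_def by (rule someI_ex)
    qed
    let ?l = "sorted_list_of_set (?A X)"
    have s: "set ?l = ?A X" using fin by (rule set_sorted_list_of_set)
    have m: "map (ring_time X) (map f ?l) = ?l" unfolding map_map by (rule map_idI) (use f s in auto)
    have "ev (map f ?l) X"
      unfolding ev_def m using f s
      by (auto simp: strict_sorted_list_of_set ring_times_eq)
    moreover have "map f ?l \<in> lists ?I" using f s by (auto simp: in_lists_conv_set)
    ultimately show ?thesis by blast
  qed
  have ev_fin: "ev L X \<Longrightarrow> L \<in> lists ?I \<Longrightarrow> finite (?A X)" for L X
    using set_eq[of L X] by (metis List.finite_set)
  have "chase_escape E X (\<tau> X) v = c \<longleftrightarrow>
      (\<exists>L\<in>lists ?I. ev L X \<and> fold (update E X) (map (ring_time X) L) initial v = c)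
      \<or> ((\<forall>L\<in>lists ?I. \<not> ev L X) \<and> initial v = c)" for X
  proof (cases "finite (?A X)")
    case True
    then obtain L where L: "L \<in> lists ?I" "ev L X" using ev_ex by blast
    have "chase_escape E X (\<tau> X) v = fold (update E X) (map (ring_time X) L') initial v"
      if "L' \<in> lists ?I" "ev L' X" for L'
      unfolding chase_escape_def ev_list[OF that(2,1)] ..
    then show ?thesis using L by metis
  next
    case False
    \<comment> \<open>\<open>sorted_list_of_set\<close> returns the empty list for an infinite set,
      so with infinitely many rings the configuration keeps its initial value. This event has a
      disjunct of its own.\<close>
    then have "\<forall>L\<in>lists ?I. \<not> ev L X" using ev_fin by blast
    moreover have "chase_escape E X (\<tau> X) v = initial v"
      unfolding chase_escape_def by (simp add: sorted_list_of_set.fold_insort_key.infinite[OF False])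
    ultimately show ?thesis by auto
  qed
  moreover have "Measurable.pred clock_space (\<lambda>X.
      (\<exists>L\<in>lists ?I. ev L X \<and> fold (update E X) (map (ring_time X) L) initial v = c)
      \<or> ((\<forall>L\<in>lists ?I. \<not> ev L X) \<and> initial v = c))"
    by (intro pred_intros_logic pred_Ball_countable pred_Bex_countable LI fold_update_measurable E) measurable
  ultimately show ?thesis by simp
qed

text \<open>The configuration changes only at rings, so the uncountable range of \<open>t\<close>
  reduces to ring times and rational times. The rationals take care of the time before any ring and
  of the case of infinitely many rings up to some time.\<close>

lemma ever_color_measurable:
  assumes E: "finite E"
  shows "Measurable.pred clock_space (\<lambda>X. \<exists>t\<ge>0. chase_escape E X t v = c)"
proof -
  let ?I = "E \<times> (UNIV :: (kind \<times> nat) set)"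
  have UK: "countable (UNIV :: kind set)" by (simp add: UNIV_kind)
  have "countable (UNIV :: (kind \<times> nat) set)"
    using countable_SIGMA[OF UK, of "\<lambda>_. UNIV :: nat set"] by (simp add: UNIV_Times_UNIV)
  then have I: "countable ?I" using E by (intro countable_SIGMA) (auto intro: countable_finite)
  have "(\<exists>t\<ge>0. chase_escape E X t v = c) \<longleftrightarrow>
     (\<exists>q::rat. 0 \<le> q \<and> chase_escape E X (of_rat q) v = c)
     \<or> (\<exists>i\<in>?I. 0 \<le> ring_time X i \<and> chase_escape E X (ring_time X i) v = c)" (is "_ = ?R X") for X
  proof
    assume "\<exists>t\<ge>0. chase_escape E X t v = c"
    then obtain t where t: "0 \<le> t" "chase_escape E X t v = c" by blast
    let ?A = "\<lambda>t. {s \<in> ring_times E X. s \<le> t}"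
    have cong: "chase_escape E X t v = chase_escape E X t' v" if "?A t = ?A t'" for t'
      unfolding chase_escape_def that ..
    show "?R X"
    proof (cases "finite (?A t)")
      case True
      show ?thesis
      proof (cases "{s \<in> ?A t. 0 \<le> s} = {}")
        case emp: True
        then have "?A t = ?A 0" using t by force
        then have "chase_escape E X (of_rat 0) v = c" using cong[of 0] t by simp
        then show ?thesis by (metis order_refl)
      next
        case False
        define p where "p = Max {s \<in> ?A t. 0 \<le> s}"
        have fin: "finite {s \<in> ?A t. 0 \<le> s}" by (rule finite_subset[OF _ True]) auto
        have p: "p \<in> {s \<in> ?A t. 0 \<le> s}" unfolding p_def using fin False by (rule Max_in)
        have "s \<le> p" if "s \<in> ?A t" for s
        proof (cases "0 \<le> s")
          case True
          then show ?thesis unfolding p_def using that fin by (intro Max_ge) auto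
        qed (use p in auto)
        then have "?A t = ?A p" using p by force
        then have "chase_escape E X p v = c" using cong[of p] t by simp
        moreover obtain i where "i \<in> ?I" "p = ring_time X i" using p by (auto simp: ring_times_eq)
        ultimately show ?thesis using p by auto
      qed
    next
      case False
      obtain q where q: "t < of_rat q" using of_rat_dense[of t "t + 1"] by auto
      have "infinite (?A (of_rat q))"
        using False q by (rule_tac infinite_super[of "?A t"]) auto
      then have "chase_escape E X (of_rat q) v = initial v"
        unfolding chase_escape_def by (simp add: sorted_list_of_set.fold_insort_key.infinite)
      moreover have "chase_escape E X t v = initial v"
        using False unfolding chase_escape_def by (simp add: sorted_list_of_set.fold_insort_key.infinite)
      moreover have "0 \<le> q" using q t by (metis less_eq_real_def order_less_le_trans zero_le_of_rat_iff)
      ultimately show ?thesis using t by metis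
    qed
  next
    assume "?R X"
    then show "\<exists>t\<ge>0. chase_escape E X t v = c" by (metis zero_le_of_rat_iff)
  qed
  moreover have "Measurable.pred clock_space ?R"
    by (intro pred_intros_logic pred_intros_countable pred_Bex_countable I
      chase_escape_measurable[OF E]) measurable
  ultimately show ?thesis by simp
qed

lemma card_ever_red_measurable [measurable]:
  assumes E: "finite E"
  shows "(\<lambda>X. real (card (ever_red n E X))) \<in> borel_measurable clock_space"
proof -
  have "real (card (ever_red n E X)) = (\<Sum>v=0..n. if \<exists>t\<ge>0. chase_escape E X t v = Red then 1 else 0)" for X
  proof -
    have "ever_red n E X = {v \<in> {0..n}. \<exists>t\<ge>0. chase_escape E X t v = Red}" by (simp add: ever_red_def)
    then show ?thesis by (simp add: sum.If_cases Int_def del: of_nat_Suc)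
  qed
  moreover have "(\<lambda>X. \<Sum>v=0..n. if \<exists>t\<ge>0. chase_escape E X t v = Red then 1 else 0 :: real)
      \<in> borel_measurable clock_space"
    by (intro borel_measurable_sum measurable_If predE ever_color_measurable[OF E]) auto
  ultimately show ?thesis by simp
qed

text \<open>Fubini. The event is a countable union of rectangles, one for each point of the support
  of the discrete component, which is why that component is restricted to its support.\<close>

lemma ennreal_prob_many_red:
  assumes l: "0 < l"
  shows "ennreal (prob_many_red D l n \<delta>) = (\<integral>\<^sup>+(d, M). emeasure (clock_measure l)
     {X. \<delta> * real n < real (card (ever_red n (graph_edges M) X))} \<partial>config_model D n)"
proof -
  let ?C = "measure_pmf (config_model D n)" and ?S = "set_pmf (config_model D n)" and ?P = "clock_measure l"
  let ?N = "restrict_space ?C ?S"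
  let ?B = "\<lambda>M. {X. \<delta> * real n < real (card (ever_red n (graph_edges M) X))}"
  interpret P: prob_space ?P using l by (rule prob_space_clock_measure)
  interpret N: prob_space ?N
    by (intro prob_space_restrict_space measure_pmf.emeasure_eq_1_AE) (auto simp: AE_measure_pmf_iff)
  interpret NP: pair_prob_space ?N ?P ..
  have B: "?B M \<in> sets ?P" if "(d, M) \<in> ?S" for d M
  proof -
    have fin: "finite (graph_edges M)"
      using that set_config_model[of D n] finite_graph_edges by auto
    note [measurable] = card_ever_red_measurable[OF fin]
    show ?thesis unfolding sets_clock_measure by (rule clock_sets_Collect) measurable
  qed
  let ?A = "{\<omega> \<in> space (?N \<Otimes>\<^sub>M ?P). case \<omega> of (x, X) \<Rightarrow> (case x of (d, M) \<Rightarrow> \<lambda>X.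
        \<delta> * real n < real (card (ever_red n (graph_edges M) X))) X}"
  have A_eq: "?A = (\<Union>x\<in>?S. {x} \<times> ?B (snd x))"
    by (auto simp: space_pair_measure space_restrict_space)
  have sec: "{x} \<times> ?B (snd x) \<in> sets (?N \<Otimes>\<^sub>M ?P)" if "x \<in> ?S" for x
    using that B[of "fst x" "snd x"] by (intro pair_measureI) (auto simp: sets_restrict_space)
  have A: "?A \<in> sets (?N \<Otimes>\<^sub>M ?P)"
    unfolding A_eq using sec by (intro sets.countable_UN') auto
  have "ennreal (prob_many_red D l n \<delta>) = emeasure (?N \<Otimes>\<^sub>M ?P) ?A"
    unfolding prob_many_red_def chase_escape_measure_def
    by (subst NP.emeasure_eq_measure) (simp add: case_prod_unfold)
  also have "\<dots> = (\<integral>\<^sup>+x. emeasure ?P (Pair x -` ?A) \<partial>?N)"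
    using A by (rule P.emeasure_pair_measure_alt)
  also have "\<dots> = (\<integral>\<^sup>+x. emeasure ?P (?B (snd x)) \<partial>?N)"
    by (intro nn_integral_cong arg_cong2[where f = emeasure]) (auto simp: space_restrict_space space_pair_measure)
  also have "\<dots> = (\<integral>\<^sup>+x. emeasure ?P (?B (snd x)) * indicator ?S x \<partial>?C)"
    by (rule nn_integral_restrict_space) simp
  also have "\<dots> = (\<integral>\<^sup>+x. emeasure ?P (?B (snd x)) \<partial>?C)"
    by (intro nn_integral_cong_AE) (auto simp: AE_measure_pmf_iff)
  finally show ?thesis by (simp add: case_prod_unfold)
qed

section \<open>Sums of independent degrees\<close>

lemma exp_le_quadratic:
  fixes y :: real
  assumes "y \<le> 1"
  shows "exp y \<le> 1 + y + y\<^sup>2"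
proof (cases "0 \<le> y")
  case True
  then show ?thesis using assms by (rule exp_bound)
next
  case False
  have pos: "0 < 1 - y + y\<^sup>2 / 2" using False by (intro add_pos_nonneg) auto
  have "1 + (- y) + (- y)\<^sup>2 / 2 \<le> exp (- y)" using False by (intro exp_lower_Taylor_quadratic) simp
  then have "exp y \<le> 1 / (1 - y + y\<^sup>2 / 2)"
    using pos by (simp add: exp_minus field_simps)
  also have "\<dots> \<le> 1 + y + y\<^sup>2"
  proof -
    have "(1 + y + y\<^sup>2) * (1 - y + y\<^sup>2 / 2) = 1 + y\<^sup>2 / 2 - y ^ 3 / 2 + y ^ 4 / 2"
      by (simp add: field_simps power2_eq_square power3_eq_cube power4_eq_xxxx)
    moreover have "y ^ 3 \<le> 0" using False by (simp add: power_le_zero_eq)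
    moreover have "0 \<le> y\<^sup>2" "0 \<le> y ^ 4" by (simp_all add: zero_le_even_power)
    ultimately have "1 \<le> (1 + y + y\<^sup>2) * (1 - y + y\<^sup>2 / 2)" by linarith
    then show ?thesis using pos by (simp add: divide_le_eq)
  qed
  finally show ?thesis .
qed

lemma nn_integral_prod_Pi_pmf_subset:
  fixes f :: "'i \<Rightarrow> 'a \<Rightarrow> ennreal"
  assumes A: "finite A" "I \<subseteq> A"
  shows "(\<integral>\<^sup>+d. (\<Prod>i\<in>I. f i (d i)) \<partial>Pi_pmf A dflt p) = (\<Prod>i\<in>I. \<integral>\<^sup>+k. f i k \<partial>p i)"
proof -
  let ?f = "\<lambda>i k. if i \<in> I then f i k else 1"
  have "(\<integral>\<^sup>+d. (\<Prod>i\<in>I. f i (d i)) \<partial>Pi_pmf A dflt p) = (\<integral>\<^sup>+d. (\<Prod>i\<in>A. ?f i (d i)) \<partial>Pi_pmf A dflt p)"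
    using A by (intro nn_integral_cong prod.mono_neutral_cong_left) auto
  also have "\<dots> = (\<Prod>i\<in>A. \<integral>\<^sup>+k. ?f i k \<partial>p i)" by (rule nn_integral_prod_Pi_pmf[OF A(1)])
  also have "\<dots> = (\<Prod>i\<in>I. \<integral>\<^sup>+k. f i k \<partial>p i)"
    using A by (intro prod.mono_neutral_cong_right) (auto simp: measure_pmf.emeasure_space_1[simplified])
  finally show ?thesis .
qed

text \<open>Chernoff bound. For the lower tail a lower bound on \<open>Y\<close> keeps the exponent
  \<open>- s * Y\<close> below 1, and \<open>exp_le_quadratic\<close> then controls the moment
  generating function by the second moment.\<close>

lemma Pi_pmf_lower_tail:
  fixes Y :: "nat \<Rightarrow> real" and D :: "nat pmf"
  assumes Y: "\<And>k. - C \<le> Y k" and int2: "integrable (measure_pmf D) (\<lambda>k. (Y k)\<^sup>2)" and \<kappa>: "0 < \<kappa>"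
  obtains q where "0 < q" "q < 1"
    "\<And>(A :: 'i set) I. finite A \<Longrightarrow> I \<subseteq> A \<Longrightarrow> measure_pmf.prob (Pi_pmf A 0 (\<lambda>_. D))
      {d. (\<Sum>i\<in>I. Y (d i)) \<le> (measure_pmf.expectation D Y - \<kappa>) * real (card I)} \<le> q ^ card I"
proof -
  let ?E = "measure_pmf.expectation D"
  have int1: "integrable (measure_pmf D) Y"
    by (rule measure_pmf.square_integrable_imp_integrable[OF _ int2]) simp
  \<comment> \<open>The first term of the minimum ensures \<open>- s * Y \<le> 1\<close>, the second
    keeps the quadratic correction below half of the gain \<open>s * \<kappa>\<close>; the other
    half is the exponent of \<open>q\<close>.\<close>
  define s where "s = min (1 / (\<bar>C\<bar> + 1)) (\<kappa> / (2 * (?E (\<lambda>k. (Y k)\<^sup>2) + 1)))"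
  have E2: "0 \<le> ?E (\<lambda>k. (Y k)\<^sup>2)" by (rule Bochner_Integration.integral_nonneg) simp
  have s0: "0 < s" using \<kappa> E2 by (auto simp: s_def intro!: divide_pos_pos add_nonneg_pos)
  have sC: "s * \<bar>C\<bar> \<le> 1"
  proof -
    have "s * \<bar>C\<bar> \<le> 1 / (\<bar>C\<bar> + 1) * \<bar>C\<bar>" by (intro mult_right_mono) (auto simp: s_def)
    also have "\<dots> \<le> 1" by (simp add: field_simps)
    finally show ?thesis .
  qed
  have s2: "s * ?E (\<lambda>k. (Y k)\<^sup>2) \<le> \<kappa> / 2"
  proof -
    have "s * ?E (\<lambda>k. (Y k)\<^sup>2) \<le> \<kappa> / (2 * (?E (\<lambda>k. (Y k)\<^sup>2) + 1)) * ?E (\<lambda>k. (Y k)\<^sup>2)"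
      using E2 by (intro mult_right_mono) (auto simp: s_def)
    also have "\<dots> = \<kappa> / 2 * (?E (\<lambda>k. (Y k)\<^sup>2) / (?E (\<lambda>k. (Y k)\<^sup>2) + 1))" by simp
    also have "\<dots> \<le> \<kappa> / 2 * 1"
    proof -
      have "x / (x + 1) \<le> 1" if "0 \<le> x" for x :: real using that by (simp add: divide_le_eq)
      from this[OF E2] show ?thesis using \<kappa> by (intro mult_left_mono) auto
    qed
    also have "\<dots> = \<kappa> / 2" by simp
    finally show ?thesis .
  qed
  have pt: "exp (- s * Y k) \<le> 1 - s * Y k + s\<^sup>2 * (Y k)\<^sup>2" for k
  proof -
    have "- Y k \<le> \<bar>C\<bar>" using Y[of k] by linarith
    then have "s * (- Y k) \<le> s * \<bar>C\<bar>" using s0 by (intro mult_left_mono) auto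
    with sC have "- s * Y k \<le> 1" by simp
    from exp_le_quadratic[OF this] show ?thesis by (simp add: power_mult_distrib)
  qed
  define mgf where "mgf = (\<integral>\<^sup>+k. ennreal (exp (- s * Y k)) \<partial>D)"
  have mgf: "mgf \<le> ennreal (exp (- s * ?E Y + s\<^sup>2 * ?E (\<lambda>k. (Y k)\<^sup>2)))"
  proof -
    have "mgf \<le> (\<integral>\<^sup>+k. ennreal (1 - s * Y k + s\<^sup>2 * (Y k)\<^sup>2) \<partial>D)"
      unfolding mgf_def using pt by (intro nn_integral_mono ennreal_leI)
    also have "\<dots> = ennreal (?E (\<lambda>k. 1 - s * Y k + s\<^sup>2 * (Y k)\<^sup>2))"
    proof (rule nn_integral_eq_integral)
      show "integrable (measure_pmf D) (\<lambda>k. 1 - s * Y k + s\<^sup>2 * (Y k)\<^sup>2)" using int1 int2 by simp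
      have "0 \<le> 1 - s * Y k + s\<^sup>2 * (Y k)\<^sup>2" for k using pt[of k] by (rule order_trans[rotated]) simp
      then show "AE k in measure_pmf D. 0 \<le> 1 - s * Y k + s\<^sup>2 * (Y k)\<^sup>2" by simp
    qed
    also have "?E (\<lambda>k. 1 - s * Y k + s\<^sup>2 * (Y k)\<^sup>2) = 1 + (- s * ?E Y + s\<^sup>2 * ?E (\<lambda>k. (Y k)\<^sup>2))"
      using int1 int2 by simp
    also have "ennreal \<dots> \<le> ennreal (exp (- s * ?E Y + s\<^sup>2 * ?E (\<lambda>k. (Y k)\<^sup>2)))"
      by (intro ennreal_leI exp_ge_add_one_self)
    finally show ?thesis .
  qed
  define q where "q = exp (- s * \<kappa> / 2)"
  show thesis
  proof (rule that[of q])
    show "0 < q" "q < 1" using s0 \<kappa> by (auto simp: q_def)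
    fix A :: "'i set" and I assume A: "finite A" "I \<subseteq> A"
    let ?P = "Pi_pmf A 0 (\<lambda>_. D)" and ?N = "real (card I)"
    let ?B = "{d. (\<Sum>i\<in>I. Y (d i)) \<le> (?E Y - \<kappa>) * ?N}"
    have fin: "finite I" using A by (rule finite_subset[rotated])
    have "emeasure ?P ?B = (\<integral>\<^sup>+d. indicator ?B d \<partial>?P)" by simp
    also have "\<dots> \<le> (\<integral>\<^sup>+d. ennreal (exp (s * ((?E Y - \<kappa>) * ?N))) * (\<Prod>i\<in>I. ennreal (exp (- s * Y (d i)))) \<partial>?P)"
    proof (rule nn_integral_mono)
      fix d
      show "indicator ?B d \<le> ennreal (exp (s * ((?E Y - \<kappa>) * ?N))) * (\<Prod>i\<in>I. ennreal (exp (- s * Y (d i))))"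
      proof (cases "d \<in> ?B")
        case True
        then have "0 \<le> s * ((?E Y - \<kappa>) * ?N) - s * (\<Sum>i\<in>I. Y (d i))"
          using s0 by (simp add: mult_left_mono)
        then have "1 \<le> exp (s * ((?E Y - \<kappa>) * ?N) + (\<Sum>i\<in>I. - s * Y (d i)))"
          by (simp add: sum_distrib_left sum_negf)
        also have "\<dots> = exp (s * ((?E Y - \<kappa>) * ?N)) * (\<Prod>i\<in>I. exp (- s * Y (d i)))"
          by (simp only: exp_add exp_sum[OF fin])
        finally have "1 \<le> exp (s * ((?E Y - \<kappa>) * ?N)) * (\<Prod>i\<in>I. exp (- s * Y (d i)))" .
        then have "ennreal 1 \<le> ennreal (exp (s * ((?E Y - \<kappa>) * ?N)) * (\<Prod>i\<in>I. exp (- s * Y (d i))))"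
          by (rule ennreal_leI)
        then show ?thesis using True by (simp add: ennreal_mult prod_nonneg prod_ennreal)
      qed simp
    qed
    also have "\<dots> = ennreal (exp (s * ((?E Y - \<kappa>) * ?N))) * mgf ^ card I"
      by (subst nn_integral_cmult, simp, subst nn_integral_prod_Pi_pmf_subset[OF A]) (simp add: mgf_def)
    also have "\<dots> \<le> ennreal (exp (s * ((?E Y - \<kappa>) * ?N)))
        * ennreal (exp (- s * ?E Y + s\<^sup>2 * ?E (\<lambda>k. (Y k)\<^sup>2))) ^ card I"
      using mgf by (intro mult_left_mono power_mono) auto
    also have "\<dots> = ennreal (exp (s * ((?E Y - \<kappa>) * ?N) + ?N * (- s * ?E Y + s\<^sup>2 * ?E (\<lambda>k. (Y k)\<^sup>2))))"
      by (simp add: exp_add exp_of_nat_mult ennreal_power ennreal_mult)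
    also have "\<dots> \<le> ennreal (exp (?N * (- s * \<kappa> / 2)))"
    proof -
      have "s * (s * ?E (\<lambda>k. (Y k)\<^sup>2)) \<le> s * (\<kappa> / 2)" using s0 s2 by (intro mult_left_mono) auto
      then have "?N * (s * (s * ?E (\<lambda>k. (Y k)\<^sup>2))) \<le> ?N * (s * (\<kappa> / 2))" by (rule mult_left_mono) simp
      moreover have "s * ((?E Y - \<kappa>) * ?N) + ?N * (- s * ?E Y + s\<^sup>2 * ?E (\<lambda>k. (Y k)\<^sup>2))
          = ?N * (s * (s * ?E (\<lambda>k. (Y k)\<^sup>2))) - 2 * (?N * (s * (\<kappa> / 2)))"
        by (simp add: algebra_simps power2_eq_square)
      moreover have "?N * (- s * \<kappa> / 2) = - (?N * (s * (\<kappa> / 2)))" by simp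
      ultimately show ?thesis by (intro ennreal_leI iffD2[OF exp_le_cancel_iff]) linarith
    qed
    also have "\<dots> = ennreal (q ^ card I)" unfolding q_def by (simp only: exp_of_nat_mult)
    finally show "measure_pmf.prob ?P ?B \<le> q ^ card I"
      by (simp add: measure_pmf.emeasure_eq_measure q_def)
  qed
qed

section \<open>Infection paths\<close>

lemma fresh_clock_regularize:
  assumes l: "0 < l"
    and "f \<in> borel_measurable clock_space" "\<tau> \<in> borel_measurable clock_space" "g \<in> borel_measurable borel"
    and "clock_free e c f" "clock_free e c \<tau>" "\<And>X. 0 \<le> \<tau> X"
  shows "(\<integral>\<^sup>+X. f X * g (next_ring (regularize X) e c (\<tau> X) - \<tau> X) \<partial>clock_measure l)
    = (\<integral>\<^sup>+X. f X \<partial>clock_measure l) * (\<integral>\<^sup>+y. g y \<partial>exponential (rate l c))"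
proof -
  have "AE X in clock_measure l. regular_clock X e c" using l by (rule AE_regular_clock)
  then have "AE X in clock_measure l. f X * g (next_ring (regularize X) e c (\<tau> X) - \<tau> X)
      = f X * g (next_ring X e c (\<tau> X) - \<tau> X)"
  proof eventually_elim
    case (elim X)
    then have "next_ring (regularize X) e c = next_ring X e c"
      by (intro next_ring_cong) (simp add: regularize_def)
    then show ?case by simp
  qed
  then show ?thesis using fresh_clock[OF assms] by (simp cong: nn_integral_cong_AE)
qed

text \<open>The time at which the rings of the clocks of kind \<open>c\<close> along \<open>es\<close>, each awaited after the previous one, have occurred.\<close>

definition chain_time :: "kind \<Rightarrow> clocks \<Rightarrow> edge list \<Rightarrow> real" where
  "chain_time c X es = foldl (\<lambda>t e. next_ring X e c t) 0 es"

lemma chain_time_Nil [simp]: "chain_time c X [] = 0"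
  and chain_time_snoc [simp]: "chain_time c X (es @ [e]) = next_ring X e c (chain_time c X es)"
  by (simp_all add: chain_time_def)

lemma chain_time_nonneg: "regular X \<Longrightarrow> 0 \<le> chain_time c X es"
proof (induction es rule: rev_induct)
  case (snoc e es)
  then have "chain_time c X es < next_ring X e c (chain_time c X es)"
    by (intro next_ring_gt) (auto simp: regular_def)
  with snoc show ?case by simp
qed simp

lemma chain_time_measurable [measurable]:
  "(\<lambda>X. chain_time c (regularize X) es) \<in> borel_measurable clock_space"
proof (induction es rule: rev_induct)
  case (snoc e es)
  note [measurable] = snoc
  show ?case by simp
qed simp

lemma chain_time_cong:
  assumes "\<And>e k. e \<in> set es \<Longrightarrow> X (e, c, k) = X' (e, c, k)"
  shows "chain_time c (regularize X) es = chain_time c (regularize X') es"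
  using assms
proof (induction es rule: rev_induct)
  case (snoc e es)
  have "next_ring (regularize X) e c = next_ring (regularize X') e c"
    using snoc.prems by (intro next_ring_cong regularize_cong) auto
  then show ?case using snoc by simp
qed simp

lemma clock_free_chain_time:
  "e \<notin> set es \<or> c \<noteq> c' \<Longrightarrow> clock_free e c (\<lambda>X. chain_time c' (regularize X) es)"
  unfolding clock_free_def by (intro allI impI chain_time_cong) (metis prod.inject)

lemma clock_free_comp: "clock_free e c f \<Longrightarrow> clock_free e c (\<lambda>X. h (f X))"
  unfolding clock_free_def by metis

lemma clock_free_comp2: "clock_free e c f \<Longrightarrow> clock_free e c g \<Longrightarrow> clock_free e c (\<lambda>X. h (f X) (g X))"
  unfolding clock_free_def by metis

text \<open>The last clock of a chain is fresh, because its edge does not recur in its list and the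
  two chains use different kinds of clocks. So every edge contributes an independent factor,
  \<open>1 / (1 - \<theta>)\<close> for \<open>Chase\<close> and \<open>l / (l + \<theta>)\<close>
  for \<open>Spread\<close>, even if the two lists share edges.\<close>

lemma nn_integral_chain_times:
  fixes \<theta> :: real
  assumes l: "0 < l" and \<theta>: "0 < \<theta>" "\<theta> < 1" and "distinct cs" "distinct ss"
  shows "(\<integral>\<^sup>+X. ennreal (exp (\<theta> * chain_time Chase (regularize X) cs))
      * ennreal (exp (- \<theta> * chain_time Spread (regularize X) ss)) \<partial>clock_measure l)
    = ennreal ((1 / (1 - \<theta>)) ^ length cs * (l / (l + \<theta>)) ^ length ss)"
  using assms(5)
proof (induction ss rule: rev_induct)
  case Nil
  show ?case
    using assms(4)
  proof (induction cs rule: rev_induct)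
    case Nil
    then show ?case using prob_space.emeasure_space_1[OF prob_space_clock_measure[OF l]] by simp
  next
    case (snoc e cs)
    let ?\<tau> = "\<lambda>X. chain_time Chase (regularize X) cs"
    have "(\<integral>\<^sup>+X. ennreal (exp (\<theta> * chain_time Chase (regularize X) (cs @ [e])))
        * ennreal (exp (- \<theta> * chain_time Spread (regularize X) [])) \<partial>clock_measure l)
      = (\<integral>\<^sup>+X. ennreal (exp (\<theta> * ?\<tau> X)) * ennreal (exp (\<theta> * (next_ring (regularize X) e Chase (?\<tau> X) - ?\<tau> X))) \<partial>clock_measure l)"
      by (intro nn_integral_cong) (simp add: algebra_simps flip: ennreal_mult exp_add)
    also have "\<dots> = (\<integral>\<^sup>+X. ennreal (exp (\<theta> * ?\<tau> X)) \<partial>clock_measure l)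
        * (\<integral>\<^sup>+y. ennreal (exp (\<theta> * y)) \<partial>exponential (rate l Chase))"
      using snoc.prems
      by (intro fresh_clock_regularize[OF l] chain_time_nonneg regular_regularize
        clock_free_comp[where h = "\<lambda>x. ennreal (exp (\<theta> * x))"] clock_free_chain_time) auto
    also have "(\<integral>\<^sup>+y. ennreal (exp (\<theta> * y)) \<partial>exponential (rate l Chase)) = ennreal (1 / (1 - \<theta>))"
      using nn_integral_exp_exponential[of 1 "- \<theta>"] \<theta> by simp
    also have "(\<integral>\<^sup>+X. ennreal (exp (\<theta> * ?\<tau> X)) \<partial>clock_measure l) = ennreal ((1 / (1 - \<theta>)) ^ length cs)"
      using snoc by simp
    finally show ?case using \<theta> by (simp add: mult.commute flip: ennreal_mult)
  qed
next
  case (snoc e ss)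
  let ?\<tau> = "\<lambda>X. chain_time Spread (regularize X) ss"
  let ?b = "\<lambda>X. ennreal (exp (\<theta> * chain_time Chase (regularize X) cs))"
  have "(\<integral>\<^sup>+X. ?b X * ennreal (exp (- \<theta> * chain_time Spread (regularize X) (ss @ [e]))) \<partial>clock_measure l)
    = (\<integral>\<^sup>+X. ?b X * ennreal (exp (- \<theta> * ?\<tau> X))
        * ennreal (exp (- \<theta> * (next_ring (regularize X) e Spread (?\<tau> X) - ?\<tau> X))) \<partial>clock_measure l)"
    by (intro nn_integral_cong) (simp add: algebra_simps flip: ennreal_mult exp_add)
  also have "\<dots> = (\<integral>\<^sup>+X. ?b X * ennreal (exp (- \<theta> * ?\<tau> X)) \<partial>clock_measure l)
      * (\<integral>\<^sup>+y. ennreal (exp (- \<theta> * y)) \<partial>exponential (rate l Spread))"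
    using snoc.prems
    by (intro fresh_clock_regularize[OF l] chain_time_nonneg regular_regularize clock_free_chain_time
      clock_free_comp2[where h = "\<lambda>x y. ennreal (exp (\<theta> * x)) * ennreal (exp (- \<theta> * y))"]) auto
  also have "(\<integral>\<^sup>+y. ennreal (exp (- \<theta> * y)) \<partial>exponential (rate l Spread)) = ennreal (l / (l + \<theta>))"
    using nn_integral_exp_exponential[of l \<theta>] \<theta> l by simp
  also have "(\<integral>\<^sup>+X. ?b X * ennreal (exp (- \<theta> * ?\<tau> X)) \<partial>clock_measure l)
      = ennreal ((1 / (1 - \<theta>)) ^ length cs * (l / (l + \<theta>)) ^ length ss)"
    using snoc by simp
  finally show ?case using \<theta> l by (simp add: mult_ac flip: ennreal_mult)
qed

text \<open>Exponential Markov inequality for the difference of the two times.\<close>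

lemma emeasure_chain_times_le:
  assumes l: "0 < l" "l < 1" and "distinct cs" "distinct ss" "length cs = k" "length ss = k"
  shows "emeasure (clock_measure l)
      {X. chain_time Spread (regularize X) ss \<le> chain_time Chase (regularize X) cs}
    \<le> ennreal ((4 * l / (1 + l)\<^sup>2) ^ k)"
proof -
  \<comment> \<open>This \<open>\<theta>\<close> maximises
    \<open>(1 - \<theta>) * (l + \<theta>)\<close>; both factors are then equal to
    \<open>(1 + l) / 2\<close>.\<close>
  let ?P = "clock_measure l" and ?\<theta> = "(1 - l) / 2"
  let ?S = "\<lambda>X. chain_time Spread (regularize X) ss" and ?C = "\<lambda>X. chain_time Chase (regularize X) cs"
  let ?A = "{X. ?S X \<le> ?C X}"
  have A: "?A \<in> sets ?P" unfolding sets_clock_measure by (rule clock_sets_Collect) measurable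
  have "emeasure ?P ?A = (\<integral>\<^sup>+X. indicator ?A X \<partial>?P)" by (rule nn_integral_indicator[symmetric, OF A])
  also have "\<dots> \<le> (\<integral>\<^sup>+X. ennreal (exp (?\<theta> * ?C X)) * ennreal (exp (- ?\<theta> * ?S X)) \<partial>?P)"
  proof (rule nn_integral_mono)
    fix X
    show "indicator ?A X \<le> ennreal (exp (?\<theta> * ?C X)) * ennreal (exp (- ?\<theta> * ?S X))"
    proof (cases "X \<in> ?A")
      case True
      then have "0 \<le> ?\<theta> * (?C X - ?S X)" using l by (intro mult_nonneg_nonneg) auto
      then have "1 \<le> exp (?\<theta> * ?C X + - ?\<theta> * ?S X)" by (simp add: algebra_simps)
      then have "ennreal 1 \<le> ennreal (exp (?\<theta> * ?C X) * exp (- ?\<theta> * ?S X))"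
        unfolding exp_add by (rule ennreal_leI)
      then show ?thesis using True by (simp add: ennreal_mult)
    qed simp
  qed
  also have "\<dots> = ennreal ((1 / (1 - ?\<theta>)) ^ k * (l / (l + ?\<theta>)) ^ k)"
    using assms by (subst nn_integral_chain_times) auto
  also have "(1 / (1 - ?\<theta>)) ^ k * (l / (l + ?\<theta>)) ^ k = (4 * l / (1 + l)\<^sup>2) ^ k"
  proof -
    have *: "1 - ?\<theta> = (1 + l) / 2" "l + ?\<theta> = (1 + l) / 2" by (auto simp: field_simps)
    have "(1 / (1 - ?\<theta>)) * (l / (l + ?\<theta>)) = 4 * l / (1 + l)\<^sup>2"
      unfolding * by (simp add: power2_eq_square)
    then show ?thesis by (simp only: power_mult_distrib[symmetric])
  qed
  finally show ?thesis .
qed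

section \<open>Self-avoiding paths of half-edges and their number\<close>

definition pair_edge :: "half_edge \<times> half_edge \<Rightarrow> edge" where
  "pair_edge = (\<lambda>(x, y). Matched {x, y})"

definition path_end :: "(half_edge \<times> half_edge) list \<Rightarrow> vertex" where
  "path_end ps = (if ps = [] then 1 else fst (snd (last ps)))"

abbreviation path_vertices :: "(half_edge \<times> half_edge) list \<Rightarrow> vertex list" where
  "path_vertices ps \<equiv> map (\<lambda>p. fst (snd p)) ps"

abbreviation path_halves :: "('a \<times> 'a) list \<Rightarrow> 'a list" where
  "path_halves ps \<equiv> concat (map (\<lambda>(x, y). [x, y]) ps)"

inductive_set paths :: "half_edge set \<Rightarrow> (half_edge \<times> half_edge) list set" for H where
  Nil: "[] \<in> paths H"
| snoc: "ps @ [(x, y)] \<in> paths H"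
    if "ps \<in> paths H" "x \<in> H" "y \<in> H" "fst x = path_end ps"
      "fst y \<notin> insert 1 (set (path_vertices ps))" "x \<notin> set (path_halves ps)"

lemma path_end_Nil [simp]: "path_end [] = 1"
  and path_end_snoc [simp]: "path_end (ps @ [(x, y)]) = fst y"
  by (simp_all add: path_end_def)

lemma path_end_visited: "path_end ps \<in> insert 1 (set (path_vertices ps))"
  by (cases ps rule: rev_cases) auto

lemma paths_facts:
  assumes "ps \<in> paths H"
  shows paths_distinct_halves: "distinct (path_halves ps)"
    and paths_halves_subset: "set (path_halves ps) \<subseteq> H"
    and paths_distinct_vertices: "distinct (1 # path_vertices ps)"
    and paths_halves_visited: "z \<in> set (path_halves ps) \<Longrightarrow> fst z \<in> insert 1 (set (path_vertices ps))"
proof -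
  have "distinct (path_halves ps) \<and> set (path_halves ps) \<subseteq> H \<and> distinct (1 # path_vertices ps)
    \<and> (\<forall>z\<in>set (path_halves ps). fst z \<in> insert 1 (set (path_vertices ps)))"
    using assms
  proof induction
    case (snoc ps x y)
    define h where "h = path_halves ps"
    have h': "path_halves (ps @ [(x, y)]) = h @ [x, y]" by (simp add: h_def)
    have IH: "distinct h" "set h \<subseteq> H" "distinct (1 # path_vertices ps)"
      "\<And>z. z \<in> set h \<Longrightarrow> fst z \<in> insert 1 (set (path_vertices ps))"
      using snoc.IH by (auto simp only: h_def)
    have x: "x \<notin> set h" using snoc.hyps(6) by (simp only: h_def not_False_eq_True)
    have "y \<notin> set h" using IH(4) snoc.hyps(5) by blast
    moreover have "y \<noteq> x" using snoc.hyps(4,5) path_end_visited[of ps] by metis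
    moreover have "fst x \<in> insert 1 (set (path_vertices ps))"
      using snoc.hyps(4) path_end_visited[of ps] by simp
    ultimately show ?case
      unfolding h' using IH x snoc.hyps(2,3,5) by auto
  qed simp
  then show "distinct (path_halves ps)" "set (path_halves ps) \<subseteq> H" "distinct (1 # path_vertices ps)"
    "z \<in> set (path_halves ps) \<Longrightarrow> fst z \<in> insert 1 (set (path_vertices ps))" by blast+
qed

lemma finite_paths_length: "finite H \<Longrightarrow> finite {ps \<in> paths H. length ps = k}"
proof (rule finite_subset)
  show "{ps \<in> paths H. length ps = k} \<subseteq> {ps. set ps \<subseteq> H \<times> H \<and> length ps = k}"
    using paths_halves_subset by fastforce
  show "finite H \<Longrightarrow> finite {ps. set ps \<subseteq> H \<times> H \<and> length ps = k}"
    by (intro finite_lists_length_eq) simp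
qed

text \<open>Vertex 1 chooses an exit, the last vertex an entrance, and every vertex in between an
  ordered pair of distinct half-edges. In expectation each intermediate vertex therefore contributes
  the mean of \<open>D * (D - 1)\<close>.\<close>

lemma card_paths_le:
  fixes H :: "half_edge set"
  assumes fin: "finite H"
  defines "deg \<equiv> \<lambda>w. card {h \<in> H. fst h = w}"
  shows "card {ps \<in> paths H. path_vertices ps = vs @ [v]}
    \<le> deg 1 * (\<Prod>w\<leftarrow>vs. deg w * (deg w - 1)) * deg v"
proof (induction vs arbitrary: v rule: rev_induct)
  case Nil
  have "{ps \<in> paths H. path_vertices ps = [v]}
      \<subseteq> (\<lambda>(x, y). [(x, y)]) ` ({h \<in> H. fst h = 1} \<times> {h \<in> H. fst h = v})"
  proof
    fix ps assume "ps \<in> {ps \<in> paths H. path_vertices ps = [v]}"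
    then have ps: "ps \<in> paths H" "path_vertices ps = [v]" by auto
    then show "ps \<in> (\<lambda>(x, y). [(x, y)]) ` ({h \<in> H. fst h = 1} \<times> {h \<in> H. fst h = v})"
      by (cases rule: paths.cases) auto
  qed
  then have "card {ps \<in> paths H. path_vertices ps = [v]}
      \<le> card ((\<lambda>(x, y). [(x, y)]) ` ({h \<in> H. fst h = 1} \<times> {h \<in> H. fst h = v}))"
    using fin by (intro card_mono) auto
  also have "\<dots> \<le> card ({h \<in> H. fst h = 1} \<times> {h \<in> H. fst h = v})"
    using fin by (intro card_image_le) auto
  finally show ?case by (simp add: deg_def card_cartesian_product)
next
  case (snoc w vs)
  let ?N = "{ps \<in> paths H. path_vertices ps = vs @ [w]}"
  let ?S = "SIGMA ps:?N. ({h \<in> H. fst h = w} - {snd (last ps)}) \<times> {h \<in> H. fst h = v}"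
  have finN: "finite ?N"
    by (rule finite_subset[OF _ finite_paths_length[OF fin, of "Suc (length vs)"]])
      (auto dest: arg_cong[where f = length])
  have fibre: "card (({h \<in> H. fst h = w} - {snd (last ps)}) \<times> {h \<in> H. fst h = v}) = (deg w - 1) * deg v"
    if ps: "ps \<in> ?N" for ps
  proof -
    have "ps \<in> paths H" "path_vertices ps = vs @ [w]" using ps by auto
    then have "snd (last ps) \<in> {h \<in> H. fst h = w}"
      by (cases rule: paths.cases) auto
    then show ?thesis using fin by (simp add: card_cartesian_product deg_def)
  qed
  have "{ps \<in> paths H. path_vertices ps = (vs @ [w]) @ [v]} \<subseteq> (\<lambda>(ps, x, y). ps @ [(x, y)]) ` ?S"
  proof
    fix qs assume "qs \<in> {ps \<in> paths H. path_vertices ps = (vs @ [w]) @ [v]}"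
    then have qs: "qs \<in> paths H" "path_vertices qs = (vs @ [w]) @ [v]" by auto
    then show "qs \<in> (\<lambda>(ps, x, y). ps @ [(x, y)]) ` ?S"
    proof (cases rule: paths.cases)
      case (snoc ps x y)
      have "path_vertices ps = vs @ [w]" "fst y = v" using qs(2) snoc(1) by auto
      moreover from this obtain ps' p where ps': "ps = ps' @ [p]" "fst (snd p) = w"
        by (cases ps rule: rev_cases) auto
      moreover have "snd p \<in> set (path_halves ps)" using ps' by (cases p) auto
      ultimately have "(ps, x, y) \<in> ?S" using snoc by (auto simp: path_end_def)
      then show ?thesis using snoc(1) by force
    qed (use qs in auto)
  qed
  then have "card {ps \<in> paths H. path_vertices ps = (vs @ [w]) @ [v]} \<le> card ((\<lambda>(ps, x, y). ps @ [(x, y)]) ` ?S)"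
    using fin finN by (intro card_mono) auto
  also have "\<dots> \<le> card ?S"
    using fin finN by (intro card_image_le) auto
  also have "\<dots> = (\<Sum>ps\<in>?N. (deg w - 1) * deg v)"
    using fin finN fibre by (subst card_SigmaI) (auto intro!: sum.cong)
  also have "\<dots> = card ?N * ((deg w - 1) * deg v)" by simp
  also have "\<dots> \<le> (deg 1 * (\<Prod>w\<leftarrow>vs. deg w * (deg w - 1)) * deg w) * ((deg w - 1) * deg v)"
    by (intro mult_le_mono1 snoc)
  also have "\<dots> = deg 1 * (\<Prod>w\<leftarrow>vs @ [w]. deg w * (deg w - 1)) * deg v" by simp
  finally show ?case .
qed

lemma sum_prod_list_lists:
  fixes f :: "'a \<Rightarrow> 'b::comm_semiring_1"
  assumes "finite A"
  shows "(\<Sum>xs | set xs \<subseteq> A \<and> length xs = k. \<Prod>x\<leftarrow>xs. f x) = (\<Sum>x\<in>A. f x) ^ k"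
proof (induction k)
  case (Suc k)
  let ?L = "{xs. set xs \<subseteq> A \<and> length xs = k}"
  have "(\<Sum>xs | set xs \<subseteq> A \<and> length xs = Suc k. \<Prod>x\<leftarrow>xs. f x)
      = (\<Sum>z\<in>?L \<times> A. \<Prod>x\<leftarrow>snd z # fst z. f x)"
    unfolding lists_length_Suc_eq
    by (subst sum.reindex) (auto simp: inj_on_def case_prod_unfold intro!: sum.cong)
  also have "\<dots> = (\<Sum>xs\<in>?L. \<Sum>x\<in>A. f x * (\<Prod>x\<leftarrow>xs. f x))"
    by (subst sum.cartesian_product) (simp add: case_prod_unfold)
  also have "\<dots> = (\<Sum>xs\<in>?L. (\<Sum>x\<in>A. f x) * (\<Prod>x\<leftarrow>xs. f x))"
    by (simp add: sum_distrib_right)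
  also have "\<dots> = (\<Sum>x\<in>A. f x) ^ Suc k" by (simp add: Suc flip: sum_distrib_left)
  finally show ?case .
qed (simp add: Collect_conv_if)

text \<open>The parity correction at \<open>n\<close> depends on all degrees and would destroy
  independence. Adding the extra half-edge in every case gives an upper bound in which each vertex
  contributes a function of its own degree.\<close>

definition deg_bound :: "nat \<Rightarrow> (vertex \<Rightarrow> nat) \<Rightarrow> vertex \<Rightarrow> nat" where
  "deg_bound n d i = d i + (if i = n then 1 else 0)"

lemma card_half_edges_at:
  "card {h \<in> half_edges n d. fst h = w} = (if w \<in> {1..n} then vertex_degree n d w else 0)"
proof -
  have "{h \<in> half_edges n d. fst h = w} = (if w \<in> {1..n} then {w} \<times> {..<vertex_degree n d w} else {})"
    by (auto simp: half_edges_def)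
  then show ?thesis by (auto simp: card_cartesian_product)
qed

lemma card_half_edges_at_le: "card {h \<in> half_edges n d. fst h = w} \<le> deg_bound n d w"
  by (simp add: card_half_edges_at vertex_degree_def deg_bound_def)

text \<open>The vertices of a path are distinct, so the expectation of the product over them
  factorises. Distinctness is given up afterwards, which turns the sum over vertex sequences into a
  power of a single sum.\<close>

lemma nn_integral_card_paths_le:
  fixes D :: "nat pmf"
  assumes n: "2 \<le> n"
  defines "e1 \<equiv> \<lambda>i. \<integral>\<^sup>+k. of_nat (k + (if i = n then 1 else 0)) \<partial>measure_pmf D"
    and "e2 \<equiv> \<lambda>i. \<integral>\<^sup>+k. of_nat ((k + (if i = n then 1 else 0)) * (k + (if i = n then 1 else 0) - 1)) \<partial>measure_pmf D"
  shows "(\<integral>\<^sup>+d. of_nat (card {ps \<in> paths (half_edges n d). length ps = Suc k}) \<partial>Pi_pmf {1..n} 0 (\<lambda>_. D))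
    \<le> e1 1 * (\<Sum>i=1..n. e2 i) ^ k * (\<Sum>i=1..n. e1 i)"
proof -
  let ?g = "deg_bound n"
  define VS where "VS = {(vs, v). distinct (1 # vs @ [v]) \<and> set (vs @ [v]) \<subseteq> {1..n} \<and> length vs = k}"
  let ?L = "{vs. set vs \<subseteq> {1..n} \<and> length vs = k} \<times> {1..n}"
  have VSL: "VS \<subseteq> ?L" by (auto simp: VS_def)
  have finL: "finite ?L" by (intro finite_cartesian_product finite_lists_length_eq) auto
  have finVS: "finite VS" using VSL finL by (rule finite_subset)
  have le: "card {ps \<in> paths (half_edges n d). length ps = Suc k}
      \<le> (\<Sum>(vs, v)\<in>VS. ?g d 1 * (\<Prod>w\<leftarrow>vs. ?g d w * (?g d w - 1)) * ?g d v)" for d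
  proof -
    let ?H = "half_edges n d"
    have "{ps \<in> paths ?H. length ps = Suc k} \<subseteq> (\<Union>(vs, v)\<in>VS. {ps \<in> paths ?H. path_vertices ps = vs @ [v]})"
    proof
      fix ps assume "ps \<in> {ps \<in> paths ?H. length ps = Suc k}"
      then have ps: "ps \<in> paths ?H" "length ps = Suc k" by auto
      obtain vs v where vs: "path_vertices ps = vs @ [v]"
        using ps(2) by (metis length_0_conv length_map nat.distinct(1) rev_exhaust)
      have "length vs = k" using ps(2) arg_cong[OF vs, of length] by simp
      moreover have "set (path_vertices ps) \<subseteq> {1..n}"
      proof -
        have "snd p \<in> ?H" if "p \<in> set ps" for p
          using paths_halves_subset[OF ps(1)] that by (cases p) fastforce
        then show ?thesis using fst_half_edges by fastforce
      qed
      ultimately have "(vs, v) \<in> VS"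
        using paths_distinct_vertices[OF ps(1)] unfolding VS_def vs by simp
      then show "ps \<in> (\<Union>(vs, v)\<in>VS. {ps \<in> paths ?H. path_vertices ps = vs @ [v]})"
        using ps(1) vs by auto
    qed
    moreover have "finite {ps \<in> paths ?H. path_vertices ps = vs @ [v]}" for vs v
      by (rule finite_subset[OF _ finite_paths_length[of ?H "Suc (length vs)"]])
        (auto dest: arg_cong[where f = length])
    ultimately have "card {ps \<in> paths ?H. length ps = Suc k}
        \<le> card (\<Union>(vs, v)\<in>VS. {ps \<in> paths ?H. path_vertices ps = vs @ [v]})"
      using finVS by (intro card_mono) auto
    also have "\<dots> \<le> (\<Sum>(vs, v)\<in>VS. card {ps \<in> paths ?H. path_vertices ps = vs @ [v]})"
      using card_UN_le[OF finVS, of "\<lambda>(vs, v). {ps \<in> paths ?H. path_vertices ps = vs @ [v]}"]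
      by (simp add: case_prod_unfold)
    also have "\<dots> \<le> (\<Sum>(vs, v)\<in>VS. ?g d 1 * (\<Prod>w\<leftarrow>vs. ?g d w * (?g d w - 1)) * ?g d v)"
    proof (intro sum_mono, clarify)
      fix vs v
      let ?deg = "\<lambda>w. card {h \<in> ?H. fst h = w}"
      have "card {ps \<in> paths ?H. path_vertices ps = vs @ [v]}
          \<le> ?deg 1 * (\<Prod>w\<leftarrow>vs. ?deg w * (?deg w - 1)) * ?deg v"
        by (rule card_paths_le) simp
      also have "\<dots> \<le> ?g d 1 * (\<Prod>w\<leftarrow>vs. ?g d w * (?g d w - 1)) * ?g d v"
      proof -
        have "(\<Prod>w\<leftarrow>vs. ?deg w * (?deg w - 1)) \<le> (\<Prod>w\<leftarrow>vs. ?g d w * (?g d w - 1))"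
          by (induction vs) (auto intro!: mult_le_mono diff_le_mono card_half_edges_at_le)
        then show ?thesis by (intro mult_le_mono card_half_edges_at_le)
      qed
      finally show "card {ps \<in> paths ?H. path_vertices ps = vs @ [v]}
          \<le> ?g d 1 * (\<Prod>w\<leftarrow>vs. ?g d w * (?g d w - 1)) * ?g d v" .
    qed
    finally show ?thesis .
  qed
  have one: "(\<integral>\<^sup>+d. of_nat (?g d 1 * (\<Prod>w\<leftarrow>vs. ?g d w * (?g d w - 1)) * ?g d v) \<partial>Pi_pmf {1..n} 0 (\<lambda>_. D))
      = e1 1 * (\<Prod>w\<leftarrow>vs. e2 w) * e1 v" if "(vs, v) \<in> VS" for vs v
  proof -
    have vs: "distinct (1 # vs @ [v])" "set (1 # vs @ [v]) \<subseteq> {1..n}"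
      using that n by (auto simp: VS_def)
    \<comment> \<open>One factor per vertex lets the product along the path be read as a product
      over a set of coordinates; inner vertices contribute \<open>m * (m - 1)\<close>, the two end
      vertices \<open>m\<close>.\<close>
    define f where "f i k = (let m = k + (if i = n then 1 else 0) in
        if i \<in> set vs then m * (m - 1) else m)" for i k :: nat
    have "?g d 1 * (\<Prod>w\<leftarrow>vs. ?g d w * (?g d w - 1)) * ?g d v = (\<Prod>i\<in>set (1 # vs @ [v]). f i (d i))" for d
    proof -
      have "(\<Prod>i\<in>set (1 # vs @ [v]). f i (d i)) = (\<Prod>i\<leftarrow>1 # vs @ [v]. f i (d i))"
        using vs(1) by (rule prod.distinct_set_conv_list)
      also have "\<dots> = f 1 (d 1) * (\<Prod>i\<leftarrow>vs. f i (d i)) * f v (d v)" by (simp add: mult.assoc)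
      also have "(\<Prod>i\<leftarrow>vs. f i (d i)) = (\<Prod>w\<leftarrow>vs. ?g d w * (?g d w - 1))"
        by (intro arg_cong[where f = prod_list] map_cong) (auto simp: f_def deg_bound_def Let_def)
      finally show ?thesis using vs(1) by (auto simp: f_def deg_bound_def)
    qed
    then have "(\<integral>\<^sup>+d. of_nat (?g d 1 * (\<Prod>w\<leftarrow>vs. ?g d w * (?g d w - 1)) * ?g d v) \<partial>Pi_pmf {1..n} 0 (\<lambda>_. D))
      = (\<integral>\<^sup>+d. (\<Prod>i\<in>set (1 # vs @ [v]). (of_nat (f i (d i)) :: ennreal)) \<partial>Pi_pmf {1..n} 0 (\<lambda>_. D))"
      by (simp only: of_nat_prod)
    also have "\<dots> = (\<Prod>i\<in>set (1 # vs @ [v]). \<integral>\<^sup>+k. of_nat (f i k) \<partial>D)"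
      using vs(2) by (intro nn_integral_prod_Pi_pmf_subset) auto
    also have "\<dots> = (\<Prod>i\<leftarrow>1 # vs @ [v]. \<integral>\<^sup>+k. of_nat (f i k) \<partial>D)"
      using vs(1) by (rule prod.distinct_set_conv_list)
    also have "\<dots> = (\<integral>\<^sup>+k. of_nat (f 1 k) \<partial>D) * (\<Prod>i\<leftarrow>vs. \<integral>\<^sup>+k. of_nat (f i k) \<partial>D) * (\<integral>\<^sup>+k. of_nat (f v k) \<partial>D)"
      by (simp add: mult.assoc)
    also have "(\<Prod>i\<leftarrow>vs. \<integral>\<^sup>+k. of_nat (f i k) \<partial>D) = (\<Prod>w\<leftarrow>vs. e2 w)"
      by (intro arg_cong[where f = prod_list] map_cong) (auto simp: f_def e2_def Let_def)
    also have "(\<integral>\<^sup>+k. of_nat (f 1 k) \<partial>D) = e1 1"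
      using vs(1) by (auto simp: f_def e1_def Let_def intro!: nn_integral_cong)
    also have "(\<integral>\<^sup>+k. of_nat (f v k) \<partial>D) = e1 v"
      using vs(1) by (auto simp: f_def e1_def Let_def intro!: nn_integral_cong)
    finally show ?thesis .
  qed
  have "(\<integral>\<^sup>+d. of_nat (card {ps \<in> paths (half_edges n d). length ps = Suc k}) \<partial>Pi_pmf {1..n} 0 (\<lambda>_. D))
    \<le> (\<integral>\<^sup>+d. (\<Sum>(vs, v)\<in>VS. of_nat (?g d 1 * (\<Prod>w\<leftarrow>vs. ?g d w * (?g d w - 1)) * ?g d v)) \<partial>Pi_pmf {1..n} 0 (\<lambda>_. D))"
  proof (rule nn_integral_mono)
    fix d
    have "(of_nat (card {ps \<in> paths (half_edges n d). length ps = Suc k}) :: ennreal)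
      \<le> of_nat (\<Sum>(vs, v)\<in>VS. ?g d 1 * (\<Prod>w\<leftarrow>vs. ?g d w * (?g d w - 1)) * ?g d v)"
      using le by (rule of_nat_mono)
    then show "(of_nat (card {ps \<in> paths (half_edges n d). length ps = Suc k}) :: ennreal)
      \<le> (\<Sum>(vs, v)\<in>VS. of_nat (?g d 1 * (\<Prod>w\<leftarrow>vs. ?g d w * (?g d w - 1)) * ?g d v))"
      by (simp only: of_nat_sum case_prod_unfold)
  qed
  also have "\<dots> = (\<Sum>(vs, v)\<in>VS. e1 1 * (\<Prod>w\<leftarrow>vs. e2 w) * e1 v)"
    unfolding case_prod_unfold
    by (subst nn_integral_sum, simp) (rule sum.cong[OF refl], rule one, simp)
  also have "\<dots> \<le> (\<Sum>(vs, v)\<in>?L. e1 1 * (\<Prod>w\<leftarrow>vs. e2 w) * e1 v)"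
    using finL VSL by (intro sum_mono2) auto
  also have "\<dots> = (\<Sum>vs | set vs \<subseteq> {1..n} \<and> length vs = k. \<Sum>v=1..n. e1 1 * (\<Prod>w\<leftarrow>vs. e2 w) * e1 v)"
    by (rule sum.cartesian_product[symmetric])
  also have "\<dots> = e1 1 * (\<Sum>i=1..n. e2 i) ^ k * (\<Sum>i=1..n. e1 i)"
    by (simp add: sum_prod_list_lists[symmetric] sum_distrib_left[symmetric] sum_distrib_right[symmetric])
  finally show ?thesis .
qed

section \<open>Slow paths and the paths present in a matching\<close>

definition matching_paths :: "half_edge set \<Rightarrow> half_edge set set \<Rightarrow> nat \<Rightarrow> (half_edge \<times> half_edge) list set" where
  "matching_paths H M k = {ps \<in> paths H. length ps = k \<and> (\<forall>(x, y)\<in>set ps. {x, y} \<in> M)}"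

lemma finite_matching_paths: "finite H \<Longrightarrow> finite (matching_paths H M k)"
  by (rule finite_subset[OF _ finite_paths_length[of H k]]) (auto simp: matching_paths_def)

lemma mem_path_halves:
  assumes "(a, b) \<in> set ps"
  shows "a \<in> set (path_halves ps)" "b \<in> set (path_halves ps)"
  using assms by (induction ps) auto

text \<open>\<open>Root\<close> is prepended and the last edge omitted, so both chains have the same
  length and \<open>emeasure_chain_times_le\<close> applies. The \<open>Chase\<close> chain bounds
  the time at which blue takes the last vertex but one.\<close>

definition slow_path :: "clocks \<Rightarrow> (half_edge \<times> half_edge) list \<Rightarrow> bool" where
  "slow_path X ps \<longleftrightarrow>
     chain_time Spread X (map pair_edge ps) \<le> chain_time Chase X (Root # map pair_edge (butlast ps))"

lemma paths_distinct_edges: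
  assumes "ps \<in> paths H"
  shows "distinct (map pair_edge ps)"
  using assms
proof induction
  case (snoc ps x y)
  have "pair_edge (x, y) \<notin> set (map pair_edge ps)"
  proof
    assume "pair_edge (x, y) \<in> set (map pair_edge ps)"
    then obtain x' y' where "(x', y') \<in> set ps" "{x, y} = {x', y'}" by (auto simp: pair_edge_def)
    then have "x \<in> set (path_halves ps)"
      using mem_path_halves[of x' y' ps] by (simp only: doubleton_eq_iff) blast
    then show False using snoc.hyps(6) by contradiction
  qed
  then show ?case using snoc by simp
qed simp

lemma emeasure_slow_path_le:
  assumes l: "0 < l" "l < 1" and ps: "ps \<in> paths H" "ps \<noteq> []"
  shows "emeasure (clock_measure l) {X. slow_path (regularize X) ps}
    \<le> ennreal ((4 * l / (1 + l)\<^sup>2) ^ length ps)"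
  unfolding slow_path_def
proof (rule emeasure_chain_times_le[OF l])
  show d: "distinct (map pair_edge ps)" using ps(1) by (rule paths_distinct_edges)
  have "distinct (map pair_edge (butlast ps))" using distinct_butlast[OF d] by (simp add: map_butlast)
  then show "distinct (Root # map pair_edge (butlast ps))" by (auto simp: pair_edge_def)
  show "length (Root # map pair_edge (butlast ps)) = length ps" using ps(2) by simp
qed simp

text \<open>Every infected vertex is reached by a path along which the infection travelled. Blue follows along
  the same path at the latest at \<open>chain_time Chase X (Root # map pair_edge ps)\<close>, and it must not
  have overtaken the infection.\<close>

lemma infection_path:
  assumes dyn: "chase_dynamics (graph_edges M) X" and M: "M \<in> perfect_matchings H"
    and v: "infected (graph_edges M) X v" "v \<noteq> 0"
  shows "\<exists>ps\<in>paths H. path_end ps = v \<and> (\<forall>(x, y)\<in>set ps. {x, y} \<in> M)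
    \<and> (\<forall>k. 0 < k \<longrightarrow> k \<le> length ps \<longrightarrow> take k ps \<in> paths H \<and> slow_path X (take k ps))"
proof -
  interpret chase_dynamics "graph_edges M" X by fact
  let ?r = "\<lambda>ps. chain_time Spread X (map pair_edge ps)"
  let ?b = "\<lambda>ps. chain_time Chase X (Root # map pair_edge ps)"
  \<comment> \<open>The induction carries more than the claim: the \<open>Spread\<close> chain ends
    exactly at \<open>T v\<close>, the vertex \<open>v\<close> is blue at the end of the
    \<open>Chase\<close> chain, and no vertex of the path is infected after \<open>v\<close>, which
    keeps extensions self-avoiding.\<close>
  define Q where "Q ps v \<longleftrightarrow> ps \<in> paths H \<and> path_end ps = v \<and> (\<forall>(x, y)\<in>set ps. {x, y} \<in> M)
    \<and> (\<forall>k. 0 < k \<longrightarrow> k \<le> length ps \<longrightarrow> take k ps \<in> paths H \<and> slow_path X (take k ps))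
    \<and> ?r ps = T v \<and> config (?b ps) v = Blue
    \<and> (\<forall>w\<in>insert 1 (set (path_vertices ps)). infected (graph_edges M) X w \<and> T w \<le> T v)" for ps v
  have "\<exists>ps. Q ps v"
    using v
  proof (induction "card {s \<in> rings. s \<le> T v}" arbitrary: v rule: less_induct)
    case less
    show ?case
    proof (cases "v = 1")
      case True
      have t: "0 \<le> (0::real)" by simp
      have b: "0 < next_ring X Root Chase 0" "next_ring X Root Chase 0 \<in> arrivals X Root Chase"
        using next_ring_gt[OF regular_clock t] next_ring_arrival[OF regular_clock t] by auto
      then have "config (next_ring X Root Chase 0) 1 = Blue"
      proof -
        obtain p where p: "0 \<le> p" "p < next_ring X Root Chase 0" "rings \<inter> {p<..<next_ring X Root Chase 0} = {}"
          using ex_predecessor[OF finite_rings order_refl b(1)] by blast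
        show ?thesis
          using p b(2) root_Blue[OF p(1)] infected_1 nonwhite_iff[of p 1]
          by (intro chase_step[of p _ 0 1 Root]) (auto simp: graph_edges_def)
      qed
      then have "Q [] v"
        unfolding Q_def using infected_1 True by (auto simp: paths.Nil chain_time_def)
      then show ?thesis ..
    next
      case False
      obtain e u p where e: "e \<in> graph_edges M" "ends e = {u, v}" "T v \<in> arrivals X e Spread"
        and p: "0 \<le> p" "p < T v" "rings \<inter> {p<..<T v} = {}" "config p u = Red" and uv: "u \<noteq> v"
        using infection_source[OF less.prems False] by metis
      have u0: "u \<noteq> 0" using root_Blue[OF p(1)] p(4) by (metis state.distinct(1))
      have u: "infected (graph_edges M) X u" "T u \<le> p" using nonwhite_iff[OF p(1), of u] p(4) by auto
      obtain q where q: "q \<in> M" "e = Matched q" using e(1,2) u0 less.prems(2) by (auto simp: graph_edges_def)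
      obtain x y where xy: "q = {x, y}" "fst x = u" "fst y = v"
      proof -
        have "card q = 2" using M q(1) by (rule perfect_matchings_card)
        then obtain x y where "q = {x, y}" by (auto simp: card_2_iff)
        moreover have "fst ` q = {u, v}" using e(2) q by simp
        ultimately show ?thesis using that[of x y] that[of y x] uv by (auto simp: doubleton_eq_iff insert_commute)
      qed
      have Tuv: "T u < T v" using u p by simp
      have "T v \<in> rings" using inf_time_ring[OF less.prems(1)] inf_time_pos[OF less.prems False] by auto
      then have "T v \<in> {s \<in> rings. s \<le> T v} - {s \<in> rings. s \<le> T u}" using Tuv by simp
      moreover have "{s \<in> rings. s \<le> T u} \<subseteq> {s \<in> rings. s \<le> T v}" using Tuv by auto
      ultimately have "{s \<in> rings. s \<le> T u} \<subset> {s \<in> rings. s \<le> T v}" by blast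
      then have "card {s \<in> rings. s \<le> T u} < card {s \<in> rings. s \<le> T v}"
        by (intro psubset_card_mono finite_rings)
      from less.hyps[OF this u(1) u0] obtain ps where "Q ps u" by blast
      then have ps: "ps \<in> paths H" "path_end ps = u" "\<forall>(x, y)\<in>set ps. {x, y} \<in> M"
          "\<And>k. 0 < k \<Longrightarrow> k \<le> length ps \<Longrightarrow> take k ps \<in> paths H \<and> slow_path X (take k ps)"
          "?r ps = T u" "config (?b ps) u = Blue"
          "\<And>w. w \<in> insert 1 (set (path_vertices ps)) \<Longrightarrow> infected (graph_edges M) X w \<and> T w \<le> T u"
        unfolding Q_def by blast+
      let ?qs = "ps @ [(x, y)]"
      have new: "v \<notin> insert 1 (set (path_vertices ps))" using ps(7)[of v] Tuv by auto
      have xyM: "{x, y} \<in> M" using q xy by simp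
      \<comment> \<open>A half-edge on the path has its partner on the path too; then
        \<open>y\<close>, and with it \<open>v\<close>, would have been visited already.\<close>
      have "x \<notin> set (path_halves ps)"
      proof
        assume "x \<in> set (path_halves ps)"
        then obtain a b where ab: "(a, b) \<in> set ps" "x = a \<or> x = b"
          by (auto simp only: set_concat set_map UN_iff image_iff split: prod.splits) auto
        then have "{a, b} \<in> M" using ps(3) by auto
        then have "{x, y} = {a, b}"
          using ab(2) by (intro perfect_matchings_disjoint[OF M xyM, of _ x]) auto
        then have "y \<in> set (path_halves ps)"
          using mem_path_halves[OF ab(1)] by (simp only: doubleton_eq_iff) blast
        then have "fst y \<in> insert 1 (set (path_vertices ps))" by (rule paths_halves_visited[OF ps(1)])
        then show False using new xy(3) by blast
      qed
      then have qs: "?qs \<in> paths H"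
        using ps(1,2) perfect_matchings_Union[OF M] xyM xy new
        by (intro paths.snoc) auto
      have redu: "config t u = Red" if "T u \<le> t" "t < T v" for t
      proof (cases "t \<le> p")
        case True
        have "0 \<le> t" using inf_time_nonneg[OF u(1)] that by simp
        then have "config t u \<noteq> White" "config t u \<noteq> Blue"
          using nonwhite_iff[of t u] u(1) that config_Blue_mono[of t p u] True p(4) by auto
        then show ?thesis by (cases "config t u") auto
      next
        case False
        then have "config t = config p" using p(3) that by (intro config_const) auto
        then show ?thesis using p(4) by simp
      qed
      have pe: "pair_edge (x, y) = e" using q xy by (simp add: pair_edge_def)
      have Tu0: "0 \<le> T u" using u(1) by (rule inf_time_nonneg)
      \<comment> \<open>The first \<open>Spread\<close> ring of \<open>e\<close> after
        \<open>T u\<close> finds \<open>u\<close> still red and infects \<open>v\<close> unless it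
        is infected already, so this ring is the one at \<open>T v\<close>.\<close>
      define s where "s = next_ring X e Spread (T u)"
      have s: "T u < s" "s \<in> arrivals X e Spread" "s \<le> T v"
        unfolding s_def using next_ring_gt[OF regular_clock Tu0] next_ring_arrival[OF regular_clock Tu0]
          next_ring_le[OF regular_clock Tu0 e(3) Tuv] by auto
      obtain p' where p': "T u \<le> p'" "p' < s" "rings \<inter> {p'<..<s} = {}"
        using ex_predecessor[of rings "T u" s] finite_rings Tu0 s(1) by auto
      have "config s v \<noteq> White"
        using spread_step[OF _ p'(2,3) redu e(1,2) s(2)] p' s(3) Tu0 by auto
      then have "T v \<le> s" using inf_time_least[OF less.prems(1), of s] Tu0 s(1) by simp
      with s(3) have sT: "s = T v" by simp
      have r: "?r ?qs = T v" using ps(5) sT by (simp add: pe s_def)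
      have b0: "0 \<le> ?b ps" by (rule chain_time_nonneg[OF regular_X])
      \<comment> \<open>\<open>u\<close> stays red until \<open>T v\<close> but is blue at the end
        of its \<open>Chase\<close> chain, so that end cannot come before \<open>T v\<close>. This
        is the condition \<open>slow_path\<close> for the extended path.\<close>
      have Tb: "T v \<le> ?b ps"
      proof (rule ccontr)
        assume "\<not> T v \<le> ?b ps"
        moreover have "T u \<le> ?b ps" using nonwhite_iff[OF b0, of u] ps(6) by simp
        ultimately show False using redu[of "?b ps"] ps(6) by simp
      qed
      have b': "?b ?qs = next_ring X e Chase (?b ps)"
        using chain_time_snoc[of Chase X "Root # map pair_edge ps" e] by (simp add: pe)
      have b: "?b ps < ?b ?qs" "?b ?qs \<in> arrivals X e Chase"
        unfolding b' using next_ring_gt[OF regular_clock b0] next_ring_arrival[OF regular_clock b0] by auto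
      obtain p'' where p'': "?b ps \<le> p''" "p'' < ?b ?qs" "rings \<inter> {p''<..<?b ?qs} = {}"
        using ex_predecessor[of rings "?b ps" "?b ?qs"] finite_rings b0 b(1) by auto
      have "config p'' u = Blue" using config_Blue_mono[OF b0 p''(1)] ps(6) by simp
      moreover have "config p'' v \<noteq> White" using nonwhite_iff[of p'' v] less.prems(1) b0 Tb p''(1) by simp
      ultimately have blue: "config (?b ?qs) v = Blue"
        using chase_step[OF _ p''(2,3) _ _ e(1,2) b(2)] b0 p''(1) by simp
      have "slow_path X ?qs" unfolding slow_path_def r using Tb by simp
      then have take: "take k ?qs \<in> paths H \<and> slow_path X (take k ?qs)"
        if "0 < k" "k \<le> length ?qs" for k
        using that ps(4)[of k] qs by (cases "k = Suc (length ps)") auto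
      have "infected (graph_edges M) X w \<and> T w \<le> T v"
        if "w \<in> insert 1 (set (path_vertices ?qs))" for w
      proof (cases "w = v")
        case False
        with that xy(3) have "w \<in> insert 1 (set (path_vertices ps))" by simp
        from ps(7)[OF this] show ?thesis using Tuv by simp
      qed (use less.prems(1) in simp)
      then have "Q ?qs v"
        unfolding Q_def using qs xy(3) ps(3) xyM take r blue by auto
      then show ?thesis ..
    qed
  qed
  then show ?thesis unfolding Q_def by blast
qed

lemma chase_escape_cong:
  assumes "\<And>e c. e \<in> E \<Longrightarrow> arrivals X e c = arrivals X' e c"
  shows "chase_escape E X = chase_escape E X'"
proof -
  have "ring_times E X = ring_times E X'" using assms by (auto simp: ring_times_def)
  moreover have "update E X = update E X'"
  proof (intro ext)
    fix t v and \<sigma> :: "vertex \<Rightarrow> state"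
    have "(\<exists>e\<in>E. \<exists>u. ends e = {u, v} \<and> \<sigma> u = s \<and> t \<in> arrivals X e c)
      = (\<exists>e\<in>E. \<exists>u. ends e = {u, v} \<and> \<sigma> u = s \<and> t \<in> arrivals X' e c)" for s c
      using assms by auto
    then show "update E X t \<sigma> v = update E X' t \<sigma> v" by (simp only: update_def)
  qed
  ultimately show ?thesis by (intro ext) (simp only: chase_escape_def)
qed

lemma ever_red_infected:
  assumes "chase_dynamics E X" "v \<in> ever_red n E X"
  shows "infected E X v" "v \<noteq> 0"
proof -
  interpret chase_dynamics E X by fact
  obtain t where t: "0 \<le> t" "config t v = Red" using assms(2) by (auto simp: ever_red_def)
  then show "infected E X v" by (auto simp: infected_def)
  show "v \<noteq> 0" using root_Blue[OF t(1)] t(2) by (metis state.distinct(1))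
qed

lemma AE_ever_red_regularize:
  assumes "0 < l" "finite E"
  shows "AE X in clock_measure l. ever_red n E (regularize X) = ever_red n E X"
  using AE_regularize_eq[OF assms]
proof eventually_elim
  case (elim X)
  then have "chase_escape E (regularize X) = chase_escape E X"
    by (intro chase_escape_cong arrivals_cong) auto
  then show ?case by (simp add: ever_red_def)
qed

lemma slow_path_measurable [measurable]:
  "Measurable.pred clock_space (\<lambda>X. slow_path (regularize X) ps)"
  unfolding slow_path_def by measurable

text \<open>If there are more red vertices than paths of length below \<open>K\<close>, some red
  vertex has an infection path of length at least \<open>K\<close>, whose prefix of length
  \<open>K\<close> is slow. If instead the short paths number at least \<open>\<delta> * n\<close>,
  the last term alone is at least 1, as in Markov's inequality.\<close>

lemma emeasure_many_red_le:
  assumes l: "0 < l" "l < 1" and M: "M \<in> perfect_matchings H" and fin: "finite H"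
    and K: "0 < K" and \<delta>: "0 < \<delta>" "0 < n"
  shows "emeasure (clock_measure l) {X. \<delta> * real n < real (card (ever_red n (graph_edges M) X))}
    \<le> ennreal ((4 * l / (1 + l)\<^sup>2) ^ K) * of_nat (card (matching_paths H M K))
      + ennreal (1 / (\<delta> * real n)) * (\<Sum>k<K. of_nat (card (matching_paths H M k)))"
proof -
  let ?P = "clock_measure l" and ?E = "graph_edges M" and ?q = "ennreal ((4 * l / (1 + l)\<^sup>2) ^ K)"
  let ?A = "{X. \<delta> * real n < real (card (ever_red n ?E X))}"
  let ?N = "\<Sum>k<K. card (matching_paths H M k)"
  interpret P: prob_space ?P using l(1) by (rule prob_space_clock_measure)
  have finM: "finite M" by (rule finite_UnionD) (simp add: perfect_matchings_Union[OF M] fin)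
  have finE: "finite ?E" using finM by (simp add: graph_edges_def)
  let ?S = "\<lambda>ps. {X. slow_path (regularize X) ps}"
  have S: "?S ps \<in> sets ?P" for ps
    unfolding sets_clock_measure by (rule clock_sets_Collect) measurable
  define B where "B = (\<Union>ps\<in>matching_paths H M K. ?S ps)"
  have B: "B \<in> sets ?P"
    unfolding B_def using finite_matching_paths[OF fin] S by (intro sets.finite_UN) auto
  have "emeasure ?P ?A \<le> ?q * of_nat (card (matching_paths H M K)) + ennreal (1 / (\<delta> * real n)) * of_nat ?N"
  proof (cases "\<delta> * real n \<le> real ?N")
    case True
    have "emeasure ?P ?A \<le> 1" by (rule P.emeasure_le_1)
    also have "1 \<le> ennreal (1 / (\<delta> * real n) * real ?N)"
    proof -
      have "1 \<le> 1 / (\<delta> * real n) * real ?N" using True \<delta> by (simp add: field_simps)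
      then show ?thesis by (metis ennreal_leI ennreal_1)
    qed
    also have "\<dots> = ennreal (1 / (\<delta> * real n)) * of_nat ?N"
      using \<delta> by (simp only: ennreal_mult ennreal_of_nat_eq_real_of_nat) (subst ennreal_mult, auto intro!: sum_nonneg)
    finally show ?thesis by (rule order_trans) simp
  next
    case False
    have sub: "X \<in> B" if X: "ever_red n ?E (regularize X) = ever_red n ?E X" "X \<in> ?A" for X
    proof (rule ccontr)
      let ?Y = "regularize X"
      assume "X \<notin> B"
      have dyn: "chase_dynamics ?E ?Y" using finE regular_regularize by unfold_locales
      have "ever_red n ?E ?Y \<subseteq> path_end ` (\<Union>k<K. matching_paths H M k)"
      proof
        fix v assume v: "v \<in> ever_red n ?E ?Y"
        from infection_path[OF dyn M ever_red_infected[OF dyn v]]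
        obtain ps where ps: "ps \<in> paths H" "path_end ps = v" "\<forall>(x, y)\<in>set ps. {x, y} \<in> M"
          "\<And>k. 0 < k \<Longrightarrow> k \<le> length ps \<Longrightarrow> take k ps \<in> paths H \<and> slow_path ?Y (take k ps)"
          by blast
        have "length ps < K"
        proof (rule ccontr)
          assume "\<not> length ps < K"
          then have "take K ps \<in> matching_paths H M K" "slow_path ?Y (take K ps)"
            using ps(3) ps(4)[of K] K by (auto simp: matching_paths_def dest: in_set_takeD)
          then show False using \<open>X \<notin> B\<close> by (auto simp: B_def)
        qed
        then have "ps \<in> (\<Union>k<K. matching_paths H M k)" using ps by (auto simp: matching_paths_def)
        then show "v \<in> path_end ` (\<Union>k<K. matching_paths H M k)" using ps(2) by blast
      qed
      moreover have finU: "finite (\<Union>k<K. matching_paths H M k)"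
        using finite_matching_paths[OF fin] by auto
      ultimately have "card (ever_red n ?E ?Y) \<le> card (\<Union>k<K. matching_paths H M k)"
        by (metis card_image_le card_mono finite_imageI le_trans)
      also have "\<dots> \<le> ?N" by (rule card_UN_le) simp
      finally show False using X False by simp
    qed
    have "emeasure ?P ?A \<le> emeasure ?P B"
      using AE_ever_red_regularize[OF l(1) finE, of n] sub B
      by (intro emeasure_mono_AE) auto
    also have "\<dots> \<le> (\<Sum>ps\<in>matching_paths H M K. emeasure ?P (?S ps))"
      unfolding B_def using finite_matching_paths[OF fin] S
      by (intro emeasure_subadditive_finite) auto
    also have "\<dots> \<le> (\<Sum>ps\<in>matching_paths H M K. ?q)"
    proof (rule sum_mono)
      fix ps assume "ps \<in> matching_paths H M K"
      then have "ps \<in> paths H" "length ps = K" by (auto simp: matching_paths_def)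
      with emeasure_slow_path_le[OF l this(1)] K show "emeasure ?P (?S ps) \<le> ?q" by auto
    qed
    also have "\<dots> = ?q * of_nat (card (matching_paths H M K))" by (simp add: mult.commute)
    finally show ?thesis by (rule order_trans) simp
  qed
  then show ?thesis by (simp only: of_nat_sum)
qed

text \<open>A path of length \<open>k\<close> prescribes \<open>k\<close> disjoint pairs, so it is
  present in the fraction \<open>num_matchings (card H - 2 * k) / num_matchings (card H)\<close> of
  the matchings; \<open>num_matchings_ge\<close> bounds this quotient.\<close>

lemma nn_integral_card_matching_paths_le:
  assumes fin: "finite H" and even: "even (card H)" and k: "2 * k < card H"
  shows "(\<integral>\<^sup>+M. of_nat (card (matching_paths H M k)) \<partial>pmf_of_set (perfect_matchings H))
    \<le> of_nat (card {ps \<in> paths H. length ps = k}) * ennreal (1 / (real (card H) - 2 * real k) ^ k)"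
proof -
  let ?PM = "perfect_matchings H" and ?m = "card H" and ?L = "{ps \<in> paths H. length ps = k}"
  have finPM: "finite ?PM" using fin by (rule finite_perfect_matchings)
  have cPM: "card ?PM = num_matchings ?m" using fin by (rule card_perfect_matchings)
  have pos: "0 < num_matchings ?m" using even by (rule num_matchings_pos)
  then have ne: "?PM \<noteq> {}" using cPM by auto
  have finL: "finite ?L" using fin by (rule finite_paths_length)
  have one: "card {M \<in> ?PM. \<forall>(x, y)\<in>set ps. {x, y} \<in> M} = num_matchings (?m - 2 * k)" if "ps \<in> ?L" for ps
  proof -
    have ps: "ps \<in> paths H" "length ps = k" using that by auto
    note pm = perfect_matchings_of_list[OF paths_distinct_halves[OF ps(1)]]
    have "{M \<in> ?PM. \<forall>(x, y)\<in>set ps. {x, y} \<in> M} = {M \<in> ?PM. (\<lambda>(x, y). {x, y}) ` set ps \<subseteq> M}"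
      by (auto simp: image_subset_iff)
    then show ?thesis
      using card_perfect_matchings_extend[OF fin pm(1) paths_halves_subset[OF ps(1)]] pm(2) ps(2) by simp
  qed
  have "(\<Sum>M\<in>?PM. card (matching_paths H M k)) = (\<Sum>M\<in>?PM. \<Sum>ps\<in>?L. if \<forall>(x, y)\<in>set ps. {x, y} \<in> M then 1 else 0)"
  proof (rule sum.cong[OF refl])
    fix M
    have "matching_paths H M k = ?L \<inter> {ps. \<forall>(x, y)\<in>set ps. {x, y} \<in> M}" by (auto simp: matching_paths_def)
    then show "card (matching_paths H M k) = (\<Sum>ps\<in>?L. if \<forall>(x, y)\<in>set ps. {x, y} \<in> M then 1 else 0)"
      using finL by (simp add: sum.If_cases)
  qed
  also have "\<dots> = (\<Sum>ps\<in>?L. \<Sum>M\<in>?PM. if \<forall>(x, y)\<in>set ps. {x, y} \<in> M then 1 else 0)" by (rule sum.swap)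
  also have "\<dots> = (\<Sum>ps\<in>?L. num_matchings (?m - 2 * k))"
  proof (rule sum.cong[OF refl])
    fix ps assume "ps \<in> ?L"
    from one[OF this] show "(\<Sum>M\<in>?PM. if \<forall>(x, y)\<in>set ps. {x, y} \<in> M then 1 else 0) = num_matchings (?m - 2 * k)"
      using finPM by (simp add: sum.If_cases Int_def)
  qed
  finally have S: "(\<Sum>M\<in>?PM. card (matching_paths H M k)) = card ?L * num_matchings (?m - 2 * k)" by simp
  have ratio: "real (num_matchings (?m - 2 * k)) / real (num_matchings ?m) \<le> 1 / (real ?m - 2 * real k) ^ k"
  proof -
    have "num_matchings (?m - 2 * k) * (?m - 2 * k) ^ k \<le> num_matchings ?m"
      using num_matchings_ge[of "?m - 2 * k" k] k by simp
    then have "real (num_matchings (?m - 2 * k)) * (real ?m - 2 * real k) ^ k \<le> real (num_matchings ?m)"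
      using k by (simp flip: of_nat_le_iff[where 'a = real] add: of_nat_diff)
    moreover have "0 < (real ?m - 2 * real k) ^ k" using k by (intro zero_less_power) linarith
    ultimately show ?thesis using pos by (simp add: field_simps)
  qed
  have "(\<integral>\<^sup>+M. of_nat (card (matching_paths H M k)) \<partial>pmf_of_set ?PM)
      = (\<Sum>M\<in>?PM. of_nat (card (matching_paths H M k))) / of_nat (card ?PM)"
    using finPM ne by (rule nn_integral_pmf_of_set[rotated])
  also have "\<dots> = of_nat (card ?L * num_matchings (?m - 2 * k)) / of_nat (num_matchings ?m)"
    by (simp only: S cPM flip: of_nat_sum)
  also have "\<dots> = ennreal (real (card ?L) * (real (num_matchings (?m - 2 * k)) / real (num_matchings ?m)))"
    using pos by (simp add: ennreal_of_nat_eq_real_of_nat divide_ennreal)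
  also have "\<dots> \<le> ennreal (real (card ?L) * (1 / (real ?m - 2 * real k) ^ k))"
    using ratio by (intro ennreal_leI mult_left_mono) auto
  also have "\<dots> = of_nat (card ?L) * ennreal (1 / (real ?m - 2 * real k) ^ k)"
    using k by (subst ennreal_mult) (auto simp: ennreal_of_nat_eq_real_of_nat)
  finally show ?thesis .
qed

section \<open>The first-moment bound and its limit\<close>

lemma nn_integral_of_nat_pmf:
  fixes f :: "nat \<Rightarrow> nat"
  assumes "integrable (measure_pmf D) (\<lambda>k. real (f k))"
  shows "(\<integral>\<^sup>+k. of_nat (f k) \<partial>measure_pmf D) = ennreal (measure_pmf.expectation D (\<lambda>k. real (f k)))"
  using nn_integral_eq_integral[OF assms] by (simp add: ennreal_of_nat_eq_real_of_nat)

text \<open>The quotient \<open>b / \<mu>\<close> is the branching factor of the exploration, the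
  number \<open>a\<close> of the final theorem.\<close>

locale square_integrable_degrees =
  fixes D :: "nat pmf" and \<mu> b :: real
  assumes square_integrable: "integrable (measure_pmf D) (\<lambda>k. (real k)\<^sup>2)"
    and mean: "\<mu> = measure_pmf.expectation D real"
    and branching: "b = measure_pmf.expectation D (\<lambda>k. real k * (real k - 1))"
    and pos: "0 < \<mu>" "0 < b"
begin

lemma integrable_real: "integrable (measure_pmf D) real"
  by (rule measure_pmf.square_integrable_imp_integrable[OF _ square_integrable]) simp

lemma integrable_falling: "integrable (measure_pmf D) (\<lambda>k. real k * (real k - 1))"
  using integrable_real square_integrable by (simp add: algebra_simps power2_eq_square)

lemma deg_moment1:
  "(\<integral>\<^sup>+k. of_nat (k + (if i = n then 1 else 0)) \<partial>measure_pmf D) = ennreal (\<mu> + (if i = n then 1 else 0))"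
proof -
  have "integrable (measure_pmf D) (\<lambda>k. real (k + (if i = n then 1 else 0)))"
    using integrable_real by simp
  from nn_integral_of_nat_pmf[OF this] show ?thesis
    using integrable_real by (simp add: mean measure_pmf.prob_space[simplified])
qed

lemma deg_moment2:
  "(\<integral>\<^sup>+k. of_nat ((k + (if i = n then 1 else 0)) * (k + (if i = n then 1 else 0) - 1)) \<partial>measure_pmf D)
    = ennreal (b + (if i = n then 2 * \<mu> else 0))"
proof -
  have eq: "real ((k + (if i = n then 1 else 0)) * (k + (if i = n then 1 else 0) - 1))
      = real k * (real k - 1) + (if i = n then 2 * real k else 0)" for k
    by (cases k) (auto simp: algebra_simps)
  have int: "integrable (measure_pmf D) (\<lambda>k. real k * (real k - 1) + (if i = n then 2 * real k else 0))"
    using integrable_real integrable_falling by (cases "i = n") auto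
  then have "integrable (measure_pmf D)
      (\<lambda>k. real ((k + (if i = n then 1 else 0)) * (k + (if i = n then 1 else 0) - 1)))"
    by (simp only: eq)
  from nn_integral_of_nat_pmf[OF this] show ?thesis
    unfolding eq using integrable_real integrable_falling by (cases "i = n") (auto simp: mean branching)
qed

lemma nn_integral_card_paths_le':
  assumes n: "2 \<le> n"
  shows "(\<integral>\<^sup>+d. of_nat (card {ps \<in> paths (half_edges n d). length ps = Suc k}) \<partial>Pi_pmf {1..n} 0 (\<lambda>_. D))
    \<le> ennreal (\<mu> * (real n * b + 2 * \<mu>) ^ k * (real n * \<mu> + 1))"
proof -
  have split: "{1..n} = insert n {1..<n}" using n by auto
  have "(\<Sum>i=1..n. ennreal (b + (if i = n then 2 * \<mu> else 0))) = ennreal (\<Sum>i=1..n. b + (if i = n then 2 * \<mu> else 0))"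
    using pos by (intro sum_ennreal) auto
  also have "(\<Sum>i=1..n. b + (if i = n then 2 * \<mu> else 0)) = real n * b + 2 * \<mu>"
    using n unfolding split by (simp add: of_nat_diff algebra_simps)
  finally have s2: "(\<Sum>i=1..n. ennreal (b + (if i = n then 2 * \<mu> else 0))) = ennreal (real n * b + 2 * \<mu>)" .
  have "(\<Sum>i=1..n. ennreal (\<mu> + (if i = n then 1 else 0))) = ennreal (\<Sum>i=1..n. \<mu> + (if i = n then 1 else 0))"
    using pos by (intro sum_ennreal) auto
  also have "(\<Sum>i=1..n. \<mu> + (if i = n then 1 else 0)) = real n * \<mu> + 1"
    using n unfolding split by (simp add: of_nat_diff algebra_simps)
  finally have s1: "(\<Sum>i=1..n. ennreal (\<mu> + (if i = n then 1 else 0))) = ennreal (real n * \<mu> + 1)" .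
  have "(\<integral>\<^sup>+d. of_nat (card {ps \<in> paths (half_edges n d). length ps = Suc k}) \<partial>Pi_pmf {1..n} 0 (\<lambda>_. D))
    \<le> ennreal (\<mu> + (if 1 = n then 1 else 0)) * (\<Sum>i=1..n. ennreal (b + (if i = n then 2 * \<mu> else 0))) ^ k
      * (\<Sum>i=1..n. ennreal (\<mu> + (if i = n then 1 else 0)))"
    using nn_integral_card_paths_le[OF n, of D k] unfolding deg_moment1 deg_moment2 .
  also have "\<dots> = ennreal (\<mu> * (real n * b + 2 * \<mu>) ^ k * (real n * \<mu> + 1))"
    unfolding s1 s2 using n pos by (simp add: ennreal_power ennreal_mult[symmetric] del: ennreal_plus)
  finally show ?thesis .
qed

text \<open>Bounds the expected number of paths of length \<open>k\<close> present in the matching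
  when there are more than \<open>\<beta> * n\<close> half-edges. The powers of \<open>n\<close>
  have been cancelled, \<open>k\<close> free vertices against \<open>k\<close> prescribed pairs, so
  that for \<open>k > 0\<close> the limit is finite and proportional to
  \<open>(b / \<beta>) ^ k\<close>.\<close>

definition path_weight :: "real \<Rightarrow> nat \<Rightarrow> nat \<Rightarrow> real" where
  "path_weight \<beta> n k = (if k = 0 then 1 else
     \<mu> * (b + 2 * \<mu> / real n) ^ (k - 1) * (\<mu> + 1 / real n) / (\<beta> - 2 * real k / real n) ^ k)"

lemma path_weight_nonneg: "2 * real k < \<beta> * real n \<Longrightarrow> 0 < n \<Longrightarrow> 0 \<le> path_weight \<beta> n k"
  using pos by (auto simp: path_weight_def field_simps intro!: divide_nonneg_nonneg mult_nonneg_nonneg zero_le_power)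

lemma path_weight_tendsto:
  assumes "0 < \<beta>" "0 < k"
  shows "(\<lambda>n. path_weight \<beta> n k) \<longlonglongrightarrow> \<mu> * b ^ (k - 1) * \<mu> / \<beta> ^ k"
proof -
  have lim: "(\<lambda>n. c / real n) \<longlonglongrightarrow> 0" for c :: real
    by (rule tendsto_divide_0[OF tendsto_const]) (simp add: filterlim_real_at_infinity_sequentially)
  have "(\<lambda>n. \<mu> * (b + 2 * \<mu> / real n) ^ (k - 1) * (\<mu> + 1 / real n) / (\<beta> - 2 * real k / real n) ^ k)
      \<longlonglongrightarrow> \<mu> * (b + 0) ^ (k - 1) * (\<mu> + 0) / (\<beta> - 0) ^ k"
    using assms by (intro tendsto_intros lim) auto
  then show ?thesis using assms by (simp add: path_weight_def)
qed

lemma nn_integral_card_paths_weight: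
  assumes n: "2 \<le> n" and \<beta>: "0 < \<beta>" "2 * real k < \<beta> * real n"
  shows "(\<integral>\<^sup>+d. of_nat (card {ps \<in> paths (half_edges n d). length ps = k}) \<partial>Pi_pmf {1..n} 0 (\<lambda>_. D))
    * ennreal (1 / (\<beta> * real n - 2 * real k) ^ k) \<le> ennreal (path_weight \<beta> n k)"
proof (cases k)
  case 0
  have "{ps \<in> paths (half_edges n d). length ps = 0} = {[]}" for d by (auto intro: paths.Nil)
  then show ?thesis using 0 by (simp add: path_weight_def measure_pmf.emeasure_space_1[simplified])
next
  case (Suc j)
  let ?u = "\<beta> * real n - 2 * real k"
  have n0: "real n \<noteq> 0" using n by simp
  have "(\<integral>\<^sup>+d. of_nat (card {ps \<in> paths (half_edges n d). length ps = k}) \<partial>Pi_pmf {1..n} 0 (\<lambda>_. D)) * ennreal (1 / ?u ^ k)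
      \<le> ennreal (\<mu> * (real n * b + 2 * \<mu>) ^ j * (real n * \<mu> + 1)) * ennreal (1 / ?u ^ k)"
    using nn_integral_card_paths_le'[OF n, of j] Suc by (intro mult_right_mono) auto
  also have "\<dots> = ennreal (\<mu> * (real n * b + 2 * \<mu>) ^ j * (real n * \<mu> + 1) * (1 / ?u ^ k))"
    using pos \<beta> by (intro ennreal_mult[symmetric]) auto
  also have "\<mu> * (real n * b + 2 * \<mu>) ^ j * (real n * \<mu> + 1) * (1 / ?u ^ k) = path_weight \<beta> n k"
  proof -
    have "real n * b + 2 * \<mu> = real n * (b + 2 * \<mu> / real n)" using n0 by (simp add: field_simps)
    moreover have "real n * \<mu> + 1 = real n * (\<mu> + 1 / real n)" using n0 by (simp add: field_simps)
    moreover have "?u = real n * (\<beta> - 2 * real k / real n)" using n0 by (simp add: field_simps)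
    ultimately show ?thesis
      using n0 Suc by (simp add: path_weight_def power_mult_distrib)
  qed
  finally show ?thesis .
qed

text \<open>Degree sequences with sum at most \<open>\<beta> * n\<close> are estimated by their
  probability. For all others the average over matchings has a denominator bounded below by means of
  \<open>\<beta> * n\<close>, which no longer depends on the degrees.\<close>

lemma prob_many_red_le:
  assumes l: "0 < l" "l < 1" and K: "0 < K" and \<delta>: "0 < \<delta>" and n: "2 \<le> n"
    and \<beta>: "0 < \<beta>" "2 * real K < \<beta> * real n"
  shows "prob_many_red D l n \<delta>
    \<le> measure_pmf.prob (Pi_pmf {1..n} 0 (\<lambda>_. D)) {d. (\<Sum>i\<in>{1..n}. real (d i)) \<le> \<beta> * real n}
      + (4 * l / (1 + l)\<^sup>2) ^ K * path_weight \<beta> n K + 1 / (\<delta> * real n) * (\<Sum>k<K. path_weight \<beta> n k)"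
proof -
  let ?P = "Pi_pmf {1..n} 0 (\<lambda>_. D)" and ?q = "4 * l / (1 + l)\<^sup>2"
  let ?B = "{d. (\<Sum>i\<in>{1..n}. real (d i)) \<le> \<beta> * real n}"
  let ?L = "\<lambda>d k. {ps \<in> paths (half_edges n d). length ps = k}"
  let ?u = "\<lambda>k. ennreal (1 / (\<beta> * real n - 2 * real k) ^ k)"
  let ?em = "\<lambda>M. emeasure (clock_measure l) {X. \<delta> * real n < real (card (ever_red n (graph_edges M) X))}"
  have q0: "0 \<le> ?q" using l by simp
  have w0: "0 \<le> path_weight \<beta> n k" if "k \<le> K" for k
    using that \<beta> n by (intro path_weight_nonneg) auto
  have "ennreal (prob_many_red D l n \<delta>)
      = (\<integral>\<^sup>+d. (\<integral>\<^sup>+M. ?em M \<partial>pmf_of_set (perfect_matchings (half_edges n d))) \<partial>?P)"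
    unfolding ennreal_prob_many_red[OF l(1)] config_model_def
    by (simp add: nn_integral_bind_pmf nn_integral_map_pmf)
  also have "\<dots> \<le> (\<integral>\<^sup>+d. indicator ?B d + (ennreal (?q ^ K) * (of_nat (card (?L d K)) * ?u K)
      + ennreal (1 / (\<delta> * real n)) * (\<Sum>k<K. of_nat (card (?L d k)) * ?u k)) \<partial>?P)"
  proof (rule nn_integral_mono)
    fix d
    let ?H = "half_edges n d"
    let ?pm = "pmf_of_set (perfect_matchings ?H)"
    show "(\<integral>\<^sup>+M. ?em M \<partial>?pm) \<le> indicator ?B d + (ennreal (?q ^ K) * (of_nat (card (?L d K)) * ?u K)
      + ennreal (1 / (\<delta> * real n)) * (\<Sum>k<K. of_nat (card (?L d k)) * ?u k))"
    proof (cases "d \<in> ?B")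
      case True
      have "(\<integral>\<^sup>+M. ?em M \<partial>?pm) \<le> (\<integral>\<^sup>+M. 1 \<partial>?pm)"
        by (intro nn_integral_mono prob_space.emeasure_le_1 prob_space_clock_measure l)
      also have "\<dots> = 1" by (simp add: measure_pmf.emeasure_space_1[simplified])
      also have "\<dots> \<le> indicator ?B d + (ennreal (?q ^ K) * (of_nat (card (?L d K)) * ?u K)
        + ennreal (1 / (\<delta> * real n)) * (\<Sum>k<K. of_nat (card (?L d k)) * ?u k))"
        using True by simp
      finally show ?thesis .
    next
      case False
      have "(\<Sum>i\<in>{1..n}. real (d i)) \<le> real (card ?H)"
        unfolding card_half_edges of_nat_sum by (intro sum_mono) (simp add: vertex_degree_def)
      with False have H: "\<beta> * real n < real (card ?H)" by simp
      have mp: "(\<integral>\<^sup>+M. of_nat (card (matching_paths ?H M k)) \<partial>?pm) \<le> of_nat (card (?L d k)) * ?u k"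
        if k: "k \<le> K" for k
      proof -
        have kn: "2 * real k < \<beta> * real n" using k \<beta> by simp
        have "(\<integral>\<^sup>+M. of_nat (card (matching_paths ?H M k)) \<partial>?pm)
            \<le> of_nat (card (?L d k)) * ennreal (1 / (real (card ?H) - 2 * real k) ^ k)"
        proof (intro nn_integral_card_matching_paths_le even_card_half_edges finite_half_edges)
          have "real (2 * k) < real (card ?H)" using kn H by simp
          then show "2 * k < card ?H" by (simp only: of_nat_less_iff)
        qed
        also have "\<dots> \<le> of_nat (card (?L d k)) * ?u k"
          using kn H by (intro mult_left_mono ennreal_leI divide_left_mono power_mono mult_pos_pos zero_less_power) auto
        finally show ?thesis .
      qed
      have "(\<integral>\<^sup>+M. ?em M \<partial>?pm) \<le> (\<integral>\<^sup>+M. ennreal (?q ^ K) * of_nat (card (matching_paths ?H M K))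
          + ennreal (1 / (\<delta> * real n)) * (\<Sum>k<K. of_nat (card (matching_paths ?H M k))) \<partial>?pm)"
      proof (rule nn_integral_mono_AE)
        have "set_pmf ?pm = perfect_matchings ?H"
          using perfect_matchings_half_edges by (intro set_pmf_of_set)
        then show "AE M in ?pm. ?em M \<le> ennreal (?q ^ K) * of_nat (card (matching_paths ?H M K))
          + ennreal (1 / (\<delta> * real n)) * (\<Sum>k<K. of_nat (card (matching_paths ?H M k)))"
          using n by (auto simp: AE_measure_pmf_iff intro!: emeasure_many_red_le l K \<delta>)
      qed
      also have "\<dots> = ennreal (?q ^ K) * (\<integral>\<^sup>+M. of_nat (card (matching_paths ?H M K)) \<partial>?pm)
          + ennreal (1 / (\<delta> * real n)) * (\<Sum>k<K. \<integral>\<^sup>+M. of_nat (card (matching_paths ?H M k)) \<partial>?pm)"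
        by (simp add: nn_integral_add nn_integral_cmult nn_integral_sum)
      also have "\<dots> \<le> ennreal (?q ^ K) * (of_nat (card (?L d K)) * ?u K)
        + ennreal (1 / (\<delta> * real n)) * (\<Sum>k<K. of_nat (card (?L d k)) * ?u k)"
        by (intro add_mono mult_left_mono sum_mono mp) auto
      also have "\<dots> \<le> indicator ?B d + (ennreal (?q ^ K) * (of_nat (card (?L d K)) * ?u K)
        + ennreal (1 / (\<delta> * real n)) * (\<Sum>k<K. of_nat (card (?L d k)) * ?u k))"
        using False by simp
      finally show ?thesis .
    qed
  qed
  also have "\<dots> = emeasure ?P ?B + (ennreal (?q ^ K) * ((\<integral>\<^sup>+d. of_nat (card (?L d K)) \<partial>?P) * ?u K)
      + ennreal (1 / (\<delta> * real n)) * (\<Sum>k<K. (\<integral>\<^sup>+d. of_nat (card (?L d k)) \<partial>?P) * ?u k))"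
    by (simp add: nn_integral_add nn_integral_cmult nn_integral_multc nn_integral_sum)
  also have "\<dots> \<le> emeasure ?P ?B + (ennreal (?q ^ K) * ennreal (path_weight \<beta> n K)
      + ennreal (1 / (\<delta> * real n)) * (\<Sum>k<K. ennreal (path_weight \<beta> n k)))"
  proof -
    have "(\<integral>\<^sup>+d. of_nat (card (?L d k)) \<partial>?P) * ?u k \<le> ennreal (path_weight \<beta> n k)" if "k \<le> K" for k
      using that \<beta> by (intro nn_integral_card_paths_weight n) auto
    then show ?thesis by (intro add_mono mult_left_mono sum_mono order_refl) auto
  qed
  also have "\<dots> = ennreal (measure_pmf.prob ?P ?B + ?q ^ K * path_weight \<beta> n K
      + 1 / (\<delta> * real n) * (\<Sum>k<K. path_weight \<beta> n k))"
  proof -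
    have s: "(\<Sum>k<K. ennreal (path_weight \<beta> n k)) = ennreal (\<Sum>k<K. path_weight \<beta> n k)"
      using w0 by (intro sum_ennreal) auto
    have s0: "0 \<le> (\<Sum>k<K. path_weight \<beta> n k)" using w0 by (intro sum_nonneg) auto
    show ?thesis
      unfolding s measure_pmf.emeasure_eq_measure using q0 w0[of K] s0 \<delta> n
      by (simp add: ennreal_mult[symmetric] ennreal_plus[symmetric] add.assoc del: ennreal_plus)
  qed
  finally have le: "ennreal (prob_many_red D l n \<delta>) \<le> ennreal (measure_pmf.prob ?P ?B + ?q ^ K * path_weight \<beta> n K
      + 1 / (\<delta> * real n) * (\<Sum>k<K. path_weight \<beta> n k))" .
  have "0 \<le> measure_pmf.prob ?P ?B + ?q ^ K * path_weight \<beta> n K + 1 / (\<delta> * real n) * (\<Sum>k<K. path_weight \<beta> n k)"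
    by (intro add_nonneg_nonneg mult_nonneg_nonneg sum_nonneg zero_le_power q0 w0 measure_nonneg)
      (use \<delta> in auto)
  with le show ?thesis by (simp only: ennreal_le_iff)
qed

text \<open>As \<open>n\<close> grows with \<open>K\<close> fixed, the degree tail and the short
  paths disappear, and the slow paths leave a multiple of \<open>(q * b / \<beta>) ^ K\<close> with
  \<open>q = 4 * l / (1 + l) ^ 2\<close>. This is geometric because \<open>\<beta>\<close> is chosen
  halfway between \<open>q * b\<close> and \<open>\<mu>\<close>; \<open>\<beta> < \<mu>\<close>
  makes the degree tail exponentially small.\<close>

lemma subcritical_limsup:
  assumes l: "0 < l" "l < 1" and sub: "4 * l * b < (1 + l)\<^sup>2 * \<mu>" and \<delta>: "0 < \<delta>"
  shows "limsup (\<lambda>n. ereal (prob_many_red D l n \<delta>)) = 0"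
proof -
  let ?q = "4 * l / (1 + l)\<^sup>2"
  have q0: "0 \<le> ?q" using l by simp
  have qb: "?q * b < \<mu>" using sub l by (simp add: field_simps)
  define \<beta> where "\<beta> = (?q * b + \<mu>) / 2"
  have \<beta>: "0 < \<beta>" "\<beta> < \<mu>" "?q * b < \<beta>"
  proof -
    have "0 \<le> ?q * b" using q0 pos by (intro mult_nonneg_nonneg) auto
    moreover have "0 < (x + \<mu>) / 2 \<and> (x + \<mu>) / 2 < \<mu> \<and> x < (x + \<mu>) / 2" if "0 \<le> x" "x < \<mu>" for x
      using that pos by auto
    ultimately show "0 < \<beta>" "\<beta> < \<mu>" "?q * b < \<beta>" unfolding \<beta>_def using qb by blast+
  qed
  obtain c where c: "0 < c" "c < 1" and tail: "\<And>(A :: nat set) I. finite A \<Longrightarrow> I \<subseteq> A \<Longrightarrow>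
      measure_pmf.prob (Pi_pmf A 0 (\<lambda>_. D))
        {d. (\<Sum>i\<in>I. real (d i)) \<le> (measure_pmf.expectation D real - (\<mu> - \<beta>)) * real (card I)} \<le> c ^ card I"
    using Pi_pmf_lower_tail[of 0 real D "\<mu> - \<beta>"] square_integrable \<beta> by (metis diff_gt_0_iff_gt minus_zero of_nat_0_le_iff)
  have tail': "measure_pmf.prob (Pi_pmf {1..n} 0 (\<lambda>_. D)) {d. (\<Sum>i\<in>{1..n}. real (d i)) \<le> \<beta> * real n} \<le> c ^ n" for n
    using tail[of "{1..n}" "{1..n}"] by (simp add: mean[symmetric])
  have bound: "limsup (\<lambda>n. ereal (prob_many_red D l n \<delta>)) \<le> ereal (\<mu> * \<mu> / b * (?q * b / \<beta>) ^ K)" if K: "0 < K" for K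
  proof -
    define g where "g n = c ^ n + ?q ^ K * path_weight \<beta> n K + 1 / (\<delta> * real n) * (\<Sum>k<K. path_weight \<beta> n k)" for n
    have inv: "(\<lambda>n. 1 / (\<delta> * real n)) \<longlonglongrightarrow> 0"
    proof -
      have "(\<lambda>n. (1 / \<delta>) / real n) \<longlonglongrightarrow> 0"
        by (rule tendsto_divide_0[OF tendsto_const]) (simp add: filterlim_real_at_infinity_sequentially)
      then show ?thesis by simp
    qed
    have pw: "\<exists>L. (\<lambda>n. path_weight \<beta> n k) \<longlonglongrightarrow> L" for k
      using path_weight_tendsto[OF \<beta>(1), of k] by (cases "k = 0") (auto simp: path_weight_def)
    then obtain L where L: "\<And>k. (\<lambda>n. path_weight \<beta> n k) \<longlonglongrightarrow> L k" by metis
    have "g \<longlonglongrightarrow> 0 + ?q ^ K * (\<mu> * b ^ (K - 1) * \<mu> / \<beta> ^ K) + 0 * (\<Sum>k<K. L k)"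
      unfolding g_def using c by (intro tendsto_intros LIMSEQ_realpow_zero path_weight_tendsto \<beta> K inv L) auto
    moreover have "0 + ?q ^ K * (\<mu> * b ^ (K - 1) * \<mu> / \<beta> ^ K) + 0 * (\<Sum>k<K. L k) = \<mu> * \<mu> / b * (?q * b / \<beta>) ^ K"
      using K pos by (cases K) (simp_all add: power_mult_distrib power_divide mult_ac)
    ultimately have lim: "(\<lambda>n. ereal (g n)) \<longlonglongrightarrow> ereal (\<mu> * \<mu> / b * (?q * b / \<beta>) ^ K)" by simp
    have "eventually (\<lambda>n. 2 * real K / \<beta> < real n) sequentially"
      by (metis eventually_gt_at_top filterlim_at_top_dense filterlim_real_sequentially)
    then have "eventually (\<lambda>n. ereal (prob_many_red D l n \<delta>) \<le> ereal (g n)) sequentially"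
      using eventually_ge_at_top[of 2]
    proof eventually_elim
      case (elim n)
      then have "2 * real K < \<beta> * real n" using \<beta> by (simp add: field_simps)
      from prob_many_red_le[OF l K \<delta> elim(2) \<beta>(1) this] tail'[of n] show ?case by (simp add: g_def)
    qed
    then have "limsup (\<lambda>n. ereal (prob_many_red D l n \<delta>)) \<le> limsup (\<lambda>n. ereal (g n))"
      by (rule Limsup_mono)
    also have "\<dots> = ereal (\<mu> * \<mu> / b * (?q * b / \<beta>) ^ K)"
      using lim by (intro lim_imp_Limsup) auto
    finally show ?thesis .
  qed
  have r: "0 \<le> ?q * b / \<beta>"
    using pos by (intro divide_nonneg_pos mult_nonneg_nonneg[OF q0] \<beta>(1)) simp
  have r1: "?q * b / \<beta> < 1" using \<beta>(1,3) by (simp only: divide_less_eq_1_pos)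
  have "(\<lambda>K. ereal (\<mu> * \<mu> / b * (?q * b / \<beta>) ^ K)) \<longlonglongrightarrow> ereal (\<mu> * \<mu> / b * 0)"
    by (intro tendsto_ereal tendsto_mult tendsto_const LIMSEQ_realpow_zero r r1)
  then have "limsup (\<lambda>n. ereal (prob_many_red D l n \<delta>)) \<le> ereal (\<mu> * \<mu> / b * 0)"
    by (rule LIMSEQ_le_const) (use bound in \<open>auto intro!: exI[of _ 1]\<close>)
  moreover have "0 \<le> limsup (\<lambda>n. ereal (prob_many_red D l n \<delta>))"
    by (rule le_Limsup) (auto simp: prob_many_red_def)
  ultimately show ?thesis by (simp add: zero_ereal_def[symmetric])
qed

end

section \<open>Exploration in the order of infection\<close>

definition pending :: "edge set \<Rightarrow> clocks \<Rightarrow> vertex set \<Rightarrow> vertex set" where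
  "pending E X V = {v. infected E X v \<and> v \<notin> V}"

text \<open>Infection times may coincide for exceptional clocks; the least label breaks the tie, so
  the exploration is determined for every realisation.\<close>

definition next_vertex :: "edge set \<Rightarrow> clocks \<Rightarrow> vertex set \<Rightarrow> vertex" where
  "next_vertex E X V =
     (LEAST v. v \<in> pending E X V \<and> (\<forall>w\<in>pending E X V. inf_time E X v \<le> inf_time E X w))"

fun explore :: "edge set \<Rightarrow> clocks \<Rightarrow> nat \<Rightarrow> vertex set" where
  "explore E X 0 = {0}"
| "explore E X (Suc t) = (let V = explore E X t in
     if pending E X V = {} then V else insert (next_vertex E X V) V)"

declare explore.simps(2) [simp del]

lemma explore_Suc:
  "explore E X (Suc t) = (if pending E X (explore E X t) = {} then explore E X t
     else insert (next_vertex E X (explore E X t)) (explore E X t))"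
  by (simp add: explore.simps(2) Let_def)

text \<open>The vertex \<open>v\<close>, explored after \<open>V\<close>, is bad if within time \<open>\<epsilon>\<close> after its infection blue could cross
  an edge from \<open>V \<union> L\<close> to it, or it could fail to infect some other neighbour.
  Only clocks that were irrelevant before the infection of \<open>v\<close> are involved.\<close>

definition bad :: "edge set \<Rightarrow> clocks \<Rightarrow> vertex set \<Rightarrow> real \<Rightarrow> vertex set \<Rightarrow> vertex \<Rightarrow> bool" where
  "bad E X L \<epsilon> V v \<longleftrightarrow>
     (\<exists>e\<in>E. \<exists>z\<in>L \<union> V. z \<noteq> v \<and> ends e = {z, v} \<and>
        arrivals X e Chase \<inter> {inf_time E X v<..inf_time E X v + \<epsilon>} \<noteq> {}) \<or>
     (\<exists>e\<in>E. \<exists>w. w \<notin> L \<union> V \<union> {v} \<and> ends e = {v, w} \<and>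
        arrivals X e Spread \<inter> {inf_time E X v<..inf_time E X v + \<epsilon>} = {})"

lemma bad_iff:
  "bad E X L \<epsilon> V v \<longleftrightarrow>
     (\<exists>e z. e \<in> E \<and> z \<in> L \<union> V \<and> z \<noteq> v \<and> ends e = {z, v} \<and>
        arrivals X e Chase \<inter> {inf_time E X v<..inf_time E X v + \<epsilon>} \<noteq> {}) \<or>
     (\<exists>e w. e \<in> E \<and> w \<notin> L \<union> V \<union> {v} \<and> ends e = {v, w} \<and>
        arrivals X e Spread \<inter> {inf_time E X v<..inf_time E X v + \<epsilon>} = {})"
  unfolding bad_def by (intro arg_cong2[where f = "(\<or>)"]) blast+

text \<open>\<open>C\<close> will be \<open>counted\<close>: only vertices whose exploration earns
  the bonus \<open>\<zeta>\<close> may be charged for being bad.\<close>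

definition bad_step :: "edge set \<Rightarrow> clocks \<Rightarrow> vertex set \<Rightarrow> real \<Rightarrow> vertex set \<Rightarrow> nat \<Rightarrow> bool" where
  "bad_step E X L \<epsilon> C t \<longleftrightarrow> (let V = explore E X t; v = next_vertex E X V in
     pending E X V \<noteq> {} \<and> v \<in> C \<and> bad E X L \<epsilon> V v)"

definition num_bad :: "edge set \<Rightarrow> clocks \<Rightarrow> vertex set \<Rightarrow> real \<Rightarrow> vertex set \<Rightarrow> nat \<Rightarrow> nat" where
  "num_bad E X L \<epsilon> C t = card {s. s < t \<and> bad_step E X L \<epsilon> C s}"

lemma num_bad_0 [simp]: "num_bad E X L \<epsilon> C 0 = 0"
  by (simp add: num_bad_def)

lemma num_bad_Suc: "num_bad E X L \<epsilon> C (Suc t) = num_bad E X L \<epsilon> C t + (if bad_step E X L \<epsilon> C t then 1 else 0)"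
proof -
  have "{s. s < Suc t \<and> bad_step E X L \<epsilon> C s} =
      (if bad_step E X L \<epsilon> C t then insert t {s. s < t \<and> bad_step E X L \<epsilon> C s} else {s. s < t \<and> bad_step E X L \<epsilon> C s})"
    by (auto simp: less_Suc_eq)
  then show ?thesis by (simp add: num_bad_def)
qed

locale exploration = chase_dynamics +
  assumes finite_ends: "finite (\<Union> (ends ` E))"
begin

abbreviation "pend \<equiv> pending E X"
abbreviation "nv \<equiv> next_vertex E X"
abbreviation "V \<equiv> explore E X"

lemma infected_subset: "{v. infected E X v} \<subseteq> {0, 1} \<union> \<Union> (ends ` E)"
proof
  fix v assume "v \<in> {v. infected E X v}"
  then have v: "infected E X v" by simp
  show "v \<in> {0, 1} \<union> \<Union> (ends ` E)"
  proof (cases "v = 0 \<or> v = 1")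
    case False
    then show ?thesis using infection_source[OF v] by (metis UN_I UnI2 insertI1 insert_commute)
  qed auto
qed

lemma finite_infected: "finite {v. infected E X v}"
  by (rule finite_subset[OF infected_subset]) (use finite_ends in simp)

lemma finite_pending: "finite (pend W)"
  by (rule finite_subset[OF _ finite_infected]) (auto simp: pending_def)

lemma next_vertex:
  assumes "pend W \<noteq> {}"
  shows "nv W \<in> pend W" "\<And>w. w \<in> pend W \<Longrightarrow> T (nv W) \<le> T w"
proof -
  have "Min (T ` pend W) \<in> T ` pend W" using assms finite_pending by (intro Min_in) auto
  then obtain v where v: "v \<in> pend W" "T v = Min (T ` pend W)" by auto
  then have "\<forall>w\<in>pend W. T v \<le> T w" using finite_pending by (auto intro: Min_le)
  with v(1) have "v \<in> pend W \<and> (\<forall>w\<in>pend W. T v \<le> T w)" by blast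
  then have "nv W \<in> pend W \<and> (\<forall>w\<in>pend W. T (nv W) \<le> T w)"
    unfolding next_vertex_def by (rule LeastI)
  then show "nv W \<in> pend W" "\<And>w. w \<in> pend W \<Longrightarrow> T (nv W) \<le> T w" by auto
qed

lemma explore_Suc_pending: "pend (V t) \<noteq> {} \<Longrightarrow> V (Suc t) = insert (nv (V t)) (V t)"
  and explore_Suc_stuck: "pend (V t) = {} \<Longrightarrow> V (Suc t) = V t"
  by (simp_all add: explore_Suc)

lemma explore_mono: "s \<le> t \<Longrightarrow> V s \<subseteq> V t"
  by (rule lift_Suc_mono_le[of V]) (auto simp: explore_Suc)

lemma root_explored: "0 \<in> V t"
  using explore_mono[of 0 t] by simp

lemma explore_infected: "v \<in> V t \<Longrightarrow> infected E X v"
proof (induction t)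
  case (Suc t)
  then show ?case using next_vertex(1)[of "V t"] by (auto simp: explore_Suc pending_def split: if_splits)
qed (simp add: infected_root)

lemma finite_explore: "finite (V t)"
  by (induction t) (auto simp: explore_Suc)

lemma explore_prefix:
  assumes "u \<in> V t" "w \<in> pend (V t)"
  shows "T u \<le> T w"
  using assms
proof (induction t)
  case 0
  then have "u = 0" by simp
  then show ?case using infected_root(2) inf_time_nonneg[of w] 0 by (auto simp: pending_def)
next
  case (Suc t)
  have w: "w \<in> pend (V t)" using Suc.prems(2) by (auto simp: explore_Suc pending_def split: if_splits)
  show ?case
  proof (cases "u \<in> V t")
    case False
    then have "u = nv (V t)" "pend (V t) \<noteq> {}" using Suc.prems(1) by (auto simp: explore_Suc split: if_splits)
    then show ?thesis using next_vertex(2) w by simp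
  qed (use Suc.IH w in simp)
qed

lemma explored_at:
  assumes "u \<in> V t" "u \<noteq> 0"
  obtains s where "s < t" "pend (V s) \<noteq> {}" "nv (V s) = u"
  using assms
proof (induction t arbitrary: thesis)
  case (Suc t)
  show ?case
  proof (cases "u \<in> V t")
    case True
    then show ?thesis using Suc.IH[OF _ True Suc.prems(3)] Suc.prems(1) by (metis less_SucI)
  next
    case False
    then show ?thesis using Suc.prems by (auto simp: explore_Suc split: if_splits)
  qed
qed simp

lemma card_explore:
  assumes "pend (V t) \<noteq> {}"
  shows "card (V t) = Suc t"
  using assms
proof (induction t)
  case (Suc t)
  have p: "pend (V t) \<noteq> {}" using Suc.prems explore_Suc_stuck[of t] by auto
  have "nv (V t) \<notin> V t" using next_vertex(1)[OF p] by (auto simp: pending_def)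
  then show ?case using Suc.IH[OF p] finite_explore[of t] by (simp add: explore_Suc_pending[OF p])
qed simp

lemma explore_step_notin: "s < t \<Longrightarrow> pend (V s) \<noteq> {} \<Longrightarrow> nv (V s) \<notin> V s \<and> nv (V s) \<in> V t"
  using next_vertex(1)[of "V s"] explore_mono[of "Suc s" t] explore_Suc_pending[of s]
  by (auto simp: pending_def)

text \<open>If the exploration has stopped, any edge from an explored vertex to an uninfected one is due to
  a bad vertex nearby.\<close>

lemma stuck_bad:
  assumes stuck: "pend (V t) = {}" and u: "u \<in> V t" "u \<noteq> 0"
    and e: "e \<in> E" "ends e = {u, w}" "w \<notin> L \<union> V t"
  shows "\<exists>s<t. pend (V s) \<noteq> {} \<and> bad E X L \<epsilon> (V s) (nv (V s)) \<and>
    (nv (V s) = u \<or> nv (V s) \<notin> L \<and> (\<exists>e'\<in>E. ends e' = {u, nv (V s)}))"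
proof (rule ccontr)
  assume contra: "\<not> ?thesis"
  obtain s where s: "s < t" "pend (V s) \<noteq> {}" "nv (V s) = u" using u by (rule explored_at)
  have nb: "\<not> bad E X L \<epsilon> (V s) u" using contra s by blast
  have "V s \<subseteq> V t" using s(1) by (intro explore_mono) simp
  then have "w \<notin> L \<union> V s \<union> {u}" using e(3) u(1) by auto
  then have "arrivals X e Spread \<inter> {T u<..T u + \<epsilon>} \<noteq> {}" using nb e(1,2) unfolding bad_def by blast
  then obtain r where r: "r \<in> arrivals X e Spread" "T u < r" "r \<le> T u + \<epsilon>" by auto
  have iu: "infected E X u" using u(1) by (rule explore_infected)
  have Tu0: "0 \<le> T u" using iu by (rule inf_time_nonneg)
  have Ru: "config (T u) u = Red" using iu u(2) by (rule inf_time_Red)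
  obtain p where p: "T u \<le> p" "p < r" "rings \<inter> {p<..<r} = {}"
    using ex_predecessor[OF finite_rings Tu0 r(2)] by blast
  have "\<not> infected E X w" using stuck e(3) by (auto simp: pending_def)
  then have "config r w = White" using nonwhite_iff[of r w] Tu0 r(2) by auto
  then have "config p u \<noteq> Red" using spread_step[OF _ p(2,3) _ e(1,2) r(1)] Tu0 p(1) by auto
  moreover have "config p u \<noteq> White" using nonwhite_iff[of p u] iu p(1) Tu0 by auto
  ultimately have "config p u = Blue" by (cases "config p u") auto
  \<comment> \<open>The edge \<open>e\<close> rings in time and yet \<open>w\<close> stays white, so
    \<open>u\<close> must have been caught before. The blame moves to the vertex \<open>z\<close>
    that caught it.\<close>
  from blue_source[OF Tu0 p(1) Ru this] obtain r' e' z p' where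
    r': "T u < r'" "r' \<le> p" "e' \<in> E" "ends e' = {z, u}" "r' \<in> arrivals X e' Chase"
    and p': "T u \<le> p'" "p' < r'" "config p' z = Blue" "config p' u = Red" by blast
  have zu: "z \<noteq> u" using p' by auto
  have iz: "infected E X z" "T z \<le> p'" using nonwhite_iff[of p' z] p' Tu0 by auto
  have r'u: "r' \<in> {T u<..T u + \<epsilon>}" using r' r p by auto
  \<comment> \<open>If \<open>z\<close> belonged to \<open>L\<close> or had been explored before
    \<open>u\<close>, this ring would make \<open>u\<close> itself bad.\<close>
  have zV: "z \<notin> L \<union> V s" using nb r'(3-5) r'u zu unfolding bad_def by blast
  have "z \<in> V t" using stuck iz(1) by (auto simp: pending_def)
  moreover have "z \<noteq> 0" using zV root_explored[of s] by (metis UnI2)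
  ultimately obtain s' where s': "s' < t" "pend (V s') \<noteq> {}" "nv (V s') = z" by (rule explored_at)
  have "s < s'"
  proof (rule ccontr)
    assume "\<not> s < s'"
    then consider "s' = s" | "s' < s" by linarith
    then show False using explore_step_notin[of s' s] s s' zV zu by cases auto
  qed
  then have uV: "u \<in> V s'" using explore_step_notin[of s s'] s by auto
  have "z \<in> pend (V s')" using next_vertex(1)[OF s'(2)] s'(3) by simp
  then have "T u \<le> T z" using explore_prefix[OF uV] by blast
  \<comment> \<open>\<open>z\<close> is infected not before \<open>u\<close> but before
    \<open>r'\<close>, so the ring also falls into the time window of \<open>z\<close>. A
    \<open>Chase\<close> clock serves both directions of its edge; hence it makes \<open>z\<close>
    bad through the explored vertex \<open>u\<close>.\<close>
  then have "r' \<in> {T z<..T z + \<epsilon>}" using r'u iz(2) p'(2) by auto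
  moreover have "ends e' = {u, z}" using r'(4) by auto
  ultimately have "bad E X L \<epsilon> (V s') z"
    using r'(3,5) uV zu unfolding bad_def by (intro disjI1 bexI[of _ e'] bexI[of _ u]) auto
  then show False using contra s' zV \<open>ends e' = {u, z}\<close> r'(3) by blast
qed

end

text \<open>Up to the next infection the exploration reads only the edges and clocks at the explored
  set \<open>V\<close>, and \<open>bad\<close> in addition the \<open>Chase\<close> clocks towards
  \<open>L\<close>. Two applications: two matchings with the same revealed pairs and common clocks,
  and one graph with two clock families that differ in one fresh clock.\<close>

lemma exploration_agree:
  fixes t :: nat
  assumes A: "exploration E X" and B: "exploration E' X'"
  defines "V \<equiv> explore E X t"
  assumes edges: "\<And>e. ends e \<inter> V \<noteq> {} \<Longrightarrow> e \<in> E \<longleftrightarrow> e \<in> E'"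
    and spread: "\<And>e. e \<in> E \<Longrightarrow> ends e \<inter> V \<noteq> {} \<Longrightarrow> arrivals X e Spread = arrivals X' e Spread"
    and chase: "\<And>e. e \<in> E \<Longrightarrow> ends e \<subseteq> V \<or> ends e \<inter> (V - L) \<noteq> {} \<and> ends e \<inter> L \<noteq> {} \<Longrightarrow>
      arrivals X e Chase = arrivals X' e Chase"
    and C: "\<And>v. v \<in> V \<Longrightarrow> v \<in> C \<longleftrightarrow> v \<in> C'" "C \<inter> L = {}"
  shows explore_agree: "explore E' X' t = explore E X t"
    and pending_agree: "pending E' X' V = {} \<longleftrightarrow> pending E X V = {}"
    and next_vertex_agree: "pending E X V \<noteq> {} \<Longrightarrow> next_vertex E' X' V = next_vertex E X V"
    and inf_time_agree: "pending E X V \<noteq> {} \<Longrightarrow>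
      inf_time E' X' (next_vertex E X V) = inf_time E X (next_vertex E X V)"
    and num_bad_agree: "num_bad E' X' L \<epsilon> C' t = num_bad E X L \<epsilon> C t"
proof -
  interpret A: exploration E X by (rule A)
  interpret B: exploration E' X' by (rule B)
  have dyn: "chase_dynamics E X" "chase_dynamics E' X'" by unfold_locales
  have chaseV: "arrivals X e Chase = arrivals X' e Chase" if "e \<in> E" "ends e \<subseteq> V" for e
    using chase that by blast
  have agree: "A.config r = B.config r"
    if in_V: "\<And>r v. 0 \<le> r \<Longrightarrow> r < \<tau> \<Longrightarrow> A.config r v \<noteq> White \<Longrightarrow> v \<in> V" and r: "0 \<le> r" "r \<le> \<tau>" for r \<tau>
    by (rule chase_escape_agree[OF dyn edges spread chaseV in_V r])
  have all: "A.config r = B.config r" if "A.pend V = {}" "0 \<le> r" for r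
  proof (rule agree[of r])
    fix r' v assume "0 \<le> r'" "A.config r' v \<noteq> White"
    then show "v \<in> V" using that(1) A.nonwhite_iff[of r' v] by (auto simp: pending_def)
  qed (use that in auto)
  \<comment> \<open>\<open>\<tau>\<close> is the next infection time or, if nothing is pending, the
    last infection time within \<open>V\<close>.\<close>
  obtain \<tau> where \<tau>: "0 \<le> \<tau>" "\<And>r. 0 \<le> r \<Longrightarrow> r \<le> \<tau> \<Longrightarrow> A.config r = B.config r"
    "\<And>u. u \<in> V \<Longrightarrow> A.T u \<le> \<tau>" "A.pend V \<noteq> {} \<Longrightarrow> A.T (A.nv V) \<le> \<tau>"
  proof (cases "A.pend V = {}")
    case True
    let ?m = "Max (A.T ` V)"
    have fin: "finite V" unfolding V_def by (rule A.finite_explore)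
    have le: "A.T u \<le> ?m" if "u \<in> V" for u using fin that by (intro Max_ge) auto
    have "0 \<in> V" unfolding V_def by (rule A.root_explored)
    then have "0 \<le> ?m" using le[of 0] A.infected_root(2) by simp
    then show ?thesis using that[of ?m] all[OF True] le True by blast
  next
    case False
    let ?m = "A.T (A.nv V)"
    have nx: "A.nv V \<in> A.pend V" using False by (rule A.next_vertex)
    have "A.config r = B.config r" if "0 \<le> r" "r \<le> ?m" for r
    proof (rule agree[OF _ that])
      fix r' v assume r': "0 \<le> r'" "r' < ?m" "A.config r' v \<noteq> White"
      then have "infected E X v" "A.T v \<le> r'" using A.nonwhite_iff[of r' v] by auto
      then show "v \<in> V" using A.next_vertex(2)[OF False, of v] r'(2) by (force simp: pending_def)
    qed
    moreover have "A.T u \<le> ?m" if "u \<in> V" for u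
      using A.explore_prefix[of u t "A.nv V"] that nx by (simp add: V_def)
    moreover have "0 \<le> ?m" using nx A.inf_time_nonneg by (auto simp: pending_def)
    ultimately show ?thesis using that[of ?m] by blast
  qed
  have inf_iff: "infected E X v \<and> A.T v \<le> r \<longleftrightarrow> infected E' X' v \<and> B.T v \<le> r" if "0 \<le> r" "r \<le> \<tau>" for v r
    using A.nonwhite_iff[OF that(1), of v] B.nonwhite_iff[OF that(1), of v] \<tau>(2)[OF that] by simp
  have T_eq: "B.T v = A.T v" if "infected E X v" "A.T v \<le> \<tau>" for v
  proof (rule antisym)
    show "B.T v \<le> A.T v"
      using inf_iff[of "A.T v" v] that A.inf_time_nonneg[OF that(1)] by auto
    have iB: "infected E' X' v" "B.T v \<le> \<tau>" using inf_iff[of \<tau> v] that \<tau>(1) by auto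
    then show "A.T v \<le> B.T v" using inf_iff[of "B.T v" v] B.inf_time_nonneg[of v] by auto
  qed
  \<comment> \<open>Infection times up to \<open>\<tau>\<close> are common to both processes, and a
    vertex infected after \<open>\<tau>\<close> in one of them is not infected by time
    \<open>\<tau>\<close> in the other, so the minimisers coincide.\<close>
  have next_eq: "B.pend W \<noteq> {} \<and> B.nv W = A.nv W" if W: "A.pend W \<noteq> {}" "A.T (A.nv W) \<le> \<tau>" for W
  proof
    let ?m = "A.T (A.nv W)"
    note nx = A.next_vertex[OF W(1)]
    have nB: "A.nv W \<in> B.pend W" "B.T (A.nv W) = ?m"
      using nx(1) inf_iff[OF \<tau>(1) order_refl, of "A.nv W"] T_eq[of "A.nv W"] W(2) by (auto simp: pending_def)
    then show "B.pend W \<noteq> {}" by auto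
    have "(v \<in> B.pend W \<and> (\<forall>w\<in>B.pend W. B.T v \<le> B.T w)) \<longleftrightarrow> (v \<in> A.pend W \<and> (\<forall>w\<in>A.pend W. A.T v \<le> A.T w))"
      (is "?PB v \<longleftrightarrow> ?PA v") for v
    proof
      assume b: "?PB v"
      then have "B.T v \<le> \<tau>" using nB W(2) by fastforce
      with b have v: "v \<in> A.pend W" "A.T v \<le> \<tau>" using inf_iff[OF \<tau>(1) order_refl, of v] by (auto simp: pending_def)
      have "A.T v = B.T v" using T_eq[of v] v by (auto simp: pending_def)
      then have "A.T v \<le> ?m" using b nB by fastforce
      then show "?PA v" using v nx(2) by (auto intro: order_trans)
    next
      assume a: "?PA v"
      then have vm: "A.T v \<le> ?m" using nx(1) by auto
      then have v: "v \<in> B.pend W" "B.T v = A.T v"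
        using a W(2) inf_iff[OF \<tau>(1) order_refl, of v] T_eq[of v] by (auto simp: pending_def)
      have "B.T v \<le> B.T w" if w: "w \<in> B.pend W" for w
      proof (cases "B.T w \<le> \<tau>")
        case True
        then have "w \<in> A.pend W" "A.T w \<le> \<tau>" using w inf_iff[OF \<tau>(1) order_refl, of w] by (auto simp: pending_def)
        then show ?thesis using a v(2) T_eq[of w] by (auto simp: pending_def)
      next
        case False
        then show ?thesis using vm v(2) W(2) by linarith
      qed
      then show "?PB v" using v by blast
    qed
    then show "B.nv W = A.nv W" by (simp only: next_vertex_def)
  qed
  have stuck: "B.pend V = {}" if "A.pend V = {}"
  proof (rule ccontr)
    assume "B.pend V \<noteq> {}"
    then obtain v where v: "infected E' X' v" "v \<notin> V" by (auto simp: pending_def)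
    have "0 \<le> B.T v" using v(1) by (rule B.inf_time_nonneg)
    then have "A.config (B.T v) v \<noteq> White" using all[OF that] B.inf_time_nonwhite[OF v(1)] by simp
    then have "infected E X v" using A.nonwhite_iff \<open>0 \<le> B.T v\<close> by blast
    then show False using that v(2) by (auto simp: pending_def)
  qed
  show pend_iff: "pending E' X' V = {} \<longleftrightarrow> pending E X V = {}"
    using stuck next_eq[of V] \<tau>(4) by blast
  show "next_vertex E' X' V = next_vertex E X V" if "pending E X V \<noteq> {}"
    using next_eq[of V] \<tau>(4) that by blast
  show "inf_time E' X' (next_vertex E X V) = inf_time E X (next_vertex E X V)" if "pending E X V \<noteq> {}"
    using T_eq[of "A.nv V"] \<tau>(4)[OF that] A.next_vertex(1)[OF that] by (auto simp: pending_def)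
  have before: "B.pend (A.V s) = {} \<longleftrightarrow> A.pend (A.V s) = {}"
    "A.pend (A.V s) \<noteq> {} \<Longrightarrow> B.nv (A.V s) = A.nv (A.V s)"
    "A.pend (A.V s) \<noteq> {} \<Longrightarrow> A.nv (A.V s) \<in> V" if "s < t" for s
  proof -
    show nV: "A.nv (A.V s) \<in> V" if "A.pend (A.V s) \<noteq> {}"
      using A.explore_step_notin[OF \<open>s < t\<close> that] by (simp add: V_def)
    show "B.nv (A.V s) = A.nv (A.V s)" if "A.pend (A.V s) \<noteq> {}"
      using next_eq[OF that] \<tau>(3)[OF nV[OF that]] by blast
    have "B.pend (A.V s) = {}" if st: "A.pend (A.V s) = {}"
    proof -
      have "A.V s' = A.V s" if "s \<le> s'" for s'
        using that by (induction s' rule: dec_induct) (auto simp: explore_Suc st)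
      from this[of t] have "V = A.V s" unfolding V_def using \<open>s < t\<close> by simp
      then show ?thesis using stuck st by simp
    qed
    then show "B.pend (A.V s) = {} \<longleftrightarrow> A.pend (A.V s) = {}"
      using next_eq[of "A.V s"] \<tau>(3)[OF nV] by blast
  qed
  have ex: "B.V s = A.V s" if "s \<le> t" for s
    using that
  proof (induction s)
    case (Suc s)
    then have s: "s < t" "B.V s = A.V s" by auto
    then show ?case using before[OF s(1)] by (simp add: explore_Suc)
  qed simp
  then show "explore E' X' t = explore E X t" by simp
  have "bad_step E' X' L \<epsilon> C' s \<longleftrightarrow> bad_step E X L \<epsilon> C s" if s: "s < t" for s
  proof (cases "A.pend (A.V s) = {}")
    case True
    then show ?thesis using before(1)[OF s] ex[of s] s by (simp add: bad_step_def)
  next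
    case False
    let ?v = "A.nv (A.V s)"
    have v: "?v \<in> V" using before(3)[OF s False] .
    have Tv: "B.T ?v = A.T ?v"
      using T_eq[of ?v] \<tau>(3)[OF v] A.explore_infected[of ?v t] v by (simp add: V_def)
    have VsV: "A.V s \<subseteq> V" unfolding V_def using s by (intro A.explore_mono) simp
    have "bad E' X' L \<epsilon> (A.V s) ?v \<longleftrightarrow> bad E X L \<epsilon> (A.V s) ?v" if vL: "?v \<notin> L"
    proof -
      have c: "e \<in> E \<and> z \<in> L \<union> A.V s \<and> z \<noteq> ?v \<and> ends e = {z, ?v} \<and>
          arrivals X e Chase \<inter> {A.T ?v<..A.T ?v + \<epsilon>} \<noteq> {} \<longleftrightarrow>
        e \<in> E' \<and> z \<in> L \<union> A.V s \<and> z \<noteq> ?v \<and> ends e = {z, ?v} \<and>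
          arrivals X' e Chase \<inter> {A.T ?v<..A.T ?v + \<epsilon>} \<noteq> {}" for e z
      proof (cases "z \<in> L \<union> A.V s \<and> ends e = {z, ?v}")
        case True
        then have "ends e \<inter> V \<noteq> {}" "ends e \<subseteq> V \<or> ends e \<inter> (V - L) \<noteq> {} \<and> ends e \<inter> L \<noteq> {}"
          using v vL VsV by auto
        then show ?thesis using edges[of e] chase[of e] by auto
      qed auto
      have d: "e \<in> E \<and> w \<notin> L \<union> A.V s \<union> {?v} \<and> ends e = {?v, w} \<and>
          arrivals X e Spread \<inter> {A.T ?v<..A.T ?v + \<epsilon>} = {} \<longleftrightarrow>
        e \<in> E' \<and> w \<notin> L \<union> A.V s \<union> {?v} \<and> ends e = {?v, w} \<and>
          arrivals X' e Spread \<inter> {A.T ?v<..A.T ?v + \<epsilon>} = {}" for e w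
      proof (cases "ends e = {?v, w}")
        case True
        then have "ends e \<inter> V \<noteq> {}" using v by auto
        then show ?thesis using edges[of e] spread[of e] by auto
      qed auto
      show ?thesis by (simp only: bad_iff Tv c d)
    qed
    then show ?thesis
      using before[OF s] False ex[of s] s C v unfolding bad_step_def Let_def by auto
  qed
  then show "num_bad E' X' L \<epsilon> C' t = num_bad E X L \<epsilon> C t"
    unfolding num_bad_def by (intro arg_cong[where f = card]) auto
qed

section \<open>The drift of the exploration\<close>

definition deg :: "half_edge set \<Rightarrow> vertex \<Rightarrow> nat" where
  "deg H w = card {h \<in> H. fst h = w}"

definition weight :: "real \<Rightarrow> half_edge set \<Rightarrow> vertex set \<Rightarrow> real" where
  "weight \<zeta> H F = real (card {h \<in> H. fst h \<in> F}) - \<zeta> * real (card F)"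

text \<open>The sum, over all half-edges of \<open>H\<close>, of the change of \<open>weight\<close>
  when a half-edge at \<open>F\<close> is paired with that one. A partner inside \<open>F\<close>
  removes two half-edges at \<open>F\<close>; a new vertex \<open>w\<close> costs one and
  \<open>\<zeta>\<close>, and brings \<open>deg H w - 1\<close>. Grouped by vertices, a new vertex
  occurs \<open>deg H w\<close> times; this size bias is where \<open>D * (D - 2)\<close> comes
  from.\<close>

definition drift :: "real \<Rightarrow> vertex set \<Rightarrow> half_edge set \<Rightarrow> vertex set \<Rightarrow> real" where
  "drift \<zeta> A H F = (\<Sum>w\<in>A. if w \<in> F then - 2 * real (deg H w)
     else real (deg H w) * (real (deg H w) - 2 - \<zeta>))"

lemma sum_deg:
  fixes g :: "vertex \<Rightarrow> real"
  assumes "finite H" "finite A" "fst ` H \<subseteq> A"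
  shows "(\<Sum>h\<in>H. g (fst h)) = (\<Sum>w\<in>A. real (deg H w) * g w)"
proof -
  have "(\<Sum>h\<in>H. g (fst h)) = (\<Sum>w\<in>A. \<Sum>h\<in>{h \<in> H. fst h = w}. g (fst h))"
    using assms by (intro sum.group[symmetric]) auto
  also have "\<dots> = (\<Sum>w\<in>A. real (deg H w) * g w)" by (intro sum.cong refl) (simp add: deg_def)
  finally show ?thesis .
qed

text \<open>Only the vertex of \<open>h'\<close> can change from undiscovered to discovered, and its
  term falls from at most \<open>K ^ 2\<close> to at least \<open>- 2 * K\<close>. Removing
  half-edges at vertices of \<open>F\<close> can only raise the sum.\<close>

lemma drift_remove:
  assumes H: "finite H" "finite A" and F: "fst h \<in> F"
    and K: "\<And>w. deg H w \<le> K" and \<zeta>: "0 \<le> \<zeta>"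
  shows "drift \<zeta> A H F - (real K ^ 2 + 2 * real K)
    \<le> drift \<zeta> A (H - {h, h'}) (insert (fst h') F)"
proof -
  define c where "c = real K ^ 2 + 2 * real K"
  have c0: "0 \<le> c" by (simp add: c_def)
  let ?H' = "H - {h, h'}"
  have le: "deg ?H' w \<le> deg H w" for w
    unfolding deg_def using H by (intro card_mono) auto
  have eq: "deg ?H' w = deg H w" if "w \<noteq> fst h" "w \<noteq> fst h'" for w
  proof -
    have "{x \<in> ?H'. fst x = w} = {x \<in> H. fst x = w}" using that by auto
    then show ?thesis by (simp add: deg_def)
  qed
  have "drift \<zeta> A H F - (c) \<le> drift \<zeta> A H F - (\<Sum>w\<in>A. if w = fst h' then c else 0)"
  proof -
    show ?thesis using H c0 by (simp add: sum.delta)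
  qed
  also have "\<dots> = (\<Sum>w\<in>A. (if w \<in> F then - 2 * real (deg H w) else real (deg H w) * (real (deg H w) - 2 - \<zeta>))
      - (if w = fst h' then c else 0))"
    by (simp add: drift_def sum_subtractf)
  also have "\<dots> \<le> drift \<zeta> A ?H' (insert (fst h') F)"
    unfolding drift_def
  proof (rule sum_mono)
    fix w
    show "(if w \<in> F then - 2 * real (deg H w) else real (deg H w) * (real (deg H w) - 2 - \<zeta>))
        - (if w = fst h' then c else 0)
      \<le> (if w \<in> insert (fst h') F then - 2 * real (deg ?H' w) else real (deg ?H' w) * (real (deg ?H' w) - 2 - \<zeta>))"
    proof (cases "w \<in> F")
      case True
      then show ?thesis using le[of w] c0 by auto
    next
      case notF: False
      show ?thesis
      proof (cases "w = fst h'")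
        case True
        have "real (deg H w) * (real (deg H w) - 2 - \<zeta>) \<le> real (deg H w) * real (deg H w)"
          using \<zeta> by (intro mult_left_mono) auto
        also have "\<dots> \<le> real K ^ 2" using K[of w] by (simp add: power2_eq_square mult_mono)
        finally show ?thesis using True notF le[of w] K[of w] by (auto simp: c_def)
      next
        case False
        moreover have "w \<noteq> fst h" using notF F by auto
        ultimately show ?thesis using notF eq[of w] by simp
      qed
    qed
  qed
  finally show ?thesis unfolding c_def .
qed

text \<open>The average of the change of \<open>weight\<close> is controlled by \<open>drift\<close>; a second-order expansion of the
  exponential does the unrevealed.\<close>

lemma drift_step:
  assumes H: "finite H" "finite A" "fst ` H \<subseteq> A" and F: "finite F" "fst h \<in> F" and h: "h \<in> H"
    and K: "\<And>w. deg H w \<le> K" and \<zeta>: "0 \<le> \<zeta>" "\<zeta> \<le> 1"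
    and \<theta>: "0 < \<theta>" "\<theta> * (real K + 3) \<le> 1"
    and dr: "\<theta> * (real K + 3) ^ 2 * real (card H) \<le> drift \<zeta> A H F"
  shows "(\<Sum>h'\<in>H - {h}. exp (- \<theta> * weight \<zeta> (H - {h, h'}) (insert (fst h') F)))
    \<le> (real (card H) - 1) * exp (- \<theta> * weight \<zeta> H F)"
proof -
  define \<Delta> where "\<Delta> w = (if w \<in> F then - 2 else real (deg H w) - 2 - \<zeta>)" for w
  have change: "weight \<zeta> (H - {h, h'}) (insert (fst h') F) = weight \<zeta> H F + \<Delta> (fst h')" if h': "h' \<in> H - {h}" for h'
  proof (cases "fst h' \<in> F")
    case True
    then have "{x \<in> H - {h, h'}. fst x \<in> insert (fst h') F} = {x \<in> H. fst x \<in> F} - {h, h'}" by auto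
    moreover have "card ({x \<in> H. fst x \<in> F} - {h, h'}) = card {x \<in> H. fst x \<in> F} - 2"
      using h h' True F H by (subst card_Diff_subset) auto
    moreover have "2 \<le> card {x \<in> H. fst x \<in> F}"
    proof -
      have "card {h, h'} \<le> card {x \<in> H. fst x \<in> F}" using H h h' True F by (intro card_mono) auto
      then show ?thesis using h' by auto
    qed
    ultimately show ?thesis using True by (simp add: weight_def \<Delta>_def insert_absorb of_nat_diff)
  next
    case False
    then have eq: "{x \<in> H - {h, h'}. fst x \<in> insert (fst h') F}
        = ({x \<in> H. fst x \<in> F} - {h}) \<union> ({x \<in> H. fst x = fst h'} - {h'})" using F by auto
    have c1: "card ({x \<in> H. fst x \<in> F} - {h}) = card {x \<in> H. fst x \<in> F} - 1" using h F H by simp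
    have c2: "card ({x \<in> H. fst x = fst h'} - {h'}) = deg H (fst h') - 1"
      unfolding deg_def using h' H by simp
    have "card {h} \<le> card {x \<in> H. fst x \<in> F}" using h F H by (intro card_mono) auto
    then have p1: "1 \<le> card {x \<in> H. fst x \<in> F}" by simp
    have "card {h'} \<le> deg H (fst h')" unfolding deg_def using h' H by (intro card_mono) auto
    then have p2: "1 \<le> deg H (fst h')" by simp
    have "card {x \<in> H - {h, h'}. fst x \<in> insert (fst h') F}
        = (card {x \<in> H. fst x \<in> F} - 1) + (deg H (fst h') - 1)"
      unfolding eq using False H by (subst card_Un_disjoint) (auto simp: c1 c2)
    then have "real (card {x \<in> H - {h, h'}. fst x \<in> insert (fst h') F})
        = real (card {x \<in> H. fst x \<in> F}) - 1 + (real (deg H (fst h')) - 1)"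
      using p1 p2 by (simp add: of_nat_diff)
    then show ?thesis using False F(1) by (simp add: weight_def \<Delta>_def algebra_simps)
  qed
  have \<Delta>: "\<bar>\<Delta> w\<bar> \<le> real K + 3" for w
    using K[of w] \<zeta> by (auto simp: \<Delta>_def abs_le_iff)
  have quad: "exp (- \<theta> * \<Delta> w) \<le> 1 - \<theta> * \<Delta> w + \<theta>\<^sup>2 * (real K + 3)\<^sup>2" for w
  proof -
    have "\<theta> * \<bar>\<Delta> w\<bar> \<le> \<theta> * (real K + 3)" using \<theta> \<Delta> by (intro mult_left_mono) auto
    moreover have "\<theta> * - \<Delta> w \<le> \<theta> * \<bar>\<Delta> w\<bar>" using \<theta> by (intro mult_left_mono) auto
    ultimately have "- \<theta> * \<Delta> w \<le> 1" using \<theta>(2) by simp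
    then have "exp (- \<theta> * \<Delta> w) \<le> 1 + (- \<theta> * \<Delta> w) + (- \<theta> * \<Delta> w)\<^sup>2" by (rule exp_le_quadratic)
    also have "(- \<theta> * \<Delta> w)\<^sup>2 = \<theta>\<^sup>2 * \<bar>\<Delta> w\<bar>\<^sup>2" by (simp add: power_mult_distrib)
    also have "\<dots> \<le> \<theta>\<^sup>2 * (real K + 3)\<^sup>2" using \<Delta> by (intro mult_left_mono power_mono) auto
    finally show ?thesis by simp
  qed
  have cH: "real (card (H - {h})) = real (card H) - 1"
  proof -
    have "card (H - {h}) = card H - 1" "1 \<le> card H"
      using h H by (auto simp: Suc_le_eq card_gt_0_iff)
    then show ?thesis by (simp add: of_nat_diff)
  qed
  have "(\<Sum>h'\<in>H. \<Delta> (fst h')) = (\<Sum>w\<in>A. real (deg H w) * \<Delta> w)" by (rule sum_deg[OF H])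
  also have "\<dots> = drift \<zeta> A H F" unfolding drift_def by (intro sum.cong) (auto simp: \<Delta>_def)
  \<comment> \<open>\<open>h\<close> is not its own partner; omitting its contribution of -2 works
    in the right direction.\<close>
  finally have "(\<Sum>h'\<in>H - {h}. \<Delta> (fst h')) = drift \<zeta> A H F + 2"
    using h H F by (simp add: sum_diff1 \<Delta>_def)
  then have sum\<Delta>: "drift \<zeta> A H F \<le> (\<Sum>h'\<in>H - {h}. \<Delta> (fst h'))" by simp
  have "(\<Sum>h'\<in>H - {h}. exp (- \<theta> * \<Delta> (fst h'))) \<le> (\<Sum>h'\<in>H - {h}. 1 - \<theta> * \<Delta> (fst h') + \<theta>\<^sup>2 * (real K + 3)\<^sup>2)"
    by (intro sum_mono quad)
  also have "\<dots> = (real (card H) - 1) * (1 + \<theta>\<^sup>2 * (real K + 3)\<^sup>2) - \<theta> * (\<Sum>h'\<in>H - {h}. \<Delta> (fst h'))"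
    by (simp add: sum.distrib sum_subtractf sum_distrib_left[symmetric] cH[symmetric] algebra_simps)
  \<comment> \<open>By \<open>dr\<close> the linear gain absorbs the second-order error of all
    partners together.\<close>
  also have "\<dots> \<le> (real (card H) - 1) * (1 + \<theta>\<^sup>2 * (real K + 3)\<^sup>2) - \<theta> * (\<theta> * (real K + 3)\<^sup>2 * real (card H))"
    using \<theta> sum\<Delta> dr by (intro diff_left_mono mult_left_mono) auto
  also have "\<dots> = real (card H) - 1 - (\<theta> * (real K + 3))\<^sup>2"
    by (simp add: algebra_simps power2_eq_square)
  also have "\<dots> \<le> real (card H) - 1" by simp
  finally have "(\<Sum>h'\<in>H - {h}. exp (- \<theta> * \<Delta> (fst h'))) \<le> real (card H) - 1" .
  then have "exp (- \<theta> * weight \<zeta> H F) * (\<Sum>h'\<in>H - {h}. exp (- \<theta> * \<Delta> (fst h')))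
      \<le> exp (- \<theta> * weight \<zeta> H F) * (real (card H) - 1)"
    by (intro mult_left_mono) auto
  moreover have "(\<Sum>h'\<in>H - {h}. exp (- \<theta> * weight \<zeta> (H - {h, h'}) (insert (fst h') F)))
      = exp (- \<theta> * weight \<zeta> H F) * (\<Sum>h'\<in>H - {h}. exp (- \<theta> * \<Delta> (fst h')))"
    unfolding sum_distrib_left
    by (rule sum.cong[OF refl]) (simp only: change exp_add[symmetric] distrib_left)
  ultimately show ?thesis by (simp only: mult.commute)
qed

text \<open>The partners of \<open>S\<close> are revealed one at a time. Each revelation costs at
  most \<open>K ^ 2 + 2 * K\<close> of the drift, so the reserve proportional to
  \<open>card S\<close> keeps \<open>drift_step\<close> applicable throughout. Two elements of
  \<open>S\<close> may be partners of each other; then \<open>S\<close> shrinks by two.\<close>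

lemma drift_multistep:
  assumes "finite H" "finite A" "fst ` H \<subseteq> A" "finite F" "S \<subseteq> H" "fst ` S \<subseteq> F"
    and K: "\<And>w. deg H w \<le> K" and \<zeta>: "0 \<le> \<zeta>" "\<zeta> \<le> 1" and \<theta>: "0 < \<theta>" "\<theta> * (real K + 3) \<le> 1"
    and B: "card H \<le> B"
    and dr: "\<theta> * (real K + 3) ^ 2 * real B + (real K ^ 2 + 2 * real K) * real (card S) \<le> drift \<zeta> A H F"
  shows "(\<Sum>M\<in>perfect_matchings H. exp (- \<theta> * weight \<zeta> (H - \<Union>{p \<in> M. p \<inter> S \<noteq> {}})
      (F \<union> fst ` \<Union>{p \<in> M. p \<inter> S \<noteq> {}})))
    \<le> real (card (perfect_matchings H)) * exp (- \<theta> * weight \<zeta> H F)"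
  using assms(1,3-7) B dr
proof (induction "card S" arbitrary: H F S rule: less_induct)
  case less
  let ?w = "\<lambda>H F S M. exp (- \<theta> * weight \<zeta> (H - \<Union>{p \<in> M. p \<inter> S \<noteq> {}}) (F \<union> fst ` \<Union>{p \<in> M. p \<inter> S \<noteq> {}}))"
  show ?case
  proof (cases "S = {}")
    case False
    then obtain h where hS: "h \<in> S" by blast
    then have h: "h \<in> H" "fst h \<in> F" using less.prems by auto
    have finS: "finite S" using less.prems(1,4) by (rule rev_finite_subset)
    have step: "(\<Sum>M\<in>perfect_matchings (H - {h, h'}). ?w H F S (insert {h, h'} M))
        \<le> real (card (perfect_matchings (H - {h, h'}))) * exp (- \<theta> * weight \<zeta> (H - {h, h'}) (insert (fst h') F))"
      if h': "h' \<in> H - {h}" for h'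
    proof -
      let ?H = "H - {h, h'}" and ?F = "insert (fst h') F" and ?S = "S - {h, h'}"
      have cS: "card ?S < card S" using finS hS by (intro psubset_card_mono) auto
      have degle: "deg ?H w \<le> deg H w" for w unfolding deg_def using less.prems(1) by (intro card_mono) auto
      have "(\<Sum>M\<in>perfect_matchings ?H. ?w H F S (insert {h, h'} M)) = (\<Sum>M\<in>perfect_matchings ?H. ?w ?H ?F ?S M)"
      proof (rule sum.cong[OF refl])
        fix M assume M: "M \<in> perfect_matchings ?H"
        have "p \<inter> S = p \<inter> ?S" if "p \<in> M" for p
          using perfect_matchings_Union[OF M] that by blast
        then have "{p \<in> insert {h, h'} M. p \<inter> S \<noteq> {}} = insert {h, h'} {p \<in> M. p \<inter> ?S \<noteq> {}}"
          using hS by auto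
        then have U: "\<Union>{p \<in> insert {h, h'} M. p \<inter> S \<noteq> {}} = {h, h'} \<union> \<Union>{p \<in> M. p \<inter> ?S \<noteq> {}}" by simp
        have "H - ({h, h'} \<union> \<Union>{p \<in> M. p \<inter> ?S \<noteq> {}}) = ?H - \<Union>{p \<in> M. p \<inter> ?S \<noteq> {}}" by auto
        moreover have "F \<union> fst ` ({h, h'} \<union> \<Union>{p \<in> M. p \<inter> ?S \<noteq> {}}) = ?F \<union> fst ` \<Union>{p \<in> M. p \<inter> ?S \<noteq> {}}"
          using h(2) by auto
        ultimately show "?w H F S (insert {h, h'} M) = ?w ?H ?F ?S M" by (simp only: U)
      qed
      also have "\<dots> \<le> real (card (perfect_matchings ?H)) * exp (- \<theta> * weight \<zeta> ?H ?F)"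
      proof (rule less.hyps[OF cS])
        show "deg ?H w \<le> K" for w using degle less.prems(6) by (rule order_trans)
        have "card ?H \<le> card H" using less.prems(1) by (intro card_mono) auto
        then show "card ?H \<le> B" using less.prems(7) by simp
        have "(real K ^ 2 + 2 * real K) * real (card ?S) + (real K ^ 2 + 2 * real K)
            = (real K ^ 2 + 2 * real K) * real (Suc (card ?S))" by (simp add: algebra_simps)
        also have "\<dots> \<le> (real K ^ 2 + 2 * real K) * real (card S)"
          using cS by (intro mult_left_mono) auto
        finally show "\<theta> * (real K + 3) ^ 2 * real B + (real K ^ 2 + 2 * real K) * real (card ?S) \<le> drift \<zeta> A ?H ?F"
          using drift_remove[OF less.prems(1) assms(2) h(2) less.prems(6) \<zeta>(1), of h'] less.prems(8) by linarith
      qed (use less.prems in auto)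
      finally show ?thesis .
    qed
    have cpm: "card (perfect_matchings (H - {h, h'})) = num_matchings (card H - 2)" if h': "h' \<in> H - {h}" for h'
    proof -
      have "card {h, h'} = 2" using h' by auto
      moreover have "card (H - {h, h'}) = card H - card {h, h'}" using h h' less.prems(1) by (intro card_Diff_subset) auto
      ultimately have "card (H - {h, h'}) = card H - 2" by (simp only:)
      then show ?thesis using less.prems(1) by (simp only: card_perfect_matchings finite_Diff)
    qed
    have "(\<Sum>M\<in>perfect_matchings H. ?w H F S M)
        = (\<Sum>h'\<in>H - {h}. \<Sum>M\<in>perfect_matchings (H - {h, h'}). ?w H F S (insert {h, h'} M))"
      by (rule perfect_matchings_step(2)[OF less.prems(1) h(1)])
    also have "\<dots> \<le> (\<Sum>h'\<in>H - {h}. real (num_matchings (card H - 2)) * exp (- \<theta> * weight \<zeta> (H - {h, h'}) (insert (fst h') F)))"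
      by (intro sum_mono order_trans[OF step]) (simp_all add: cpm)
    also have "\<dots> = real (num_matchings (card H - 2)) * (\<Sum>h'\<in>H - {h}. exp (- \<theta> * weight \<zeta> (H - {h, h'}) (insert (fst h') F)))"
      by (rule sum_distrib_left[symmetric])
    also have "\<dots> \<le> real (num_matchings (card H - 2)) * ((real (card H) - 1) * exp (- \<theta> * weight \<zeta> H F))"
    proof (intro mult_left_mono drift_step[where A = A and K = K] less.prems(1,2,3) assms(2) h \<zeta> \<theta> less.prems(6))
      have "\<theta> * (real K + 3) ^ 2 * real (card H) \<le> \<theta> * (real K + 3) ^ 2 * real B"
        using less.prems(7) \<theta> by (intro mult_left_mono) auto
      moreover have "0 \<le> (real K ^ 2 + 2 * real K) * real (card S)" by simp
      ultimately show "\<theta> * (real K + 3) ^ 2 * real (card H) \<le> drift \<zeta> A H F"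
        using less.prems(8) by linarith
    qed simp
    also have "\<dots> = real (card (perfect_matchings H)) * exp (- \<theta> * weight \<zeta> H F)"
    proof -
      have "1 \<le> card H" using h less.prems(1) by (auto simp: Suc_le_eq card_gt_0_iff)
      \<comment> \<open>A single half-edge admits no matching, and both sides are 0.\<close>
      then consider "card H = 1" | m where "card H = Suc (Suc m)"
        by (metis One_nat_def Suc_le_D le_SucE le_antisym not0_implies_Suc)
      then show ?thesis
        by cases (simp_all add: card_perfect_matchings[OF less.prems(1)] algebra_simps)
    qed
    finally show ?thesis .
  qed simp
qed

lemma card_sum_pairs:
  assumes "finite H" "M \<in> perfect_matchings H" "S \<subseteq> H"
  shows "card S = (\<Sum>p\<in>M. card (p \<inter> S))"
proof -
  have fin: "finite M" by (rule finite_UnionD) (simp add: perfect_matchings_Union[OF assms(2)] assms(1))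
  have "S = (\<Union>p\<in>M. p \<inter> S)" using perfect_matchings_Union[OF assms(2)] assms(3) by blast
  also have "card \<dots> = (\<Sum>p\<in>M. card (p \<inter> S))"
  proof (rule card_UN_disjoint[OF fin])
    show "\<forall>p\<in>M. finite (p \<inter> S)" using assms by (auto intro: rev_finite_subset)
    show "\<forall>p\<in>M. \<forall>q\<in>M. p \<noteq> q \<longrightarrow> (p \<inter> S) \<inter> (q \<inter> S) = {}"
      using perfect_matchings_disjoint[OF assms(2)] by blast
  qed
  finally show ?thesis .
qed

lemma card_Union_pairs_le:
  assumes "finite H" "M \<in> perfect_matchings H" "S \<subseteq> H"
  shows "card (\<Union>{p \<in> M. p \<inter> S \<noteq> {}}) \<le> 2 * card S"
proof -
  let ?P = "{p \<in> M. p \<inter> S \<noteq> {}}"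
  have fin: "finite M" by (rule finite_UnionD) (simp add: perfect_matchings_Union[OF assms(2)] assms(1))
  have finS: "finite S" using assms(1,3) by (rule rev_finite_subset)
  have "card (\<Union>?P) \<le> (\<Sum>p\<in>?P. card p)" by (rule card_Union_le_sum_card)
  also have "\<dots> \<le> (\<Sum>p\<in>?P. 2 * card (p \<inter> S))"
  proof (rule sum_mono)
    fix p assume "p \<in> ?P"
    then have "card p = 2" "0 < card (p \<inter> S)"
      using perfect_matchings_card[OF assms(2)] finS by (auto simp: card_gt_0_iff)
    then show "card p \<le> 2 * card (p \<inter> S)" by linarith
  qed
  also have "\<dots> \<le> (\<Sum>p\<in>M. 2 * card (p \<inter> S))" using fin by (intro sum_mono2) auto
  also have "\<dots> = 2 * card S" by (simp add: card_sum_pairs[OF assms] sum_distrib_left)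
  finally show ?thesis .
qed

section \<open>The revealed and the unrevealed part of a matching\<close>

definition free_pairs :: "half_edge set set \<Rightarrow> vertex set \<Rightarrow> half_edge set set" where
  "free_pairs M L = {p \<in> M. fst ` p \<inter> L = {}}"

definition discovered :: "half_edge set set \<Rightarrow> vertex set \<Rightarrow> vertex set \<Rightarrow> vertex set" where
  "discovered M L V = insert 1 {w. \<exists>p\<in>free_pairs M L. w \<in> fst ` p \<and> fst ` p \<inter> V \<noteq> {}}"

definition unrevealed :: "half_edge set set \<Rightarrow> vertex set \<Rightarrow> vertex set \<Rightarrow> half_edge set" where
  "unrevealed M L V = \<Union>{p \<in> free_pairs M L. fst ` p \<inter> V = {}}"

text \<open>Pairs at \<open>L\<close> count as revealed from the outset. The half-edges that remain
  random all lie outside \<open>L\<close>, where degrees are bounded.\<close>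

definition revealed :: "half_edge set set \<Rightarrow> vertex set \<Rightarrow> vertex set \<Rightarrow> half_edge set set" where
  "revealed M L V = {p \<in> M. fst ` p \<inter> (V \<union> L) \<noteq> {}}"

text \<open>Exploring such a vertex makes it discovered through its own pair, so its exploration
  earns the bonus in \<open>potential\<close>. A vertex other than 1 whose pairs all lead to
  \<open>L\<close> can be explored without ever being discovered.\<close>

definition counted :: "half_edge set set \<Rightarrow> vertex set \<Rightarrow> vertex set" where
  "counted M L = {v. \<exists>p\<in>free_pairs M L. v \<in> fst ` p}"

lemma counted_Int: "counted M L \<inter> L = {}"
  by (auto simp: counted_def free_pairs_def)

lemma unrevealed_eq:
  assumes "M \<in> perfect_matchings H"
  shows "unrevealed M L V = H - \<Union>(revealed M L V)"
proof -
  have "{p \<in> free_pairs M L. fst ` p \<inter> V = {}} = M - revealed M L V"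
    by (auto simp: free_pairs_def revealed_def)
  moreover have "revealed M L V \<subseteq> M" by (auto simp: revealed_def)
  ultimately show ?thesis
    unfolding unrevealed_def using perfect_matchings_Union[OF perfect_matchings_Diff[OF assms]] by metis
qed

locale bounded_matching =
  fixes H :: "half_edge set" and L A :: "vertex set" and K :: nat
  assumes finite_H: "finite H" and finite_A: "finite A" and ends_A: "fst ` H \<subseteq> A \<union> L" and AL: "A \<inter> L = {}"
    and no_root: "0 \<notin> A \<union> L"
    and degree_le: "\<And>w. w \<notin> L \<Longrightarrow> deg H w \<le> K"
begin

text \<open>Each half-edge at \<open>L\<close>, the set of vertices of high degree, is matched to at most one half-edge outside \<open>L\<close>,
  whose removal lowers the drift by at most \<open>2 K\<close>.\<close>

definition excess :: "real \<Rightarrow> real" where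
  "excess \<zeta> = (\<Sum>w\<in>A. real (deg H w) * (real (deg H w) - 2 - \<zeta>)) - 2 * real K * real (card {h \<in> H. fst h \<in> L})"

lemma unrevealed_subset: "M \<in> perfect_matchings H \<Longrightarrow> unrevealed M L V \<subseteq> {h \<in> H. fst h \<notin> L}"
  using perfect_matchings_Union by (auto simp: unrevealed_def free_pairs_def)

lemma finite_unrevealed: "M \<in> perfect_matchings H \<Longrightarrow> finite (unrevealed M L V)"
  by (rule finite_subset[OF unrevealed_subset]) (simp_all add: finite_H)

lemma deg_unrevealed_le:
  assumes "M \<in> perfect_matchings H"
  shows "deg (unrevealed M L V) w \<le> K"
proof (cases "w \<in> L")
  case True
  then have "{h \<in> unrevealed M L V. fst h = w} = {}" using unrevealed_subset[OF assms, of V] by blast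
  then have "deg (unrevealed M L V) w = 0" unfolding deg_def by (simp only: card.empty)
  then show ?thesis by simp
next
  case False
  have "deg (unrevealed M L V) w \<le> deg H w"
    unfolding deg_def using unrevealed_subset[OF assms] finite_H by (intro card_mono) auto
  then show ?thesis using degree_le[OF False] by simp
qed

text \<open>A pair that meets \<open>L\<close> has at most one half-edge outside \<open>L\<close>
  and at least one inside.\<close>

lemma lost_le:
  assumes M: "M \<in> perfect_matchings H"
  shows "card {h \<in> H. fst h \<notin> L \<and> (\<exists>p\<in>M. h \<in> p \<and> fst ` p \<inter> L \<noteq> {})} \<le> card {h \<in> H. fst h \<in> L}"
proof -
  let ?X = "{h \<in> H. fst h \<notin> L \<and> (\<exists>p\<in>M. h \<in> p \<and> fst ` p \<inter> L \<noteq> {})}" and ?Y = "{h \<in> H. fst h \<in> L}"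
  have "card ?X = (\<Sum>p\<in>M. card (p \<inter> ?X))" by (rule card_sum_pairs[OF finite_H M]) auto
  also have "\<dots> \<le> (\<Sum>p\<in>M. card (p \<inter> ?Y))"
  proof (rule sum_mono)
    fix p assume p: "p \<in> M"
    obtain x y where xy: "p = {x, y}" "x \<noteq> y" using perfect_matchings_card[OF M p] by (auto simp: card_2_iff)
    have pH: "p \<subseteq> H" using perfect_matchings_Union[OF M] p by auto
    show "card (p \<inter> ?X) \<le> card (p \<inter> ?Y)"
    proof (cases "p \<inter> ?X = {}")
      case False
      then obtain h where h: "h \<in> p" "h \<in> ?X" by blast
      then obtain q where q: "q \<in> M" "h \<in> q" "fst ` q \<inter> L \<noteq> {}" by auto
      have "q = p" using perfect_matchings_disjoint[OF M q(1) p q(2) h(1)] .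
      then obtain h' where h': "h' \<in> p" "fst h' \<in> L" using q(3) by auto
      have "p \<inter> ?X \<subseteq> {h}" "h' \<in> p \<inter> ?Y" using xy h h' pH by auto
      moreover have "finite (p \<inter> ?Y)" using finite_H by auto
      ultimately have "card (p \<inter> ?X) \<le> 1" "0 < card (p \<inter> ?Y)"
        by (auto simp: card_gt_0_iff dest: card_mono[rotated])
      then show ?thesis by simp
    qed simp
  qed
  also have "\<dots> = card ?Y" by (rule card_sum_pairs[OF finite_H M, symmetric]) auto
  finally show ?thesis .
qed

text \<open>Comparison with the whole graph, vertex by vertex. A vertex of \<open>F\<close> costs at
  most \<open>K ^ 2 + 2 * K\<close>. Any other vertex has lost only half-edges matched to
  \<open>L\<close>, each worth at most \<open>2 * K\<close>, and \<open>lost_le\<close> limits their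
  number.\<close>

lemma drift_lower:
  assumes M: "M \<in> perfect_matchings H" and F: "discovered M L V \<subseteq> F" "finite F" and \<zeta>: "0 \<le> \<zeta>"
  shows "excess \<zeta> - (real K ^ 2 + 2 * real K) * real (card F) \<le> drift \<zeta> A (unrevealed M L V) F"
proof -
  let ?R = "unrevealed M L V"
  define c where "c = real K ^ 2 + 2 * real K"
  have c0: "0 \<le> c" by (simp add: c_def)
  let ?X = "{h \<in> H. fst h \<notin> L \<and> (\<exists>p\<in>M. h \<in> p \<and> fst ` p \<inter> L \<noteq> {})}"
  have fst_unrevealed: "fst ` ?X \<subseteq> A" using ends_A by auto
  have lost: "deg H w \<le> deg ?R w + deg ?X w" if w: "w \<in> A" "w \<notin> F" for w
  proof -
    have "{h \<in> H. fst h = w} \<subseteq> {h \<in> ?R. fst h = w} \<union> {h \<in> ?X. fst h = w}"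
    proof
      fix h assume "h \<in> {h \<in> H. fst h = w}"
      then have h: "h \<in> H" "fst h = w" by auto
      obtain p where p: "p \<in> M" "h \<in> p" using perfect_matchings_Union[OF M] h by blast
      show "h \<in> {h \<in> ?R. fst h = w} \<union> {h \<in> ?X. fst h = w}"
      proof (cases "fst ` p \<inter> L = {}")
        case True
        then have "p \<in> free_pairs M L" using p by (simp add: free_pairs_def)
        moreover have "w \<in> fst ` p" using p h by auto
        moreover have "fst ` p \<inter> V = {}" using calculation w(2) F(1) by (auto simp: discovered_def)
        ultimately show ?thesis using p h by (auto simp: unrevealed_def)
      next
        case False
        then show ?thesis using p h w AL by auto
      qed
    qed
    then have "deg H w \<le> card ({h \<in> ?R. fst h = w} \<union> {h \<in> ?X. fst h = w})"
      unfolding deg_def using finite_unrevealed[OF M] finite_H by (intro card_mono) auto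
    also have "\<dots> \<le> deg ?R w + deg ?X w" unfolding deg_def by (rule card_Un_le)
    finally show ?thesis .
  qed
  have "(\<Sum>w\<in>A. real (deg H w) * (real (deg H w) - 2 - \<zeta>)) - (\<Sum>w\<in>A. if w \<in> F then c else 0) - (\<Sum>w\<in>A. real (deg ?X w) * (2 * real K))
      \<le> drift \<zeta> A ?R F"
    unfolding drift_def sum_subtractf[symmetric]
  proof (rule sum_mono)
    fix w assume w: "w \<in> A"
    have DK: "deg H w \<le> K" using degree_le w AL by auto
    have RD: "deg ?R w \<le> deg H w"
      unfolding deg_def using unrevealed_subset[OF M] finite_H by (intro card_mono) auto
    show "real (deg H w) * (real (deg H w) - 2 - \<zeta>) - (if w \<in> F then c else 0) - real (deg ?X w) * (2 * real K)
      \<le> (if w \<in> F then - 2 * real (deg ?R w) else real (deg ?R w) * (real (deg ?R w) - 2 - \<zeta>))"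
    proof (cases "w \<in> F")
      case True
      have "real (deg H w) * (real (deg H w) - 2 - \<zeta>) \<le> real (deg H w) * real (deg H w)"
        using \<zeta> by (intro mult_left_mono) auto
      also have "\<dots> \<le> real K ^ 2" using DK by (simp add: power2_eq_square mult_mono)
      finally have "real (deg H w) * (real (deg H w) - 2 - \<zeta>) \<le> real K ^ 2" .
      moreover have "0 \<le> real (deg ?X w) * (2 * real K)" by simp
      moreover have "real (deg ?R w) \<le> real K" using RD DK by simp
      ultimately show ?thesis using True unfolding c_def by (simp only: if_True)
    next
      case False
      define D R where "D = real (deg H w)" and "R = real (deg ?R w)"
      have b: "R \<le> D" "D \<le> real K" "D - R \<le> real (deg ?X w)" "0 \<le> R"
        using RD DK lost[OF w False] by (auto simp: D_def R_def)
      have "D * (D - 2 - \<zeta>) - R * (R - 2 - \<zeta>) = (D - R) * (D + R - 2 - \<zeta>)" by (simp add: algebra_simps)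
      also have "\<dots> \<le> (D - R) * (2 * real K)" using b \<zeta> by (intro mult_left_mono) auto
      also have "\<dots> \<le> real (deg ?X w) * (2 * real K)" using b by (intro mult_right_mono) auto
      finally show ?thesis using False by (simp add: D_def R_def)
    qed
  qed
  moreover have "(\<Sum>w\<in>A. if w \<in> F then c else 0) \<le> c * real (card F)"
  proof -
    have "(\<Sum>w\<in>A. if w \<in> F then c else 0) = c * real (card (A \<inter> F))"
      using finite_A by (simp add: sum.If_cases)
    also have "\<dots> \<le> c * real (card F)" using c0 F(2) by (intro mult_left_mono) (auto intro: card_mono)
    finally show ?thesis .
  qed
  moreover have "(\<Sum>w\<in>A. real (deg ?X w) * (2 * real K)) \<le> 2 * real K * real (card {h \<in> H. fst h \<in> L})"
  proof -
    have "(\<Sum>w\<in>A. real (deg ?X w) * (2 * real K)) = (\<Sum>h\<in>?X. 2 * real K)"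
      using finite_H finite_A fst_unrevealed by (intro sum_deg[symmetric]) auto
    also have "\<dots> = 2 * real K * real (card ?X)" by simp
    also have "\<dots> \<le> 2 * real K * real (card {h \<in> H. fst h \<in> L})"
      using lost_le[OF M] by (intro mult_left_mono) auto
    finally show ?thesis .
  qed
  ultimately show ?thesis unfolding excess_def c_def[symmetric] by linarith
qed

lemma discovered_subset: 
  assumes M: "M \<in> perfect_matchings H"
  shows "discovered M L V \<subseteq> insert 1 (fst ` \<Union>{p \<in> M. p \<inter> {h \<in> H. fst h \<in> V - L} \<noteq> {}})"
proof
  fix w assume "w \<in> discovered M L V"
  then consider "w = 1" | p where "p \<in> M" "fst ` p \<inter> L = {}" "w \<in> fst ` p" "fst ` p \<inter> V \<noteq> {}"
    by (auto simp: discovered_def free_pairs_def)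
  then show "w \<in> insert 1 (fst ` \<Union>{p \<in> M. p \<inter> {h \<in> H. fst h \<in> V - L} \<noteq> {}})"
  proof cases
    case 2
    then obtain h where h: "h \<in> p" "fst h \<in> V" by auto
    moreover have "h \<in> H" "fst h \<notin> L" using h 2 perfect_matchings_Union[OF M] by auto
    ultimately have "p \<inter> {h \<in> H. fst h \<in> V - L} \<noteq> {}" by auto
    then show ?thesis using 2 by blast
  qed simp
qed

lemma card_halves_le:
  assumes "finite W" "W \<inter> L = {}"
  shows "card {h \<in> H. fst h \<in> W} \<le> K * card W"
proof -
  have eq: "{h \<in> H. fst h \<in> W} = (\<Union>w\<in>W. {h \<in> H. fst h = w})" by auto
  have "card {h \<in> H. fst h \<in> W} \<le> (\<Sum>w\<in>W. deg H w)"
    unfolding deg_def eq by (rule card_UN_le[OF assms(1)])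
  also have "\<dots> \<le> (\<Sum>w\<in>W. K)" using assms(2) by (intro sum_mono degree_le) auto
  finally show ?thesis by (simp add: mult.commute)
qed

lemma card_discovered_le:
  assumes M: "M \<in> perfect_matchings H" and V: "finite V"
  shows "finite (discovered M L V)" "card (discovered M L V) \<le> 1 + 2 * K * card V"
proof -
  let ?S = "{h \<in> H. fst h \<in> V - L}"
  let ?U = "\<Union>{p \<in> M. p \<inter> ?S \<noteq> {}}"
  have finU: "finite ?U"
    by (rule finite_subset[OF _ finite_H]) (use perfect_matchings_Union[OF M] in blast)
  show "finite (discovered M L V)" by (rule finite_subset[OF discovered_subset[OF M]]) (intro finite.insertI finite_imageI finU)
  have "card (discovered M L V) \<le> card (insert 1 (fst ` ?U))"
    using finU discovered_subset[OF M] by (intro card_mono) auto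
  also have "\<dots> \<le> Suc (card ?U)"
    using finU by (intro order_trans[OF card_insert_le_m1[of "Suc (card ?U)"]]) (auto intro: card_image_le)
  also have "card ?U \<le> 2 * card ?S" by (rule card_Union_pairs_le[OF finite_H M]) auto
  also have "card ?S \<le> K * card (V - L)" using V by (intro card_halves_le) auto
  also have "card (V - L) \<le> card V" using V by (intro card_mono) auto
  finally show "card (discovered M L V) \<le> 1 + 2 * K * card V" by simp
qed

text \<open>A pair of \<open>M\<close> that meets \<open>V\<close> or \<open>L\<close> shares a
  half-edge with a revealed pair of \<open>M0\<close>. That pair belongs to \<open>M\<close> as
  well, so disjointness identifies the two, and everything computed from the revealed pairs is
  common to the class.\<close>

lemma class_facts:
  assumes M0: "M0 \<in> perfect_matchings H" and M: "M \<in> perfect_matchings H" "revealed M0 L V \<subseteq> M"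
  shows "revealed M L V = revealed M0 L V" "unrevealed M L V = unrevealed M0 L V" "discovered M L V = discovered M0 L V"
    "counted M L = counted M0 L"
proof -
  have rev: "revealed M L W = revealed M0 L W" if "revealed M0 L W \<subseteq> M" for W
  proof
    show "revealed M0 L W \<subseteq> revealed M L W" using that by (auto simp: revealed_def)
    show "revealed M L W \<subseteq> revealed M0 L W"
    proof
      fix p assume "p \<in> revealed M L W"
      then obtain h where p: "p \<in> M" "h \<in> p" "fst h \<in> W \<union> L" by (auto simp: revealed_def)
      then have "h \<in> H" using perfect_matchings_Union[OF M(1)] by auto
      then obtain q where q: "q \<in> M0" "h \<in> q" using perfect_matchings_Union[OF M0] by auto
      then have "q \<in> revealed M0 L W" using p by (auto simp: revealed_def)
      moreover from this have "q \<in> M" using that by blast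
      then have "q = p" using perfect_matchings_disjoint[OF M(1) _ p(1) q(2) p(2)] by simp
      ultimately show "p \<in> revealed M0 L W" by simp
    qed
  qed
  have sub: "revealed M0 L {} \<subseteq> M" using M(2) by (auto simp: revealed_def)
  show r: "revealed M L V = revealed M0 L V" by (rule rev[OF M(2)])
  show "unrevealed M L V = unrevealed M0 L V" unfolding unrevealed_eq[OF M(1)] unrevealed_eq[OF M0] r ..
  have d: "discovered M L V = insert 1 {w. \<exists>p\<in>revealed M L V. fst ` p \<inter> L = {} \<and> w \<in> fst ` p \<and> fst ` p \<inter> V \<noteq> {}}" for M
    by (auto simp: discovered_def revealed_def free_pairs_def)
  show "discovered M L V = discovered M0 L V" unfolding d r ..
  have c: "counted M L = fst ` unrevealed M L {}" for M
  proof -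
    have "unrevealed M L {} = \<Union>(free_pairs M L)" by (simp add: unrevealed_def)
    then show ?thesis unfolding counted_def by blast
  qed
  show "counted M L = counted M0 L"
    unfolding c unrevealed_eq[OF M(1)] unrevealed_eq[OF M0] rev[OF sub] ..
qed

text \<open>Within the class, the rest of the matching is uniform on
  \<open>unrevealed M0 L V\<close>, and exploring \<open>v\<close> reveals the partners of its
  half-edges \<open>S\<close> there. In \<open>dr\<close>, the summand \<open>K\<close> bounds
  \<open>card S\<close>, and \<open>2 + 2 * K * card V\<close> bounds the number of discovered
  vertices including \<open>v\<close>.\<close>

lemma class_drift:
  assumes M0: "M0 \<in> perfect_matchings H" and V: "finite V" and v: "v \<notin> V \<union> L"
    and \<zeta>: "0 \<le> \<zeta>" "\<zeta> \<le> 1" and \<theta>: "0 < \<theta>" "\<theta> * (real K + 3) \<le> 1"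
    and dr: "\<theta> * (real K + 3) ^ 2 * real (K * card A)
      + (real K ^ 2 + 2 * real K) * (real K + 2 + 2 * real K * real (card V)) \<le> excess \<zeta>"
  shows "(\<Sum>M\<in>{M \<in> perfect_matchings H. revealed M0 L V \<subseteq> M}.
      exp (- \<theta> * weight \<zeta> (unrevealed M L (insert v V)) (discovered M L (insert v V))))
    \<le> (\<Sum>M\<in>{M \<in> perfect_matchings H. revealed M0 L V \<subseteq> M}. exp (- \<theta> * weight \<zeta> (unrevealed M L V) (discovered M L V)))"
proof -
  define y where "y = revealed M0 L V"
  define H1 where "H1 = unrevealed M0 L V"
  define F0 where "F0 = discovered M0 L V"
  define S where "S = {h \<in> H1. fst h = v}"
  \<comment> \<open>A vertex infected through \<open>L\<close> may be undiscovered when it is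
    explored; it is added if it has a half-edge left to reveal.\<close>
  define F1 where "F1 = (if S = {} then F0 else insert v F0)"
  have H1: "H1 = H - \<Union>y" unfolding H1_def y_def by (rule unrevealed_eq[OF M0])
  have yM0: "y \<subseteq> M0" by (auto simp: y_def revealed_def)
  have yS: "y \<in> perfect_matchings (\<Union>y)" using M0 yM0 by (rule perfect_matchings_subset)
  have yH: "\<Union>y \<subseteq> H" using perfect_matchings_Union[OF M0] yM0 by auto
  note ext = perfect_matchings_extend[OF yS yH, folded H1]
  have H1L: "H1 \<subseteq> {h \<in> H. fst h \<notin> L}" unfolding H1_def by (rule unrevealed_subset[OF M0])
  have finH1: "finite H1" unfolding H1_def by (rule finite_unrevealed[OF M0])
  have finF0: "finite F0" unfolding F0_def by (rule card_discovered_le[OF M0 V])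
  have H1V: "fst h \<notin> V \<union> L" if h: "h \<in> H1" for h
  proof
    assume hv: "fst h \<in> V \<union> L"
    have "h \<in> H" using h H1 by auto
    then obtain p where "p \<in> M0" "h \<in> p" using perfect_matchings_Union[OF M0] by auto
    then show False using hv h H1 by (auto simp: y_def revealed_def)
  qed
  have new: "unrevealed (y \<union> M') L (insert v V) = H1 - \<Union>{p \<in> M'. p \<inter> S \<noteq> {}}"
    "discovered (y \<union> M') L (insert v V) = F1 \<union> fst ` \<Union>{p \<in> M'. p \<inter> S \<noteq> {}}"
    if M': "M' \<in> perfect_matchings H1" for M'
  proof -
    have UM': "\<Union>M' = H1" using M' by (rule perfect_matchings_Union)
    have free': "fst ` p \<inter> (V \<union> L) = {}" if "p \<in> M'" for p using that UM' H1V by auto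
    have tS: "p \<inter> S \<noteq> {} \<longleftrightarrow> v \<in> fst ` p" if "p \<in> M'" for p
      using that UM' by (auto simp: S_def)
    have ynf: "fst ` p \<inter> (V \<union> L) \<noteq> {}" if "p \<in> y" for p using that by (simp add: y_def revealed_def)
    have "p \<in> {p \<in> free_pairs (y \<union> M') L. fst ` p \<inter> insert v V = {}} \<longleftrightarrow> p \<in> {p \<in> M'. v \<notin> fst ` p}" for p
      using ynf[of p] free'[of p] unfolding free_pairs_def by blast
    then have "{p \<in> free_pairs (y \<union> M') L. fst ` p \<inter> insert v V = {}} = {p \<in> M'. v \<notin> fst ` p}"
      by (rule set_eqI)
    then have "unrevealed (y \<union> M') L (insert v V) = \<Union>{p \<in> M'. v \<notin> fst ` p}"
      unfolding unrevealed_def by (rule arg_cong[where f = Union])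
    also have "{p \<in> M'. v \<notin> fst ` p} = M' - {p \<in> M'. p \<inter> S \<noteq> {}}" using tS by blast
    also have "\<Union>\<dots> = H1 - \<Union>{p \<in> M'. p \<inter> S \<noteq> {}}"
      by (rule perfect_matchings_Union[OF perfect_matchings_Diff[OF M']]) auto
    finally show "unrevealed (y \<union> M') L (insert v V) = H1 - \<Union>{p \<in> M'. p \<inter> S \<noteq> {}}" .
    have F0: "F0 = insert 1 {w. \<exists>p\<in>y. fst ` p \<inter> L = {} \<and> w \<in> fst ` p}"
      unfolding F0_def discovered_def y_def revealed_def free_pairs_def by auto
    have pairs: "(p \<in> free_pairs (y \<union> M') L \<and> fst ` p \<inter> insert v V \<noteq> {}) \<longleftrightarrow>
        (p \<in> y \<and> fst ` p \<inter> L = {} \<or> p \<in> M' \<and> v \<in> fst ` p)" for p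
      using ynf[of p] free'[of p] unfolding free_pairs_def by blast
    have "w \<in> discovered (y \<union> M') L (insert v V) \<longleftrightarrow> w \<in> F0 \<union> fst ` \<Union>{p \<in> M'. v \<in> fst ` p}" for w
    proof -
      have "w \<in> discovered (y \<union> M') L (insert v V) \<longleftrightarrow> w = 1 \<or>
          (\<exists>p. (p \<in> free_pairs (y \<union> M') L \<and> fst ` p \<inter> insert v V \<noteq> {}) \<and> w \<in> fst ` p)"
        unfolding discovered_def Bex_def insert_iff mem_Collect_eq by (simp only: conj_ac)
      also have "\<dots> \<longleftrightarrow> w = 1 \<or> (\<exists>p. (p \<in> y \<and> fst ` p \<inter> L = {} \<or> p \<in> M' \<and> v \<in> fst ` p) \<and> w \<in> fst ` p)"
        by (simp only: pairs)
      also have "\<dots> \<longleftrightarrow> w \<in> F0 \<union> fst ` \<Union>{p \<in> M'. v \<in> fst ` p}"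
        unfolding F0 image_Union Un_iff insert_iff mem_Collect_eq UN_iff Bex_def by (simp only: conj_disj_distribR ex_disj_distrib conj_assoc disj_assoc)
      finally show ?thesis .
    qed
    then have "discovered (y \<union> M') L (insert v V) = F0 \<union> fst ` \<Union>{p \<in> M'. v \<in> fst ` p}"
      by (rule set_eqI)
    also have "{p \<in> M'. v \<in> fst ` p} = {p \<in> M'. p \<inter> S \<noteq> {}}" using tS by blast
    also have "F0 \<union> fst ` \<Union>{p \<in> M'. p \<inter> S \<noteq> {}} = F1 \<union> fst ` \<Union>{p \<in> M'. p \<inter> S \<noteq> {}}"
    proof (cases "S = {}")
      case False
      then obtain h where h: "h \<in> S" by auto
      then obtain p where "p \<in> M'" "h \<in> p" using UM' by (auto simp: S_def)
      then have "v \<in> fst ` \<Union>{p \<in> M'. p \<inter> S \<noteq> {}}" using h by (force simp: S_def)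
      then show ?thesis by (auto simp: F1_def)
    qed (simp add: F1_def)
    finally show "discovered (y \<union> M') L (insert v V) = F1 \<union> fst ` \<Union>{p \<in> M'. p \<inter> S \<noteq> {}}" .
  qed
  have cF1: "card F1 \<le> 2 + 2 * K * card V"
  proof -
    have "card F1 \<le> Suc (card F0)" using finF0 by (simp add: F1_def card_insert_if)
    also have "card F0 \<le> 1 + 2 * K * card V" unfolding F0_def by (rule card_discovered_le[OF M0 V])
    finally show ?thesis by simp
  qed
  have degH1: "deg H1 w \<le> K" for w unfolding H1_def by (rule deg_unrevealed_le[OF M0])
  have cS: "card S \<le> K" using degH1[of v] by (simp add: S_def deg_def)
  have cH1: "card H1 \<le> K * card A"
  proof -
    have "card H1 \<le> card {h \<in> H. fst h \<in> A}" using H1L ends_A finite_H by (intro card_mono) auto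
    also have "\<dots> \<le> K * card A" using finite_A AL by (rule card_halves_le)
    finally show ?thesis .
  qed
  have "(\<Sum>M\<in>{M \<in> perfect_matchings H. y \<subseteq> M}. exp (- \<theta> * weight \<zeta> (unrevealed M L (insert v V)) (discovered M L (insert v V))))
      = (\<Sum>M'\<in>perfect_matchings H1. exp (- \<theta> * weight \<zeta> (unrevealed (y \<union> M') L (insert v V)) (discovered (y \<union> M') L (insert v V))))"
    unfolding ext(1) by (rule sum.reindex[OF ext(2), unfolded o_def])
  also have "\<dots> = (\<Sum>M'\<in>perfect_matchings H1. exp (- \<theta> * weight \<zeta> (H1 - \<Union>{p \<in> M'. p \<inter> S \<noteq> {}})
      (F1 \<union> fst ` \<Union>{p \<in> M'. p \<inter> S \<noteq> {}})))"
    by (intro sum.cong refl) (simp only: new)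
  also have "\<dots> \<le> real (card (perfect_matchings H1)) * exp (- \<theta> * weight \<zeta> H1 F1)"
  proof (rule drift_multistep[where A = A and K = K and B = "K * card A"])
    show "fst ` H1 \<subseteq> A" using H1L ends_A by auto
    show "finite F1" using finF0 by (simp add: F1_def)
    show "S \<subseteq> H1" "fst ` S \<subseteq> F1" by (auto simp: S_def F1_def)
    define c where "c = real K ^ 2 + 2 * real K"
    have c0: "0 \<le> c" by (simp add: c_def)
    have "excess \<zeta> - c * real (card F1) \<le> drift \<zeta> A H1 F1"
      unfolding c_def H1_def using finF0 \<zeta> by (intro drift_lower[OF M0]) (auto simp: F1_def F0_def)
    moreover have "c * real (card F1) \<le> c * (2 + 2 * real K * real (card V))"
    proof (intro mult_left_mono c0)
      have "real (card F1) \<le> real (2 + 2 * K * card V)" using cF1 by (simp only: of_nat_le_iff)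
      then show "real (card F1) \<le> 2 + 2 * real K * real (card V)" by simp
    qed
    moreover have "c * real (card S) \<le> c * real K" using cS by (intro mult_left_mono c0) simp
    moreover have "c * (real K + 2 + 2 * real K * real (card V)) = c * real K + c * (2 + 2 * real K * real (card V))"
      by (simp add: algebra_simps)
    ultimately show "\<theta> * (real K + 3) ^ 2 * real (K * card A) + (real K ^ 2 + 2 * real K) * real (card S) \<le> drift \<zeta> A H1 F1"
      using dr unfolding c_def[symmetric] by linarith
  qed (use finH1 finite_A degH1 cH1 \<zeta> \<theta> in auto)
  also have "\<dots> \<le> real (card (perfect_matchings H1)) * exp (- \<theta> * weight \<zeta> H1 F0)"
  proof -
    \<comment> \<open>Adding \<open>v\<close> gains at least one half-edge and costs
      \<open>\<zeta> \<le> 1\<close>.\<close>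
    have "weight \<zeta> H1 F0 \<le> weight \<zeta> H1 F1"
    proof (cases "S = {} \<or> v \<in> F0")
      case False
      then have "{h \<in> H1. fst h \<in> insert v F0} = {h \<in> H1. fst h \<in> F0} \<union> S" "{h \<in> H1. fst h \<in> F0} \<inter> S = {}"
        by (auto simp: S_def)
      then have "card {h \<in> H1. fst h \<in> insert v F0} = card {h \<in> H1. fst h \<in> F0} + card S"
        using finH1 by (simp add: card_Un_disjoint S_def)
      moreover have "0 < card S" using False finH1 by (simp add: card_gt_0_iff S_def)
      ultimately show ?thesis using False finF0 \<zeta> by (simp add: weight_def F1_def algebra_simps)
    qed (auto simp: F1_def insert_absorb)
    then show ?thesis using \<theta> by (intro mult_left_mono) auto
  qed
  also have "\<dots> = (\<Sum>M\<in>{M \<in> perfect_matchings H. y \<subseteq> M}. exp (- \<theta> * weight \<zeta> (unrevealed M L V) (discovered M L V)))"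
  proof -
    have "card {M \<in> perfect_matchings H. y \<subseteq> M} = card (perfect_matchings H1)"
      unfolding ext(1) by (rule card_image[OF ext(2)])
    moreover have "unrevealed M L V = H1" "discovered M L V = F0" if "M \<in> {M \<in> perfect_matchings H. y \<subseteq> M}" for M
      using class_facts[OF M0, of M V] that by (auto simp: H1_def F0_def y_def)
    ultimately show ?thesis by simp
  qed
  finally show ?thesis by (simp only: y_def)
qed

end

lemma exploration_graph_edges:
  assumes "finite H" "M \<in> perfect_matchings H" "regular X"
  shows "exploration (graph_edges M) X"
proof
  have fin: "finite M" by (rule finite_UnionD) (simp add: perfect_matchings_Union[OF assms(2)] assms(1))
  then show "finite (graph_edges M)" by (simp add: graph_edges_def)
  have "finite p" if "p \<in> M" for p
    using perfect_matchings_card[OF assms(2) that] by (intro card_ge_0_finite) simp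
  then show "finite (\<Union> (ends ` graph_edges M))" using fin by (auto simp: graph_edges_def)
qed fact

locale matching_exploration = bounded_matching +
  fixes \<zeta> \<theta> \<epsilon> :: real
  assumes \<zeta>: "0 \<le> \<zeta>" "\<zeta> \<le> 1" and \<theta>: "0 < \<theta>" "\<theta> * (real K + 3) \<le> 1"
begin

text \<open>If the exploration is stuck, every unrevealed half-edge at a discovered vertex can be charged to a bad
  vertex, and \<open>penalty\<close> bounds how many are charged to the same one.\<close>

definition penalty :: real where
  "penalty = real (K * ((1 + 2 * K) * (2 * K)))"

text \<open>The second term refunds the charge \<open>\<zeta>\<close> for discovered vertices once
  they are explored. The supermartingale is \<open>exp (- \<theta> * potential)\<close>; the refund
  must outweigh the penalty on average.\<close>

definition potential :: "half_edge set set \<Rightarrow> vertex set \<Rightarrow> nat \<Rightarrow> real" where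
  "potential M V N = weight \<zeta> (unrevealed M L V) (discovered M L V) + \<zeta> * real (card (discovered M L V \<inter> V)) - penalty * real N"

abbreviation "bads M X t \<equiv> num_bad (graph_edges M) X L \<epsilon> (counted M L) t"

definition nbrs :: "half_edge set set \<Rightarrow> vertex \<Rightarrow> vertex set" where
  "nbrs M u = fst ` \<Union>{p \<in> M. p \<inter> {h \<in> H. fst h = u} \<noteq> {}}"

lemma card_nbrs_le:
  assumes M: "M \<in> perfect_matchings H" and u: "u \<notin> L"
  shows "finite (nbrs M u)" "card (nbrs M u) \<le> 2 * K"
proof -
  let ?U = "\<Union>{p \<in> M. p \<inter> {h \<in> H. fst h = u} \<noteq> {}}"
  have fin: "finite ?U"
    by (rule finite_subset[OF _ finite_H]) (use perfect_matchings_Union[OF M] in blast)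
  then show "finite (nbrs M u)" unfolding nbrs_def by (rule finite_imageI)
  have "card (nbrs M u) \<le> card ?U" unfolding nbrs_def using fin by (rule card_image_le)
  also have "\<dots> \<le> 2 * card {h \<in> H. fst h = u}" by (rule card_Union_pairs_le[OF finite_H M]) auto
  also have "\<dots> \<le> 2 * K" using degree_le[OF u] by (simp add: deg_def)
  finally show "card (nbrs M u) \<le> 2 * K" .
qed

text \<open>Such a half-edge sits at an uninfected vertex next to an explored one, so
  \<open>stuck_bad\<close> provides a bad vertex at distance at most two, reached without passing
  through \<open>L\<close>. The terms with \<open>\<zeta>\<close> together are at most 0.\<close>

lemma stuck_potential:
  assumes M: "M \<in> perfect_matchings H" and X: "regular X"
    and stuck: "pending (graph_edges M) X (explore (graph_edges M) X t) = {}"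
  shows "potential M (explore (graph_edges M) X t) (bads M X t) \<le> 0"
proof -
  interpret exploration "graph_edges M" X by (rule exploration_graph_edges[OF finite_H M X])
  define W where "W = explore (graph_edges M) X t"
  define Bad where "Bad = {s. s < t \<and> bad_step (graph_edges M) X L \<epsilon> (counted M L) s}"
  \<comment> \<open>Every degree on the way is at most \<open>K\<close>; a neighbourhood counts up
    to \<open>2 * K\<close> vertices because \<open>nbrs\<close> contains both ends of each
    pair.\<close>
  define near where "near v = (\<Union>u\<in>insert v (nbrs M v) - L. nbrs M u) - L" for v
  have pairH: "p \<subseteq> H" if "p \<in> M" for p using perfect_matchings_Union[OF M] that by auto
  have finBad: "finite Bad" by (auto simp: Bad_def)
  have vL: "nv (V s) \<notin> L" if "s \<in> Bad" for s
    using that counted_Int[of M L] by (auto simp: Bad_def bad_step_def Let_def)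
  have one: "1 \<in> W" using stuck infected_1 by (auto simp: W_def pending_def)
  have sub: "{h \<in> unrevealed M L W. fst h \<in> discovered M L W} \<subseteq> (\<Union>s\<in>Bad. {h \<in> H. fst h \<in> near (nv (V s))})"
  proof
    fix h assume "h \<in> {h \<in> unrevealed M L W. fst h \<in> discovered M L W}"
    then have h: "h \<in> unrevealed M L W" "fst h \<in> discovered M L W" by auto
    have hH: "h \<in> H" and hW: "fst h \<notin> W" using h(1) unrevealed_subset[OF M] by (auto simp: unrevealed_def)
    from h(2) hW one obtain p where p: "p \<in> free_pairs M L" "fst h \<in> fst ` p" "fst ` p \<inter> W \<noteq> {}"
      by (auto simp: discovered_def)
    have pM: "p \<in> M" and pL: "fst ` p \<inter> L = {}" using p(1) by (auto simp: free_pairs_def)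
    obtain x where x: "x \<in> p" "fst x \<in> W" using p(3) by auto
    obtain y where y: "y \<in> p" "fst y = fst h" using p(2) by auto
    have xy: "p = {x, y}"
      using perfect_matchings_card[OF M pM] x y hW by (auto simp: card_2_iff)
    let ?u = "fst x" and ?w = "fst h"
    have uL: "?u \<notin> L" "?w \<notin> L" using pL x y by auto
    have "?u \<in> A \<union> L" using pairH[OF pM] x(1) ends_A by blast
    then have u0: "?u \<noteq> 0" using no_root by metis
    have e: "Matched p \<in> graph_edges M" "ends (Matched p) = {?u, ?w}"
      using pM xy y by (auto simp: graph_edges_def)
    obtain s where s: "s < t" "pend (V s) \<noteq> {}" "bad (graph_edges M) X L \<epsilon> (V s) (nv (V s))"
      and alt: "nv (V s) = ?u \<or> nv (V s) \<notin> L \<and> (\<exists>e'\<in>graph_edges M. ends e' = {?u, nv (V s)})"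
      using stuck_bad[OF stuck x(2)[unfolded W_def] u0 e(1,2)] hW uL unfolding W_def by blast
    let ?v = "nv (V s)"
    have "?v \<notin> V s" using next_vertex(1)[OF s(2)] by (simp add: pending_def)
    then have v0: "?v \<noteq> 0" using root_explored[of s] by metis
    have "?v \<in> counted M L \<and> ?u \<in> insert ?v (nbrs M ?v)"
    proof (cases "?v = ?u")
      case True
      then show ?thesis using p(1) x(1) by (auto simp: counted_def)
    next
      case False
      with alt obtain e' where e': "?v \<notin> L" "e' \<in> graph_edges M" "ends e' = {?u, ?v}" by blast
      then obtain p' where p': "p' \<in> M" "e' = Matched p'"
        using u0 v0 by (auto simp: graph_edges_def doubleton_eq_iff)
      have fp': "fst ` p' = {?u, ?v}" using e'(3) p'(2) by simp
      then have "p' \<in> free_pairs M L" using p'(1) uL(1) e'(1) by (auto simp: free_pairs_def)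
      moreover obtain z where z: "z \<in> p'" "fst z = ?v" using fp' by (metis imageE insertI1 insert_commute)
      moreover have "z \<in> H" using z(1) pairH[OF p'(1)] by auto
      ultimately have "p' \<inter> {h \<in> H. fst h = ?v} \<noteq> {}" by auto
      then have "?u \<in> nbrs M ?v" unfolding nbrs_def using p'(1) fp' by blast
      moreover have "?v \<in> counted M L" unfolding counted_def using \<open>p' \<in> free_pairs M L\<close> fp' by blast
      ultimately show ?thesis by simp
    qed
    then have "s \<in> Bad" "?u \<in> insert ?v (nbrs M ?v) - L"
      using s uL by (auto simp: Bad_def bad_step_def Let_def)
    moreover have "?w \<in> nbrs M ?u"
    proof -
      have "x \<in> p \<inter> {h \<in> H. fst h = ?u}" using x(1) pairH[OF pM] by auto
      then show ?thesis unfolding nbrs_def using pM p(2) by blast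
    qed
    ultimately show "h \<in> (\<Union>s\<in>Bad. {h \<in> H. fst h \<in> near (nv (V s))})"
      using hH uL(2) unfolding near_def by blast
  qed
  have near: "finite (near v)" "card (near v) \<le> (1 + 2 * K) * (2 * K)" if v: "v \<notin> L" for v
  proof -
    have fin: "finite (insert v (nbrs M v) - L)" using card_nbrs_le[OF M v] by auto
    have "finite (\<Union>u\<in>insert v (nbrs M v) - L. nbrs M u)" using fin card_nbrs_le[OF M] by auto
    then show "finite (near v)" by (simp add: near_def)
    have "card (near v) \<le> card (\<Union>u\<in>insert v (nbrs M v) - L. nbrs M u)"
      unfolding near_def using \<open>finite (\<Union>u\<in>insert v (nbrs M v) - L. nbrs M u)\<close> by (intro card_mono) auto
    also have "\<dots> \<le> (\<Sum>u\<in>insert v (nbrs M v) - L. card (nbrs M u))" using fin by (rule card_UN_le)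
    also have "\<dots> \<le> (\<Sum>u\<in>insert v (nbrs M v) - L. 2 * K)" using card_nbrs_le[OF M] by (intro sum_mono) auto
    also have "\<dots> = card (insert v (nbrs M v) - L) * (2 * K)" by simp
    also have "\<dots> \<le> (1 + 2 * K) * (2 * K)"
    proof (rule mult_le_mono1)
      have "card (insert v (nbrs M v) - L) \<le> card (insert v (nbrs M v))"
        using card_nbrs_le[OF M v] by (intro card_mono) auto
      also have "\<dots> \<le> Suc (card (nbrs M v))" by (rule card_insert_le_m1) auto
      also have "\<dots> \<le> 1 + 2 * K" using card_nbrs_le[OF M v] by simp
      finally show "card (insert v (nbrs M v) - L) \<le> 1 + 2 * K" .
    qed
    finally show "card (near v) \<le> (1 + 2 * K) * (2 * K)" .
  qed
  have "card {h \<in> unrevealed M L W. fst h \<in> discovered M L W} \<le> card (\<Union>s\<in>Bad. {h \<in> H. fst h \<in> near (nv (V s))})"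
    using sub finBad finite_H by (intro card_mono) auto
  also have "\<dots> \<le> (\<Sum>s\<in>Bad. card {h \<in> H. fst h \<in> near (nv (V s))})" using finBad by (rule card_UN_le)
  also have "\<dots> \<le> (\<Sum>s\<in>Bad. K * ((1 + 2 * K) * (2 * K)))"
  proof (rule sum_mono)
    fix s assume s: "s \<in> Bad"
    have "card {h \<in> H. fst h \<in> near (nv (V s))} \<le> K * card (near (nv (V s)))"
      using near[OF vL[OF s]] by (intro card_halves_le) (auto simp: near_def)
    also have "\<dots> \<le> K * ((1 + 2 * K) * (2 * K))" using near[OF vL[OF s]] by (intro mult_le_mono2)
    finally show "card {h \<in> H. fst h \<in> near (nv (V s))} \<le> K * ((1 + 2 * K) * (2 * K))" .
  qed
  also have "\<dots> = bads M X t * (K * ((1 + 2 * K) * (2 * K)))" by (simp add: num_bad_def Bad_def)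
  finally have "real (card {h \<in> unrevealed M L W. fst h \<in> discovered M L W}) \<le> real (bads M X t * (K * ((1 + 2 * K) * (2 * K))))"
    by (simp only: of_nat_le_iff)
  then have "real (card {h \<in> unrevealed M L W. fst h \<in> discovered M L W}) \<le> penalty * real (bads M X t)"
    by (simp add: penalty_def mult.commute)
  moreover have "\<zeta> * real (card (discovered M L W \<inter> W)) \<le> \<zeta> * real (card (discovered M L W))"
    using \<zeta> card_discovered_le(1)[OF M, of W] finite_explore[of t]
    by (intro mult_left_mono) (auto simp: W_def intro!: card_mono)
  ultimately show ?thesis unfolding potential_def weight_def W_def by simp
qed

text \<open>The value after the pairs of the next vertex are revealed but before its bonus and
  penalty are booked. It separates the randomness of the matching from that of the clocks.\<close>

definition half_step :: "half_edge set set \<Rightarrow> clocks \<Rightarrow> nat \<Rightarrow> real" where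
  "half_step M X t = (let E = graph_edges M; V = explore E X t; V' = insert (next_vertex E X V) V in
     if pending E X V = {} then potential M V (bads M X t)
     else weight \<zeta> (unrevealed M L V') (discovered M L V') + \<zeta> * real (card (discovered M L V \<inter> V)) - penalty * real (bads M X t))"

text \<open>Given the revealed pairs, the dynamics up to the next infection does not depend on the other
  pairs, which therefore form a uniform matching of the remaining half-edges.\<close>

lemma same_class:
  assumes M0: "M0 \<in> perfect_matchings H" and X: "regular X"
    and V: "V = explore (graph_edges M0) X t"
    and M: "M \<in> perfect_matchings H" "revealed M0 L V \<subseteq> M"
  shows "explore (graph_edges M) X t = V"
    "pending (graph_edges M) X V = {} \<longleftrightarrow> pending (graph_edges M0) X V = {}"
    "pending (graph_edges M0) X V \<noteq> {} \<Longrightarrow> next_vertex (graph_edges M) X V = next_vertex (graph_edges M0) X V"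
    "bads M X t = bads M0 X t"
proof -
  note cf = class_facts[OF M0 M]
  have A: "exploration (graph_edges M0) X" "exploration (graph_edges M) X"
    using exploration_graph_edges[OF finite_H _ X] M0 M(1) by auto
  have edges: "e \<in> graph_edges M0 \<longleftrightarrow> e \<in> graph_edges M" if t: "ends e \<inter> explore (graph_edges M0) X t \<noteq> {}" for e
  proof (cases e)
    case (Matched p)
    then have "fst ` p \<inter> (V \<union> L) \<noteq> {}" using t V by auto
    then have "p \<in> M0 \<longleftrightarrow> p \<in> revealed M0 L V" "p \<in> M \<longleftrightarrow> p \<in> revealed M L V" by (auto simp: revealed_def)
    then show ?thesis using Matched cf(1) by (auto simp: graph_edges_def)
  qed (simp add: graph_edges_def)
  note agree = exploration_agree[OF A, of t L "counted M0 L" "counted M L" for t, OF edges]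
  show "explore (graph_edges M) X t = V"
    unfolding V by (rule agree(1)) (auto simp: cf counted_Int)
  show "pending (graph_edges M) X V = {} \<longleftrightarrow> pending (graph_edges M0) X V = {}"
    unfolding V by (rule agree(2)) (auto simp: cf counted_Int)
  show "next_vertex (graph_edges M) X V = next_vertex (graph_edges M0) X V" if "pending (graph_edges M0) X V \<noteq> {}"
    using that unfolding V by (intro agree(3)) (auto simp: cf counted_Int)
  show "bads M X t = bads M0 X t"
    by (rule agree(5)) (auto simp: cf counted_Int)
qed

text \<open>The matchings are grouped by their revealed pairs. By \<open>same_class\<close> a group
  consists of all matchings containing these pairs, with common next vertex and common number of bad
  steps, so \<open>class_drift\<close> applies after a constant factor is pulled out.\<close>

lemma matching_step:
  assumes X: "regular X"
    and dr: "\<theta> * (real K + 3) ^ 2 * real (K * card A)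
      + (real K ^ 2 + 2 * real K) * (real K + 2 + 2 * real K * (real t + 1)) \<le> excess \<zeta>"
  shows "(\<Sum>M\<in>perfect_matchings H. exp (- \<theta> * half_step M X t))
    \<le> (\<Sum>M\<in>perfect_matchings H. exp (- \<theta> * potential M (explore (graph_edges M) X t) (bads M X t)))"
proof -
  let ?V = "\<lambda>M. explore (graph_edges M) X t"
  define key where "key M = revealed M L (?V M)" for M
  have finPM: "finite (perfect_matchings H)" using finite_H by (rule finite_perfect_matchings)
  have "(\<Sum>M\<in>perfect_matchings H. exp (- \<theta> * half_step M X t))
      = (\<Sum>y\<in>key ` perfect_matchings H. \<Sum>M\<in>{M \<in> perfect_matchings H. key M = y}. exp (- \<theta> * half_step M X t))"
    by (rule sum.image_gen[OF finPM])
  also have "\<dots> \<le> (\<Sum>y\<in>key ` perfect_matchings H. \<Sum>M\<in>{M \<in> perfect_matchings H. key M = y}. exp (- \<theta> * potential M (?V M) (bads M X t)))"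
  proof (rule sum_mono)
    fix y assume "y \<in> key ` perfect_matchings H"
    then obtain M0 where M0: "M0 \<in> perfect_matchings H" and y: "y = key M0" by blast
    define V where "V = ?V M0"
    define N where "N = bads M0 X t"
    have yV: "y = revealed M0 L V" by (simp add: y key_def V_def)
    interpret exploration "graph_edges M0" X by (rule exploration_graph_edges[OF finite_H M0 X])
    note sc = same_class[OF M0 X V_def]
    let ?C = "{M \<in> perfect_matchings H. y \<subseteq> M}"
    have cls: "{M \<in> perfect_matchings H. key M = y} = ?C"
    proof
      show "{M \<in> perfect_matchings H. key M = y} \<subseteq> ?C" by (auto simp: key_def revealed_def)
      show "?C \<subseteq> {M \<in> perfect_matchings H. key M = y}"
      proof
        fix M assume "M \<in> ?C"
        then have M: "M \<in> perfect_matchings H" "revealed M0 L V \<subseteq> M" by (auto simp: yV)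
        have "key M = y" unfolding key_def sc(1)[OF M] yV by (rule class_facts(1)[OF M0 M])
        then show "M \<in> {M \<in> perfect_matchings H. key M = y}" using M by simp
      qed
    qed
    have V_M: "?V M = V" "bads M X t = N" "discovered M L V = discovered M0 L V"
      "pending (graph_edges M) X V = {} \<longleftrightarrow> pend V = {}"
      "pend V \<noteq> {} \<Longrightarrow> next_vertex (graph_edges M) X V = nv V" if "M \<in> ?C" for M
      using that sc[of M] class_facts[OF M0, of M V] by (auto simp: yV N_def)
    have "(\<Sum>M\<in>?C. exp (- \<theta> * half_step M X t)) \<le> (\<Sum>M\<in>?C. exp (- \<theta> * potential M (?V M) (bads M X t)))"
    proof (cases "pend V = {}")
      case True
      then have "half_step M X t = potential M (?V M) (bads M X t)" if "M \<in> ?C" for M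
        using V_M[OF that] by (simp add: half_step_def Let_def)
      then show ?thesis by (intro sum_mono) simp
    next
      case False
      define v where "v = nv V"
      define c where "c = \<zeta> * real (card (discovered M0 L V \<inter> V)) - penalty * real N"
      have vV: "v \<notin> V" using next_vertex(1)[OF False] by (auto simp: v_def pending_def)
      have half: "half_step M X t = weight \<zeta> (unrevealed M L (insert v V)) (discovered M L (insert v V)) + c"
        and full: "potential M (?V M) (bads M X t) = weight \<zeta> (unrevealed M L V) (discovered M L V) + c" if "M \<in> ?C" for M
        using V_M[OF that] False by (auto simp: half_step_def potential_def Let_def v_def c_def)
      have "(\<Sum>M\<in>?C. exp (- \<theta> * weight \<zeta> (unrevealed M L (insert v V)) (discovered M L (insert v V))))
          \<le> (\<Sum>M\<in>?C. exp (- \<theta> * weight \<zeta> (unrevealed M L V) (discovered M L V)))"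
      \<comment> \<open>A vertex of \<open>L\<close> meets no free pair, so exploring it reveals
        nothing new.\<close>
      proof (cases "v \<in> L")
        case True
        then have "fst ` p \<inter> insert v V = fst ` p \<inter> V" if "p \<in> free_pairs M L" for p M
          using that by (auto simp: free_pairs_def)
        then have "unrevealed M L (insert v V) = unrevealed M L V" "discovered M L (insert v V) = discovered M L V" for M
          unfolding unrevealed_def discovered_def by (auto cong: conj_cong)
        then show ?thesis by simp
      next
        case False
        \<comment> \<open>The root is explored from the start, hence \<open>real t + 1\<close> in
          \<open>dr\<close>.\<close>
        have "card V = Suc t" unfolding V_def using \<open>pend V \<noteq> {}\<close> by (intro card_explore) (simp add: V_def)
        then show ?thesis
          unfolding yV using dr vV False \<zeta> \<theta> finite_explore[of t]
          by (intro class_drift M0) (auto simp: V_def add.commute)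
      qed
      then have "exp (- \<theta> * c) * (\<Sum>M\<in>?C. exp (- \<theta> * weight \<zeta> (unrevealed M L (insert v V)) (discovered M L (insert v V))))
          \<le> exp (- \<theta> * c) * (\<Sum>M\<in>?C. exp (- \<theta> * weight \<zeta> (unrevealed M L V) (discovered M L V)))"
        by (intro mult_left_mono) auto
      moreover have e: "exp (- \<theta> * (w + c)) = exp (- \<theta> * c) * exp (- \<theta> * w)" for w
        by (simp add: distrib_left mult_exp_exp add.commute)
      have "(\<Sum>M\<in>?C. exp (- \<theta> * half_step M X t))
          = exp (- \<theta> * c) * (\<Sum>M\<in>?C. exp (- \<theta> * weight \<zeta> (unrevealed M L (insert v V)) (discovered M L (insert v V))))"
        unfolding sum_distrib_left by (rule sum.cong[OF refl]) (simp only: half e)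
      moreover have "(\<Sum>M\<in>?C. exp (- \<theta> * potential M (?V M) (bads M X t)))
          = exp (- \<theta> * c) * (\<Sum>M\<in>?C. exp (- \<theta> * weight \<zeta> (unrevealed M L V) (discovered M L V)))"
        unfolding sum_distrib_left by (rule sum.cong[OF refl]) (simp only: full e)
      ultimately show ?thesis by (simp only:)
    qed
    then show "(\<Sum>M\<in>{M \<in> perfect_matchings H. key M = y}. exp (- \<theta> * half_step M X t))
      \<le> (\<Sum>M\<in>{M \<in> perfect_matchings H. key M = y}. exp (- \<theta> * potential M (?V M) (bads M X t)))"
      by (simp only: cls)
  qed
  also have "\<dots> = (\<Sum>M\<in>perfect_matchings H. exp (- \<theta> * potential M (?V M) (bads M X t)))"
    by (rule sum.image_gen[OF finPM, symmetric])
  finally show ?thesis .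
qed

end

subsection \<open>Measurability of the exploration\<close>

locale finite_graph =
  fixes E :: "edge set"
  assumes finite_edges: "finite E" and finite_end_vertices: "finite (\<Union> (ends ` E))"
begin

lemma exploration_regularize: "exploration E (regularize X)"
  using finite_edges finite_end_vertices regular_regularize by unfold_locales

lemma config_measurable [measurable]:
  "Measurable.pred clock_space (\<lambda>X. chase_escape E (regularize X) t v = c)"
  using measurable_compose[OF regularize_measurable chase_escape_measurable[OF finite_edges, of "\<lambda>_. t" v c]]
  by simp

lemma infected_measurable [measurable]: "Measurable.pred clock_space (\<lambda>X. infected E (regularize X) v)"
proof -
  have "infected E (regularize X) v \<longleftrightarrow> (\<exists>n::nat. \<not> chase_escape E (regularize X) (real n) v = White)" for X
  proof -
    interpret exploration E "regularize X" by (rule exploration_regularize)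
    show ?thesis
    proof
      assume v: "infected E (regularize X) v"
      obtain n where "T v \<le> real n" using real_arch_simple by blast
      then show "\<exists>n::nat. \<not> config (real n) v = White" using nonwhite_iff[of "real n" v] v by auto
    next
      assume "\<exists>n::nat. \<not> config (real n) v = White"
      then show "infected E (regularize X) v" unfolding infected_def by (metis of_nat_0_le_iff)
    qed
  qed
  then show ?thesis by simp
qed

lemma inf_time_measurable [measurable]: "(\<lambda>X. inf_time E (regularize X) v) \<in> borel_measurable clock_space"
proof (rule borel_measurableI_le)
  fix a :: real
  have "inf_time E (regularize X) v \<le> a \<longleftrightarrow>
      (infected E (regularize X) v \<and> 0 \<le> a \<and> \<not> chase_escape E (regularize X) a v = White)
      \<or> (\<not> infected E (regularize X) v \<and> Inf {} \<le> a)" for X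
  proof -
    interpret exploration E "regularize X" by (rule exploration_regularize)
    show ?thesis
    proof (cases "infected E (regularize X) v")
      case True
      then show ?thesis using nonwhite_iff[of a v] inf_time_nonneg[of v] by (cases "0 \<le> a") auto
    next
      case False
      then have "{t. 0 \<le> t \<and> config t v \<noteq> White} = {}" by (auto simp: infected_def)
      then have "T v = Inf {}" by (simp only: inf_time_def)
      then show ?thesis using False by simp
    qed
  qed
  then show "{X \<in> space clock_space. inf_time E (regularize X) v \<le> a} \<in> sets clock_space" by simp
qed

definition is_next :: "vertex set \<Rightarrow> vertex \<Rightarrow> clocks \<Rightarrow> bool" where
  "is_next W v Y \<longleftrightarrow> pending E Y W \<noteq> {} \<and> next_vertex E Y W = v"

text \<open>Pending sets and minimisers are rewritten with quantifiers over the countable type of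
  vertices, so that the event is visibly measurable.\<close>

lemma is_next_iff:
  fixes W v and Y :: clocks
  defines "P \<equiv> \<lambda>v. (infected E Y v \<and> v \<notin> W) \<and> (\<forall>w. infected E Y w \<and> w \<notin> W \<longrightarrow> inf_time E Y v \<le> inf_time E Y w)"
  assumes "regular Y"
  shows "is_next W v Y \<longleftrightarrow> P v \<and> (\<forall>u<v. \<not> P u)"
proof -
  interpret exploration E Y
    using finite_edges finite_end_vertices assms(2) by unfold_locales
  have P: "P v \<longleftrightarrow> v \<in> pend W \<and> (\<forall>w\<in>pend W. T v \<le> T w)" for v
    by (auto simp: P_def pending_def)
  have nx: "nv W = (LEAST v. P v)" by (simp only: next_vertex_def P)
  show ?thesis
  proof
    assume a: "is_next W v Y"
    then have ne: "pend W \<noteq> {}" and eq: "nv W = v" by (auto simp: is_next_def)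
    have "P v" unfolding P using next_vertex[OF ne] eq by auto
    moreover have "\<not> P u" if "u < v" for u using that not_less_Least[of u P] eq nx by simp
    ultimately show "P v \<and> (\<forall>u<v. \<not> P u)" by blast
  next
    assume a: "P v \<and> (\<forall>u<v. \<not> P u)"
    then have "(LEAST v. P v) = v" by (intro Least_equality) (auto simp: not_less[symmetric])
    moreover have "pend W \<noteq> {}" using a unfolding P by auto
    ultimately show "is_next W v Y" by (simp add: is_next_def nx)
  qed
qed

lemma is_next_measurable [measurable]: "Measurable.pred clock_space (\<lambda>X. is_next W v (regularize X))"
  unfolding is_next_iff[OF regular_regularize] by measurable

lemma stuck_measurable [measurable]: "Measurable.pred clock_space (\<lambda>X. pending E (regularize X) W = {})"
proof -
  have "pending E Y W = {} \<longleftrightarrow> (\<forall>v. \<not> (infected E Y v \<and> v \<notin> W))" for Y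
    by (auto simp: pending_def)
  then show ?thesis by simp
qed

lemma explore_measurable [measurable]: "Measurable.pred clock_space (\<lambda>X. explore E (regularize X) t = W)"
proof (induction t arbitrary: W)
  case (Suc t)
  note [measurable] = Suc
  have "explore E (regularize X) (Suc t) = W \<longleftrightarrow>
      (\<exists>U\<in>{U. finite U}. explore E (regularize X) t = U \<and> (pending E (regularize X) U = {} \<and> U = W
        \<or> (\<exists>v. is_next U v (regularize X) \<and> insert v U = W)))" for X
  proof -
    interpret exploration E "regularize X" by (rule exploration_regularize)
    show ?thesis using finite_explore[of t] by (auto simp: explore_Suc is_next_def)
  qed
  moreover have "Measurable.pred clock_space (\<lambda>X. \<exists>U\<in>{U. finite U}. explore E (regularize X) t = U \<and>
      (pending E (regularize X) U = {} \<and> U = W \<or> (\<exists>v. is_next U v (regularize X) \<and> insert v U = W)))"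
    by (intro pred_Bex_countable countable_Collect_finite) measurable
  ultimately show ?case by simp
qed simp

lemma arrival_between_measurable [measurable]:
  assumes [measurable]: "\<tau> \<in> borel_measurable clock_space"
  shows "Measurable.pred clock_space (\<lambda>X. arrivals (regularize X) e c \<inter> {\<tau> X<..\<tau> X + d} = {})"
proof -
  have [measurable]: "(\<lambda>X. clock_sum (regularize X) e c k) \<in> borel_measurable clock_space" for k
    using measurable_compose[OF regularize_measurable clock_sum_measurable] .
  have "arrivals Y e c \<inter> {a<..b} = {} \<longleftrightarrow> (\<forall>k. \<not> (a < clock_sum Y e c (Suc k) \<and> clock_sum Y e c (Suc k) \<le> b))" for Y and a b :: real
    by (auto simp: arrivals_eq disjoint_iff)
  then show ?thesis by simp
qed

lemma bad_measurable [measurable]: "Measurable.pred clock_space (\<lambda>X. bad E (regularize X) L \<epsilon> W v)"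
proof -
  have "Measurable.pred clock_space (\<lambda>X. \<exists>e\<in>E. \<exists>z. z \<in> L \<union> W \<and> z \<noteq> v \<and> ends e = {z, v} \<and>
        \<not> arrivals (regularize X) e Chase \<inter> {inf_time E (regularize X) v<..inf_time E (regularize X) v + \<epsilon>} = {})"
    using finite_edges by (intro pred_intros_finite(4)) measurable
  moreover have "Measurable.pred clock_space (\<lambda>X. \<exists>e\<in>E. \<exists>w. w \<notin> L \<union> W \<union> {v} \<and> ends e = {v, w} \<and>
        arrivals (regularize X) e Spread \<inter> {inf_time E (regularize X) v<..inf_time E (regularize X) v + \<epsilon>} = {})"
    using finite_edges by (intro pred_intros_finite(4)) measurable
  ultimately show ?thesis unfolding bad_def Bex_def by (rule pred_intros_logic(5))
qed

lemma num_bad_measurable [measurable]: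
  "(\<lambda>X. num_bad E (regularize X) L \<epsilon> C t) \<in> measurable clock_space (count_space UNIV)"
proof (induction t)
  case (Suc t)
  have "bad_step E (regularize X) L \<epsilon> C t \<longleftrightarrow> (\<exists>U\<in>{U. finite U}. explore E (regularize X) t = U \<and>
      (\<exists>v. is_next U v (regularize X) \<and> v \<in> C \<and> bad E (regularize X) L \<epsilon> U v))" for X
  proof -
    interpret exploration E "regularize X" by (rule exploration_regularize)
    show ?thesis using finite_explore[of t] by (auto simp: bad_step_def is_next_def Let_def)
  qed
  moreover have "Measurable.pred clock_space (\<lambda>X. \<exists>U\<in>{U. finite U}. explore E (regularize X) t = U \<and>
      (\<exists>v. is_next U v (regularize X) \<and> v \<in> C \<and> bad E (regularize X) L \<epsilon> U v))"
    by (intro pred_Bex_countable countable_Collect_finite) measurable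
  ultimately have [measurable]: "Measurable.pred clock_space (\<lambda>X. bad_step E (regularize X) L \<epsilon> C t)" by simp
  note [measurable] = Suc
  show ?case unfolding num_bad_Suc by measurable
qed simp

lemma arrivals_regularize_cong:
  assumes "\<And>e' c' k. (e', c') \<noteq> (e, c) \<Longrightarrow> X (e', c', k) = X' (e', c', k)" "(e', c') \<noteq> (e, c)"
  shows "arrivals (regularize X) e' c' = arrivals (regularize X') e' c'"
  using assms by (intro arrivals_cong regularize_cong) blast

text \<open>The clocks that decide whether the next vertex is bad are fresh.\<close>

lemma exploration_clock_free:
  assumes v: "v \<notin> L" "C \<inter> L = {}"
    and fresh: "c = Chase \<and> (\<exists>z. ends e = {z, v}) \<or> c = Spread \<and> (\<exists>w. w \<notin> W \<and> ends e = {v, w})"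
  shows "clock_free e c (\<lambda>X. if explore E (regularize X) t = W \<and> is_next W v (regularize X)
    then Some (num_bad E (regularize X) L \<epsilon> C t, inf_time E (regularize X) v) else None)"
  unfolding clock_free_def
proof (intro allI impI)
  fix X X' :: clocks
  assume "\<forall>e' c' k. (e', c') \<noteq> (e, c) \<longrightarrow> X (e', c', k) = X' (e', c', k)"
  then have agr: "\<And>e' c' k. (e', c') \<noteq> (e, c) \<Longrightarrow> X (e', c', k) = X' (e', c', k)" by blast
  \<comment> \<open>One direction suffices by symmetry. A \<open>Chase\<close> clock at
    \<open>v\<close> belongs to no edge inside \<open>W\<close> or between \<open>W - L\<close> and
    \<open>L\<close>, because \<open>v\<close> lies in none of these sets; a \<open>Spread\<close>
    clock from \<open>v\<close> to an unexplored vertex belongs to no edge that meets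
    \<open>W\<close>.\<close>
  have one: "explore E (regularize X') t = W \<and> is_next W v (regularize X') \<and>
      num_bad E (regularize X') L \<epsilon> C t = num_bad E (regularize X) L \<epsilon> C t \<and>
      inf_time E (regularize X') v = inf_time E (regularize X) v"
    if agr: "\<And>e' c' k. (e', c') \<noteq> (e, c) \<Longrightarrow> X (e', c', k) = X' (e', c', k)"
      and h: "explore E (regularize X) t = W" "is_next W v (regularize X)" for X X' :: clocks
  proof -
    interpret exploration E "regularize X" by (rule exploration_regularize)
    have vW: "v \<notin> W" using h next_vertex(1)[of W] by (auto simp: is_next_def pending_def)
    have sp: "arrivals (regularize X) e' Spread = arrivals (regularize X') e' Spread" if "ends e' \<inter> W \<noteq> {}" for e'
      using fresh that vW by (intro arrivals_regularize_cong[where e = e and c = c and X = X and X' = X', OF agr]) auto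
    have ch: "arrivals (regularize X) e' Chase = arrivals (regularize X') e' Chase"
      if "ends e' \<subseteq> W \<or> ends e' \<inter> (W - L) \<noteq> {} \<and> ends e' \<inter> L \<noteq> {}" for e'
    proof (rule arrivals_regularize_cong[where e = e and c = c and X = X and X' = X', OF agr])
      show "(e', Chase) \<noteq> (e, c)"
      proof
        assume "(e', Chase) = (e, c)"
        then obtain z where "ends e' = {z, v}" using fresh by auto
        then show False using that vW v(1) by auto
      qed
    qed
    note agree = exploration_agree[OF exploration_regularize[of X] exploration_regularize[of X'],
        of t L C C, unfolded h(1)]
    have p: "pend W \<noteq> {}" "nv W = v" using h(2) by (auto simp: is_next_def)
    have "explore E (regularize X') t = W" by (rule agree(1)) (use sp ch v(2) in auto)
    moreover have "pending E (regularize X') W = {} \<longleftrightarrow> pend W = {}" by (rule agree(2)) (use sp ch v(2) in auto)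
    moreover have "next_vertex E (regularize X') W = nv W" by (rule agree(3)) (use sp ch v(2) p(1) in auto)
    moreover have "inf_time E (regularize X') (nv W) = T (nv W)" by (rule agree(4)) (use sp ch v(2) p(1) in auto)
    moreover have "num_bad E (regularize X') L \<epsilon> C t = num_bad E (regularize X) L \<epsilon> C t"
      by (rule agree(5)) (use sp ch v(2) in auto)
    ultimately show ?thesis using p by (auto simp: is_next_def)
  qed
  show "(if explore E (regularize X) t = W \<and> is_next W v (regularize X)
      then Some (num_bad E (regularize X) L \<epsilon> C t, inf_time E (regularize X) v) else None)
    = (if explore E (regularize X') t = W \<and> is_next W v (regularize X')
      then Some (num_bad E (regularize X') L \<epsilon> C t, inf_time E (regularize X') v) else None)"
    using one[of X X'] one[of X' X] agr by (metis (no_types, lifting))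
qed

end

section \<open>The probability that the next vertex is bad\<close>

lemma nn_integral_exponential_greater:
  assumes "0 < r" "0 \<le> a"
  shows "(\<integral>\<^sup>+y. indicator {a<..} y \<partial>exponential r) = ennreal (exp (- r * a))"
  using exponential_memoryless[of "\<lambda>_. 1" r a] assms
    prob_space.emeasure_space_1[OF prob_space_exponential_density[OF assms(1)]]
  by simp

lemma nn_integral_exponential_atMost:
  assumes "0 < r" "0 \<le> a"
  shows "(\<integral>\<^sup>+y. indicator {..a} y \<partial>exponential r) = ennreal (1 - exp (- r * a))"
proof -
  interpret prob_space "exponential r" using assms(1) by (rule prob_space_exponential_density)
  have "(\<integral>\<^sup>+y. indicator {a<..} y \<partial>exponential r) + (\<integral>\<^sup>+y. indicator {..a} y \<partial>exponential r)
      = (\<integral>\<^sup>+y. indicator {a<..} y + indicator {..a} y \<partial>exponential r)"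
    by (rule nn_integral_add[symmetric]) auto
  also have "\<dots> = (\<integral>\<^sup>+y. 1 \<partial>exponential r)"
    by (intro nn_integral_cong) (auto simp: indicator_def)
  also have "\<dots> = 1" using emeasure_space_1 by simp
  finally have eq: "ennreal (exp (- r * a)) + (\<integral>\<^sup>+y. indicator {..a} y \<partial>exponential r) = 1"
    by (simp only: nn_integral_exponential_greater[OF assms])
  have "(\<integral>\<^sup>+y. indicator {..a} y \<partial>exponential r) = 1 - ennreal (exp (- r * a))"
    unfolding eq[symmetric] by simp
  also have "\<dots> = ennreal (1 - exp (- r * a))"
    by (simp add: ennreal_minus[symmetric])
  finally show ?thesis .
qed

context matching_exploration
begin

lemma finite_graph_edges_locale:
  assumes "M \<in> perfect_matchings H"
  shows "finite_graph (graph_edges M)"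
proof -
  interpret exploration "graph_edges M" "regularize X" for X
    by (rule exploration_graph_edges[OF finite_H assms regular_regularize])
  show ?thesis using finite_E finite_ends by unfold_locales
qed

lemma card_incident_edges_le:
  assumes M: "M \<in> perfect_matchings H" and v: "v \<notin> L"
  shows "finite {e \<in> graph_edges M. v \<in> ends e}" "card {e \<in> graph_edges M. v \<in> ends e} \<le> K + 1"
proof -
  let ?P = "{p \<in> M. p \<inter> {h \<in> H. fst h = v} \<noteq> {}}"
  have finM: "finite M" by (rule finite_UnionD) (simp add: perfect_matchings_Union[OF M] finite_H)
  have "{e \<in> graph_edges M. v \<in> ends e} \<subseteq> insert Root (Matched ` ?P)"
  proof
    fix e assume "e \<in> {e \<in> graph_edges M. v \<in> ends e}"
    then have e: "e \<in> graph_edges M" "v \<in> ends e" by auto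
    show "e \<in> insert Root (Matched ` ?P)"
    proof (cases e)
      case (Matched p)
      then have "p \<in> M" "v \<in> fst ` p" using e by (auto simp: graph_edges_def)
      then have "p \<in> ?P" using perfect_matchings_Union[OF M] by blast
      then show ?thesis using Matched by blast
    qed simp
  qed
  moreover have fin: "finite (insert Root (Matched ` ?P))" using finM by simp
  ultimately show "finite {e \<in> graph_edges M. v \<in> ends e}" by (rule finite_subset)
  have "card {e \<in> graph_edges M. v \<in> ends e} \<le> card (insert Root (Matched ` ?P))"
    using fin \<open>_ \<subseteq> _\<close> by (rule card_mono)
  also have "\<dots> \<le> Suc (card (Matched ` ?P))" by (rule card_insert_le_m1) auto
  also have "card (Matched ` ?P) \<le> card ?P" using finM by (intro card_image_le) auto
  also have "card ?P \<le> K"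
  proof -
    have "card ?P = (\<Sum>p\<in>?P. 1)" by simp
    also have "\<dots> \<le> (\<Sum>p\<in>?P. card (p \<inter> {h \<in> H. fst h = v}))"
    proof (rule sum_mono)
      fix p assume "p \<in> ?P"
      moreover have "finite (p \<inter> {h \<in> H. fst h = v})" using finite_H by auto
      ultimately have "0 < card (p \<inter> {h \<in> H. fst h = v})" by (simp only: card_gt_0_iff mem_Collect_eq) blast
      then show "1 \<le> card (p \<inter> {h \<in> H. fst h = v})" by simp
    qed
    also have "\<dots> \<le> (\<Sum>p\<in>M. card (p \<inter> {h \<in> H. fst h = v}))" using finM by (intro sum_mono2) auto
    also have "\<dots> = card {h \<in> H. fst h = v}" by (rule card_sum_pairs[OF finite_H M, symmetric]) auto
    also have "\<dots> \<le> K" using degree_le[OF v] by (simp add: deg_def)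
    finally show ?thesis .
  qed
  finally show "card {e \<in> graph_edges M. v \<in> ends e} \<le> K + 1" by simp
qed

text \<open>Union bound over at most \<open>K\<close> matched edges and \<open>Root\<close>: blue
  rings within time \<open>\<epsilon>\<close>, or the infection fails to ring within that
  time.\<close>

definition \<eta> :: "real \<Rightarrow> real" where
  "\<eta> l = (real K + 1) * ((1 - exp (- \<epsilon>)) + exp (- l * \<epsilon>))"

text \<open>The history up to the infection of \<open>v\<close> does not involve the clocks that
  \<open>bad\<close> tests, so each of them contributes its plain exponential probability. The
  function \<open>g\<close> carries the history, including earlier bad steps, so that the bound can
  be used under the supermartingale.\<close>

lemma nn_integral_bad_le:
  fixes t :: nat and W :: "vertex set" and h :: "nat \<Rightarrow> real"
  assumes l: "0 < l" and \<epsilon>: "0 < \<epsilon>" and M: "M \<in> perfect_matchings H" and v: "v \<in> counted M L"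
    and h: "\<And>N. 0 \<le> h N"
  defines "E \<equiv> graph_edges M"
  defines "g \<equiv> \<lambda>X. if explore E (regularize X) t = W \<and> finite_graph.is_next E W v (regularize X)
      then ennreal (h (bads M (regularize X) t)) else 0"
  shows "(\<integral>\<^sup>+X. g X * indicator {X. bad E (regularize X) L \<epsilon> W v} X \<partial>clock_measure l)
    \<le> ennreal (\<eta> l) * (\<integral>\<^sup>+X. g X \<partial>clock_measure l)"
proof -
  let ?P = "clock_measure l"
  interpret finite_graph E unfolding E_def by (rule finite_graph_edges_locale[OF M])
  have vL: "v \<notin> L" using v counted_Int[of M L] by auto
  define F where "F X = (if explore E (regularize X) t = W \<and> is_next W v (regularize X)
    then Some (num_bad E (regularize X) L \<epsilon> (counted M L) t, inf_time E (regularize X) v) else None)" for X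
  \<comment> \<open>Setting the time to 0 off the event keeps it nonnegative and makes both
    \<open>g\<close> and \<open>\<tau>\<close> functions of \<open>F\<close>, so their invariance
    follows from that of \<open>F\<close>.\<close>
  define \<tau> where "\<tau> X = (if explore E (regularize X) t = W \<and> is_next W v (regularize X)
    then inf_time E (regularize X) v else 0)" for X
  have gF: "g = (\<lambda>X. case F X of None \<Rightarrow> 0 | Some (N, s) \<Rightarrow> ennreal (h N))"
    and \<tau>F: "\<tau> = (\<lambda>X. case F X of None \<Rightarrow> 0 | Some (N, s) \<Rightarrow> s)"
    by (auto simp: fun_eq_iff g_def \<tau>_def F_def E_def)
  have [measurable]: "(\<lambda>X. num_bad E (regularize X) L \<epsilon> (counted M L) t) \<in> measurable clock_space (count_space UNIV)"
    by measurable
  have [measurable]: "(\<lambda>X. h (num_bad E (regularize X) L \<epsilon> (counted M L) t)) \<in> borel_measurable clock_space"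
    by (rule measurable_compose[OF num_bad_measurable]) simp
  have gm [measurable]: "g \<in> borel_measurable clock_space" unfolding g_def E_def[symmetric] by measurable
  have \<tau>m [measurable]: "\<tau> \<in> borel_measurable clock_space" unfolding \<tau>_def by measurable
  have \<tau>0: "0 \<le> \<tau> X" for X
  proof -
    interpret exploration E "regularize X" by (rule exploration_regularize)
    show ?thesis using next_vertex(1)[of W] inf_time_nonneg[of v] by (auto simp: \<tau>_def is_next_def pending_def)
  qed
  have free: "clock_free e c g" "clock_free e c \<tau>"
    if "c = Chase \<and> (\<exists>z. ends e = {z, v}) \<or> c = Spread \<and> (\<exists>w. w \<notin> W \<and> ends e = {v, w})" for e c
  proof -
    have "clock_free e c F" unfolding F_def by (rule exploration_clock_free[OF vL counted_Int that])
    then show "clock_free e c g" "clock_free e c \<tau>" unfolding gF \<tau>F by (rule clock_free_comp)+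
  qed
  have reg: "regular_clock (regularize X) e c" for X e c using regular_regularize by (simp add: regular_def)
  let ?J = "{e \<in> E. v \<in> ends e}"
  have J: "finite ?J" "card ?J \<le> K + 1" using card_incident_edges_le[OF M vL] by (auto simp: E_def)
  define a where "a e X = (if \<exists>z\<in>L \<union> W. z \<noteq> v \<and> ends e = {z, v}
    then indicator {..\<epsilon>} (next_ring (regularize X) e Chase (\<tau> X) - \<tau> X) else 0 :: ennreal)" for e X
  define s where "s e X = (if \<exists>w. w \<notin> L \<union> W \<union> {v} \<and> ends e = {v, w}
    then indicator {\<epsilon><..} (next_ring (regularize X) e Spread (\<tau> X) - \<tau> X) else 0 :: ennreal)" for e X
  have [measurable]: "a e \<in> borel_measurable clock_space" "s e \<in> borel_measurable clock_space" for e
    unfolding a_def s_def by measurable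
  have le: "g X * indicator {X. bad E (regularize X) L \<epsilon> W v} X \<le> (\<Sum>e\<in>?J. g X * a e X + g X * s e X)" for X
  proof (cases "explore E (regularize X) t = W \<and> is_next W v (regularize X) \<and> bad E (regularize X) L \<epsilon> W v")
    case True
    then have T: "inf_time E (regularize X) v = \<tau> X" by (simp add: \<tau>_def)
    have iff: "arrivals (regularize X) e c \<inter> {\<tau> X<..\<tau> X + \<epsilon>} = {} \<longleftrightarrow> \<epsilon> < next_ring (regularize X) e c (\<tau> X) - \<tau> X" for e c
      using no_arrival_iff[OF reg \<tau>0, of X e c X \<epsilon>] by (simp add: less_diff_eq add.commute)
    from True[unfolded bad_def T iff] obtain e where e: "e \<in> ?J" "1 \<le> a e X + s e X"
    proof -
      from True have "bad E (regularize X) L \<epsilon> W v" by simp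
      then consider e z where "e \<in> E" "z \<in> L \<union> W" "z \<noteq> v" "ends e = {z, v}" "\<not> \<epsilon> < next_ring (regularize X) e Chase (\<tau> X) - \<tau> X"
        | e w where "e \<in> E" "w \<notin> L \<union> W \<union> {v}" "ends e = {v, w}" "\<epsilon> < next_ring (regularize X) e Spread (\<tau> X) - \<tau> X"
        unfolding bad_def T iff by blast
      then show ?thesis
      proof cases
        case 1
        then have "a e X = 1" by (auto simp: a_def)
        then show ?thesis using 1 by (intro that[of e]) auto
      next
        case 2
        then have "s e X = 1" by (auto simp: s_def)
        then show ?thesis using 2 by (intro that[of e]) auto
      qed
    qed
    have "g X * indicator {X. bad E (regularize X) L \<epsilon> W v} X \<le> g X * (a e X + s e X)"
      using e(2) True by (intro mult_left_mono) auto
    also have "\<dots> = g X * a e X + g X * s e X" by (simp add: distrib_left)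
    also have "\<dots> \<le> (\<Sum>e\<in>?J. g X * a e X + g X * s e X)"
      using J(1) e(1) by (intro member_le_sum[where f = "\<lambda>e. g X * a e X + g X * s e X"]) auto
    finally show ?thesis .
  qed (auto simp: g_def E_def)
  have int_a: "(\<integral>\<^sup>+X. g X * a e X \<partial>?P) \<le> (\<integral>\<^sup>+X. g X \<partial>?P) * ennreal (1 - exp (- \<epsilon>))" for e
  proof (cases "\<exists>z\<in>L \<union> W. z \<noteq> v \<and> ends e = {z, v}")
    case True
    then have "(\<integral>\<^sup>+X. g X * a e X \<partial>?P) = (\<integral>\<^sup>+X. g X * indicator {..\<epsilon>} (next_ring (regularize X) e Chase (\<tau> X) - \<tau> X) \<partial>?P)"
      by (simp add: a_def)
    also have "\<dots> = (\<integral>\<^sup>+X. g X \<partial>?P) * (\<integral>\<^sup>+y. indicator {..\<epsilon>} y \<partial>exponential (rate l Chase))"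
      using True by (intro fresh_clock_regularize[OF l] gm \<tau>m free \<tau>0) auto
    also have "(\<integral>\<^sup>+y. indicator {..\<epsilon>} y \<partial>exponential (rate l Chase)) = ennreal (1 - exp (- \<epsilon>))"
      using nn_integral_exponential_atMost[of 1 \<epsilon>] \<epsilon> by simp
    finally show ?thesis by simp
  next
    case False
    then have "g X * a e X = 0" for X by (simp only: a_def if_False mult_zero_right)
    then show ?thesis by (simp only: nn_integral_0_iff_AE nn_integral_const mult_zero_left zero_le)
  qed
  have int_s: "(\<integral>\<^sup>+X. g X * s e X \<partial>?P) \<le> (\<integral>\<^sup>+X. g X \<partial>?P) * ennreal (exp (- l * \<epsilon>))" for e
  proof (cases "\<exists>w. w \<notin> L \<union> W \<union> {v} \<and> ends e = {v, w}")
    case True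
    then have "(\<integral>\<^sup>+X. g X * s e X \<partial>?P) = (\<integral>\<^sup>+X. g X * indicator {\<epsilon><..} (next_ring (regularize X) e Spread (\<tau> X) - \<tau> X) \<partial>?P)"
      by (simp add: s_def)
    also have "\<dots> = (\<integral>\<^sup>+X. g X \<partial>?P) * (\<integral>\<^sup>+y. indicator {\<epsilon><..} y \<partial>exponential (rate l Spread))"
      using True by (intro fresh_clock_regularize[OF l] gm \<tau>m free \<tau>0) auto
    also have "(\<integral>\<^sup>+y. indicator {\<epsilon><..} y \<partial>exponential (rate l Spread)) = ennreal (exp (- l * \<epsilon>))"
      using nn_integral_exponential_greater[of l \<epsilon>] \<epsilon> l by simp
    finally show ?thesis by simp
  next
    case False
    then have "g X * s e X = 0" for X by (simp only: s_def if_False mult_zero_right)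
    then show ?thesis by (simp only: nn_integral_0_iff_AE nn_integral_const mult_zero_left zero_le)
  qed
  have e1: "0 \<le> 1 - exp (- \<epsilon>)" using \<epsilon> by simp
  have "(\<integral>\<^sup>+X. g X * indicator {X. bad E (regularize X) L \<epsilon> W v} X \<partial>?P) \<le> (\<integral>\<^sup>+X. (\<Sum>e\<in>?J. g X * a e X + g X * s e X) \<partial>?P)"
    by (intro nn_integral_mono le)
  also have "\<dots> = (\<Sum>e\<in>?J. (\<integral>\<^sup>+X. g X * a e X \<partial>?P) + (\<integral>\<^sup>+X. g X * s e X \<partial>?P))"
    by (subst nn_integral_sum) (auto intro!: sum.cong nn_integral_add)
  also have "\<dots> \<le> (\<Sum>e\<in>?J. (\<integral>\<^sup>+X. g X \<partial>?P) * ennreal ((1 - exp (- \<epsilon>)) + exp (- l * \<epsilon>)))"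
  proof (rule sum_mono)
    fix e
    have "(\<integral>\<^sup>+X. g X * a e X \<partial>?P) + (\<integral>\<^sup>+X. g X * s e X \<partial>?P)
        \<le> (\<integral>\<^sup>+X. g X \<partial>?P) * ennreal (1 - exp (- \<epsilon>)) + (\<integral>\<^sup>+X. g X \<partial>?P) * ennreal (exp (- l * \<epsilon>))"
      by (intro add_mono int_a int_s)
    also have "\<dots> = (\<integral>\<^sup>+X. g X \<partial>?P) * ennreal ((1 - exp (- \<epsilon>)) + exp (- l * \<epsilon>))"
      using e1 by (subst ennreal_plus) (auto simp: distrib_left)
    finally show "(\<integral>\<^sup>+X. g X * a e X \<partial>?P) + (\<integral>\<^sup>+X. g X * s e X \<partial>?P)
        \<le> (\<integral>\<^sup>+X. g X \<partial>?P) * ennreal ((1 - exp (- \<epsilon>)) + exp (- l * \<epsilon>))" .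
  qed
  also have "\<dots> = of_nat (card ?J) * ((\<integral>\<^sup>+X. g X \<partial>?P) * ennreal ((1 - exp (- \<epsilon>)) + exp (- l * \<epsilon>)))" by simp
  also have "\<dots> \<le> of_nat (K + 1) * ((\<integral>\<^sup>+X. g X \<partial>?P) * ennreal ((1 - exp (- \<epsilon>)) + exp (- l * \<epsilon>)))"
    using J(2) by (intro mult_right_mono of_nat_mono) auto
  also have "\<dots> = ennreal (\<eta> l) * (\<integral>\<^sup>+X. g X \<partial>?P)"
  proof -
    have "ennreal (\<eta> l) = of_nat (K + 1) * ennreal ((1 - exp (- \<epsilon>)) + exp (- l * \<epsilon>))"
      unfolding \<eta>_def using e1 by (subst ennreal_mult) (auto simp: ennreal_of_nat_eq_real_of_nat add.commute)
    then show ?thesis by (simp only: mult_ac)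
  qed
  finally show ?thesis .
qed

end

section \<open>The supermartingale step of the clocks\<close>

context matching_exploration
begin

lemma penalty_nonneg: "0 \<le> penalty"
  by (simp add: penalty_def)

context
  fixes M :: "half_edge set set"
  assumes M: "M \<in> perfect_matchings H"
begin

interpretation finite_graph "graph_edges M" by (rule finite_graph_edges_locale[OF M])

text \<open>A finite range for the explored set and the next vertex: expectations split into
  finitely many pieces on which both are constant.\<close>

definition "reachable = insert 0 (insert 1 (\<Union> (ends ` graph_edges M)))"

lemma reachable: "finite reachable" "explore (graph_edges M) (regularize X) t \<in> Pow reachable"
  "is_next W v (regularize X) \<Longrightarrow> v \<in> reachable"
proof -
  interpret exploration "graph_edges M" "regularize X" by (rule exploration_regularize)
  show "finite reachable" using finite_end_vertices by (simp add: reachable_def)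
  show "V t \<in> Pow reachable" using explore_infected infected_subset by (auto simp: reachable_def)
  show "is_next W v (regularize X) \<Longrightarrow> v \<in> reachable"
    using next_vertex(1)[of W] infected_subset by (auto simp: reachable_def is_next_def pending_def)
qed

definition c :: "vertex set \<Rightarrow> vertex \<Rightarrow> real" where
  "c W v = weight \<zeta> (unrevealed M L (insert v W)) (discovered M L (insert v W)) + \<zeta> * real (card (discovered M L W \<inter> W))"

definition running :: "nat \<Rightarrow> vertex set \<times> vertex \<Rightarrow> clocks \<Rightarrow> ennreal" where
  "running t = (\<lambda>(W, v) X. if explore (graph_edges M) (regularize X) t = W \<and> is_next W v (regularize X)
     then ennreal (exp (- \<theta> * (c W v - penalty * real (bads M (regularize X) t)))) else 0)"

definition halted :: "nat \<Rightarrow> clocks \<Rightarrow> ennreal" where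
  "halted t X = (\<Sum>W\<in>Pow reachable. if explore (graph_edges M) (regularize X) t = W \<and> pending (graph_edges M) (regularize X) W = {}
     then ennreal (exp (- \<theta> * potential M W (bads M (regularize X) t))) else 0)"

lemma measurable_bads_fun [measurable]:
  "(\<lambda>X. f (bads M (regularize X) t) :: real) \<in> borel_measurable clock_space"
  by (rule measurable_compose[OF num_bad_measurable]) simp

lemma running_measurable [measurable]: "running t i \<in> borel_measurable clock_space"
  unfolding running_def case_prod_unfold by measurable

lemma halted_measurable [measurable]: "halted t \<in> borel_measurable clock_space"
  unfolding halted_def by measurable

lemma running_sum:
  "(\<Sum>i\<in>Pow reachable \<times> reachable. f i * running t i X) = (let W = explore (graph_edges M) (regularize X) t;
      v = next_vertex (graph_edges M) (regularize X) W in
    if pending (graph_edges M) (regularize X) W = {} then 0 else f (W, v) * running t (W, v) X)"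
proof -
  let ?W = "explore (graph_edges M) (regularize X) t"
  let ?v = "next_vertex (graph_edges M) (regularize X) ?W"
  have fin: "finite (Pow reachable \<times> reachable)" using reachable(1) by simp
  show ?thesis
  proof (cases "pending (graph_edges M) (regularize X) ?W = {}")
    case True
    then have "f i * running t i X = 0" for i by (auto simp: running_def is_next_def case_prod_unfold)
    then show ?thesis using True by (simp only: Let_def if_True sum.neutral_const simp_thms)
  next
    case False
    have mem: "(?W, ?v) \<in> Pow reachable \<times> reachable" using reachable(2)[of X t] reachable(3)[of ?W ?v X] False by (simp add: is_next_def)
    have zero: "running t i X = 0" if "i \<noteq> (?W, ?v)" for i
    proof -
      obtain W v where i: "i = (W, v)" by (cases i)
      have "\<not> (?W = W \<and> is_next W v (regularize X))"
        using that unfolding i is_next_def by auto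
      then show ?thesis by (simp only: i running_def prod.case if_False)
    qed
    have "(\<Sum>i\<in>Pow reachable \<times> reachable. f i * running t i X) = (\<Sum>i\<in>Pow reachable \<times> reachable. if i = (?W, ?v) then f (?W, ?v) * running t (?W, ?v) X else 0)"
    proof (rule sum.cong[OF refl])
      fix i
      show "f i * running t i X = (if i = (?W, ?v) then f (?W, ?v) * running t (?W, ?v) X else 0)"
        using zero[of i] by (cases "i = (?W, ?v)") simp_all
    qed
    also have "\<dots> = f (?W, ?v) * running t (?W, ?v) X" using fin mem by (subst sum.delta) auto
    finally show ?thesis using False by (simp add: Let_def)
  qed
qed

lemma halted_eq: "halted t X = (if pending (graph_edges M) (regularize X) (explore (graph_edges M) (regularize X) t) = {}
    then ennreal (exp (- \<theta> * potential M (explore (graph_edges M) (regularize X) t) (bads M (regularize X) t))) else 0)"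
proof -
  let ?W = "explore (graph_edges M) (regularize X) t"
  have "halted t X = (\<Sum>W\<in>Pow reachable. if W = ?W then (if pending (graph_edges M) (regularize X) ?W = {}
    then ennreal (exp (- \<theta> * potential M ?W (bads M (regularize X) t))) else 0) else 0)"
    unfolding halted_def by (intro sum.cong) auto
  also have "\<dots> = (if pending (graph_edges M) (regularize X) ?W = {}
    then ennreal (exp (- \<theta> * potential M ?W (bads M (regularize X) t))) else 0)"
    using reachable(1) reachable(2)[of X t] by (subst sum.delta) auto
  finally show ?thesis .
qed

lemma half_eq:
  "ennreal (exp (- \<theta> * half_step M (regularize X) t)) = (\<Sum>i\<in>Pow reachable \<times> reachable. 1 * running t i X) + halted t X"
  unfolding running_sum halted_eq half_step_def by (auto simp: Let_def running_def is_next_def c_def)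

lemma potential_measurable:
  "(\<lambda>X. ennreal (exp (- \<theta> * potential M (explore (graph_edges M) (regularize X) t) (bads M (regularize X) t))))
    \<in> borel_measurable clock_space"
proof -
  have "ennreal (exp (- \<theta> * potential M (explore (graph_edges M) (regularize X) t) (bads M (regularize X) t)))
    = (\<Sum>W\<in>Pow reachable. if explore (graph_edges M) (regularize X) t = W
       then ennreal (exp (- \<theta> * potential M W (bads M (regularize X) t))) else 0)" for X
  proof -
    have "(\<Sum>W\<in>Pow reachable. if explore (graph_edges M) (regularize X) t = W
       then ennreal (exp (- \<theta> * potential M W (bads M (regularize X) t))) else 0)
      = (if explore (graph_edges M) (regularize X) t \<in> Pow reachable then ennreal (exp (- \<theta> * potential M (explore (graph_edges M) (regularize X) t) (bads M (regularize X) t))) else 0)"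
      using reachable(1) by (intro sum.delta') simp
    then show ?thesis using reachable(2)[of X t] by simp
  qed
  then show ?thesis by simp
qed

lemma half_step_measurable:
  "(\<lambda>X. ennreal (exp (- \<theta> * half_step M (regularize X) t))) \<in> borel_measurable clock_space"
  unfolding half_eq by measurable

text \<open>The bonus \<open>\<zeta>\<close> for exploring a discovered vertex pays for the small probability that it is bad.\<close>

lemma clock_step:
  assumes l: "0 < l" and \<epsilon>: "0 < \<epsilon>" and pay: "1 + \<eta> l * (exp (\<theta> * penalty) - 1) \<le> exp (\<theta> * \<zeta>)"
  shows "(\<integral>\<^sup>+X. ennreal (exp (- \<theta> * potential M (explore (graph_edges M) (regularize X) (Suc t)) (bads M (regularize X) (Suc t)))) \<partial>clock_measure l)
    \<le> (\<integral>\<^sup>+X. ennreal (exp (- \<theta> * half_step M (regularize X) t)) \<partial>clock_measure l)"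
proof -
  let ?P = "clock_measure l" and ?E = "graph_edges M" and ?C = "counted M L"
  let ?I = "Pow reachable \<times> reachable"
  have finI: "finite ?I" using reachable(1) by simp
  define b where "b = (\<lambda>(W, v) X. indicator {X. bad ?E (regularize X) L \<epsilon> W v} X :: ennreal)"
  \<comment> \<open>The factor by which one exploration changes the exponential: the bonus gives
    \<open>exp (- \<theta> * \<zeta>)\<close>, a bad vertex gives
    \<open>exp (\<theta> * penalty)\<close>. By \<open>nn_integral_bad_le\<close> and
    \<open>pay\<close> it is at most 1 on average.\<close>
  define F where "F i X = (if snd i \<in> ?C then ennreal (exp (- \<theta> * \<zeta>)) * (1 + ennreal (exp (\<theta> * penalty) - 1) * b i X) else 1)" for i X
  have \<theta>p: "0 \<le> exp (\<theta> * penalty) - 1" using \<theta> penalty_nonneg by simp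
  have bm [measurable]: "b i \<in> borel_measurable clock_space" for i
    unfolding b_def case_prod_unfold indicator_def by measurable
  have Fm [measurable]: "F i \<in> borel_measurable clock_space" for i unfolding F_def by measurable
  have le: "ennreal (exp (- \<theta> * potential M (explore ?E (regularize X) (Suc t)) (bads M (regularize X) (Suc t))))
      \<le> (\<Sum>i\<in>?I. F i X * running t i X) + halted t X" for X
  proof -
    interpret exploration ?E "regularize X" by (rule exploration_regularize)
    define W where "W = V t"
    define v where "v = nv W"
    define N where "N = bads M (regularize X) t"
    show ?thesis
    proof (cases "pend W = {}")
      case True
      then have "V (Suc t) = W" by (simp add: explore_Suc W_def)
      moreover have "bads M (regularize X) (Suc t) = N"
        using True by (simp add: num_bad_Suc bad_step_def Let_def W_def N_def)
      ultimately show ?thesis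
        using True unfolding halted_eq by (simp add: W_def N_def)
    next
      case False
      have vW: "v \<notin> W" using next_vertex(1)[OF False] by (auto simp: v_def pending_def)
      have S: "V (Suc t) = insert v W" using False by (simp add: explore_Suc W_def v_def)
      define \<beta> where "\<beta> = (if v \<in> ?C \<and> bad ?E (regularize X) L \<epsilon> W v then 1 else 0 :: nat)"
      have N': "bads M (regularize X) (Suc t) = N + \<beta>"
        using False by (simp add: num_bad_Suc bad_step_def Let_def W_def N_def v_def \<beta>_def)
      have d: "\<zeta> * real (card (discovered M L W \<inter> W)) + (if v \<in> ?C then \<zeta> else 0)
          \<le> \<zeta> * real (card (discovered M L (insert v W) \<inter> insert v W))"
      proof -
        have fin: "finite (discovered M L (insert v W) \<inter> insert v W)" using finite_explore[of t] by (simp add: W_def)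
        have sub: "discovered M L W \<inter> W \<subseteq> discovered M L (insert v W) \<inter> insert v W" by (auto simp: discovered_def)
        have "card (discovered M L W \<inter> W) + (if v \<in> ?C then 1 else 0) \<le> card (discovered M L (insert v W) \<inter> insert v W)"
        proof (cases "v \<in> ?C")
          case True
          then have "v \<in> discovered M L (insert v W)" by (auto simp: counted_def discovered_def)
          then have "insert v (discovered M L W \<inter> W) \<subseteq> discovered M L (insert v W) \<inter> insert v W" using sub by auto
          then have "card (insert v (discovered M L W \<inter> W)) \<le> card (discovered M L (insert v W) \<inter> insert v W)"
            by (rule card_mono[OF fin])
          then show ?thesis using True vW finite_explore[of t] by (simp add: W_def)
        qed (use card_mono[OF fin sub] in simp)
        then have "\<zeta> * real (card (discovered M L W \<inter> W) + (if v \<in> ?C then 1 else 0))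
            \<le> \<zeta> * real (card (discovered M L (insert v W) \<inter> insert v W))"
          using \<zeta> by (intro mult_left_mono) (simp_all only: of_nat_le_iff)
        then show ?thesis by (cases "v \<in> ?C") (simp_all add: distrib_left)
      qed
      have running: "running t (W, v) X = ennreal (exp (- \<theta> * (c W v - penalty * real N)))"
        using False by (simp add: running_def is_next_def W_def v_def N_def)
      have "exp (- \<theta> * potential M (insert v W) (N + \<beta>))
          \<le> exp (- \<theta> * (if v \<in> ?C then \<zeta> else 0)) * exp (\<theta> * penalty * real \<beta>) * exp (- \<theta> * (c W v - penalty * real N))"
      proof -
        have "c W v + (if v \<in> ?C then \<zeta> else 0) - penalty * real N - penalty * real \<beta> \<le> potential M (insert v W) (N + \<beta>)"
          using d by (simp add: potential_def c_def algebra_simps)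
        then have "- \<theta> * potential M (insert v W) (N + \<beta>) \<le> - \<theta> * (c W v + (if v \<in> ?C then \<zeta> else 0) - penalty * real N - penalty * real \<beta>)"
          using \<theta> by simp
        then show ?thesis unfolding exp_add[symmetric] exp_le_cancel_iff by (simp add: algebra_simps)
      qed
      then have "ennreal (exp (- \<theta> * potential M (insert v W) (N + \<beta>)))
          \<le> ennreal (exp (- \<theta> * (if v \<in> ?C then \<zeta> else 0)) * exp (\<theta> * penalty * real \<beta>)) * running t (W, v) X"
        unfolding running by (subst ennreal_mult[symmetric]) (auto intro: ennreal_leI)
      also have "ennreal (exp (- \<theta> * (if v \<in> ?C then \<zeta> else 0)) * exp (\<theta> * penalty * real \<beta>)) = F (W, v) X"
      proof (cases "v \<in> ?C")
        case True
        have "(1::ennreal) + ennreal (exp (\<theta> * penalty) - 1) = ennreal (exp (\<theta> * penalty))"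
          using \<theta>p by (subst ennreal_1[symmetric], subst ennreal_plus[symmetric]) auto
        then show ?thesis using True
          by (auto simp: F_def b_def \<beta>_def ennreal_mult)
      qed (simp add: F_def \<beta>_def)
      finally show ?thesis
        using False unfolding running_sum halted_eq S N' by (simp add: Let_def W_def v_def)
    qed
  qed
  have gF: "(\<integral>\<^sup>+X. F i X * running t i X \<partial>?P) \<le> (\<integral>\<^sup>+X. running t i X \<partial>?P)" for i
  proof (cases "snd i \<in> ?C")
    case True
    obtain W v where i: "i = (W, v)" by (cases i)
    have \<eta>0: "0 \<le> \<eta> l" using \<epsilon> by (simp add: \<eta>_def)
    have bb: "(\<integral>\<^sup>+X. running t i X * b i X \<partial>?P) \<le> ennreal (\<eta> l) * (\<integral>\<^sup>+X. running t i X \<partial>?P)"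
      using nn_integral_bad_le[OF l \<epsilon> M, of v "\<lambda>N. exp (- \<theta> * (c W v - penalty * real N))" t W] True
      by (simp add: i running_def b_def)
    have "(\<integral>\<^sup>+X. F i X * running t i X \<partial>?P)
        = (\<integral>\<^sup>+X. ennreal (exp (- \<theta> * \<zeta>)) * (running t i X + ennreal (exp (\<theta> * penalty) - 1) * (running t i X * b i X)) \<partial>?P)"
      using True by (intro nn_integral_cong) (simp add: F_def distrib_left distrib_right mult_ac)
    also have "\<dots> = ennreal (exp (- \<theta> * \<zeta>)) * ((\<integral>\<^sup>+X. running t i X \<partial>?P) + ennreal (exp (\<theta> * penalty) - 1) * (\<integral>\<^sup>+X. running t i X * b i X \<partial>?P))"
      by (simp add: nn_integral_cmult nn_integral_add)
    also have "\<dots> \<le> ennreal (exp (- \<theta> * \<zeta>)) * ((\<integral>\<^sup>+X. running t i X \<partial>?P) + ennreal (exp (\<theta> * penalty) - 1) * (ennreal (\<eta> l) * (\<integral>\<^sup>+X. running t i X \<partial>?P)))"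
      by (intro mult_left_mono add_left_mono bb) auto
    also have "\<dots> = ennreal (exp (- \<theta> * \<zeta>) * (1 + \<eta> l * (exp (\<theta> * penalty) - 1))) * (\<integral>\<^sup>+X. running t i X \<partial>?P)"
    proof -
      have e: "ennreal (exp (- \<theta> * \<zeta>) * (1 + \<eta> l * (exp (\<theta> * penalty) - 1)))
          = ennreal (exp (- \<theta> * \<zeta>)) * (1 + ennreal (\<eta> l) * ennreal (exp (\<theta> * penalty) - 1))"
        using \<eta>0 \<theta>p by (simp add: ennreal_mult ennreal_plus)
      show ?thesis unfolding e by (simp add: distrib_left distrib_right mult_ac)
    qed
    also have "\<dots> \<le> ennreal 1 * (\<integral>\<^sup>+X. running t i X \<partial>?P)"
    proof (intro mult_right_mono ennreal_leI)
      have "exp (- \<theta> * \<zeta>) * (1 + \<eta> l * (exp (\<theta> * penalty) - 1)) \<le> exp (- \<theta> * \<zeta>) * exp (\<theta> * \<zeta>)"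
        using pay by (intro mult_left_mono) auto
      then show "exp (- \<theta> * \<zeta>) * (1 + \<eta> l * (exp (\<theta> * penalty) - 1)) \<le> 1" by (simp flip: exp_add)
    qed simp
    finally show ?thesis by simp
  next
    case False
    then show ?thesis by (simp add: F_def)
  qed
  have "(\<integral>\<^sup>+X. ennreal (exp (- \<theta> * potential M (explore ?E (regularize X) (Suc t)) (bads M (regularize X) (Suc t)))) \<partial>?P)
      \<le> (\<integral>\<^sup>+X. (\<Sum>i\<in>?I. F i X * running t i X) + halted t X \<partial>?P)"
    by (intro nn_integral_mono le)
  also have "\<dots> = (\<Sum>i\<in>?I. \<integral>\<^sup>+X. F i X * running t i X \<partial>?P) + (\<integral>\<^sup>+X. halted t X \<partial>?P)"
    by (simp add: nn_integral_add nn_integral_sum)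
  also have "\<dots> \<le> (\<Sum>i\<in>?I. \<integral>\<^sup>+X. running t i X \<partial>?P) + (\<integral>\<^sup>+X. halted t X \<partial>?P)"
    by (intro add_right_mono sum_mono gF)
  also have "\<dots> = (\<integral>\<^sup>+X. (\<Sum>i\<in>?I. 1 * running t i X) + halted t X \<partial>?P)"
    by (simp add: nn_integral_add nn_integral_sum)
  also have "\<dots> = (\<integral>\<^sup>+X. ennreal (exp (- \<theta> * half_step M (regularize X) t)) \<partial>?P)"
    by (simp only: half_eq)
  finally show ?thesis .
qed

end

end

section \<open>From the supermartingale to many red vertices\<close>

context matching_exploration
begin

lemma potential_start:
  assumes M: "M \<in> perfect_matchings H"
  shows "potential M {0} 0 = real (deg (unrevealed M L {}) 1) - \<zeta>"
proof -
  have "0 \<notin> fst ` p" if "p \<in> M" for p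
    using perfect_matchings_Union[OF M] that ends_A no_root by blast
  then have z: "fst ` p \<inter> {0} = {}" if "p \<in> free_pairs M L" for p
    using that by (auto simp: free_pairs_def)
  then have "unrevealed M L {0} = unrevealed M L {}" "discovered M L {0} = {1}"
    by (auto simp: unrevealed_def discovered_def)
  then show ?thesis by (simp add: potential_def weight_def deg_def)
qed

text \<open>An exploration still running at step \<open>t\<close> would supply \<open>t + 1\<close>
  vertices other than the root, each red when infected. So few red vertices mean a stuck
  exploration, a potential of at most 0 and an exponential of at least 1.\<close>

lemma few_red_le:
  assumes M: "M \<in> perfect_matchings H" and n: "A \<union> L \<subseteq> {1..n}" "1 \<le> n" and l: "0 < l"
  shows "emeasure (clock_measure l) {X. card (ever_red n (graph_edges M) X) \<le> t}
    \<le> (\<integral>\<^sup>+X. ennreal (exp (- \<theta> * potential M (explore (graph_edges M) (regularize X) t) (bads M (regularize X) t))) \<partial>clock_measure l)"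
proof -
  let ?P = "clock_measure l" and ?E = "graph_edges M"
  let ?B = "{X. card (ever_red n ?E X) \<le> t}"
  interpret finite_graph ?E by (rule finite_graph_edges_locale[OF M])
  have "?B = {X. real (card (ever_red n ?E X)) \<le> real t}" by simp
  moreover note [measurable] = card_ever_red_measurable[OF finite_edges, of n]
  ultimately have B: "?B \<in> sets ?P"
    unfolding sets_clock_measure by (simp only:) (rule clock_sets_Collect, measurable)
  have "emeasure ?P ?B = (\<integral>\<^sup>+X. indicator ?B X \<partial>?P)" by (rule nn_integral_indicator[symmetric, OF B])
  also have "\<dots> \<le> (\<integral>\<^sup>+X. ennreal (exp (- \<theta> * potential M (explore ?E (regularize X) t) (bads M (regularize X) t))) \<partial>?P)"
  proof (rule nn_integral_mono_AE)
    show "AE X in ?P. indicator ?B X \<le> ennreal (exp (- \<theta> * potential M (explore ?E (regularize X) t) (bads M (regularize X) t)))"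
      using AE_ever_red_regularize[OF l finite_edges, of n]
    proof eventually_elim
      case (elim X)
      interpret exploration ?E "regularize X" by (rule exploration_regularize)
      show ?case
      proof (cases "X \<in> ?B")
        case True
        have "pend (V t) = {}"
        proof (rule ccontr)
          assume p: "pend (V t) \<noteq> {}"
          have "V (Suc t) - {0} \<subseteq> ever_red n ?E (regularize X)"
          proof
            fix u assume u: "u \<in> V (Suc t) - {0}"
            then have iu: "infected ?E (regularize X) u" using explore_infected[of u "Suc t"] by blast
            have "config (T u) u = Red" using iu u by (intro inf_time_Red) auto
            moreover have "0 \<le> T u" using iu by (rule inf_time_nonneg)
            moreover have "u \<in> {0..n}"
            proof -
              have "ends e \<subseteq> {0..n}" if "e \<in> ?E" for e
              proof (cases e)
                case (Matched p)
                then have "p \<subseteq> H" using that perfect_matchings_Union[OF M] by (auto simp: graph_edges_def)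
                then have "fst ` p \<subseteq> {1..n}" using ends_A n(1) by blast
                also have "\<dots> \<subseteq> {0..n}" by auto
                finally show ?thesis by (simp add: Matched)
              qed (use n in auto)
              then have "\<Union> (ends ` ?E) \<subseteq> {0..n}" by blast
              moreover have "{0, 1} \<subseteq> {0..n}" using n(2) by auto
              moreover have "u \<in> {0, 1} \<union> \<Union> (ends ` ?E)" using iu by (intro subsetD[OF infected_subset]) simp
              ultimately show ?thesis by blast
            qed
            ultimately show "u \<in> ever_red n ?E (regularize X)" by (auto simp: ever_red_def)
          qed
          moreover have "finite (ever_red n ?E (regularize X))" by (simp add: ever_red_def)
          ultimately have "card (V (Suc t) - {0}) \<le> card (ever_red n ?E (regularize X))" by (intro card_mono)
          moreover have "card (V (Suc t)) = Suc (Suc t)"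
            using p card_explore[OF p] next_vertex(1)[OF p] finite_explore[of t]
            by (simp add: explore_Suc pending_def)
          ultimately have "Suc t \<le> card (ever_red n ?E (regularize X))"
            using root_explored[of "Suc t"] finite_explore[of "Suc t"] by simp
          then show False using True elim by simp
        qed
        from stuck_potential[OF M regular_regularize this]
        have "0 \<le> - \<theta> * potential M (V t) (bads M (regularize X) t)" using \<theta> by (simp add: mult_nonneg_nonpos)
        then have "ennreal 1 \<le> ennreal (exp (- \<theta> * potential M (V t) (bads M (regularize X) t)))"
          by (intro ennreal_leI) simp
        then show ?thesis using True by simp
      qed simp
    qed
  qed
  finally show ?thesis .
qed

text \<open>\<open>clock_step\<close> for each matching alternates with \<open>matching_step\<close>
  for each realisation of the clocks; exchanging sum and integral links the two. The initial value
  is given by \<open>potential_start\<close>.\<close>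

lemma sum_few_red_le:
  assumes n: "A \<union> L \<subseteq> {1..n}" "1 \<le> n" and l: "0 < l" and \<epsilon>: "0 < \<epsilon>"
    and pay: "1 + \<eta> l * (exp (\<theta> * penalty) - 1) \<le> exp (\<theta> * \<zeta>)"
    and dr: "\<theta> * (real K + 3) ^ 2 * real (K * card A)
      + (real K ^ 2 + 2 * real K) * (real K + 2 + 2 * real K * real t) \<le> excess \<zeta>"
  shows "(\<Sum>M\<in>perfect_matchings H. emeasure (clock_measure l) {X. card (ever_red n (graph_edges M) X) \<le> t})
    \<le> (\<Sum>M\<in>perfect_matchings H. ennreal (exp (- \<theta> * (real (deg (unrevealed M L {}) 1) - \<zeta>))))"
proof -
  let ?P = "clock_measure l" and ?PM = "perfect_matchings H"
  interpret P: prob_space ?P using l by (rule prob_space_clock_measure)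
  define Z where "Z t M X = exp (- \<theta> * potential M (explore (graph_edges M) (regularize X) t) (bads M (regularize X) t))" for t M X
  have Zm: "(\<lambda>X. ennreal (Z s M X)) \<in> borel_measurable ?P" if "M \<in> ?PM" for s M
    using potential_measurable[OF that, of s] by (simp add: Z_def)
  have hm: "(\<lambda>X. ennreal (exp (- \<theta> * half_step M (regularize X) s))) \<in> borel_measurable ?P" if "M \<in> ?PM" for s M
    using half_step_measurable[OF that, of s] by simp
  have decr: "(\<Sum>M\<in>?PM. \<integral>\<^sup>+X. ennreal (Z (Suc s) M X) \<partial>?P) \<le> (\<Sum>M\<in>?PM. \<integral>\<^sup>+X. ennreal (Z s M X) \<partial>?P)"
    if s: "s < t" for s
  proof -
    have "(\<Sum>M\<in>?PM. \<integral>\<^sup>+X. ennreal (Z (Suc s) M X) \<partial>?P)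
        \<le> (\<Sum>M\<in>?PM. \<integral>\<^sup>+X. ennreal (exp (- \<theta> * half_step M (regularize X) s)) \<partial>?P)"
      unfolding Z_def by (intro sum_mono clock_step l \<epsilon> pay)
    also have "\<dots> = (\<integral>\<^sup>+X. (\<Sum>M\<in>?PM. ennreal (exp (- \<theta> * half_step M (regularize X) s))) \<partial>?P)"
      by (rule nn_integral_sum[symmetric]) (rule hm)
    also have "\<dots> \<le> (\<integral>\<^sup>+X. (\<Sum>M\<in>?PM. ennreal (Z s M X)) \<partial>?P)"
    proof (rule nn_integral_mono)
      fix X
      have "(real K ^ 2 + 2 * real K) * (real K + 2 + 2 * real K * (real s + 1))
          \<le> (real K ^ 2 + 2 * real K) * (real K + 2 + 2 * real K * real t)"
        using s by (intro mult_left_mono add_left_mono) auto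
      then have "(\<Sum>M\<in>?PM. exp (- \<theta> * half_step M (regularize X) s)) \<le> (\<Sum>M\<in>?PM. Z s M X)"
        unfolding Z_def using dr by (intro matching_step regular_regularize) linarith
      then have "ennreal (\<Sum>M\<in>?PM. exp (- \<theta> * half_step M (regularize X) s)) \<le> ennreal (\<Sum>M\<in>?PM. Z s M X)"
        by (rule ennreal_leI)
      then show "(\<Sum>M\<in>?PM. ennreal (exp (- \<theta> * half_step M (regularize X) s))) \<le> (\<Sum>M\<in>?PM. ennreal (Z s M X))"
        by (simp add: sum_ennreal Z_def)
    qed
    also have "\<dots> = (\<Sum>M\<in>?PM. \<integral>\<^sup>+X. ennreal (Z s M X) \<partial>?P)"
      by (rule nn_integral_sum) (rule Zm)
    finally show ?thesis .
  qed
  have "(\<Sum>M\<in>?PM. \<integral>\<^sup>+X. ennreal (Z s M X) \<partial>?P) \<le> (\<Sum>M\<in>?PM. \<integral>\<^sup>+X. ennreal (Z 0 M X) \<partial>?P)" if "s \<le> t" for s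
    using that
  proof (induction s)
    case (Suc s)
    then show ?case using decr[of s] by (auto intro: order_trans)
  qed simp
  from this[of t] have "(\<Sum>M\<in>?PM. \<integral>\<^sup>+X. ennreal (Z t M X) \<partial>?P) \<le> (\<Sum>M\<in>?PM. \<integral>\<^sup>+X. ennreal (Z 0 M X) \<partial>?P)" by simp
  moreover have "(\<integral>\<^sup>+X. ennreal (Z 0 M X) \<partial>?P) = ennreal (exp (- \<theta> * (real (deg (unrevealed M L {}) 1) - \<zeta>)))" if "M \<in> ?PM" for M
    unfolding Z_def using potential_start[OF that] P.emeasure_space_1 by simp
  moreover have "(\<Sum>M\<in>?PM. emeasure ?P {X. card (ever_red n (graph_edges M) X) \<le> t}) \<le> (\<Sum>M\<in>?PM. \<integral>\<^sup>+X. ennreal (Z t M X) \<partial>?P)"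
    unfolding Z_def by (intro sum_mono few_red_le n l)
  ultimately show ?thesis by (simp cong: sum.cong)
qed

text \<open>If every half-edge of vertex 1 is matched to \<open>L\<close>, so is \<open>h0\<close>.
  Nonnegative \<open>excess\<close> makes the half-edges at \<open>L\<close> at most half as many as
  those at \<open>A\<close>, hence at most half of the possible partners of
  \<open>h0\<close>.\<close>

lemma card_isolated_le:
  assumes h0: "h0 \<in> H" "fst h0 = 1" and one: "1 \<notin> L" and K: "0 < K" and ev: "even (card H)"
    and ex: "0 \<le> excess \<zeta>"
  shows "2 * card {M \<in> perfect_matchings H. deg (unrevealed M L {}) 1 = 0} \<le> card (perfect_matchings H)"
proof -
  let ?HL = "{h \<in> H. fst h \<in> L}" and ?HA = "{h \<in> H. fst h \<in> A}"
  define m where "m = card H"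
  have part: "card H = card ?HA + card ?HL"
  proof -
    have H: "H = ?HA \<union> ?HL" using ends_A by blast
    have "card (?HA \<union> ?HL) = card ?HA + card ?HL"
    proof (rule card_Un_disjoint)
      show "finite ?HA" "finite ?HL" using finite_H by simp_all
      show "?HA \<inter> ?HL = {}" using AL by blast
    qed
    then show ?thesis unfolding H[symmetric] .
  qed
  have "2 * real K * real (card ?HL) \<le> (\<Sum>w\<in>A. real (deg H w) * (real (deg H w) - 2 - \<zeta>))"
    using ex by (simp add: excess_def)
  also have "\<dots> \<le> (\<Sum>w\<in>A. real (deg H w) * real K)"
  proof (intro sum_mono mult_left_mono)
    fix w assume "w \<in> A"
    then have "deg H w \<le> K" using AL by (intro degree_le) auto
    then show "real (deg H w) - 2 - \<zeta> \<le> real K" using \<zeta> by simp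
  qed simp
  also have "\<dots> = (\<Sum>h\<in>?HA. real K)"
  proof -
    have "(\<Sum>h\<in>?HA. real K) = (\<Sum>w\<in>A. real (deg ?HA w) * real K)"
      using finite_H finite_A by (intro sum_deg) auto
    moreover have "deg ?HA w = deg H w" if "w \<in> A" for w
    proof -
      have "{h \<in> ?HA. fst h = w} = {h \<in> H. fst h = w}" using that by auto
      then show ?thesis by (simp only: deg_def)
    qed
    ultimately show ?thesis by simp
  qed
  finally have "2 * real K * real (card ?HL) \<le> real K * real (card ?HA)" by (simp add: mult.commute)
  then have "2 * real (card ?HL) \<le> real (card ?HA)" using K by simp
  then have HL: "2 * card ?HL \<le> m - 1"
  proof -
    assume "2 * real (card ?HL) \<le> real (card ?HA)"
    then have a: "2 * card ?HL \<le> card ?HA" by linarith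
    have "0 < m" using h0(1) finite_H by (auto simp: m_def card_gt_0_iff)
    then show ?thesis using a part by (cases "card ?HL = 0") (auto simp: m_def)
  qed
  have "0 < m" using h0(1) finite_H by (auto simp: m_def card_gt_0_iff)
  then have m2: "2 \<le> m" using ev unfolding m_def by presburger
  then obtain k where k: "m = Suc (Suc k)" by (metis add_2_eq_Suc le_Suc_ex)
  have "{M \<in> perfect_matchings H. deg (unrevealed M L {}) 1 = 0} \<subseteq> (\<Union>h'\<in>?HL. insert {h0, h'} ` perfect_matchings (H - {h0, h'}))"
  proof
    fix M assume "M \<in> {M \<in> perfect_matchings H. deg (unrevealed M L {}) 1 = 0}"
    then have M: "M \<in> perfect_matchings H" and z: "deg (unrevealed M L {}) 1 = 0" by auto
    have "finite {h \<in> unrevealed M L {}. fst h = 1}" using finite_unrevealed[OF M] by simp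
    then have "{h \<in> unrevealed M L {}. fst h = 1} = {}" using z by (simp only: deg_def card_0_eq)
    then have "h0 \<notin> unrevealed M L {}" using h0(2) by blast
    obtain h' where h': "h' \<in> H - {h0}" "M \<in> insert {h0, h'} ` perfect_matchings (H - {h0, h'})"
      using M unfolding perfect_matchings_step(1)[OF finite_H h0(1)] by blast
    then have "{h0, h'} \<in> M" by auto
    have "h0 \<in> unrevealed M L {}" if "fst ` {h0, h'} \<inter> L = {}"
    proof -
      have "{h0, h'} \<in> {p \<in> free_pairs M L. fst ` p \<inter> {} = {}}"
        using that \<open>{h0, h'} \<in> M\<close> unfolding free_pairs_def by blast
      then show ?thesis unfolding unrevealed_def by blast
    qed
    then have "fst ` {h0, h'} \<inter> L \<noteq> {}" using \<open>h0 \<notin> unrevealed M L {}\<close> by blast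
    then have "h' \<in> ?HL" using h' h0(2) one by auto
    then show "M \<in> (\<Union>h'\<in>?HL. insert {h0, h'} ` perfect_matchings (H - {h0, h'}))" using h'(2) by blast
  qed
  then have "card {M \<in> perfect_matchings H. deg (unrevealed M L {}) 1 = 0}
      \<le> card (\<Union>h'\<in>?HL. insert {h0, h'} ` perfect_matchings (H - {h0, h'}))"
    using finite_H by (intro card_mono) (auto intro!: finite_perfect_matchings)
  also have "\<dots> \<le> (\<Sum>h'\<in>?HL. card (insert {h0, h'} ` perfect_matchings (H - {h0, h'})))"
    using finite_H by (intro card_UN_le) auto
  also have "\<dots> \<le> (\<Sum>h'\<in>?HL. num_matchings k)"
  proof (rule sum_mono)
    fix h' assume h': "h' \<in> ?HL"
    then have ne: "h' \<noteq> h0" using h0(2) one by auto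
    have "card (insert {h0, h'} ` perfect_matchings (H - {h0, h'})) \<le> card (perfect_matchings (H - {h0, h'}))"
      using finite_H by (intro card_image_le finite_perfect_matchings) auto
    also have "\<dots> = num_matchings (card (H - {h0, h'}))" using finite_H by (intro card_perfect_matchings) auto
    also have "card (H - {h0, h'}) = k"
      using h' h0(1) ne k finite_H by (subst card_Diff_subset) (auto simp: m_def card_insert_if)
    finally show "card (insert {h0, h'} ` perfect_matchings (H - {h0, h'})) \<le> num_matchings k" .
  qed
  also have "\<dots> = card ?HL * num_matchings k" by simp
  finally have "2 * card {M \<in> perfect_matchings H. deg (unrevealed M L {}) 1 = 0} \<le> (2 * card ?HL) * num_matchings k"
    by simp
  also have "\<dots> \<le> (m - 1) * num_matchings k" using HL by (rule mult_le_mono1)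
  also have "\<dots> = card (perfect_matchings H)"
    using card_perfect_matchings[OF finite_H] k by (simp add: m_def)
  finally show ?thesis .
qed

text \<open>The initial mean of the exponential: at least half of the matchings leave vertex 1 with
  an unrevealed half-edge, and \<open>exp (\<theta> * \<zeta>)\<close> is the charge for its
  discovery.\<close>

definition fail_prob :: real where
  "fail_prob = exp (\<theta> * \<zeta>) * (1 + exp (- \<theta>)) / 2"

lemma sum_start_le:
  assumes h0: "h0 \<in> H" "fst h0 = 1" and one: "1 \<notin> L" and K: "0 < K" and ev: "even (card H)"
    and ex: "0 \<le> excess \<zeta>"
  shows "(\<Sum>M\<in>perfect_matchings H. exp (- \<theta> * (real (deg (unrevealed M L {}) 1) - \<zeta>)))
    \<le> real (card (perfect_matchings H)) * fail_prob"
proof -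
  let ?PM = "perfect_matchings H"
  let ?Z = "{M \<in> ?PM. deg (unrevealed M L {}) 1 = 0}"
  have fin: "finite ?PM" using finite_H by (rule finite_perfect_matchings)
  define a where "a = exp (\<theta> * \<zeta>)"
  define r where "r = exp (- \<theta>)"
  have r: "r \<le> 1" "0 < r" and a: "0 < a" using \<theta> by (auto simp: r_def a_def)
  have "(\<Sum>M\<in>?PM. exp (- \<theta> * (real (deg (unrevealed M L {}) 1) - \<zeta>)))
      \<le> (\<Sum>M\<in>?PM. a * r + (if deg (unrevealed M L {}) 1 = 0 then a * (1 - r) else 0))"
  proof (rule sum_mono)
    fix M
    have e: "exp (- \<theta> * (x - \<zeta>)) = a * exp (- \<theta> * x)" for x
      by (simp add: a_def algebra_simps flip: exp_add)
    show "exp (- \<theta> * (real (deg (unrevealed M L {}) 1) - \<zeta>)) \<le> a * r + (if deg (unrevealed M L {}) 1 = 0 then a * (1 - r) else 0)"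
    proof (cases "deg (unrevealed M L {}) 1 = 0")
      case True
      then show ?thesis unfolding e by (simp add: algebra_simps)
    next
      case False
      then have "\<theta> * 1 \<le> \<theta> * real (deg (unrevealed M L {}) 1)" using \<theta> by (intro mult_left_mono) auto
      then have "exp (- \<theta> * real (deg (unrevealed M L {}) 1)) \<le> r" by (simp add: r_def)
      then show ?thesis unfolding e using a False by simp
    qed
  qed
  also have "\<dots> = real (card ?PM) * (a * r) + real (card ?Z) * (a * (1 - r))"
    using fin by (simp add: sum.distrib sum.If_cases Int_def)
  also have "\<dots> \<le> real (card ?PM) * (a * r) + (real (card ?PM) / 2) * (a * (1 - r))"
  proof (intro add_left_mono mult_right_mono)
    have "real (2 * card ?Z) \<le> real (card ?PM)"
      using card_isolated_le[OF assms] by (simp only: of_nat_le_iff)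
    then show "real (card ?Z) \<le> real (card ?PM) / 2" by simp
  qed (use r a in auto)
  also have "\<dots> = real (card ?PM) * fail_prob"
    by (simp add: fail_prob_def a_def r_def field_simps)
  finally show ?thesis .
qed

lemma many_red_average:
  assumes n: "A \<union> L \<subseteq> {1..n}" "1 \<le> n" and l: "0 < l" and \<epsilon>: "0 < \<epsilon>"
    and pay: "1 + \<eta> l * (exp (\<theta> * penalty) - 1) \<le> exp (\<theta> * \<zeta>)"
    and dr: "\<theta> * (real K + 3) ^ 2 * real (K * card A)
      + (real K ^ 2 + 2 * real K) * (real K + 2 + 2 * real K * real t) \<le> excess \<zeta>"
    and h0: "h0 \<in> H" "fst h0 = 1" and one: "1 \<notin> L" and K: "0 < K" and ev: "even (card H)"
  shows "ennreal (1 - fail_prob) \<le> (\<integral>\<^sup>+M. emeasure (clock_measure l)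
    {X. t < card (ever_red n (graph_edges M) X)} \<partial>pmf_of_set (perfect_matchings H))"
proof -
  let ?P = "clock_measure l" and ?PM = "perfect_matchings H"
  interpret P: prob_space ?P using l by (rule prob_space_clock_measure)
  have fin: "finite ?PM" using finite_H by (rule finite_perfect_matchings)
  have c0: "0 < card ?PM" using num_matchings_pos[OF ev] card_perfect_matchings[OF finite_H] by simp
  then have ne: "?PM \<noteq> {}" by auto
  have nonneg: "0 \<le> \<theta> * (real K + 3) ^ 2 * real (K * card A)"
    "0 \<le> (real K ^ 2 + 2 * real K) * (real K + 2 + 2 * real K * real t)"
    using \<theta> by (auto intro!: mult_nonneg_nonneg)
  then have ex: "0 \<le> excess \<zeta>" using dr by linarith
  have set_m: "{X. card (ever_red n (graph_edges M) X) \<le> t} \<in> sets ?P" if "M \<in> ?PM" for M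
  proof -
    interpret finite_graph "graph_edges M" by (rule finite_graph_edges_locale[OF that])
    note [measurable] = card_ever_red_measurable[OF finite_edges, of n]
    have "{X. card (ever_red n (graph_edges M) X) \<le> t} = {X. real (card (ever_red n (graph_edges M) X)) \<le> real t}" by simp
    then show ?thesis unfolding sets_clock_measure by (simp only:) (rule clock_sets_Collect, measurable)
  qed
  have compl: "emeasure ?P {X. t < card (ever_red n (graph_edges M) X)}
      = ennreal (1 - measure ?P {X. card (ever_red n (graph_edges M) X) \<le> t})" if "M \<in> ?PM" for M
  proof -
    have "{X. t < card (ever_red n (graph_edges M) X)} = space ?P - {X. card (ever_red n (graph_edges M) X) \<le> t}"
      by auto
    then show ?thesis using P.prob_compl[OF set_m[OF that]] by (simp add: P.emeasure_eq_measure)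
  qed
  have "(\<Sum>M\<in>?PM. ennreal (measure ?P {X. card (ever_red n (graph_edges M) X) \<le> t}))
      \<le> (\<Sum>M\<in>?PM. ennreal (exp (- \<theta> * (real (deg (unrevealed M L {}) 1) - \<zeta>))))"
    using sum_few_red_le[OF n l \<epsilon> pay dr] by (simp add: P.emeasure_eq_measure)
  then have "(\<Sum>M\<in>?PM. measure ?P {X. card (ever_red n (graph_edges M) X) \<le> t})
      \<le> (\<Sum>M\<in>?PM. exp (- \<theta> * (real (deg (unrevealed M L {}) 1) - \<zeta>)))"
    by (simp add: sum_ennreal sum_nonneg)
  also have "\<dots> \<le> real (card ?PM) * fail_prob"
    by (rule sum_start_le[OF h0 one K ev ex])
  finally have few: "(\<Sum>M\<in>?PM. measure ?P {X. card (ever_red n (graph_edges M) X) \<le> t}) \<le> real (card ?PM) * fail_prob" .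
  have "(\<integral>\<^sup>+M. emeasure ?P {X. t < card (ever_red n (graph_edges M) X)} \<partial>pmf_of_set ?PM)
      = (\<Sum>M\<in>?PM. emeasure ?P {X. t < card (ever_red n (graph_edges M) X)}) / of_nat (card ?PM)"
    using fin ne by (rule nn_integral_pmf_of_set[rotated])
  also have "(\<Sum>M\<in>?PM. emeasure ?P {X. t < card (ever_red n (graph_edges M) X)})
      = ennreal (\<Sum>M\<in>?PM. 1 - measure ?P {X. card (ever_red n (graph_edges M) X) \<le> t})"
    by (subst sum_ennreal[symmetric]) (auto simp: compl)
  also have "\<dots> / of_nat (card ?PM)
      = ennreal ((\<Sum>M\<in>?PM. 1 - measure ?P {X. card (ever_red n (graph_edges M) X) \<le> t}) / real (card ?PM))"
    using c0 by (simp add: ennreal_of_nat_eq_real_of_nat divide_ennreal sum_nonneg)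
  finally have eq: "(\<integral>\<^sup>+M. emeasure ?P {X. t < card (ever_red n (graph_edges M) X)} \<partial>pmf_of_set ?PM)
      = ennreal ((\<Sum>M\<in>?PM. 1 - measure ?P {X. card (ever_red n (graph_edges M) X) \<le> t}) / real (card ?PM))" .
  have "real (card ?PM) * (1 - fail_prob) \<le> (\<Sum>M\<in>?PM. 1 - measure ?P {X. card (ever_red n (graph_edges M) X) \<le> t})"
    using few by (simp add: sum_subtractf algebra_simps)
  then have "1 - fail_prob \<le> (\<Sum>M\<in>?PM. 1 - measure ?P {X. card (ever_red n (graph_edges M) X) \<le> t}) / real (card ?PM)"
    using c0 by (simp add: field_simps)
  then show ?thesis unfolding eq by (rule ennreal_leI)
qed

end

section \<open>The supercritical bound\<close>

definition light_drift :: "nat \<Rightarrow> real \<Rightarrow> nat \<Rightarrow> real" where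
  "light_drift K \<zeta> k = (if k \<le> K then real k * (real k - 2 - \<zeta>) else 0)"

definition heavy_degree :: "nat \<Rightarrow> nat \<Rightarrow> real" where
  "heavy_degree K k = (if k \<le> K then 0 else real k)"

text \<open>\<open>K\<close> separates light from heavy degrees. Prescribing degree \<open>j\<close>
  for vertex 1 makes it light and provides a half-edge, at the price of the factor
  \<open>pmf D j\<close>; \<open>heavy\<close> is scaled by the same factor, so that the exceptional
  event can be subtracted.\<close>

locale supercritical_degrees =
  fixes D :: "nat pmf" and \<zeta> \<kappa> :: real and j K :: nat
  assumes int_degree: "integrable (measure_pmf D) real"
    and \<zeta>: "0 < \<zeta>" "\<zeta> \<le> 1 / 8" and \<kappa>: "0 < \<kappa>"
    and j: "1 \<le> j" "j \<le> K" "0 < pmf D j"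
    and drift: "4 * \<kappa> \<le> measure_pmf.expectation D (light_drift K \<zeta>)"
    and heavy: "16 * real K * measure_pmf.expectation D (heavy_degree K) \<le> pmf D j * \<kappa>"
begin

text \<open>Vertex \<open>n\<close> is kept apart because the parity correction may change its
  degree.\<close>

definition good_degrees :: "nat \<Rightarrow> (nat \<Rightarrow> nat) set" where
  "good_degrees n = {d. d 1 = j \<and> 3 * \<kappa> * (real n - 1) \<le> (\<Sum>i\<in>{1..<n}. light_drift K \<zeta> (d i))
     \<and> 2 * real K * ((\<Sum>i\<in>{1..<n}. heavy_degree K (d i)) + real (d n)) \<le> \<kappa> * real n / 2}"

lemma light_drift_bounds: "- 3 \<le> light_drift K \<zeta> k" "\<bar>light_drift K \<zeta> k\<bar> \<le> real K * (real K + 3)"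
proof -
  have "- 3 \<le> x * (x - 2 - \<zeta>)" for x :: real
  proof -
    have "0 \<le> (x - 1 - \<zeta> / 2)\<^sup>2" by simp
    moreover have "(x - 1 - \<zeta> / 2)\<^sup>2 = x * (x - 2 - \<zeta>) + (1 + \<zeta> / 2) * (1 + \<zeta> / 2)"
      by (simp add: power2_eq_square algebra_simps)
    moreover have "(1 + \<zeta> / 2) * (1 + \<zeta> / 2) \<le> (3 / 2) * (3 / 2)" using \<zeta> by (intro mult_mono) auto
    ultimately show ?thesis by linarith
  qed
  then show "- 3 \<le> light_drift K \<zeta> k" by (simp add: light_drift_def)
  show "\<bar>light_drift K \<zeta> k\<bar> \<le> real K * (real K + 3)"
  proof (cases "k \<le> K")
    case True
    then have "real k * \<bar>real k - 2 - \<zeta>\<bar> \<le> real K * (real K + 3)"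
      using \<zeta> by (intro mult_mono) auto
    then show ?thesis using True by (simp add: light_drift_def abs_mult)
  qed (simp add: light_drift_def)
qed

lemma heavy_degree_bounds: "0 \<le> heavy_degree K k" "heavy_degree K k \<le> real k"
  by (simp_all add: heavy_degree_def)

lemma int_heavy: "integrable (measure_pmf D) (heavy_degree K)"
  by (rule Bochner_Integration.integrable_bound[OF int_degree]) (use heavy_degree_bounds in auto)

lemma expectation_coordinate:
  fixes f :: "nat \<Rightarrow> real" and i n :: nat
  assumes i: "i \<in> {1..n}" and f: "integrable (measure_pmf D) f"
  shows "integrable (measure_pmf (Pi_pmf {1..n} 0 (\<lambda>_. D))) (\<lambda>d. f (d i))"
    and "measure_pmf.expectation (Pi_pmf {1..n} 0 (\<lambda>_. D)) (\<lambda>d. f (d i)) = measure_pmf.expectation D f"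
proof -
  have map: "map_pmf (\<lambda>d. d i) (Pi_pmf {1..n} 0 (\<lambda>_. D)) = D"
    using i by (simp add: Pi_pmf_component)
  then show "integrable (measure_pmf (Pi_pmf {1..n} 0 (\<lambda>_. D))) (\<lambda>d. f (d i))"
    using f by (metis integrable_map_pmf_eq)
  show "measure_pmf.expectation (Pi_pmf {1..n} 0 (\<lambda>_. D)) (\<lambda>d. f (d i)) = measure_pmf.expectation D f"
    using map by (metis integral_map_pmf)
qed

text \<open>From the probability \<open>pmf D j\<close> of \<open>d 1 = j\<close> two failures are
  subtracted: the drift fails with exponentially small probability, eventually below a quarter of
  it, and the heavy degrees fail with at most half of it, by Markov's inequality.\<close>

lemma prob_good_degrees:
  "\<forall>\<^sub>F n in sequentially. pmf D j / 4 \<le> measure_pmf.prob (Pi_pmf {1..n} 0 (\<lambda>_. D)) (good_degrees n)"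
proof -
  let ?p = "pmf D j" and ?E = "measure_pmf.expectation D"
  let ?P = "\<lambda>n. Pi_pmf {1..n} 0 (\<lambda>_. D)"
  have "integrable (measure_pmf D) (\<lambda>k. (light_drift K \<zeta> k)\<^sup>2)"
  proof (rule measure_pmf.integrable_const_bound)
    show "AE k in measure_pmf D. norm ((light_drift K \<zeta> k)\<^sup>2) \<le> (real K * (real K + 3))\<^sup>2"
      using light_drift_bounds(2) by (auto intro!: AE_I2 simp: power2_le_iff_abs_le)
  qed simp
  then obtain q where q: "0 < q" "q < 1" and tail: "\<And>(A :: nat set) I. finite A \<Longrightarrow> I \<subseteq> A \<Longrightarrow>
      measure_pmf.prob (Pi_pmf A 0 (\<lambda>_. D))
        {d. (\<Sum>i\<in>I. light_drift K \<zeta> (d i)) \<le> (?E (light_drift K \<zeta>) - \<kappa>) * real (card I)} \<le> q ^ card I"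
    by (rule Pi_pmf_lower_tail[OF light_drift_bounds(1) _ \<kappa>]) blast
  have "(\<lambda>n. q ^ (n - 1)) \<longlonglongrightarrow> 0"
    by (rule LIMSEQ_imp_Suc) (use LIMSEQ_realpow_zero[of q] q in simp)
  then have "\<forall>\<^sub>F n in sequentially. q ^ (n - 1) < ?p / 4"
    using j by (intro order_tendstoD(2)) auto
  moreover have "\<forall>\<^sub>F n in sequentially. 32 * real K * ?E real / (?p * \<kappa>) < real n"
    by (metis eventually_gt_at_top filterlim_at_top_dense filterlim_real_sequentially)
  ultimately show ?thesis using eventually_ge_at_top[of 2]
  proof eventually_elim
    case (elim n)
    define W where "W d = 2 * real K * ((\<Sum>i\<in>{1..<n}. heavy_degree K (d i)) + real (d n))" for d
    let ?B1 = "{d. (\<Sum>i\<in>{1..<n}. light_drift K \<zeta> (d i)) \<le> (?E (light_drift K \<zeta>) - \<kappa>) * real (card {1..<n})}"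
    let ?B2 = "{d. \<kappa> * real n / 2 \<le> W d}"
    have n0: "0 < \<kappa> * real n / 2" using \<kappa> elim(3) by simp
    have W0: "0 \<le> W d" for d
      unfolding W_def using heavy_degree_bounds by (intro mult_nonneg_nonneg add_nonneg_nonneg sum_nonneg) auto
    have "measure_pmf.prob (?P n) ?B1 \<le> q ^ card {1..<n}" by (rule tail) auto
    then have B1: "measure_pmf.prob (?P n) ?B1 \<le> ?p / 4" using elim(1) by simp
    have Wi: "integrable (measure_pmf (?P n)) W"
      unfolding W_def using expectation_coordinate(1)[OF _ int_heavy, of _ n] expectation_coordinate(1)[OF _ int_degree, of n n] elim(3)
      by (intro integrable_mult_right Bochner_Integration.integrable_add Bochner_Integration.integrable_sum) auto
    have EW: "measure_pmf.expectation (?P n) W = 2 * real K * ((real n - 1) * ?E (heavy_degree K) + ?E real)"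
      unfolding W_def using expectation_coordinate[OF _ int_heavy, of _ n] expectation_coordinate[OF _ int_degree, of n n] elim(3)
      by (subst integral_mult_right_zero, subst Bochner_Integration.integral_add)
        (auto intro!: Bochner_Integration.integrable_sum simp: Bochner_Integration.integral_sum of_nat_diff)
    have "0 \<le> ?E (heavy_degree K)" using heavy_degree_bounds by (intro Bochner_Integration.integral_nonneg) auto
    then have "(real n - 1) * ?E (heavy_degree K) \<le> real n * ?E (heavy_degree K)" by (intro mult_right_mono) auto
    then have "2 * real K * ((real n - 1) * ?E (heavy_degree K) + ?E real)
        \<le> 2 * real K * (real n * ?E (heavy_degree K) + ?E real)" by (intro mult_left_mono) auto
    also have "\<dots> = real n * (16 * real K * ?E (heavy_degree K)) / 8 + 2 * real K * ?E real" by (simp add: algebra_simps)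
    also have "\<dots> \<le> real n * (?p * \<kappa>) / 8 + real n * (?p * \<kappa>) / 16"
    proof (rule add_mono)
      have "real n * (16 * real K * ?E (heavy_degree K)) \<le> real n * (?p * \<kappa>)" by (intro mult_left_mono heavy) simp
      then show "real n * (16 * real K * ?E (heavy_degree K)) / 8 \<le> real n * (?p * \<kappa>) / 8" by (rule divide_right_mono) simp
      have "32 * real K * ?E real < real n * (?p * \<kappa>)" using elim(2) j \<kappa> by (simp add: pos_divide_less_eq)
      then show "2 * real K * ?E real \<le> real n * (?p * \<kappa>) / 16" by simp
    qed
    also have "\<dots> \<le> ?p / 2 * (\<kappa> * real n / 2)" using j \<kappa> by simp
    finally have "measure_pmf.expectation (?P n) W \<le> ?p / 2 * (\<kappa> * real n / 2)" unfolding EW .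
    then have "measure_pmf.expectation (?P n) W / (\<kappa> * real n / 2) \<le> ?p / 2"
      using n0 by (simp only: pos_divide_le_eq)
    moreover have "measure_pmf.prob (?P n) ?B2 \<le> measure_pmf.expectation (?P n) W / (\<kappa> * real n / 2)"
      using integral_Markov_inequality_measure[OF Wi, of UNIV "\<kappa> * real n / 2"] W0 n0 by simp
    ultimately have B2: "measure_pmf.prob (?P n) ?B2 \<le> ?p / 2" by linarith
    have p: "measure_pmf.prob (?P n) {d :: nat \<Rightarrow> nat. d 1 = j} = ?p"
    proof -
      have "D = map_pmf (\<lambda>d. d 1) (?P n)" using elim(3) by (simp add: Pi_pmf_component)
      then have "pmf D j = pmf (map_pmf (\<lambda>d. d 1) (?P n)) j" by simp
      then show ?thesis by (simp add: pmf_map vimage_def)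
    qed
    have "{d :: nat \<Rightarrow> nat. d 1 = j} \<subseteq> (good_degrees n \<union> ?B1) \<union> ?B2"
    proof
      fix d :: "nat \<Rightarrow> nat" assume d: "d \<in> {d. d 1 = j}"
      have "3 * \<kappa> * (real n - 1) \<le> (?E (light_drift K \<zeta>) - \<kappa>) * (real n - 1)"
        using drift elim(3) by (intro mult_right_mono) auto
      moreover have "real (card {1..<n}) = real n - 1" using elim(3) by simp
      ultimately have "d \<in> ?B1 \<or> 3 * \<kappa> * (real n - 1) \<le> (\<Sum>i\<in>{1..<n}. light_drift K \<zeta> (d i))"
        unfolding mem_Collect_eq by (metis linear order_trans)
      moreover have "d \<in> ?B2 \<or> W d \<le> \<kappa> * real n / 2" by auto
      ultimately show "d \<in> (good_degrees n \<union> ?B1) \<union> ?B2"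
        using d unfolding good_degrees_def W_def Un_iff mem_Collect_eq by blast
    qed
    then have "?p \<le> measure_pmf.prob (?P n) ((good_degrees n \<union> ?B1) \<union> ?B2)"
      unfolding p[symmetric] by (intro measure_pmf.finite_measure_mono) auto
    also have "\<dots> \<le> measure_pmf.prob (?P n) (good_degrees n \<union> ?B1) + measure_pmf.prob (?P n) ?B2"
      by (rule measure_Un_le) auto
    also have "\<dots> \<le> measure_pmf.prob (?P n) (good_degrees n) + measure_pmf.prob (?P n) ?B1 + measure_pmf.prob (?P n) ?B2"
      by (intro add_right_mono measure_Un_le) auto
    finally show ?case using B1 B2 by linarith
  qed
qed

text \<open>Up to the last vertex, \<open>excess\<close> is light drift minus \<open>2 * K\<close>
  times heavy degree. The last vertex contributes at least \<open>- (2 * K * (d n + 1)) - 3\<close>,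
  where the 1 is the parity half-edge and \<open>- 3\<close> bounds a light drift from
  below.\<close>

lemma good_degrees_matching:
  assumes d: "d \<in> good_degrees n" and n: "2 \<le> n" "2 * (2 * real K + 3) \<le> \<kappa> * real n"
  defines "L \<equiv> {i \<in> {1..n}. K < vertex_degree n d i}"
  shows "bounded_matching (half_edges n d) L ({1..n} - L) K"
    and "\<kappa> * real n / 2 - (2 * real K + 3) \<le> bounded_matching.excess (half_edges n d) L ({1..n} - L) K \<zeta>"
proof -
  let ?H = "half_edges n d"
  have deg: "deg ?H w = (if w \<in> {1..n} then vertex_degree n d w else 0)" for w
    unfolding deg_def by (rule card_half_edges_at)
  show bm: "bounded_matching ?H L ({1..n} - L) K"
  proof
    show "fst ` ?H \<subseteq> {1..n} - L \<union> L" using fst_half_edges by blast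
    show "deg ?H w \<le> K" if "w \<notin> L" for w using that by (auto simp: deg L_def not_less)
  qed (auto simp: L_def)
  interpret bounded_matching ?H L "{1..n} - L" K by (rule bm)
  let ?g = "\<lambda>i. (if i \<in> L then 0 else real (deg ?H i) * (real (deg ?H i) - 2 - \<zeta>))
    - 2 * real K * (if i \<in> L then real (deg ?H i) else 0)"
  have "card {h \<in> ?H. fst h \<in> L} = (\<Sum>w\<in>L. deg ?H w)"
  proof -
    have "{h \<in> ?H. fst h \<in> L} = (\<Union>w\<in>L. {h \<in> ?H. fst h = w})" by auto
    then show ?thesis unfolding deg_def
      by (simp only:) (subst card_UN_disjoint, auto simp: L_def)
  qed
  moreover have "(\<Sum>w\<in>L. real (deg ?H w)) = (\<Sum>w\<in>{1..n}. if w \<in> L then real (deg ?H w) else 0)"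
    by (intro sum.mono_neutral_cong_left) (auto simp: L_def)
  moreover have "(\<Sum>w\<in>{1..n} - L. real (deg ?H w) * (real (deg ?H w) - 2 - \<zeta>))
      = (\<Sum>w\<in>{1..n}. if w \<in> L then 0 else real (deg ?H w) * (real (deg ?H w) - 2 - \<zeta>))"
    by (intro sum.mono_neutral_cong_left) auto
  ultimately have "excess \<zeta> = (\<Sum>i\<in>{1..n}. ?g i)"
    unfolding excess_def by (simp add: sum_subtractf sum_distrib_left)
  also have "\<dots> = (\<Sum>i\<in>{1..<n}. ?g i) + ?g n"
  proof -
    have "{1..n} = insert n {1..<n}" using n by auto
    then show ?thesis by simp
  qed
  also have "(\<Sum>i\<in>{1..<n}. ?g i) = (\<Sum>i\<in>{1..<n}. light_drift K \<zeta> (d i) - 2 * real K * heavy_degree K (d i))"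
    by (intro sum.cong) (auto simp: L_def deg vertex_degree_def light_drift_def heavy_degree_def)
  finally have "excess \<zeta> = (\<Sum>i\<in>{1..<n}. light_drift K \<zeta> (d i)) - 2 * real K * (\<Sum>i\<in>{1..<n}. heavy_degree K (d i)) + ?g n"
    by (simp add: sum_subtractf sum_distrib_left)
  moreover have "- (2 * real K * (real (d n) + 1)) - 3 \<le> ?g n"
  proof (cases "n \<in> L")
    case True
    have "deg ?H n \<le> d n + 1" using n by (simp add: deg vertex_degree_def)
    then have "real K * real (deg ?H n) \<le> real K * (real (d n) + 1)" by (intro mult_left_mono) auto
    then show ?thesis using True by simp
  next
    case False
    then have "deg ?H n \<le> K" by (rule degree_le)
    then have "- 3 \<le> real (deg ?H n) * (real (deg ?H n) - 2 - \<zeta>)"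
      using light_drift_bounds(1)[of "deg ?H n"] by (simp add: light_drift_def)
    moreover have "0 \<le> 2 * real K * (real (d n) + 1)" by simp
    ultimately have "- (2 * real K * (real (d n) + 1)) - 3 \<le> real (deg ?H n) * (real (deg ?H n) - 2 - \<zeta>)" by linarith
    then show ?thesis using False by simp
  qed
  moreover have "\<kappa> * (real n * 3 / 2) \<le> \<kappa> * (3 * (real n - 1))"
    using n(1) \<kappa> by (intro mult_left_mono) auto
  ultimately show "\<kappa> * real n / 2 - (2 * real K + 3) \<le> excess \<zeta>"
    using d n(2) \<kappa> by (simp add: good_degrees_def algebra_simps)
qed


text \<open>With \<open>\<zeta> \<le> 1 / 8\<close> the product is at most
  \<open>exp (\<theta> / 8) + exp (- 7 * \<theta> / 8)\<close>, whose linear term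
  \<open>- 3 / 4 * \<theta>\<close> dominates the quadratic one for
  \<open>\<theta> \<le> 1 / 4\<close>.\<close>

lemma start_failure_less_1:
  assumes "0 < \<theta>" "\<theta> \<le> 1 / 4"
  shows "exp (\<theta> * \<zeta>) * (1 + exp (- \<theta>)) / 2 < 1"
proof -
  have "\<theta> * \<zeta> \<le> \<theta> * (1 / 8)" using assms \<zeta> by (intro mult_left_mono) auto
  then have "exp (\<theta> * \<zeta>) * (1 + exp (- \<theta>)) \<le> exp (\<theta> / 8) * (1 + exp (- \<theta>))"
    by (intro mult_right_mono) (auto intro: add_nonneg_nonneg)
  also have "\<dots> = exp (\<theta> / 8) + exp (- 7 * \<theta> / 8)" by (simp add: distrib_left flip: exp_add)
  also have "\<dots> \<le> (1 + \<theta> / 8 + (\<theta> / 8)\<^sup>2) + (1 + (- 7 * \<theta> / 8) + (- 7 * \<theta> / 8)\<^sup>2)"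
    using assms by (intro add_mono exp_le_quadratic) auto
  also have "\<dots> = 2 - 3 / 4 * \<theta> + 25 / 32 * \<theta> * \<theta>" by (simp add: power2_eq_square)
  also have "\<dots> < 2"
  proof -
    have "25 / 32 * \<theta> * \<theta> \<le> 25 / 32 * \<theta> * (1 / 4)" using assms by (intro mult_left_mono) auto
    then show ?thesis using assms by linarith
  qed
  finally show ?thesis by simp
qed

text \<open>The window \<open>\<epsilon>\<close> is short enough for a \<open>Chase\<close> ring to
  be unlikely in it; the rate, chosen afterwards, is large enough for a \<open>Spread\<close> ring
  to be almost certain in it.\<close>

lemma spread_wins:
  fixes w P :: real
  assumes "0 < w" "0 < P"
  obtains \<epsilon> l0 where "0 < \<epsilon>" "0 < l0"
    "\<And>l. l0 \<le> l \<Longrightarrow> (real K + 1) * ((1 - exp (- \<epsilon>)) + exp (- l * \<epsilon>)) * P \<le> w"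
proof -
  define r where "r = w / ((real K + 1) * P)"
  have r: "0 < r" "(real K + 1) * r * P = w" using assms by (simp_all add: r_def)
  \<comment> \<open>Each of the two terms receives \<open>r / 2\<close>; for the second,
    \<open>exp x \<ge> x\<close> is applied to an exponent that is at least
    \<open>2 / r\<close>.\<close>
  show thesis
  proof (rule that[of "r / 2" "4 / (r * r)"])
    fix l assume l: "4 / (r * r) \<le> l"
    have "1 - exp (- (r / 2)) \<le> r / 2" using exp_ge_add_one_self[of "- (r / 2)"] by linarith
    moreover have "exp (- l * (r / 2)) \<le> r / 2"
    proof -
      have "4 / (r * r) * (r / 2) \<le> l * (r / 2)" using l r by (intro mult_right_mono) auto
      then have "2 / r \<le> l * (r / 2)" using r by simp
      also have "\<dots> \<le> exp (l * (r / 2))" using exp_ge_add_one_self[of "l * (r / 2)"] by linarith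
      finally show ?thesis using r by (simp add: exp_minus field_simps)
    qed
    ultimately have "(1 - exp (- (r / 2))) + exp (- l * (r / 2)) \<le> r" by linarith
    then have "(real K + 1) * ((1 - exp (- (r / 2))) + exp (- l * (r / 2))) * P \<le> (real K + 1) * r * P"
      using assms by (intro mult_right_mono mult_left_mono) auto
    then show "(real K + 1) * ((1 - exp (- (r / 2))) + exp (- l * (r / 2))) * P \<le> w" by (simp only: r(2))
  qed (use r in auto)
qed

text \<open>The excess of order \<open>\<kappa> * n / 2\<close> is spent in four parts of
  \<open>\<kappa> * n / 8\<close>: the second-order error (by the choice of
  \<open>\<theta>\<close>), the constant terms, the vertices explored in \<open>\<delta> * n\<close>
  steps (by the choice of \<open>\<delta>\<close>), and the correction
  \<open>2 * K + 3\<close>.\<close>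

lemma many_red_supercritical:
  obtains c \<delta> l0 where "0 < c" "0 < \<delta>" "0 < l0"
    "\<And>l. l0 \<le> l \<Longrightarrow> \<forall>\<^sub>F n in sequentially. c \<le> prob_many_red D l n \<delta>"
proof -
  have K: "1 \<le> K" using j by linarith
  define \<theta> where "\<theta> = min (1 / (real K + 3)) (\<kappa> / (8 * (real K + 3)\<^sup>2 * real K))"
  have \<theta>0: "0 < \<theta>" using \<kappa> K by (simp add: \<theta>_def)
  have \<theta>1: "\<theta> * (real K + 3) \<le> 1"
  proof -
    have "\<theta> \<le> 1 / (real K + 3)" by (simp add: \<theta>_def)
    then show ?thesis by (simp add: field_simps)
  qed
  have \<theta>2: "\<theta> * (real K + 3)\<^sup>2 * real K \<le> \<kappa> / 8"
  proof -
    have "\<theta> \<le> \<kappa> / (8 * (real K + 3)\<^sup>2 * real K)" by (simp add: \<theta>_def)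
    moreover have "0 < 8 * (real K + 3)\<^sup>2 * real K" using K by simp
    ultimately have "\<theta> * (8 * (real K + 3)\<^sup>2 * real K) \<le> \<kappa>" by (simp only: pos_le_divide_eq)
    then show ?thesis by simp
  qed
  have \<theta>4: "\<theta> \<le> 1 / 4"
  proof -
    have "\<theta> * 4 \<le> \<theta> * (real K + 3)" using \<theta>0 K by (intro mult_left_mono) auto
    then show ?thesis using \<theta>1 by simp
  qed
  define f where "f = exp (\<theta> * \<zeta>) * (1 + exp (- \<theta>)) / 2"
  have f: "f < 1" unfolding f_def by (rule start_failure_less_1[OF \<theta>0 \<theta>4])
  define pen where "pen = real (K * ((1 + 2 * K) * (2 * K)))"
  have pen: "0 < pen" unfolding pen_def of_nat_0_less_iff using K by auto
  obtain \<epsilon> l0 where \<epsilon>: "0 < \<epsilon>" and l0: "0 < l0" and pay: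
    "\<And>l. l0 \<le> l \<Longrightarrow> (real K + 1) * ((1 - exp (- \<epsilon>)) + exp (- l * \<epsilon>)) * (exp (\<theta> * pen) - 1) \<le> exp (\<theta> * \<zeta>) - 1"
    using spread_wins[of "exp (\<theta> * \<zeta>) - 1" "exp (\<theta> * pen) - 1"] \<theta>0 \<zeta> pen by auto
  define k2 where "k2 = (real K)\<^sup>2 + 2 * real K"
  have k2: "0 < k2" using K by (simp add: k2_def add_pos_pos)
  define \<delta> where "\<delta> = \<kappa> / (16 * real K * k2)"
  have \<delta>: "0 < \<delta>" using \<kappa> K k2 by (simp add: \<delta>_def)
  have \<delta>2: "k2 * (2 * real K * (\<delta> * real n)) = \<kappa> * real n / 8" for n
    using K k2 by (simp add: \<delta>_def)
  define c where "c = pmf D j / 4 * (1 - f)"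
  have c: "0 < c" using j f by (simp add: c_def)
  have "\<forall>\<^sub>F n in sequentially. c \<le> prob_many_red D l n \<delta>" if l: "l0 \<le> l" for l
  proof -
    have l_pos: "0 < l" using l l0 by linarith
    have big: "\<forall>\<^sub>F n in sequentially. x < \<kappa> * real n" for x
    proof -
      have "\<forall>\<^sub>F n in sequentially. x / \<kappa> < real n"
        by (metis eventually_gt_at_top filterlim_at_top_dense filterlim_real_sequentially)
      then show ?thesis by eventually_elim (use \<kappa> in \<open>simp add: pos_divide_less_eq mult.commute\<close>)
    qed
    show ?thesis
      using prob_good_degrees eventually_ge_at_top[of 2] big[of "8 * (k2 * (real K + 2))"] big[of "8 * (2 * real K + 3)"]
    proof eventually_elim
      case (elim n)
      let ?P = "Pi_pmf {1..n} 0 (\<lambda>_. D)" and ?C = "clock_measure l"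
      let ?pm = "\<lambda>d. pmf_of_set (perfect_matchings (half_edges n d))"
      let ?em = "\<lambda>M. emeasure ?C {X. \<delta> * real n < real (card (ever_red n (graph_edges M) X))}"
      have avg: "ennreal (1 - f) \<le> (\<integral>\<^sup>+M. ?em M \<partial>?pm d)" if d: "d \<in> good_degrees n" for d
      proof -
        let ?H = "half_edges n d"
        define L where "L = {i \<in> {1..n}. K < vertex_degree n d i}"
        define A where "A = {1..n} - L"
        note bm = good_degrees_matching[OF d elim(2), folded L_def, folded A_def]
        interpret bounded_matching ?H L A K using bm(1) elim(4) by simp
        interpret matching_exploration ?H L A K \<zeta> \<theta> \<epsilon>
          by unfold_locales (use \<zeta> \<theta>0 \<theta>1 in auto)
        define t where "t = nat \<lfloor>\<delta> * real n\<rfloor>"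
        have t: "real t \<le> \<delta> * real n" using \<delta> by (simp add: t_def)
        have em: "?em M = emeasure ?C {X. t < card (ever_red n (graph_edges M) X)}" for M
        proof -
          have "\<delta> * real n < real m \<longleftrightarrow> t < m" for m
            using \<delta> by (simp add: t_def nat_less_iff floor_less_iff)
          then show ?thesis by simp
        qed
        have d1: "vertex_degree n d 1 = j" using d elim(2) by (simp add: vertex_degree_def good_degrees_def)
        have dr: "\<theta> * (real K + 3) ^ 2 * real (K * card A)
            + (real K ^ 2 + 2 * real K) * (real K + 2 + 2 * real K * real t) \<le> excess \<zeta>"
        proof -
          have "card A \<le> n" using card_mono[of "{1..n}" A] by (auto simp: A_def)
          have "\<theta> * (real K + 3) ^ 2 * real (K * card A)
              + (real K ^ 2 + 2 * real K) * (real K + 2 + 2 * real K * real t)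
              = \<theta> * (real K + 3) ^ 2 * real K * real (card A) + (k2 * (real K + 2) + k2 * (2 * real K * real t))"
            unfolding k2_def[symmetric] by (simp add: distrib_left mult.assoc)
          also have "\<dots> \<le> \<kappa> / 8 * real n + (\<kappa> * real n / 8 + \<kappa> * real n / 8)"
          proof (intro add_mono)
            show "\<theta> * (real K + 3) ^ 2 * real K * real (card A) \<le> \<kappa> / 8 * real n"
              using \<open>card A \<le> n\<close> \<theta>2 \<kappa> \<theta>0 by (intro mult_mono) auto
            have "k2 * (2 * real K * real t) \<le> k2 * (2 * real K * (\<delta> * real n))"
              using k2 t by (intro mult_left_mono) auto
            then show "k2 * (2 * real K * real t) \<le> \<kappa> * real n / 8" by (simp only: \<delta>2)
            show "k2 * (real K + 2) \<le> \<kappa> * real n / 8" using elim(3) by linarith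
          qed
          also have "\<dots> \<le> \<kappa> * real n / 2 - (2 * real K + 3)" using elim(4) by simp
          also have "\<dots> \<le> excess \<zeta>" using bm(2) elim(4) by simp
          finally show ?thesis .
        qed
        have "ennreal (1 - fail_prob) \<le> (\<integral>\<^sup>+M. emeasure ?C
            {X. t < card (ever_red n (graph_edges M) X)} \<partial>pmf_of_set (perfect_matchings ?H))"
        proof (rule many_red_average[OF _ _ l_pos \<epsilon> _ dr])
          show "A \<union> L \<subseteq> {1..n}" "1 \<le> n" "0 < K" "even (card ?H)"
            using elim(2) K even_card_half_edges by (auto simp: A_def L_def)
          show "(1, 0) \<in> ?H" using d1 j elim(2) by (simp add: half_edges_def)
          show "1 \<notin> L" using d1 j by (simp add: L_def)
          show "1 + \<eta> l * (exp (\<theta> * penalty) - 1) \<le> exp (\<theta> * \<zeta>)"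
            using pay[OF l] by (simp add: \<eta>_def penalty_def pen_def)
        qed simp
        then show ?thesis unfolding em fail_prob_def f_def .
      qed
      have "ennreal c \<le> ennreal (measure_pmf.prob ?P (good_degrees n) * (1 - f))"
        using elim(1) f unfolding c_def by (intro ennreal_leI mult_right_mono) auto
      also have "\<dots> = (\<integral>\<^sup>+d. ennreal (1 - f) * indicator (good_degrees n) d \<partial>?P)"
        using f by (simp add: measure_pmf.emeasure_eq_measure nn_integral_cmult_indicator ennreal_mult' mult.commute)
      also have "\<dots> \<le> (\<integral>\<^sup>+d. (\<integral>\<^sup>+M. ?em M \<partial>?pm d) \<partial>?P)"
        using avg by (intro nn_integral_mono) (auto split: split_indicator)
      also have "\<dots> = ennreal (prob_many_red D l n \<delta>)"
        unfolding ennreal_prob_many_red[OF l_pos] config_model_def by simp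
      finally show ?case by (simp add: prob_many_red_def)
    qed
  qed
  with c \<delta> l0 show thesis by (rule that)
qed

end

text \<open>\<open>j\<close> is chosen before \<open>K\<close>, since the condition on heavy degrees
  refers to \<open>pmf D j\<close>. Both conditions on \<open>K\<close> follow by dominated
  convergence; the heavy one uses that \<open>K * heavy_degree K k\<close> is at most
  \<open>k ^ 2\<close>.\<close>

lemma supercritical_parameters:
  fixes D :: "nat pmf"
  assumes int2: "integrable (measure_pmf D) (\<lambda>k. (real k)\<^sup>2)"
    and pos: "0 < measure_pmf.expectation D (\<lambda>k. real k * (real k - 2))"
  obtains \<zeta> \<kappa> j K where "supercritical_degrees D \<zeta> \<kappa> j K"
proof -
  let ?E = "measure_pmf.expectation D"
  define \<Delta> where "\<Delta> = ?E (\<lambda>k. real k * (real k - 2))"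
  have int1: "integrable (measure_pmf D) real"
    by (rule measure_pmf.square_integrable_imp_integrable[OF _ int2]) simp
  have \<Delta>: "0 < \<Delta>" using pos by (simp add: \<Delta>_def)
  have \<mu>: "0 \<le> ?E real" by (intro Bochner_Integration.integral_nonneg) simp
  \<comment> \<open>The charge takes at most a quarter of \<open>\<Delta>\<close>, leaving
    \<open>3 / 4 * \<Delta>\<close> against \<open>4 * \<kappa> = \<Delta> / 2\<close>; the cap
    \<open>1 / 8\<close> serves \<open>start_failure_less_1\<close>.\<close>
  define \<zeta> where "\<zeta> = min (1 / 8) (\<Delta> / (4 * (?E real + 1)))"
  have "0 < \<Delta> / (4 * (?E real + 1))" using \<Delta> \<mu> by (intro divide_pos_pos mult_pos_pos add_nonneg_pos) auto
  then have \<zeta>: "0 < \<zeta>" "\<zeta> \<le> 1 / 8" unfolding \<zeta>_def by (simp_all only: min_less_iff_conj min.cobounded1) simp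
  have \<zeta>\<mu>: "\<zeta> * ?E real \<le> \<Delta> / 4"
  proof -
    have "\<zeta> \<le> \<Delta> / (4 * (?E real + 1))" by (simp add: \<zeta>_def)
    then have "\<zeta> * (4 * (?E real + 1)) \<le> \<Delta>" using \<mu> by (simp add: pos_le_divide_eq)
    then show ?thesis using \<zeta> by (simp add: algebra_simps)
  qed
  define \<kappa> where "\<kappa> = \<Delta> / 8"
  have \<kappa>: "0 < \<kappa>" using \<Delta> by (simp add: \<kappa>_def)
  have "\<exists>j\<in>set_pmf D. 1 \<le> j"
  proof (rule ccontr)
    assume "\<not> (\<exists>j\<in>set_pmf D. 1 \<le> j)"
    then have "\<And>k. k \<in> set_pmf D \<Longrightarrow> real k * (real k - 2) = 0" by (auto simp: not_le)
    then have "?E (\<lambda>k. real k * (real k - 2)) = ?E (\<lambda>_. 0)" by (intro integral_cong_AE) (auto simp: AE_measure_pmf_iff)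
    then show False using pos by simp
  qed
  then obtain j where j: "1 \<le> j" "0 < pmf D j" by (auto simp: pmf_positive_iff)
  have "(\<lambda>K. ?E (light_drift K \<zeta>)) \<longlonglongrightarrow> ?E (\<lambda>k. real k * (real k - 2 - \<zeta>))"
  proof (rule integral_dominated_convergence)
    show "integrable (measure_pmf D) (\<lambda>k. \<bar>(real k)\<^sup>2 - (2 + \<zeta>) * real k\<bar>)" using int1 int2 by simp
    show "AE k in measure_pmf D. norm (light_drift K \<zeta> k) \<le> \<bar>(real k)\<^sup>2 - (2 + \<zeta>) * real k\<bar>" for K
      by (auto simp: light_drift_def power2_eq_square algebra_simps)
    show "AE k in measure_pmf D. (\<lambda>K. light_drift K \<zeta> k) \<longlonglongrightarrow> real k * (real k - 2 - \<zeta>)"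
    proof (rule AE_I2)
      fix k
      have "\<forall>\<^sub>F K in sequentially. light_drift K \<zeta> k = real k * (real k - 2 - \<zeta>)"
        using eventually_ge_at_top[of k] by eventually_elim (simp add: light_drift_def)
      then show "(\<lambda>K. light_drift K \<zeta> k) \<longlonglongrightarrow> real k * (real k - 2 - \<zeta>)" by (rule tendsto_eventually)
    qed
  qed simp_all
  moreover have "4 * \<kappa> < ?E (\<lambda>k. real k * (real k - 2 - \<zeta>))"
  proof -
    have "(\<lambda>k. real k * (real k - 2 - \<zeta>)) = (\<lambda>k. real k * (real k - 2) - \<zeta> * real k)" by (simp add: algebra_simps)
    moreover have "integrable (measure_pmf D) (\<lambda>k. real k * (real k - 2))"
      using int1 int2 by (simp add: right_diff_distrib power2_eq_square)
    ultimately have "?E (\<lambda>k. real k * (real k - 2 - \<zeta>)) = \<Delta> - \<zeta> * ?E real" using int1 by (simp add: \<Delta>_def)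
    then show ?thesis using \<zeta>\<mu> \<Delta> by (simp add: \<kappa>_def)
  qed
  ultimately have "\<forall>\<^sub>F K in sequentially. 4 * \<kappa> < ?E (light_drift K \<zeta>)" by (rule order_tendstoD(1))
  moreover have "(\<lambda>K. ?E (\<lambda>k. real K * heavy_degree K k)) \<longlonglongrightarrow> ?E (\<lambda>_. 0)"
  proof (rule integral_dominated_convergence)
    show "AE k in measure_pmf D. norm (real K * heavy_degree K k) \<le> (real k)\<^sup>2" for K
      by (auto simp: heavy_degree_def power2_eq_square intro!: mult_mono AE_I2)
    show "AE k in measure_pmf D. (\<lambda>K. real K * heavy_degree K k) \<longlonglongrightarrow> 0"
    proof (rule AE_I2)
      fix k
      have "\<forall>\<^sub>F K in sequentially. real K * heavy_degree K k = 0"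
        using eventually_ge_at_top[of k] by eventually_elim (simp add: heavy_degree_def)
      then show "(\<lambda>K. real K * heavy_degree K k) \<longlonglongrightarrow> 0" by (rule tendsto_eventually)
    qed
  qed (use int2 in simp_all)
  then have "\<forall>\<^sub>F K in sequentially. ?E (\<lambda>k. real K * heavy_degree K k) < pmf D j * \<kappa> / 16"
    using j \<kappa> by (intro order_tendstoD(2)) auto
  ultimately have "\<forall>\<^sub>F K in sequentially. j \<le> K \<and> 4 * \<kappa> < ?E (light_drift K \<zeta>)
      \<and> ?E (\<lambda>k. real K * heavy_degree K k) < pmf D j * \<kappa> / 16"
    using eventually_ge_at_top[of j] by eventually_elim simp
  then obtain K where K: "j \<le> K" "4 * \<kappa> < ?E (light_drift K \<zeta>)"
      "?E (\<lambda>k. real K * heavy_degree K k) < pmf D j * \<kappa> / 16"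
    by (auto dest!: eventually_happens)
  have "supercritical_degrees D \<zeta> \<kappa> j K"
    by unfold_locales (use int1 \<zeta> \<kappa> j K in auto)
  then show thesis by (rule that)
qed

text \<open>The identity behind it is
  \<open>(1 + l)^2 - 4 * l * a = (2 * a - 1 - l)^2 - 4 * (a^2 - a)\<close>; the bound
  \<open>l < 1\<close> comes from \<open>a - 1 \<le> sqrt (a^2 - a)\<close>.\<close>

lemma subcritical_region:
  fixes a l :: real
  assumes a: "1 < a" and l: "0 < l" "l < 2 * a - 1 - 2 * sqrt (a\<^sup>2 - a)"
  shows "l < 1" "4 * l * a < (1 + l)\<^sup>2"
proof -
  define s where "s = sqrt (a\<^sup>2 - a)"
  have aa: "a * 1 < a * a" using a by (intro mult_strict_left_mono) auto
  then have s: "0 \<le> s" "s\<^sup>2 = a\<^sup>2 - a" by (simp_all add: s_def power2_eq_square)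
  have "(a - 1)\<^sup>2 \<le> s\<^sup>2" unfolding s using a by (simp add: power2_eq_square algebra_simps)
  then have "a - 1 \<le> s" using s(1) by (rule power2_le_imp_le)
  then show "l < 1" using l by (simp add: s_def)
  have "(2 * s)\<^sup>2 < (2 * a - 1 - l)\<^sup>2" using l s by (intro power_strict_mono) (auto simp: s_def)
  moreover have "(2 * s)\<^sup>2 = 4 * (a\<^sup>2 - a)" using s by (simp add: power_mult_distrib)
  ultimately show "4 * l * a < (1 + l)\<^sup>2" by (simp add: power2_eq_square algebra_simps)
qed

theorem theorem1p2:
  fixes D :: "nat pmf" and a \<Lambda> :: real
  assumes "integrable (measure_pmf D) (\<lambda>k. real k * (real k - 2))"
    and "0 < measure_pmf.expectation D (\<lambda>k. real k * (real k - 2))"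
    and "a = measure_pmf.expectation D (\<lambda>k. (real k)\<^sup>2) / measure_pmf.expectation D (\<lambda>k. real k) - 1"
    and "\<Lambda> = 2 * a - 1 - 2 * sqrt (a\<^sup>2 - a)"
  shows "ereal \<Lambda> \<le> critical_rate D \<and> critical_rate D < \<infinity>"
proof -
  let ?E = "measure_pmf.expectation D"
  \<comment> \<open>The second moment is recovered from \<open>k * (k - 2)\<close> by expanding
    \<open>(k - 2)^2 \<ge> 0\<close>.\<close>
  have int2: "integrable (measure_pmf D) (\<lambda>k. (real k)\<^sup>2)"
  proof (rule Bochner_Integration.integrable_bound)
    show "integrable (measure_pmf D) (\<lambda>k. 2 * (real k * (real k - 2)) + 4)" using assms(1) by simp
    have "(real k)\<^sup>2 \<le> \<bar>2 * (real k * (real k - 2)) + 4\<bar>" for k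
    proof -
      have "0 \<le> (real k - 2)\<^sup>2" by simp
      then have "(real k)\<^sup>2 \<le> 2 * (real k * (real k - 2)) + 4" by (simp add: power2_eq_square algebra_simps)
      then show ?thesis by linarith
    qed
    then show "AE k in measure_pmf D. norm ((real k)\<^sup>2) \<le> norm (2 * (real k * (real k - 2)) + 4)" by simp
  qed simp
  have int1: "integrable (measure_pmf D) real"
    by (rule measure_pmf.square_integrable_imp_integrable[OF _ int2]) simp
  define \<mu> where "\<mu> = ?E real"
  define m where "m = ?E (\<lambda>k. (real k)\<^sup>2)"
  have E1: "?E (\<lambda>k. real k * (real k - 2)) = m - 2 * \<mu>" and E2: "?E (\<lambda>k. real k * (real k - 1)) = m - \<mu>"
    using int1 int2 by (simp_all add: m_def \<mu>_def right_diff_distrib power2_eq_square mult.commute)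
  have m: "2 * \<mu> < m" using assms(2) E1 by simp
  have "0 \<le> \<mu>" unfolding \<mu>_def by (intro Bochner_Integration.integral_nonneg) simp
  moreover have "\<mu> \<noteq> 0"
  proof
    assume "\<mu> = 0"
    then have "AE k in measure_pmf D. real k = 0"
      using integral_nonneg_eq_0_iff_AE[OF int1] by (simp add: \<mu>_def)
    then have "m = ?E (\<lambda>_. 0)" unfolding m_def by (intro integral_cong_AE) auto
    then show False using m \<open>\<mu> = 0\<close> by simp
  qed
  ultimately have \<mu>: "0 < \<mu>" by simp
  have a: "a = m / \<mu> - 1" using assms(3) by (simp add: m_def \<mu>_def)
  have a1: "1 < a" using m \<mu> by (simp add: a field_simps)
  have am: "m - \<mu> = a * \<mu>" using \<mu> by (simp add: a field_simps)
  interpret square_integrable_degrees D \<mu> "m - \<mu>"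
    by unfold_locales (use int2 E2 m \<mu> in \<open>auto simp: \<mu>_def\<close>)
  have sub: "ereal l \<le> critical_rate D" if l: "0 < l" "l < \<Lambda>" for l
  proof -
    note r = subcritical_region[OF a1 l(1) l(2)[unfolded assms(4)]]
    have "4 * l * a * \<mu> < (1 + l)\<^sup>2 * \<mu>" using r(2) \<mu> by (rule mult_strict_right_mono)
    then have "4 * l * (m - \<mu>) < (1 + l)\<^sup>2 * \<mu>" by (simp add: am mult.assoc)
    then have "(SUP \<delta>\<in>{0<..}. limsup (\<lambda>n. ereal (prob_many_red D l n \<delta>))) = (SUP \<delta>\<in>{0 :: real<..}. 0)"
      using subcritical_limsup[OF l(1) r(1)] by (intro SUP_cong) auto
    also have "\<dots> = 0" by (intro SUP_const) (auto intro: gt_ex)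
    finally show ?thesis unfolding critical_rate_def using l by (intro Sup_upper imageI) auto
  qed
  \<comment> \<open>Every rate strictly between 0 and \<open>\<Lambda>\<close> is subcritical;
    density of the extended reals closes the gap at \<open>\<Lambda>\<close>.\<close>
  have "ereal \<Lambda> \<le> critical_rate D"
  proof (rule dense_le_bounded)
    show "(0 :: ereal) < ereal \<Lambda>"
    proof -
      have "sqrt (a\<^sup>2 - a) < sqrt ((a - 1 / 2)\<^sup>2)"
        by (intro real_sqrt_less_mono) (simp add: power2_eq_square algebra_simps)
      then show ?thesis using a1 by (simp add: assms(4))
    qed
    fix w assume "(0 :: ereal) < w" "w < ereal \<Lambda>"
    then show "w \<le> critical_rate D" by (cases w) (auto intro: sub)
  qed
  moreover have "critical_rate D < \<infinity>"
  proof -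
    obtain \<zeta> \<kappa> j K where "supercritical_degrees D \<zeta> \<kappa> j K"
      using supercritical_parameters[OF int2 assms(2)] .
    then interpret S: supercritical_degrees D \<zeta> \<kappa> j K .
    obtain c \<delta> l0 where c: "0 < c" "0 < \<delta>" and super: "\<And>l. l0 \<le> l \<Longrightarrow> \<forall>\<^sub>F n in sequentially. c \<le> prob_many_red D l n \<delta>"
      by (rule S.many_red_supercritical) blast
    \<comment> \<open>The bound \<open>c\<close> holds for every rate from \<open>l0\<close> on with
      one common \<open>\<delta>\<close>, so none of these rates belongs to the set whose supremum
      is taken.\<close>
    have "critical_rate D \<le> ereal l0"
      unfolding critical_rate_def
    proof (intro Sup_least, elim imageE)
      fix x l
      assume x: "x = ereal l" and "l \<in> {l. 0 < l \<and> (SUP \<delta>\<in>{0<..}. limsup (\<lambda>n. ereal (prob_many_red D l n \<delta>))) = 0}"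
      then have z: "(SUP \<delta>\<in>{0<..}. limsup (\<lambda>n. ereal (prob_many_red D l n \<delta>))) = 0" by simp
      have "l < l0"
      proof (rule ccontr)
        assume "\<not> l < l0"
        then have "ereal c \<le> limsup (\<lambda>n. ereal (prob_many_red D l n \<delta>))"
          using super[of l] by (intro le_Limsup) auto
        also have "\<dots> \<le> 0" unfolding z[symmetric] using c by (intro SUP_upper) auto
        finally show False using c by simp
      qed
      then show "x \<le> ereal l0" by (simp add: x)
    qed
    then show ?thesis by (rule order_le_less_trans) simp
  qed
  ultimately show ?thesis ..
qed

end
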